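(* Let $G$ be a discrete group and let $\Pi\colon\mathrm{Orb}(G)\to\mathrm{Groupoids}$ be a (contravariant) functor with universal space $B\Pi$. For every $G$-CW-complex $Y$ and for every natural transformation $\Phi\colon\Pi_1(Y;G)\to\Pi$ there exists, unique up to $G$-equivariant homotopy, a $G$-equivariant cellular map $\varphi\colon Y\to B\Pi$ such that $\varphi_\#=\Phi$.
   Context: $G$ is a discrete group. A $G$-CW-complex is a $G$-space built by attaching equivariant cells $G/H\times D^n$ ($H\le G$ any subgroup) skeleton by skeleton, with the colimit topology; $X^{(k)}$ is its $k$-skeleton and a $G$-map is cellular if it preserves skeleta. Orbit category. $\mathrm{Orb}(G)$ has as objects all subgroups of $G$; morphisms from $H$ to $K$ are the $G$-maps $G/H\to G/K$. Each such map has the form $xH\mapsto xgK$ for a well-defined coset $gK$ with $g^{-1}Hg\subset K$. Fundamental groupoid functor. For a $G$-CW-complex $X$, $\Pi_1(X;G)\colon\mathrm{Orb}(G)\to\mathrm{Groupoids}$ is the contravariant functor assigning to $H$ the full subgroupoid $\Pi_1(X^H)|_{X^H_{(0)}}$ of the fundamental groupoid of $X^H$ on the $0$-skeleton $X^H_{(0)}=(X^{(0)})^H$ of $X^H$ (the empty groupoid if $X^H=\varnothing$), and to the morphism $xH\mapsto xgK$ the groupoid morphism induced by $X^K\to X^H$, $x\mapsto gx$. A cellular $G$-map $\varphi\colon Y\to X$ induces a natural transformation $\varphi_\#\colon\Pi_1(Y;G)\to\Pi_1(X;G)$ with components induced by $\varphi|_{Y^H}\colon Y^H\to X^H$. Universal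 space $B\Pi$. Take a $G$-CW-complex $X_2$ realizing $\Pi$, i.e. with a fixed identification $\Pi_1(X_2;G)=\Pi$. Inductively for $k\ge 3$, $X_k$ is obtained from $X_{k-1}$ by attaching, for each subgroup $H\le G$, $G$-cells $G/H\times D^k$ induced up from cells $H/H\times D^k$ attached to $X_{k-1}^H$, so as to kill $\pi_{k-1}$ of all components of the $H$-fixed point set; thus $\pi_j(X_k^H,x)=0$ for all $H$, all $2\le j\le k-1$ and all $x\in X_k^H$. Then $B\Pi:=\bigcup_k X_k$ with the colimit topology; canonically $\Pi_1(B\Pi;G)=\Pi$, so $\varphi_\#$ for a cellular $G$-map $\varphi\colon Y\to B\Pi$ is regarded as a natural transformation $\Pi_1(Y;G)\to\Pi$. *)

theory Defs
  imports "HOL-Analysis.Analysis" "HOL-Algebra.Left_Coset" "HOL-Algebra.Group_Action"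
begin

section \<open>Groupoids\<close>

text \<open>Composition is in diagrammatic order: \<open>cmp A f g\<close> is ``first \<open>f\<close>, then \<open>g\<close>'',
  which matches concatenation of paths.\<close>

record ('o, 'm) cat_data =
  Ob :: "'o set"
  Mor :: "'m set"
  src :: "'m \<Rightarrow> 'o"
  tgt :: "'m \<Rightarrow> 'o"
  idm :: "'o \<Rightarrow> 'm"
  cmp :: "'m \<Rightarrow> 'm \<Rightarrow> 'm"

definition groupoid :: "('o, 'm) cat_data \<Rightarrow> bool" where
  "groupoid A \<longleftrightarrow>
     (\<forall>f\<in>Mor A. src A f \<in> Ob A \<and> tgt A f \<in> Ob A) \<and>
     (\<forall>x\<in>Ob A. idm A x \<in> Mor A \<and> src A (idm A x) = x \<and> tgt A (idm A x) = x) \<and>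
     (\<forall>f\<in>Mor A. \<forall>g\<in>Mor A. tgt A f = src A g \<longrightarrow>
        cmp A f g \<in> Mor A \<and> src A (cmp A f g) = src A f \<and> tgt A (cmp A f g) = tgt A g) \<and>
     (\<forall>f\<in>Mor A. cmp A (idm A (src A f)) f = f \<and> cmp A f (idm A (tgt A f)) = f) \<and>
     (\<forall>f\<in>Mor A. \<forall>g\<in>Mor A. \<forall>h\<in>Mor A. tgt A f = src A g \<and> tgt A g = src A h \<longrightarrow>
        cmp A (cmp A f g) h = cmp A f (cmp A g h)) \<and>
     (\<forall>f\<in>Mor A. \<exists>g\<in>Mor A. src A g = tgt A f \<and> tgt A g = src A f \<and>
        cmp A f g = idm A (src A f) \<and> cmp A g f = idm A (tgt A f))"

record ('o, 'm, 'p, 'n) gpd_map =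
  on_ob :: "'o \<Rightarrow> 'p"
  on_mor :: "'m \<Rightarrow> 'n"

definition gpd_functor ::
    "('o, 'm) cat_data \<Rightarrow> ('p, 'n) cat_data \<Rightarrow> ('o, 'm, 'p, 'n) gpd_map \<Rightarrow> bool" where
  "gpd_functor A B F \<longleftrightarrow>
     (\<forall>x\<in>Ob A. on_ob F x \<in> Ob B \<and> on_mor F (idm A x) = idm B (on_ob F x)) \<and>
     (\<forall>f\<in>Mor A. on_mor F f \<in> Mor B \<and> src B (on_mor F f) = on_ob F (src A f) \<and>
        tgt B (on_mor F f) = on_ob F (tgt A f)) \<and>
     (\<forall>f\<in>Mor A. \<forall>g\<in>Mor A. tgt A f = src A g \<longrightarrow>
        on_mor F (cmp A f g) = cmp B (on_mor F f) (on_mor F g))"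

text \<open>Functors are total functions in the logic; only their values on the source matter.\<close>

definition gpd_map_eq ::
    "('o, 'm) cat_data \<Rightarrow> ('o, 'm, 'p, 'n) gpd_map \<Rightarrow> ('o, 'm, 'p, 'n) gpd_map \<Rightarrow> bool" where
  "gpd_map_eq A F F' \<longleftrightarrow>
     (\<forall>x\<in>Ob A. on_ob F x = on_ob F' x) \<and> (\<forall>f\<in>Mor A. on_mor F f = on_mor F' f)"

definition gpd_id :: "('o, 'm, 'o, 'm) gpd_map" where
  "gpd_id = \<lparr>on_ob = (\<lambda>x. x), on_mor = (\<lambda>f. f)\<rparr>"

definition gpd_comp :: "('p, 'n, 'q, 'k) gpd_map \<Rightarrow> ('o, 'm, 'p, 'n) gpd_map
    \<Rightarrow> ('o, 'm, 'q, 'k) gpd_map"  (infixr \<open>\<circ>\<^sub>g\<close> 55) where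
  "F' \<circ>\<^sub>g F = \<lparr>on_ob = on_ob F' \<circ> on_ob F, on_mor = on_mor F' \<circ> on_mor F\<rparr>"

definition gpd_iso ::
    "('o, 'm) cat_data \<Rightarrow> ('p, 'n) cat_data \<Rightarrow> ('o, 'm, 'p, 'n) gpd_map \<Rightarrow> bool" where
  "gpd_iso A B F \<longleftrightarrow> gpd_functor A B F \<and>
     bij_betw (on_ob F) (Ob A) (Ob B) \<and> bij_betw (on_mor F) (Mor A) (Mor B)"

definition gpd_inv :: "('o, 'm) cat_data \<Rightarrow> ('o, 'm, 'p, 'n) gpd_map \<Rightarrow> ('p, 'n, 'o, 'm) gpd_map" where
  "gpd_inv A F = \<lparr>on_ob = inv_into (Ob A) (on_ob F), on_mor = inv_into (Mor A) (on_mor F)\<rparr>"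


section \<open>The orbit category and contravariant functors on it\<close>

definition orb_hom ::
    "('g, 'z) monoid_scheme \<Rightarrow> 'g set \<Rightarrow> 'g set \<Rightarrow> ('g set \<Rightarrow> 'g set) set" where
  "orb_hom G H K = {f. subgroup H G \<and> subgroup K G \<and>
     f \<in> (lcosets\<^bsub>G\<^esub> H) \<rightarrow>\<^sub>E (lcosets\<^bsub>G\<^esub> K) \<and>
     (\<forall>g\<in>carrier G. \<forall>C\<in>(lcosets\<^bsub>G\<^esub> H). f (g <#\<^bsub>G\<^esub> C) = g <#\<^bsub>G\<^esub> f C)}"

text \<open>\<open>res P H K f\<close> is the functor \<open>P(K) \<rightarrow> P(H)\<close> assigned to \<open>f : G/H \<rightarrow> G/K\<close>.\<close>

record ('g, 'o, 'm) orb_data =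
  val :: "'g set \<Rightarrow> ('o, 'm) cat_data"
  res :: "'g set \<Rightarrow> 'g set \<Rightarrow> ('g set \<Rightarrow> 'g set) \<Rightarrow> ('o, 'm, 'o, 'm) gpd_map"

definition orb_functor :: "('g, 'z) monoid_scheme \<Rightarrow> ('g, 'o, 'm) orb_data \<Rightarrow> bool" where
  "orb_functor G P \<longleftrightarrow>
     (\<forall>H. subgroup H G \<longrightarrow> groupoid (val P H)) \<and>
     (\<forall>H K. \<forall>f\<in>orb_hom G H K. gpd_functor (val P K) (val P H) (res P H K f)) \<and>
     (\<forall>H. subgroup H G \<longrightarrow>
        gpd_map_eq (val P H) (res P H H (\<lambda>C\<in>(lcosets\<^bsub>G\<^esub> H). C)) gpd_id) \<and>
     (\<forall>H K L. \<forall>f\<in>orb_hom G H K. \<forall>f'\<in>orb_hom G K L.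
        gpd_map_eq (val P L)
          (res P H L (compose (lcosets\<^bsub>G\<^esub> H) f' f)) (res P H K f \<circ>\<^sub>g res P K L f'))"

definition orb_nat_trans :: "('g, 'z) monoid_scheme \<Rightarrow> ('g, 'o, 'm) orb_data \<Rightarrow> ('g, 'p, 'n) orb_data
    \<Rightarrow> ('g set \<Rightarrow> ('o, 'm, 'p, 'n) gpd_map) \<Rightarrow> bool" where
  "orb_nat_trans G P P' \<Phi> \<longleftrightarrow>
     (\<forall>H. subgroup H G \<longrightarrow> gpd_functor (val P H) (val P' H) (\<Phi> H)) \<and>
     (\<forall>H K. \<forall>f\<in>orb_hom G H K.
        gpd_map_eq (val P K) (\<Phi> H \<circ>\<^sub>g res P H K f) (res P' H K f \<circ>\<^sub>g \<Phi> K))"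

definition orb_nat_iso :: "('g, 'z) monoid_scheme \<Rightarrow> ('g, 'o, 'm) orb_data \<Rightarrow> ('g, 'p, 'n) orb_data
    \<Rightarrow> ('g set \<Rightarrow> ('o, 'm, 'p, 'n) gpd_map) \<Rightarrow> bool" where
  "orb_nat_iso G P P' \<Phi> \<longleftrightarrow> orb_nat_trans G P P' \<Phi> \<and>
     (\<forall>H. subgroup H G \<longrightarrow> gpd_iso (val P H) (val P' H) (\<Phi> H))"

definition orb_trans_eq :: "('g, 'z) monoid_scheme \<Rightarrow> ('g, 'o, 'm) orb_data
    \<Rightarrow> ('g set \<Rightarrow> ('o, 'm, 'p, 'n) gpd_map) \<Rightarrow> ('g set \<Rightarrow> ('o, 'm, 'p, 'n) gpd_map) \<Rightarrow> bool" where
  "orb_trans_eq G P \<Phi> \<Phi>' \<longleftrightarrow> (\<forall>H. subgroup H G \<longrightarrow> gpd_map_eq (val P H) (\<Phi> H) (\<Phi>' H))"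


section \<open>Fundamental groupoids and vanishing of homotopy groups\<close>

definition path_class :: "'x topology \<Rightarrow> (real \<Rightarrow> 'x) \<Rightarrow> (real \<Rightarrow> 'x) set" where
  "path_class X p = {q. pathin X q \<and>
     homotopic_with (\<lambda>r. r 0 = p 0 \<and> r 1 = p 1) (top_of_set {0..1}) X p q}"

definition path_rep :: "(real \<Rightarrow> 'x) set \<Rightarrow> real \<Rightarrow> 'x" where
  "path_rep c = (SOME p. p \<in> c)"

text \<open>The library's \<open>joinpaths\<close> is restricted to types of class \<open>topological_space\<close>.\<close>

definition path_join :: "(real \<Rightarrow> 'x) \<Rightarrow> (real \<Rightarrow> 'x) \<Rightarrow> real \<Rightarrow> 'x" where
  "path_join p q = (\<lambda>t. if t \<le> 1/2 then p (2 * t) else q (2 * t - 1))"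

text \<open>The full subgroupoid, on the objects \<open>A\<close>, of the fundamental groupoid of \<open>X\<close>.\<close>

definition fund_groupoid :: "'x topology \<Rightarrow> 'x set \<Rightarrow> ('x, (real \<Rightarrow> 'x) set) cat_data" where
  "fund_groupoid X A =
     \<lparr>Ob = topspace X \<inter> A,
      Mor = {path_class X p | p. pathin X p \<and> p 0 \<in> A \<and> p 1 \<in> A},
      src = (\<lambda>c. path_rep c 0),
      tgt = (\<lambda>c. path_rep c 1),
      idm = (\<lambda>x. path_class X (\<lambda>t. x)),
      cmp = (\<lambda>c d. path_class X (path_join (path_rep c) (path_rep d)))\<rparr>"

definition fund_groupoid_map :: "'y topology \<Rightarrow> ('x \<Rightarrow> 'y)
    \<Rightarrow> ('x, (real \<Rightarrow> 'x) set, 'y, (real \<Rightarrow> 'y) set) gpd_map" where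
  "fund_groupoid_map Y f = \<lparr>on_ob = f, on_mor = (\<lambda>c. path_class Y (f \<circ> path_rep c))\<rparr>"

text \<open>The discs \<open>D\<^sup>n\<close> as subspaces of the library's \<open>n\<close>-dimensional Euclidean space. For \<open>n = 0\<close>
  the disc is a point with empty boundary.\<close>

definition disc :: "nat \<Rightarrow> (nat \<Rightarrow> real) topology" where
  "disc n = subtopology (Euclidean_space n) {x. (\<Sum>i<n. (x i)\<^sup>2) \<le> 1}"

definition disc_boundary :: "nat \<Rightarrow> (nat \<Rightarrow> real) set" where
  "disc_boundary n = {x \<in> topspace (disc n). (\<Sum>i<n. (x i)\<^sup>2) = 1}"

text \<open>The underlying pointed set of \<open>\<pi>\<^sub>n(X, x)\<close>: homotopy classes of maps
  \<open>(D\<^sup>n, S\<^sup>n\<^sup>-\<^sup>1) \<rightarrow> (X, x)\<close> of pairs. The multiplication is irrelevant to the vanishing of the group.\<close>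

definition disc_maps :: "nat \<Rightarrow> 'x topology \<Rightarrow> 'x \<Rightarrow> ((nat \<Rightarrow> real) \<Rightarrow> 'x) set" where
  "disc_maps n X x = {f. continuous_map (disc n) X f \<and> (\<forall>d\<in>disc_boundary n. f d = x)}"

definition disc_class ::
    "nat \<Rightarrow> 'x topology \<Rightarrow> 'x \<Rightarrow> ((nat \<Rightarrow> real) \<Rightarrow> 'x) \<Rightarrow> ((nat \<Rightarrow> real) \<Rightarrow> 'x) set" where
  "disc_class n X x f = {f' \<in> disc_maps n X x.
     homotopic_with (\<lambda>h. \<forall>d\<in>disc_boundary n. h d = x) (disc n) X f f'}"

definition homotopy_group_set :: "nat \<Rightarrow> 'x topology \<Rightarrow> 'x \<Rightarrow> ((nat \<Rightarrow> real) \<Rightarrow> 'x) set set" where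
  "homotopy_group_set n X x = disc_class n X x ` disc_maps n X x"

definition homotopy_group_vanishes :: "nat \<Rightarrow> 'x topology \<Rightarrow> 'x \<Rightarrow> bool" where
  "homotopy_group_vanishes n X x \<longleftrightarrow> homotopy_group_set n X x = {disc_class n X x (\<lambda>d. x)}"


section \<open>\<open>G\<close>-CW-complexes\<close>

text \<open>A space with an action and a filtration. The filtration by skeleta, but not a choice of
  characteristic maps, is part of the structure.\<close>

record ('g, 'x) gcw_data =
  spc :: "'x topology"
  act :: "'g \<Rightarrow> 'x \<Rightarrow> 'x"
  skel :: "nat \<Rightarrow> 'x set"

text \<open>The group is discrete, so continuity of the action is continuity of each translation.\<close>

definition G_space :: "('g, 'z) monoid_scheme \<Rightarrow> ('g, 'x) gcw_data \<Rightarrow> bool" where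
  "G_space G X \<longleftrightarrow> group_action G (topspace (spc X)) (act X) \<and>
     (\<forall>g\<in>carrier G. continuous_map (spc X) (spc X) (act X g))"

definition G_cell :: "('g, 'z) monoid_scheme \<Rightarrow> 'g set \<Rightarrow> nat \<Rightarrow> ('g set \<times> (nat \<Rightarrow> real)) topology" where
  "G_cell G H n = prod_topology (discrete_topology (lcosets\<^bsub>G\<^esub> H)) (disc n)"

text \<open>\<open>B\<close> arises from \<open>A\<close> by attaching equivariant \<open>n\<close>-cells \<open>G/S\<^sub>i \<times> D\<^sup>n\<close> with characteristic
  maps \<open>q\<^sub>i\<close>, i.e. \<open>B\<close> is the pushout of \<open>A\<close> and the cells along their boundaries: as a set this
  is the bijectivity condition, as a space the last condition. Indexing the cells by
  points of \<open>X\<close> is no restriction, since distinct cells have distinct centres.\<close>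

definition attach_G_cells ::
    "('g, 'z) monoid_scheme \<Rightarrow> ('g, 'x) gcw_data \<Rightarrow> nat \<Rightarrow> 'x set \<Rightarrow> 'x set \<Rightarrow> bool" where
  "attach_G_cells G X n A B \<longleftrightarrow> A \<subseteq> B \<and> B \<subseteq> topspace (spc X) \<and>
     (\<exists>(I :: 'x set) (S :: 'x \<Rightarrow> 'g set) (q :: 'x \<Rightarrow> 'g set \<times> (nat \<Rightarrow> real) \<Rightarrow> 'x).
        (\<forall>i\<in>I. subgroup (S i) G) \<and>
        (\<forall>i\<in>I. continuous_map (G_cell G (S i) n) (subtopology (spc X) B) (q i)) \<and>
        (\<forall>i\<in>I. \<forall>g\<in>carrier G. \<forall>C\<in>(lcosets\<^bsub>G\<^esub> (S i)). \<forall>d\<in>topspace (disc n).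
           q i (g <#\<^bsub>G\<^esub> C, d) = act X g (q i (C, d))) \<and>
        (\<forall>i\<in>I. \<forall>C\<in>(lcosets\<^bsub>G\<^esub> (S i)). \<forall>d\<in>disc_boundary n. q i (C, d) \<in> A) \<and>
        bij_betw (\<lambda>(i, z). q i z)
          (SIGMA i:I. (lcosets\<^bsub>G\<^esub> (S i)) \<times> (topspace (disc n) - disc_boundary n)) (B - A) \<and>
        (\<forall>U. U \<subseteq> B \<longrightarrow>
           (openin (subtopology (spc X) B) U \<longleftrightarrow>
              openin (subtopology (spc X) A) (U \<inter> A) \<and>
              (\<forall>i\<in>I. openin (G_cell G (S i) n) {z \<in> topspace (G_cell G (S i) n). q i z \<in> U}))))"

definition colimit_topology :: "'x topology \<Rightarrow> (nat \<Rightarrow> 'x set) \<Rightarrow> bool" where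
  "colimit_topology X A \<longleftrightarrow> topspace X = (\<Union>n. A n) \<and>
     (\<forall>U. U \<subseteq> topspace X \<longrightarrow>
        (openin X U \<longleftrightarrow> (\<forall>n. openin (subtopology X (A n)) (U \<inter> A n))))"

definition G_CW_complex :: "('g, 'z) monoid_scheme \<Rightarrow> ('g, 'x) gcw_data \<Rightarrow> bool" where
  "G_CW_complex G X \<longleftrightarrow> G_space G X \<and>
     attach_G_cells G X 0 {} (skel X 0) \<and>
     (\<forall>n. attach_G_cells G X (Suc n) (skel X n) (skel X (Suc n))) \<and>
     colimit_topology (spc X) (skel X)"

definition sub_gcw :: "('g, 'x) gcw_data \<Rightarrow> 'x set \<Rightarrow> ('g, 'x) gcw_data" where
  "sub_gcw X A = \<lparr>spc = subtopology (spc X) A,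
                  act = (\<lambda>g. restrict (act X g) A),
                  skel = (\<lambda>n. skel X n \<inter> A)\<rparr>"

definition fixed_set :: "('g, 'x) gcw_data \<Rightarrow> 'g set \<Rightarrow> 'x set" where
  "fixed_set X H = {x \<in> topspace (spc X). \<forall>h\<in>H. act X h x = x}"

definition fixed_space :: "('g, 'x) gcw_data \<Rightarrow> 'g set \<Rightarrow> 'x topology" where
  "fixed_space X H = subtopology (spc X) (fixed_set X H)"

definition G_equivariant ::
    "('g, 'z) monoid_scheme \<Rightarrow> ('g, 'y) gcw_data \<Rightarrow> ('g, 'x) gcw_data \<Rightarrow> ('y \<Rightarrow> 'x) \<Rightarrow> bool" where
  "G_equivariant G Y X f \<longleftrightarrow>
     (\<forall>g\<in>carrier G. \<forall>y\<in>topspace (spc Y). f (act Y g y) = act X g (f y))"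

definition cellular_G_map ::
    "('g, 'z) monoid_scheme \<Rightarrow> ('g, 'y) gcw_data \<Rightarrow> ('g, 'x) gcw_data \<Rightarrow> ('y \<Rightarrow> 'x) \<Rightarrow> bool" where
  "cellular_G_map G Y X f \<longleftrightarrow> continuous_map (spc Y) (spc X) f \<and> G_equivariant G Y X f \<and>
     (\<forall>n. f ` skel Y n \<subseteq> skel X n)"

definition G_homotopic :: "('g, 'z) monoid_scheme \<Rightarrow> ('g, 'y) gcw_data \<Rightarrow> ('g, 'x) gcw_data
    \<Rightarrow> ('y \<Rightarrow> 'x) \<Rightarrow> ('y \<Rightarrow> 'x) \<Rightarrow> bool" where
  "G_homotopic G Y X f f' \<longleftrightarrow> homotopic_with (G_equivariant G Y X) (spc Y) (spc X) f f'"


section \<open>The fundamental groupoid functor\<close>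

text \<open>A \<open>G\<close>-map \<open>f : G/H \<rightarrow> G/K\<close> is \<open>xH \<mapsto> xgK\<close> exactly for the elements \<open>g\<close> of the
  coset \<open>f(H) = gK\<close>; on points fixed by \<open>K\<close> the translation by \<open>g\<close> only depends on this coset.\<close>

definition Pi1 :: "('g, 'x) gcw_data \<Rightarrow> ('g, 'x, (real \<Rightarrow> 'x) set) orb_data" where
  "Pi1 X =
     \<lparr>val = (\<lambda>H. fund_groupoid (fixed_space X H) (skel X 0)),
      res = (\<lambda>H K f. fund_groupoid_map (fixed_space X H) (act X (SOME g. g \<in> f H)))\<rparr>"

definition Pi1_map :: "('g, 'x) gcw_data \<Rightarrow> ('y \<Rightarrow> 'x)
    \<Rightarrow> 'g set \<Rightarrow> ('y, (real \<Rightarrow> 'y) set, 'x, (real \<Rightarrow> 'x) set) gpd_map" where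
  "Pi1_map X f = (\<lambda>H. fund_groupoid_map (fixed_space X H) f)"


section \<open>Universal spaces\<close>

text \<open>The stage \<open>X\<^sub>k\<close> of the construction is \<open>Xs k\<close> for \<open>k \<ge> 2\<close> (\<open>Xs 0\<close> and \<open>Xs 1\<close> are unused),
  and \<open>\<theta>\<close> is the identification of the fundamental groupoid functor of \<open>X\<^sub>2\<close> with \<open>P\<close>.
  It is not assumed that \<open>X\<^sub>2\<close> is \<open>2\<close>-dimensional, so the \<open>k\<close>-skeleton of \<open>B\<close> may be smaller than
  \<open>X\<^sub>k\<close>: it consists of the \<open>k\<close>-skeleton of \<open>X\<^sub>2\<close> and the cells attached up to stage \<open>k\<close>.\<close>

definition universal_space :: "('g, 'z) monoid_scheme \<Rightarrow> ('g, 'o, 'm) orb_data \<Rightarrow> ('g, 'x) gcw_data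
    \<Rightarrow> (nat \<Rightarrow> 'x set) \<Rightarrow> ('g set \<Rightarrow> ('x, (real \<Rightarrow> 'x) set, 'o, 'm) gpd_map) \<Rightarrow> bool" where
  "universal_space G P B Xs \<theta> \<longleftrightarrow>
     G_CW_complex G B \<and>
     G_CW_complex G (sub_gcw B (Xs 2)) \<and>
     orb_nat_iso G (Pi1 (sub_gcw B (Xs 2))) P \<theta> \<and>
     (\<forall>k\<ge>3. attach_G_cells G B k (Xs (k - 1)) (Xs k)) \<and>
     (\<forall>k\<ge>2. Xs k = Xs 2 \<union> skel B k) \<and>
     colimit_topology (spc B) (\<lambda>n. Xs (n + 2)) \<and>
     (\<forall>k\<ge>3. \<forall>H. subgroup H G \<longrightarrow> (\<forall>j\<in>{2..k - 1}. \<forall>x\<in>fixed_set (sub_gcw B (Xs k)) H.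
        homotopy_group_vanishes j (fixed_space (sub_gcw B (Xs k)) H) x))"

text \<open>The canonical identification of the fundamental groupoid functor of \<open>B\<close> with \<open>P\<close>: undo the
  isomorphism induced by the inclusion of \<open>X\<^sub>2\<close>, then apply \<open>\<theta>\<close>.\<close>

definition universal_ident :: "('g, 'x) gcw_data \<Rightarrow> (nat \<Rightarrow> 'x set)
    \<Rightarrow> ('g set \<Rightarrow> ('x, (real \<Rightarrow> 'x) set, 'o, 'm) gpd_map)
    \<Rightarrow> 'g set \<Rightarrow> ('x, (real \<Rightarrow> 'x) set, 'o, 'm) gpd_map" where
  "universal_ident B Xs \<theta> =
     (\<lambda>H. \<theta> H \<circ>\<^sub>g gpd_inv (val (Pi1 (sub_gcw B (Xs 2))) H) (Pi1_map B (\<lambda>x. x) H))"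

text \<open>The natural transformation \<open>\<phi>\<^sub>#\<close> of a cellular \<open>G\<close>-map \<open>\<phi>\<close> into a universal space for \<open>P\<close>,
  regarded as a transformation with target \<open>P\<close>.\<close>

definition universal_map :: "('g, 'x) gcw_data \<Rightarrow> (nat \<Rightarrow> 'x set)
    \<Rightarrow> ('g set \<Rightarrow> ('x, (real \<Rightarrow> 'x) set, 'o, 'm) gpd_map) \<Rightarrow> ('y \<Rightarrow> 'x)
    \<Rightarrow> 'g set \<Rightarrow> ('y, (real \<Rightarrow> 'y) set, 'o, 'm) gpd_map" where
  "universal_map B Xs \<theta> \<phi> = (\<lambda>H. universal_ident B Xs \<theta> H \<circ>\<^sub>g Pi1_map B \<phi> H)"

end

theory Submission
  imports Defs
begin

text \<open>The proof is obstruction theory, carried out in one fixed point set at a time. An equivariant map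
  on a cell \<open>G/S \<times> D\<^sup>n\<close> is the same as a map of \<open>D\<^sup>n\<close> into the \<open>S\<close>-fixed points of the target, since
  its values on the translates are forced (\<open>equivariant_homotopy_extension\<close>). Both existence and
  uniqueness are therefore inductions over the skeleta of \<open>Y\<close>, in which every cell of type \<open>S\<close> poses an
  ordinary extension problem in \<open>B\<^sup>S\<close>.

  Two properties of \<open>B\<^sup>S\<close> solve these problems. Its homotopy groups vanish from degree 2 on
  (\<open>fixed_points_aspherical\<close>), and its fundamental groupoid is that of the \<open>S\<close>-fixed points of \<open>X\<^sub>2\<close>
  (\<open>inclusion_iso\<close>), hence is identified with the value of \<open>P\<close> at \<open>S\<close>. Both are consequences of
  cellular approximation: a compact subset of \<open>B\<^sup>S\<close> lies in some stage of the construction, and a map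
  on a compact set of dimension \<open>l\<close> can be pushed off all cells of larger dimension, relative to the
  points that are already in the lower stage (\<open>compress_into_lower_stage\<close>). This makes sense within
  \<open>B\<^sup>S\<close> because \<open>B\<^sup>S\<close> is itself a cell complex, whose cells are those translates of equivariant
  cells that \<open>S\<close> fixes (\<open>fixed_attachment\<close>). To push a map off the centre of a cell, its
  coordinates are replaced by Lipschitz functions; by a counting argument these cannot hit all points of
  a fine grid around the origin (\<open>lipschitz_image_misses_point\<close>).

  For existence, \<open>\<Phi>\<close> is first turned into a transformation \<open>\<Psi>\<close> into the fundamental groupoid
  functor of \<open>B\<close> (\<open>universal_map_iff\<close>). On objects \<open>\<Psi>\<close> prescribes the map on vertices. An edge of
  type \<open>S\<close> is a path in \<open>Y\<^sup>S\<close>, and is mapped to a representative of its image under \<open>\<Psi>\<close>. Every path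
  between vertices of a graph is homotopic to a product of edges and their inverses (\<open>path_induct\<close>),
  and an edge of \<open>Y\<^sup>H\<close> is a translate of an edge of type \<open>S\<close> along a map of orbits
  \<open>G/H \<rightarrow> G/S\<close>; functoriality and naturality of \<open>\<Psi>\<close> imply that the map realizes \<open>\<Psi>\<close> on all paths
  in the 1-skeleton of \<open>Y\<^sup>H\<close>. The attaching circle of a 2-cell of type \<open>S\<close> is null homotopic in
  \<open>Y\<^sup>S\<close>, thus its image represents the value of \<open>\<Psi>\<close> on an identity and is null homotopic in \<open>B\<^sup>S\<close>
  (\<open>attaching_circle_null\<close>). Higher cells meet no obstruction (\<open>realization\<close>). Cellular approximation
  relative to the boundary keeps the map cellular throughout.

  For uniqueness, two maps that induce \<open>\<Phi>\<close> agree on vertices and are homotopic relative to the end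
  points on edges. On a cell of dimension \<open>n \<ge> 2\<close> the homotopy is prescribed on the boundary of
  \<open>[0,1] \<times> D\<^sup>n\<close>, which is an \<open>n\<close>-sphere, and it extends because spheres in \<open>B\<^sup>S\<close> are null homotopic
  (\<open>equivariant_homotopy_unique\<close>).\<close>

section \<open>Maps that miss the origin\<close>

text \<open>A uniform bound on covering numbers, slightly stronger than upper box dimension at most \<open>n\<close>.
  It is the only notion of dimension used for the domains of cellular approximation: it passes to
  products and bounds the size of Lipschitz images.\<close>

definition box_dim_le :: "nat \<Rightarrow> 'k::metric_space set \<Rightarrow> bool" where
  "box_dim_le n K \<longleftrightarrow> (\<exists>C::nat. \<forall>N>0. \<exists>F. finite F \<and> card F \<le> C * N ^ n \<and> K \<subseteq> \<Union>F \<and>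
     (\<forall>S\<in>F. \<forall>x\<in>S. \<forall>y\<in>S. dist x y \<le> 1 / real N))"

lemma box_dim_le_interval: "box_dim_le 1 {0..1::real}"
  unfolding box_dim_le_def
proof (intro exI[of _ 2] allI impI)
  fix N :: nat assume N: "N > 0"
  define S where "S k = {real k / N .. (real k + 1) / N}" for k
  show "\<exists>F. finite F \<and> card F \<le> 2 * N ^ 1 \<and> {0..1::real} \<subseteq> \<Union> F \<and> (\<forall>S\<in>F. \<forall>x\<in>S. \<forall>y\<in>S. dist x y \<le> 1 / real N)"
  proof (intro exI[of _ "S ` {..N}"] conjI ballI)
    have "card (S ` {..N}) \<le> N + 1" using card_image_le[of "{..N}" S] by simp
    then show "card (S ` {..N}) \<le> 2 * N ^ 1" using N by simp
    show "{0..1::real} \<subseteq> \<Union> (S ` {..N})"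
    proof
      fix x :: real assume x: "x \<in> {0..1}"
      define k where "k = nat \<lfloor>x * N\<rfloor>"
      have "x * N \<ge> 0" using x by simp
      then have k: "real k \<le> x * N" "x * N < real k + 1" unfolding k_def by linarith+
      have "x * N \<le> N" using x by (simp add: mult_left_le_one_le)
      then have "k \<le> N" using k by linarith
      moreover have "x \<in> S k" using k N by (simp add: S_def field_simps)
      ultimately show "x \<in> \<Union> (S ` {..N})" by auto
    qed
    fix T x y assume "T \<in> S ` {..N}" "x \<in> T" "y \<in> T"
    then obtain k where k: "real k / N \<le> x" "x \<le> (real k + 1) / N" "real k / N \<le> y" "y \<le> (real k + 1) / N"
      by (auto simp: S_def)
    have "(real k + 1) / N = real k / N + 1 / N" by (simp add: add_divide_distrib)
    then show "dist x y \<le> 1 / real N" using k unfolding dist_real_def by linarith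
  qed auto
qed

text \<open>Products of covers are covers; the scale is halved since the distance in a product is at most
  the sum of the distances in the factors.\<close>

lemma box_dim_le_Times:
  assumes "box_dim_le m A" "box_dim_le n B"
  shows "box_dim_le (m + n) (A \<times> B)"
proof -
  obtain C where C: "\<And>N. N > 0 \<Longrightarrow> \<exists>F. finite F \<and> card F \<le> C * N ^ m \<and> A \<subseteq> \<Union>F \<and>
     (\<forall>S\<in>F. \<forall>x\<in>S. \<forall>y\<in>S. dist x y \<le> 1 / real N)" using assms(1) unfolding box_dim_le_def by blast
  obtain D where D: "\<And>N. N > 0 \<Longrightarrow> \<exists>F. finite F \<and> card F \<le> D * N ^ n \<and> B \<subseteq> \<Union>F \<and>
     (\<forall>S\<in>F. \<forall>x\<in>S. \<forall>y\<in>S. dist x y \<le> 1 / real N)" using assms(2) unfolding box_dim_le_def by blast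
  show ?thesis unfolding box_dim_le_def
  proof (intro exI[of _ "C * D * 2 ^ (m + n)"] allI impI)
    fix N :: nat assume N: "N > 0"
    then have "2 * N > 0" by simp
    from C[OF this] obtain F where F: "finite F" "card F \<le> C * (2*N) ^ m" "A \<subseteq> \<Union>F"
      "\<And>S x y. S\<in>F \<Longrightarrow> x\<in>S \<Longrightarrow> y\<in>S \<Longrightarrow> dist x y \<le> 1 / real (2*N)" by blast
    from D[OF \<open>2 * N > 0\<close>] obtain E where E: "finite E" "card E \<le> D * (2*N) ^ n" "B \<subseteq> \<Union>E"
      "\<And>S x y. S\<in>E \<Longrightarrow> x\<in>S \<Longrightarrow> y\<in>S \<Longrightarrow> dist x y \<le> 1 / real (2*N)" by blast
    show "\<exists>F. finite F \<and> card F \<le> C * D * 2 ^ (m + n) * N ^ (m + n) \<and> A \<times> B \<subseteq> \<Union> F \<and>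
      (\<forall>S\<in>F. \<forall>x\<in>S. \<forall>y\<in>S. dist x y \<le> 1 / real N)"
    proof (intro exI[of _ "(\<lambda>(S,T). S \<times> T) ` (F \<times> E)"] conjI ballI)
      show "finite ((\<lambda>(S,T). S \<times> T) ` (F \<times> E))" using F E by simp
      have "card ((\<lambda>(S,T). S \<times> T) ` (F \<times> E)) \<le> card F * card E"
        using card_image_le[of "F \<times> E" "\<lambda>(S,T). S \<times> T"] F E by (simp add: card_cartesian_product)
      also have "\<dots> \<le> (C * (2*N) ^ m) * (D * (2*N) ^ n)" using F(2) E(2) by (rule mult_le_mono)
      also have "\<dots> = C * D * 2 ^ (m + n) * N ^ (m + n)" by (simp add: power_mult_distrib power_add)
      finally show "card ((\<lambda>(S,T). S \<times> T) ` (F \<times> E)) \<le> C * D * 2 ^ (m + n) * N ^ (m + n)" .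
      show "A \<times> B \<subseteq> \<Union> ((\<lambda>(S,T). S \<times> T) ` (F \<times> E))" using F(3) E(3) by fastforce
      fix R x y assume "R \<in> (\<lambda>(S,T). S \<times> T) ` (F \<times> E)" "x \<in> R" "y \<in> R"
      then obtain S T where ST: "S \<in> F" "T \<in> E" "fst x \<in> S" "fst y \<in> S" "snd x \<in> T" "snd y \<in> T" by auto
      have "dist x y = sqrt ((dist (fst x) (fst y))\<^sup>2 + (dist (snd x) (snd y))\<^sup>2)" by (simp add: dist_prod_def)
      also have "\<dots> \<le> dist (fst x) (fst y) + dist (snd x) (snd y)" by (rule sqrt_sum_squares_le_sum) auto
      also have "\<dots> \<le> 1 / real (2*N) + 1 / real (2*N)" using F(4) E(4) ST by (meson add_mono)
      also have "\<dots> = 1 / real N" using N by simp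
      finally show "dist x y \<le> 1 / real N" .
    qed
  qed
qed

text \<open>The largest function below \<open>f\<close> with Lipschitz constant \<open>L\<close> is the infimum of the cones with
  slope \<open>L\<close> over the graph of \<open>f\<close>. For large \<open>L\<close> it is close to \<open>f\<close>, since \<open>f\<close> is
  bounded and uniformly continuous.\<close>

lemma lipschitz_approximation:
  fixes f :: "'k::metric_space \<Rightarrow> real"
  assumes K: "compact K" and f: "continuous_on K f" and e: "e > 0"
  obtains g L where "L \<ge> 0" "\<And>x y. x \<in> K \<Longrightarrow> y \<in> K \<Longrightarrow> \<bar>g x - g y\<bar> \<le> L * dist x y"
    "\<And>x. x \<in> K \<Longrightarrow> \<bar>g x - f x\<bar> < e"
proof (cases "K = {}")
  case True then show ?thesis using that[of 0 "\<lambda>_. 0"] by auto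
next
  case ne: False
  have "bounded (f ` K)" using K f by (simp add: compact_continuous_image compact_imp_bounded)
  then obtain M where M: "\<And>x. x \<in> K \<Longrightarrow> \<bar>f x\<bar> \<le> M" by (auto simp: bounded_iff)
  have M0: "M \<ge> 0" using M ne by fastforce
  have "uniformly_continuous_on K f" by (rule compact_uniformly_continuous[OF f K])
  then obtain d where d: "d > 0" "\<And>x y. x \<in> K \<Longrightarrow> y \<in> K \<Longrightarrow> dist y x < d \<Longrightarrow> dist (f y) (f x) < e/2"
    using e unfolding uniformly_continuous_on_def by (metis half_gt_zero)
  \<comment> \<open>with this slope, points at distance at least \<open>d\<close> do not affect the infimum\<close>
  define L where "L = 2 * M / d"
  have L0: "L \<ge> 0" using M0 d by (simp add: L_def)
  define g where "g x = (INF y\<in>K. f y + L * dist x y)" for x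
  have bdd: "bdd_below ((\<lambda>y. f y + L * dist x y) ` K)" for x
  proof (rule bdd_belowI[of _ "-M"])
    fix v assume "v \<in> (\<lambda>y. f y + L * dist x y) ` K"
    then obtain y where "y \<in> K" "v = f y + L * dist x y" by auto
    moreover have "L * dist x y \<ge> 0" using L0 by simp
    ultimately show "-M \<le> v" using M[of y] by linarith
  qed
  have le: "g x \<le> f y + L * dist x y" if "y \<in> K" for x y
    unfolding g_def by (rule cINF_lower[OF bdd that])
  have lip: "g x \<le> g z + L * dist x z" for x z
  proof -
    have "g x - L * dist x z \<le> g z" unfolding g_def[of z]
    proof (rule cINF_greatest[OF ne])
      fix y assume y: "y \<in> K"
      have "L * dist x y \<le> L * (dist x z + dist z y)" by (rule mult_left_mono[OF dist_triangle L0])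
      then show "g x - L * dist x z \<le> f y + L * dist z y" using le[OF y, of x] by (simp add: algebra_simps)
    qed
    then show ?thesis by simp
  qed
  show ?thesis
  proof (rule that[OF L0])
    show "\<bar>g x - g y\<bar> \<le> L * dist x y" for x y
      using lip[of x y] lip[of y x] by (simp add: dist_commute abs_le_iff)
    fix x assume x: "x \<in> K"
    have "f x - e/2 \<le> g x" unfolding g_def
    proof (rule cINF_greatest[OF ne])
      fix y assume y: "y \<in> K"
      show "f x - e/2 \<le> f y + L * dist x y"
      proof (cases "dist x y < d")
        case True
        then have "\<bar>f y - f x\<bar> < e/2" using d(2)[OF x y] by (metis dist_commute dist_real_def)
        then have "f x - e/2 \<le> f y" by linarith
        moreover have "L * dist x y \<ge> 0" using L0 by simp
        ultimately show ?thesis by linarith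
      next
        case False
        then have "2 * M \<le> L * dist x y" using d M0 mult_left_mono[of d "dist x y" L] L0 by (simp add: L_def)
        then show ?thesis using M[OF x] M[OF y] e by linarith
      qed
    qed
    moreover have "g x \<le> f x" using le[OF x, of x] by simp
    ultimately show "\<bar>g x - f x\<bar> < e" using e by linarith
  qed
qed

text \<open>A pigeonhole argument replaces Sard's theorem: if the image contained all points of a fine
  grid with \<open>M\<^sup>m\<close> points, then distinct grid points would come from distinct members of a cover of
  \<open>K\<close> by pieces whose images are smaller than the mesh, and for \<open>n < m\<close> there are fewer than \<open>M\<^sup>m\<close>
  such pieces.\<close>

lemma lipschitz_image_misses_point:
  fixes g :: "nat \<Rightarrow> 'k::metric_space \<Rightarrow> real"
  assumes K: "box_dim_le n K" and nm: "n < m" and eta: "\<eta> > 0"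
    and lip: "\<And>i x y. i < m \<Longrightarrow> x \<in> K \<Longrightarrow> y \<in> K \<Longrightarrow> \<bar>g i x - g i y\<bar> \<le> L * dist x y"
  obtains p where "\<And>i. i < m \<Longrightarrow> 0 \<le> p i \<and> p i < \<eta>" "\<And>x. x \<in> K \<Longrightarrow> \<exists>i<m. g i x \<noteq> p i"
proof -
  obtain C where C: "\<And>N. N > 0 \<Longrightarrow> \<exists>F. finite F \<and> card F \<le> C * N ^ n \<and> K \<subseteq> \<Union>F \<and>
     (\<forall>S\<in>F. \<forall>x\<in>S. \<forall>y\<in>S. dist x y \<le> 1 / real N)" using K unfolding box_dim_le_def by blast
  obtain a :: nat where a: "real a > max L 0 / \<eta>" using reals_Archimedean2 by blast
  have a0: "a > 0" using a eta
    by (metis divide_nonneg_pos gr0I less_eq_real_def max.cobounded2 not_less of_nat_0)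
  \<comment> \<open>the mesh is \<open>\<eta> / M\<close>, the scale of the cover is \<open>1 / (M * a)\<close>; a cover of that scale has at most \<open>C * (M * a) ^ n < M ^ (n + 1)\<close> members\<close>
  define M where "M = C * a ^ n + 1"
  have M0: "M > 0" by (simp add: M_def)
  define N where "N = M * a"
  have N0: "N > 0" using a0 M0 by (simp add: N_def)
  from C[OF N0] obtain F where F: "finite F" "card F \<le> C * N ^ n" "K \<subseteq> \<Union>F"
      "\<And>S x y. S\<in>F \<Longrightarrow> x\<in>S \<Longrightarrow> y\<in>S \<Longrightarrow> dist x y \<le> 1 / real N" by blast
  define Q where "Q = ({..<m} \<rightarrow>\<^sub>E {..<M})"
  define p where "p \<kappa> i = real (\<kappa> i) / M * \<eta>" for \<kappa> :: "nat \<Rightarrow> nat" and i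
  have "\<exists>\<kappa>\<in>Q. \<forall>x\<in>K. \<exists>i<m. g i x \<noteq> p \<kappa> i"
  proof (rule ccontr)
    assume "\<not> ?thesis"
    then have "\<forall>\<kappa>\<in>Q. \<exists>x\<in>K. \<forall>i<m. g i x = p \<kappa> i" by blast
    then obtain x where x: "\<And>\<kappa>. \<kappa> \<in> Q \<Longrightarrow> x \<kappa> \<in> K" "\<And>\<kappa> i. \<kappa> \<in> Q \<Longrightarrow> i < m \<Longrightarrow> g i (x \<kappa>) = p \<kappa> i" by metis
    have "\<forall>\<kappa>\<in>Q. \<exists>S\<in>F. x \<kappa> \<in> S" using x(1) F(3) by blast
    then obtain S where S: "\<And>\<kappa>. \<kappa> \<in> Q \<Longrightarrow> S \<kappa> \<in> F" "\<And>\<kappa>. \<kappa> \<in> Q \<Longrightarrow> x \<kappa> \<in> S \<kappa>" by metis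
    have "inj_on S Q"
    proof (rule inj_onI)
      fix \<kappa> \<mu> assume k: "\<kappa> \<in> Q" "\<mu> \<in> Q" "S \<kappa> = S \<mu>"
      have d: "dist (x \<kappa>) (x \<mu>) \<le> 1 / real N" using F(4) S k by metis
      have "\<kappa> i = \<mu> i" if i: "i < m" for i
      proof (rule ccontr)
        assume "\<kappa> i \<noteq> \<mu> i"
        then have "1 \<le> \<bar>real (\<kappa> i) - real (\<mu> i)\<bar>" by linarith
        then have "\<eta> / M \<le> \<bar>real (\<kappa> i) - real (\<mu> i)\<bar> * (\<eta> / M)"
          using eta M0 by (simp add: field_simps)
        also have "\<dots> = \<bar>(real (\<kappa> i) - real (\<mu> i)) * (\<eta> / M)\<bar>" using eta M0 by (simp add: abs_mult)
        also have "(real (\<kappa> i) - real (\<mu> i)) * (\<eta> / M) = p \<kappa> i - p \<mu> i" by (simp add: p_def algebra_simps)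
        also have "\<bar>p \<kappa> i - p \<mu> i\<bar> \<le> L * dist (x \<kappa>) (x \<mu>)" using lip[OF i x(1) x(1)] x(2) k i by simp
        also have "\<dots> \<le> max L 0 * (1 / real N)" using d by (intro mult_mono) auto
        also have "\<dots> = (max L 0 / a) / M" using a0 M0 by (simp add: N_def)
        also have "\<dots> < \<eta> / M" using a eta a0 M0 by (intro divide_strict_right_mono) (auto simp: field_simps)
        finally show False by simp
      qed
      then show "\<kappa> = \<mu>" using k unfolding Q_def by (intro PiE_ext) auto
    qed
    then have "card Q \<le> card F" using S(1) F(1) by (intro card_inj_on_le[of S]) auto
    then have "M ^ m \<le> C * (M * a) ^ n" using F(2) unfolding Q_def N_def by (simp add: card_PiE)
    also have "\<dots> = (C * a ^ n) * M ^ n" by (simp add: power_mult_distrib)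
    also have "\<dots> < M * M ^ n" using M0 by (simp add: M_def)
    also have "\<dots> = M ^ Suc n" by simp
    also have "\<dots> \<le> M ^ m" using nm M0 by (intro power_increasing) auto
    finally show False by simp
  qed
  then obtain \<kappa> where k: "\<kappa> \<in> Q" "\<And>x. x\<in>K \<Longrightarrow> \<exists>i<m. g i x \<noteq> p \<kappa> i" by blast
  have "0 \<le> p \<kappa> i \<and> p \<kappa> i < \<eta>" if "i < m" for i
  proof -
    have "\<kappa> i < M" using k(1) that by (auto simp: Q_def)
    then show ?thesis using eta M0 by (simp add: p_def field_simps)
  qed
  then show ?thesis using that k(2) by blast
qed

text \<open>Approximate the coordinates by Lipschitz functions and translate by a small vector that the
  approximation does not take as a value.\<close>

lemma approximation_avoiding_origin:
  fixes f :: "nat \<Rightarrow> 'k::metric_space \<Rightarrow> real"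
  assumes K: "compact K" "box_dim_le n K" "n < m" and e: "e > 0"
    and f: "\<And>i. i < m \<Longrightarrow> continuous_on K (f i)"
  obtains g where "\<And>i. i < m \<Longrightarrow> continuous_on K (g i)"
    "\<And>i x. i < m \<Longrightarrow> x \<in> K \<Longrightarrow> \<bar>g i x - f i x\<bar> < e" "\<And>x. x \<in> K \<Longrightarrow> \<exists>i<m. g i x \<noteq> 0"
proof -
  have "\<exists>g L. L \<ge> 0 \<and> (\<forall>x\<in>K. \<forall>y\<in>K. \<bar>g x - g y\<bar> \<le> L * dist x y) \<and> (\<forall>x\<in>K. \<bar>g x - f i x\<bar> < e/2)"
    if "i < m" for i
    using lipschitz_approximation[OF K(1) f[OF that], of "e/2"] e by (metis half_gt_zero)
  then obtain g L where g: "\<And>i. i < m \<Longrightarrow> L i \<ge> (0::real)"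
    "\<And>i x y. i < m \<Longrightarrow> x \<in> K \<Longrightarrow> y \<in> K \<Longrightarrow> \<bar>g i x - g i y\<bar> \<le> L i * dist x y"
    "\<And>i x. i < m \<Longrightarrow> x \<in> K \<Longrightarrow> \<bar>g i x - f i x\<bar> < e/2" by metis
  define M where "M = (\<Sum>i<m. L i)"
  have lip: "\<bar>g i x - g i y\<bar> \<le> M * dist x y" if "i < m" "x \<in> K" "y \<in> K" for i x y
  proof -
    have "L i \<le> M" unfolding M_def using that g(1) by (intro member_le_sum) auto
    then have "L i * dist x y \<le> M * dist x y" by (simp add: mult_right_mono)
    then show ?thesis using g(2) that by (meson order_trans)
  qed
  obtain p where p: "\<And>i. i < m \<Longrightarrow> 0 \<le> p i \<and> p i < e/2" "\<And>x. x \<in> K \<Longrightarrow> \<exists>i<m. g i x \<noteq> p i"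
    using lipschitz_image_misses_point[OF K(2,3), of "e/2" g M] e lip by auto
  show ?thesis
  proof (rule that[of "\<lambda>i x. g i x - p i"])
    fix i assume i: "i < m"
    have "(L i)-lipschitz_on K (g i)" using g(1,2) i by (intro lipschitz_onI) (auto simp: dist_real_def)
    then show "continuous_on K (\<lambda>x. g i x - p i)" by (intro continuous_intros lipschitz_on_continuous_on)
    show "\<bar>g i x - p i - f i x\<bar> < e" if "x \<in> K" for x using g(3)[OF i that] p(1)[OF i] by linarith
  next
    fix x assume "x \<in> K" then show "\<exists>i<m. g i x - p i \<noteq> 0" using p(2) by fastforce
  qed
qed

section \<open>The standard discs\<close>

abbreviation I01 :: "real topology" where "I01 \<equiv> top_of_set {0..1}"

abbreviation ball_pts :: "nat \<Rightarrow> (nat \<Rightarrow> real) set" where "ball_pts n \<equiv> topspace (disc n)"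

abbreviation rad :: "nat \<Rightarrow> (nat \<Rightarrow> real) \<Rightarrow> real" where "rad n x \<equiv> L2_set x {..<n}"

lemma ball_pts_iff: "x \<in> ball_pts n \<longleftrightarrow> (\<forall>i\<ge>n. x i = 0) \<and> rad n x \<le> 1"
  by (auto simp: disc_def topspace_Euclidean_space L2_set_def)

lemma disc_boundary_iff: "x \<in> disc_boundary n \<longleftrightarrow> (\<forall>i\<ge>n. x i = 0) \<and> rad n x = 1"
  unfolding disc_boundary_def by (auto simp: disc_def topspace_Euclidean_space L2_set_def)

lemma disc_boundary_subset: "disc_boundary n \<subseteq> ball_pts n"
  by (auto simp: disc_boundary_def)

lemma disc_eq: "disc n = top_of_set (ball_pts n)"
proof -
  have "disc n = top_of_set ({x. \<forall>i\<ge>n. x i = 0} \<inter> {x. (\<Sum>i<n. (x i)\<^sup>2) \<le> 1})" (is "_ = top_of_set ?D")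
    unfolding disc_def Euclidean_space_def subtopology_subtopology euclidean_product_topology ..
  then show ?thesis by (simp only: topspace_euclidean_subtopology)
qed

lemma prod_top_of_set: "prod_topology (top_of_set S) (top_of_set T) = top_of_set (S \<times> T)"
  by (rule prod_topology_subtopology_eu)

lemma I01_disc_eq: "prod_topology I01 (disc n) = top_of_set ({0..1} \<times> ball_pts n)"
  by (subst disc_eq) (rule prod_top_of_set)

lemma continuous_map_into_disc:
  "continuous_map T (disc n) f \<longleftrightarrow>
     (\<forall>i. continuous_map T euclideanreal (\<lambda>x. f x i)) \<and> f \<in> topspace T \<rightarrow> ball_pts n"
proof -
  have "continuous_map T (disc n) f \<longleftrightarrow> continuous_map T (powertop_real UNIV) f \<and> f \<in> topspace T \<rightarrow> ball_pts n"
    by (subst disc_eq) (simp add: continuous_map_in_subtopology euclidean_product_topology)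
  then show ?thesis by (simp add: continuous_map_componentwise_UNIV)
qed

lemma continuous_on_coord:
  fixes f :: "'a::topological_space \<Rightarrow> nat \<Rightarrow> real"
  shows "continuous_on S f \<Longrightarrow> continuous_on S (\<lambda>x. f x i)"
  by (rule continuous_on_product_then_coordinatewise)

lemma continuous_on_rad [continuous_intros]:
  fixes f :: "'a::topological_space \<Rightarrow> nat \<Rightarrow> real"
  assumes "continuous_on S f" shows "continuous_on S (\<lambda>x. rad n (f x))"
  unfolding L2_set_def by (intro continuous_on_real_sqrt continuous_on_sum continuous_on_power continuous_on_coord assms)

lemma continuous_map_rad:
  assumes "continuous_map T (disc n) f" shows "continuous_map T euclideanreal (\<lambda>x. rad n (f x))"
proof -
  have "continuous_map (disc n) euclideanreal (rad n)"
    by (subst disc_eq) (auto simp: continuous_map_iff_continuous intro!: continuous_on_rad continuous_on_id)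
  from continuous_map_compose[OF assms this] show ?thesis by (simp add: o_def)
qed

lemma rad_scale: "rad n (\<lambda>i. c * x i) = \<bar>c\<bar> * rad n x"
  unfolding L2_set_def
  by (simp add: power_mult_distrib real_sqrt_mult flip: sum_distrib_left)

lemma rad_triangle: "rad n (\<lambda>i. x i + y i) \<le> rad n x + rad n y"
  by (rule L2_set_triangle_ineq)

lemma rad_nonneg: "rad n x \<ge> 0"
  by simp

lemma rad_eq_0: "rad n x = 0 \<longleftrightarrow> (\<forall>i<n. x i = 0)"
  by (auto simp: L2_set_eq_0_iff)

lemma coord_le_rad: "i < n \<Longrightarrow> \<bar>x i\<bar> \<le> rad n x"
  unfolding L2_set_def by (rule real_le_rsqrt) (auto intro!: member_le_sum)

lemma ball_pts_convex:
  assumes "x \<in> ball_pts n" "y \<in> ball_pts n" "0 \<le> t" "t \<le> 1"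
  shows "(\<lambda>i. (1 - t) * x i + t * y i) \<in> ball_pts n"
proof -
  have "rad n (\<lambda>i. (1 - t) * x i + t * y i) \<le> (1 - t) * rad n x + t * rad n y"
    using rad_triangle[of "\<lambda>i. (1-t) * x i" "\<lambda>i. t * y i" n] assms by (simp add: rad_scale)
  also have "\<dots> \<le> 1" using assms by (intro convex_bound_le) (auto simp: ball_pts_iff)
  finally show ?thesis using assms by (auto simp: ball_pts_iff)
qed

lemma compact_ball_pts: "compact (ball_pts n)"
proof -
  have "compactin (powertop_real UNIV) (PiE UNIV (\<lambda>i. {-1..1}))"
    by (simp add: compactin_PiE)
  then have "compact (PiE UNIV (\<lambda>i. {-1..1::real}) :: (nat \<Rightarrow> real) set)"
    by (simp add: euclidean_product_topology)
  moreover have "closed (ball_pts n)"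
  proof -
    have "ball_pts n = (\<Inter>i\<in>{n..}. {x. x i = 0}) \<inter> {x. rad n x \<le> 1}" by (auto simp: ball_pts_iff)
    moreover have "closed {x :: nat \<Rightarrow> real. x i = 0}" for i
      by (intro closed_Collect_eq continuous_on_coord continuous_intros)
    moreover have "closed {x. rad n x \<le> 1}"
      by (intro closed_Collect_le continuous_intros)
    ultimately show ?thesis by (metis (no_types, lifting) closed_INT closed_Int)
  qed
  moreover have "ball_pts n \<subseteq> PiE UNIV (\<lambda>i. {-1..1})"
  proof
    fix x assume x: "x \<in> ball_pts n"
    have "\<bar>x i\<bar> \<le> 1" for i
      using x coord_le_rad[of i n x] by (cases "i < n") (auto simp: ball_pts_iff)
    then show "x \<in> PiE UNIV (\<lambda>i. {-1..1})" by (auto simp: abs_le_iff minus_le_iff)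
  qed
  ultimately show ?thesis
    by (metis compact_Int_closed inf.absorb_iff2)
qed

text \<open>The ball lies in \<open>[-1,1]\<^sup>n\<close>, which is cut into cubes.\<close>

lemma box_dim_le_ball_pts: "box_dim_le n (ball_pts n)"
  unfolding box_dim_le_def
proof (intro exI[of _ "5 ^ n"] allI impI)
  fix N :: nat assume N: "N > 0"
  \<comment> \<open>the metric on sequences is at most twice the supremum of the coordinate distances\<close>
  define \<delta> where "\<delta> = 1 / (2 * real N)"
  have \<delta>: "\<delta> > 0" using N by (simp add: \<delta>_def)
  define Q where "Q = ({..<n} \<rightarrow>\<^sub>E {..4*N})"
  define S where "S \<kappa> = {x \<in> ball_pts n. \<forall>i<n. real (\<kappa> i) * \<delta> \<le> x i + 1 \<and> x i + 1 \<le> real (\<kappa> i) * \<delta> + \<delta>}" for \<kappa> :: "nat \<Rightarrow> nat"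
  show "\<exists>F. finite F \<and> card F \<le> 5 ^ n * N ^ n \<and> ball_pts n \<subseteq> \<Union> F \<and> (\<forall>S\<in>F. \<forall>x\<in>S. \<forall>y\<in>S. dist x y \<le> 1 / real N)"
  proof (intro exI[of _ "S ` Q"] conjI ballI)
    show "finite (S ` Q)" unfolding Q_def by (intro finite_imageI finite_PiE) auto
    have "card (S ` Q) \<le> card Q" unfolding Q_def by (intro card_image_le finite_PiE) auto
    also have "\<dots> = (4*N+1) ^ n" by (simp add: Q_def card_PiE)
    also have "\<dots> \<le> (5*N) ^ n" using N by (intro power_mono) auto
    finally show "card (S ` Q) \<le> 5 ^ n * N ^ n" by (simp add: power_mult_distrib)
    show "ball_pts n \<subseteq> \<Union> (S ` Q)"
    proof
      fix x assume x: "x \<in> ball_pts n"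
      define \<kappa> where "\<kappa> = (\<lambda>i\<in>{..<n}. nat \<lfloor>(x i + 1) / \<delta>\<rfloor>)"
      have b: "-1 \<le> x i" "x i \<le> 1" if "i < n" for i
        using x coord_le_rad[of i n x] that by (auto simp: ball_pts_iff)
      have k: "real (\<kappa> i) * \<delta> \<le> x i + 1" "x i + 1 \<le> real (\<kappa> i) * \<delta> + \<delta>" "\<kappa> i \<le> 4 * N" if i: "i < n" for i
      proof -
        have nn: "(x i + 1) / \<delta> \<ge> 0" using b(1)[OF i] \<delta> by simp
        have "(x i + 1) / \<delta> \<le> 2 / \<delta>" using b(2)[OF i] \<delta> by (intro divide_right_mono) auto
        also have "2 / \<delta> = real (4 * N)" by (simp add: \<delta>_def)
        finally have le: "(x i + 1) / \<delta> \<le> real (4 * N)" .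
        have r: "real (\<kappa> i) \<le> (x i + 1) / \<delta>" "(x i + 1) / \<delta> \<le> real (\<kappa> i) + 1"
          using nn i unfolding \<kappa>_def by simp_all
        show "real (\<kappa> i) * \<delta> \<le> x i + 1" using r(1) \<delta> by (simp add: field_simps)
        show "x i + 1 \<le> real (\<kappa> i) * \<delta> + \<delta>" using r(2) \<delta> by (simp add: field_simps)
        show "\<kappa> i \<le> 4 * N" using r(1) le by linarith
      qed
      have "\<kappa> \<in> Q" using k(3) by (auto simp: Q_def \<kappa>_def PiE_iff extensional_def)
      moreover have "x \<in> S \<kappa>" using k x by (auto simp: S_def)
      ultimately show "x \<in> \<Union> (S ` Q)" by blast
    qed
    fix T x y assume T: "T \<in> S ` Q" "x \<in> T" "y \<in> T"
    have d: "dist (x i) (y i) \<le> \<delta>" for i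
    proof (cases "i < n")
      case True
      obtain \<kappa> where "x \<in> S \<kappa>" "y \<in> S \<kappa>" using T by auto
      then have "real (\<kappa> i) * \<delta> \<le> x i + 1" "x i + 1 \<le> real (\<kappa> i) * \<delta> + \<delta>"
         "real (\<kappa> i) * \<delta> \<le> y i + 1" "y i + 1 \<le> real (\<kappa> i) * \<delta> + \<delta>" using True by (auto simp: S_def)
      then show ?thesis unfolding dist_real_def by linarith
    next
      case False
      then show ?thesis using T \<delta> by (auto simp: S_def ball_pts_iff)
    qed
    have *: "dist x y \<le> 2 * \<delta> + (1/2)^M" for M
    proof -
      have "dist x y \<le> 2 * Max {dist (x (from_nat k)) (y (from_nat k)) |k. k \<le> M} + (1/2)^M"
        by (rule dist_fun_le_dist_first_terms)
      moreover have "Max {dist (x (from_nat k)) (y (from_nat k)) |k. k \<le> M} \<le> \<delta>"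
        using d by (intro Max.boundedI) auto
      ultimately show ?thesis by linarith
    qed
    have "(\<lambda>M. 2 * \<delta> + (1/2)^M) \<longlonglongrightarrow> 2 * \<delta> + 0"
      by (intro tendsto_intros LIMSEQ_power_zero) auto
    then have "dist x y \<le> 2 * \<delta> + 0"
      by (rule LIMSEQ_le_const) (use * in blast)
    then show "dist x y \<le> 1 / real N" by (simp add: \<delta>_def)
  qed
qed

section \<open>Homotopies on a quotient\<close>

lemma homotopic_withI:
  assumes "continuous_map (prod_topology I01 X) Y h"
    and "\<And>x. x \<in> topspace X \<Longrightarrow> h (0, x) = f x" "\<And>x. x \<in> topspace X \<Longrightarrow> h (1, x) = g x"
    and "\<And>t. t \<in> {0..1} \<Longrightarrow> P (\<lambda>x. h (t, x))"
    and "\<And>h k. (\<And>x. x \<in> topspace X \<Longrightarrow> h x = k x) \<Longrightarrow> P h = P k"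
  shows "homotopic_with P X Y f g"
  using homotopic_with[of X P Y f g] assms by blast

lemma homotopic_withE:
  assumes "homotopic_with P X Y f g"
  obtains h where "continuous_map (prod_topology I01 X) Y h"
    "\<And>x. h (0, x) = f x" "\<And>x. h (1, x) = g x" "\<And>t. t \<in> {0..1} \<Longrightarrow> P (\<lambda>x. h (t, x))"
  using assms unfolding homotopic_with_def by blast

text \<open>For products with the interval, openness can be tested on slices and on the sets of points whose
  whole slice over a compact piece of the interval is contained. Both tests can be pulled back along
  maps into \<open>Y\<close>, which is how quotient topologies on \<open>Y\<close> become accessible.\<close>

lemma openin_prod_I01:
  assumes W: "W \<subseteq> {0..1} \<times> topspace Y"
    and slices: "\<And>y. y \<in> topspace Y \<Longrightarrow> openin I01 {t. (t, y) \<in> W}"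
    and tubes: "\<And>L. compact L \<Longrightarrow> L \<subseteq> {0..1} \<Longrightarrow> openin Y {y \<in> topspace Y. \<forall>t\<in>L. (t, y) \<in> W}"
  shows "openin (prod_topology I01 Y) W"
  unfolding openin_prod_topology_alt
proof (intro allI impI)
  fix t y assume ty: "(t, y) \<in> W"
  then have y: "y \<in> topspace Y" and t: "t \<in> {0..1}" using W by auto
  obtain e where e: "e > 0" "ball t e \<inter> {0..1} \<subseteq> {t. (t, y) \<in> W}"
    using slices[OF y] ty unfolding openin_contains_ball by blast
  define L where "L = cball t (e/2) \<inter> {0..1}"
  have L: "compact L" "L \<subseteq> {0..1}" by (auto simp: L_def intro!: compact_Int_closed)
  have sub: "L \<subseteq> ball t e \<inter> {0..1}" using e(1) by (auto simp: L_def)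
  show "\<exists>U V. openin I01 U \<and> openin Y V \<and> t \<in> U \<and> y \<in> V \<and> U \<times> V \<subseteq> W"
  proof (intro exI conjI)
    show "openin I01 ({0..1} \<inter> ball t (e/2))" by (simp add: openin_open_Int)
    show "openin Y {y \<in> topspace Y. \<forall>t\<in>L. (t, y) \<in> W}" by (rule tubes[OF L])
    show "t \<in> {0..1} \<inter> ball t (e/2)" using t e by simp
    show "y \<in> {y \<in> topspace Y. \<forall>t\<in>L. (t, y) \<in> W}" using y sub e by blast
    show "({0..1} \<inter> ball t (e/2)) \<times> {y \<in> topspace Y. \<forall>t\<in>L. (t, y) \<in> W} \<subseteq> W"
      by (auto simp: L_def)
  qed
qed

lemma openin_tube:
  assumes W: "openin (prod_topology I01 X) W" and L: "compact L" "L \<subseteq> {0..1}"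
  shows "openin X {x \<in> topspace X. \<forall>t\<in>L. (t, x) \<in> W}"
proof (subst openin_subopen, intro ballI)
  fix x assume x: "x \<in> {x \<in> topspace X. \<forall>t\<in>L. (t, x) \<in> W}"
  have "compactin I01 L" using L by (simp add: compactin_subtopology)
  then obtain U V where UV: "openin I01 U" "openin X V" "L \<subseteq> U" "x \<in> V" "U \<times> V \<subseteq> W"
    using tube_lemma_left[OF W, of L x] x by auto
  then show "\<exists>T. openin X T \<and> x \<in> T \<and> T \<subseteq> {x \<in> topspace X. \<forall>t\<in>L. (t, x) \<in> W}"
    using openin_subset[OF UV(2)] by (intro exI[of _ V]) auto
qed

text \<open>If \<open>Y\<close> has the final topology with respect to a family of maps, then so does the product of
  \<open>Y\<close> with the interval, because the interval is locally compact. Hence homotopies on a space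
  built from cells can be defined cell by cell.\<close>

lemma continuous_map_I01_final:
  assumes final: "\<And>U. U \<subseteq> topspace Y \<Longrightarrow> openin X {x \<in> topspace X. p x \<in> U} \<Longrightarrow>
      (\<And>j. j \<in> J \<Longrightarrow> openin (D j) {d \<in> topspace (D j). q j d \<in> U}) \<Longrightarrow> openin Y U"
    and p: "p \<in> topspace X \<rightarrow> topspace Y" and q: "\<And>j. j \<in> J \<Longrightarrow> q j \<in> topspace (D j) \<rightarrow> topspace Y"
    and cover: "topspace Y \<subseteq> p ` topspace X \<union> (\<Union>j\<in>J. q j ` topspace (D j))"
    and Fp: "continuous_map (prod_topology I01 X) T (\<lambda>(t, x). F (t, p x))"
    and Fq: "\<And>j. j \<in> J \<Longrightarrow> continuous_map (prod_topology I01 (D j)) T (\<lambda>(t, d). F (t, q j d))"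
  shows "continuous_map (prod_topology I01 Y) T F"
proof -
  have mp: "F (t, y) \<in> topspace T" if "t \<in> {0..1}" "y \<in> topspace Y" for t y
  proof -
    from that(2) cover consider x where "x \<in> topspace X" "y = p x" | j d where "j \<in> J" "d \<in> topspace (D j)" "y = q j d"
      by blast
    then show ?thesis
    proof cases
      case 1
      then show ?thesis using continuous_map_funspace[OF Fp] that(1) by force
    next
      case 2
      then show ?thesis using continuous_map_funspace[OF Fq[OF 2(1)]] that(1) by force
    qed
  qed
  show ?thesis unfolding continuous_map_def
  proof (intro conjI allI impI)
    show "F \<in> topspace (prod_topology I01 Y) \<rightarrow> topspace T" using mp by auto
    fix U assume U: "openin T U"
    define W where "W = {x \<in> topspace (prod_topology I01 Y). F x \<in> U}"
    have Wp: "openin (prod_topology I01 X) {x \<in> topspace (prod_topology I01 X). (case x of (t, x) \<Rightarrow> F (t, p x)) \<in> U}"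
      using Fp U unfolding continuous_map_def by blast
    have Wq: "openin (prod_topology I01 (D j)) {x \<in> topspace (prod_topology I01 (D j)). (case x of (t, x) \<Rightarrow> F (t, q j x)) \<in> U}"
      if "j \<in> J" for j
      using Fq[OF that] U unfolding continuous_map_def by blast
    have "openin (prod_topology I01 Y) W"
    proof (rule openin_prod_I01)
      show "W \<subseteq> {0..1} \<times> topspace Y" by (auto simp: W_def)
    next
      fix y assume "y \<in> topspace Y"
      with cover consider x where "x \<in> topspace X" "y = p x" | j d where "j \<in> J" "d \<in> topspace (D j)" "y = q j d"
        by blast
      then show "openin I01 {t. (t, y) \<in> W}"
      proof cases
        case 1
        have "continuous_map I01 (prod_topology I01 X) (\<lambda>t. (t, x))" using 1 by (simp add: continuous_map_pairwise o_def)
        from openin_continuous_map_preimage[OF this Wp]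
        have "openin I01 {t \<in> {0..1}. F (t, p x) \<in> U}" using 1(1) by (simp add: conj_ac cong: conj_cong)
        moreover have "{t. (t, y) \<in> W} = {t \<in> {0..1}. F (t, p x) \<in> U}" using 1 \<open>y \<in> topspace Y\<close> by (auto simp: W_def)
        ultimately show ?thesis by simp
      next
        case 2
        have "continuous_map I01 (prod_topology I01 (D j)) (\<lambda>t. (t, d))" using 2 by (simp add: continuous_map_pairwise o_def)
        from openin_continuous_map_preimage[OF this Wq[OF 2(1)]]
        have "openin I01 {t \<in> {0..1}. F (t, q j d) \<in> U}" using 2(2) by (simp add: conj_ac cong: conj_cong)
        moreover have "{t. (t, y) \<in> W} = {t \<in> {0..1}. F (t, q j d) \<in> U}" using 2 \<open>y \<in> topspace Y\<close> by (auto simp: W_def)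
        ultimately show ?thesis by simp
      qed
    next
      fix L :: "real set" assume L: "compact L" "L \<subseteq> {0..1}"
      show "openin Y {y \<in> topspace Y. \<forall>t\<in>L. (t, y) \<in> W}"
      proof (rule final)
        have "{x \<in> topspace X. p x \<in> {y \<in> topspace Y. \<forall>t\<in>L. (t, y) \<in> W}} =
          {x \<in> topspace X. \<forall>t\<in>L. (t, x) \<in> {x \<in> topspace (prod_topology I01 X). (case x of (t, x) \<Rightarrow> F (t, p x)) \<in> U}}"
          using p L(2) by (auto simp: W_def)
        then show "openin X {x \<in> topspace X. p x \<in> {y \<in> topspace Y. \<forall>t\<in>L. (t, y) \<in> W}}"
          using openin_tube[OF Wp L] by simp
        fix j assume j: "j \<in> J"
        have "{x \<in> topspace (D j). q j x \<in> {y \<in> topspace Y. \<forall>t\<in>L. (t, y) \<in> W}} =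
          {x \<in> topspace (D j). \<forall>t\<in>L. (t, x) \<in> {x \<in> topspace (prod_topology I01 (D j)). (case x of (t, x) \<Rightarrow> F (t, q j x)) \<in> U}}"
          using q[OF j] L(2) by (auto simp: W_def)
        then show "openin (D j) {x \<in> topspace (D j). q j x \<in> {y \<in> topspace Y. \<forall>t\<in>L. (t, y) \<in> W}}"
          using openin_tube[OF Wq[OF j] L] by simp
      qed auto
    qed
    then show "openin (prod_topology I01 Y) {x \<in> topspace (prod_topology I01 Y). F x \<in> U}" by (simp add: W_def)
  qed
qed

section \<open>Attaching cells\<close>

text \<open>A set of \<open>n\<close>-cells attached to \<open>A\<close>, without group action. The index type is arbitrary:
  the cells of a fixed point set will be indexed by pairs of an equivariant cell and a coset.\<close>

locale cell_attachment =
  fixes X :: "'x topology" and n :: nat and A B :: "'x set" and J :: "'j set"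
    and q :: "'j \<Rightarrow> (nat \<Rightarrow> real) \<Rightarrow> 'x"
  assumes AB: "A \<subseteq> B" and BX: "B \<subseteq> topspace X"
    and q_cont: "\<And>j. j \<in> J \<Longrightarrow> continuous_map (disc n) (subtopology X B) (q j)"
    and q_boundary: "\<And>j d. j \<in> J \<Longrightarrow> d \<in> disc_boundary n \<Longrightarrow> q j d \<in> A"
    and q_bij: "bij_betw (\<lambda>(j, d). q j d) (J \<times> (ball_pts n - disc_boundary n)) (B - A)"
    and openin_iff: "\<And>U. U \<subseteq> B \<Longrightarrow> openin (subtopology X B) U \<longleftrightarrow>
      openin (subtopology X A) (U \<inter> A) \<and> (\<forall>j\<in>J. openin (disc n) {d \<in> ball_pts n. q j d \<in> U})"
begin

abbreviation "int_pts \<equiv> ball_pts n - disc_boundary n"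

lemma int_pts_iff: "d \<in> int_pts \<longleftrightarrow> (\<forall>i\<ge>n. d i = 0) \<and> rad n d < 1"
  by (auto simp: ball_pts_iff disc_boundary_iff)

lemma AX: "A \<subseteq> topspace X" using AB BX by blast

lemma q_in_B: "j \<in> J \<Longrightarrow> d \<in> ball_pts n \<Longrightarrow> q j d \<in> B"
  using continuous_map_funspace[OF q_cont] by fastforce

lemma q_interior:
  assumes "j \<in> J" "d \<in> int_pts" shows "q j d \<in> B \<and> q j d \<notin> A"
proof -
  have "(\<lambda>(j, d). q j d) (j, d) \<in> B - A" by (rule bij_betwE[OF q_bij, rule_format]) (use assms in auto)
  then show ?thesis by simp
qed

lemma q_inj:
  assumes "j \<in> J" "j' \<in> J" "d \<in> int_pts" "d' \<in> int_pts" "q j d = q j' d'"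
  shows "j = j' \<and> d = d'"
  using inj_onD[OF bij_betw_imp_inj_on[OF q_bij], of "(j, d)" "(j', d')"] assms by simp

lemma q_inj': "j \<in> J \<Longrightarrow> j' \<in> J \<Longrightarrow> d \<in> int_pts \<Longrightarrow> d' \<in> ball_pts n \<Longrightarrow> q j' d' = q j d \<Longrightarrow> j' = j \<and> d' = d"
proof (cases "d' \<in> disc_boundary n")
  case True
  moreover assume "j \<in> J" "j' \<in> J" "d \<in> int_pts" "q j' d' = q j d"
  ultimately show ?thesis using q_interior[of j d] q_boundary[of j' d'] by simp
next
  case False
  moreover assume "j \<in> J" "j' \<in> J" "d \<in> int_pts" "d' \<in> ball_pts n" "q j' d' = q j d"
  ultimately show ?thesis using q_inj[of j j' d d'] by simp
qed

lemma q_surj: assumes "b \<in> B" "b \<notin> A" obtains j d where "j \<in> J" "d \<in> int_pts" "b = q j d"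
proof -
  have "b \<in> (\<lambda>(j, d). q j d) ` (J \<times> int_pts)"
    using bij_betw_imp_surj_on[OF q_bij] assms by blast
  then show ?thesis using that by auto
qed

lemma B_cases:
  assumes "b \<in> B" obtains "b \<in> A" | j d where "j \<in> J" "d \<in> int_pts" "b = q j d"
  using assms q_surj by metis

text \<open>A homotopy on \<open>B\<close> amounts to a homotopy on \<open>A\<close> and compatible homotopies on the cells.\<close>

lemma continuous_extension:
  assumes F0: "continuous_map (prod_topology I01 (subtopology X A)) T F0"
    and e: "\<And>j. j \<in> J \<Longrightarrow> continuous_map (prod_topology I01 (disc n)) T (e j)"
    and agree: "\<And>j t d. j \<in> J \<Longrightarrow> t \<in> {0..1} \<Longrightarrow> d \<in> disc_boundary n \<Longrightarrow> e j (t, d) = F0 (t, q j d)"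
  obtains F where "continuous_map (prod_topology I01 (subtopology X B)) T F"
    "\<And>t a. t \<in> {0..1} \<Longrightarrow> a \<in> A \<Longrightarrow> F (t, a) = F0 (t, a)"
    "\<And>j t d. j \<in> J \<Longrightarrow> t \<in> {0..1} \<Longrightarrow> d \<in> ball_pts n \<Longrightarrow> F (t, q j d) = e j (t, d)"
proof -
  have "\<forall>b\<in>B - A. \<exists>jd. fst jd \<in> J \<and> snd jd \<in> int_pts \<and> b = q (fst jd) (snd jd)"
    using q_surj by (metis DiffD1 DiffD2 fst_conv snd_conv)
  then obtain c where c: "\<And>b. b \<in> B - A \<Longrightarrow> fst (c b) \<in> J \<and> snd (c b) \<in> int_pts \<and> b = q (fst (c b)) (snd (c b))"
    by metis
  define F where "F = (\<lambda>(t, b). if b \<in> A then F0 (t, b) else e (fst (c b)) (t, snd (c b)))"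
  have FA: "F (t, a) = F0 (t, a)" if "a \<in> A" for t a using that by (simp add: F_def)
  have FJ: "F (t, q j d) = e j (t, d)" if j: "j \<in> J" and t: "t \<in> {0..1}" and d: "d \<in> ball_pts n" for j t d
  proof (cases "d \<in> disc_boundary n")
    case True
    then show ?thesis using agree[OF j t True] q_boundary[OF j True] by (simp add: F_def)
  next
    case False
    then have di: "d \<in> int_pts" using d by blast
    have "q j d \<in> B - A" using q_interior[OF j di] by simp
    from c[OF this] have "fst (c (q j d)) = j \<and> snd (c (q j d)) = d" using q_inj[OF _ j _ di] by metis
    then show ?thesis using q_interior[OF j di] by (simp add: F_def)
  qed
  have tA: "topspace (subtopology X A) = A" and tB: "topspace (subtopology X B) = B" using AX BX by auto
  have "continuous_map (prod_topology I01 (subtopology X B)) T F"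
  proof (rule continuous_map_I01_final[where X = "subtopology X A" and p = "\<lambda>a. a" and J = J and D = "\<lambda>_. disc n" and q = q])
    fix U assume U: "U \<subseteq> topspace (subtopology X B)"
      and A: "openin (subtopology X A) {x \<in> topspace (subtopology X A). x \<in> U}"
      and Q: "\<And>j. j \<in> J \<Longrightarrow> openin (disc n) {d \<in> ball_pts n. q j d \<in> U}"
    have "{x \<in> topspace (subtopology X A). x \<in> U} = U \<inter> A" using AX by auto
    then show "openin (subtopology X B) U" using openin_iff[of U] U A Q by (simp add: tB)
  next
    show "(\<lambda>a. a) \<in> topspace (subtopology X A) \<rightarrow> topspace (subtopology X B)" using AB by (auto simp: tA tB)
    show "q j \<in> ball_pts n \<rightarrow> topspace (subtopology X B)" if "j \<in> J" for j using q_in_B[OF that] BX by auto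
    show "topspace (subtopology X B) \<subseteq> (\<lambda>a. a) ` topspace (subtopology X A) \<union> (\<Union>j\<in>J. q j ` ball_pts n)"
    proof
      fix b assume "b \<in> topspace (subtopology X B)"
      then have "b \<in> B" by (simp add: tB)
      then show "b \<in> (\<lambda>a. a) ` topspace (subtopology X A) \<union> (\<Union>j\<in>J. q j ` ball_pts n)"
        using AX by (cases rule: B_cases) auto
    qed
    show "continuous_map (prod_topology I01 (subtopology X A)) T (\<lambda>(t, x). F (t, x))"
      by (rule continuous_map_eq[OF F0]) (auto simp: FA tA)
    show "continuous_map (prod_topology I01 (disc n)) T (\<lambda>(t, d). F (t, q j d))" if "j \<in> J" for j
      by (rule continuous_map_eq[OF e[OF that]]) (auto simp: FJ[OF that])
  qed
  then show ?thesis using that FA FJ by blast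
qed

text \<open>Complements of concentric closed subdiscs are open; removing them only from some of the cells gives
  neighbourhoods on which functions supported in a single cell can be extended by zero.\<close>

lemma openin_avoiding_inner_discs:
  assumes r: "r < 1" and J': "J' \<subseteq> J"
  shows "openin (subtopology X B) (B - (\<Union>j\<in>J'. q j ` {d \<in> ball_pts n. rad n d \<le> r}))" (is "openin _ ?U")
proof -
  have inner: "{d \<in> ball_pts n. rad n d \<le> r} \<subseteq> int_pts" using r by (auto simp: disc_boundary_iff)
  have "?U \<inter> A = A"
  proof -
    have "q j d \<notin> A" if "j \<in> J'" "d \<in> ball_pts n" "rad n d \<le> r" for j d
      using q_interior[of j d] inner that J' by blast
    then show ?thesis using AB by auto
  qed
  moreover have "openin (disc n) {d \<in> ball_pts n. q j d \<in> ?U}" if j: "j \<in> J" for j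
  proof (cases "j \<in> J'")
    case True
    have "q j d \<in> ?U \<longleftrightarrow> rad n d \<in> {r<..}" if d: "d \<in> ball_pts n" for d
    proof
      assume "q j d \<in> ?U"
      then have "\<not> rad n d \<le> r" using True d by auto
      then show "rad n d \<in> {r<..}" by simp
    next
      assume "rad n d \<in> {r<..}"
      have "q j d \<noteq> q j' d'" if "j' \<in> J'" "d' \<in> ball_pts n" "rad n d' \<le> r" for j' d'
      proof
        assume "q j d = q j' d'"
        moreover have "j' \<in> J" "d' \<in> int_pts" using that J' inner by auto
        ultimately have "d = d'" using q_inj' j d by blast
        then show False using \<open>rad n d \<in> {r<..}\<close> that by simp
      qed
      then show "q j d \<in> ?U" using q_in_B[OF j d] by auto
    qed
    then have "{d \<in> ball_pts n. q j d \<in> ?U} = {d \<in> ball_pts n. rad n d \<in> {r<..}}" by blast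
    moreover have "continuous_map (disc n) euclideanreal (rad n)"
      using continuous_map_rad[OF continuous_map_id[of "disc n", unfolded id_def]] by simp
    then have "openin (disc n) {d \<in> ball_pts n. rad n d \<in> {r<..}}"
      by (rule openin_continuous_map_preimage) auto
    ultimately show ?thesis by simp
  next
    case False
    have "{d \<in> ball_pts n. q j d \<in> ?U} = ball_pts n"
    proof -
      have "q j d \<noteq> q j' d'" if "j' \<in> J'" "d' \<in> ball_pts n" "rad n d' \<le> r" "d \<in> ball_pts n" for j' d d'
        using q_inj'[of j' j d' d] inner that J' j False by blast
      then show ?thesis using q_in_B[OF j] by auto
    qed
    then show ?thesis by (metis openin_topspace)
  qed
  ultimately show ?thesis using openin_iff[of ?U] openin_subtopology_self AX
    by (metis (no_types, lifting) Diff_subset openin_topspace topspace_subtopology_subset)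
qed

lemma q_open:
  assumes j: "j \<in> J" and V: "openin (disc n) V" "V \<subseteq> int_pts"
  shows "openin (subtopology X B) (q j ` V)"
proof -
  have "q j ` V \<inter> A = {}" using q_interior[OF j] V by blast
  moreover have "openin (disc n) {d \<in> ball_pts n. q j' d \<in> q j ` V}" if j': "j' \<in> J" for j'
  proof -
    have "{d \<in> ball_pts n. q j' d \<in> q j ` V} = (if j' = j then V else {})"
      using q_inj'[OF j j'] V openin_subset[OF V(1)] by auto
    then show ?thesis using V by simp
  qed
  moreover have "q j ` V \<subseteq> B" using q_in_B[OF j] openin_subset[OF V(1)] by blast
  ultimately show ?thesis using openin_iff by simp
qed

lemma openin_int_pts: "openin (disc n) int_pts"
proof -
  have "continuous_map (disc n) euclideanreal (rad n)"
    using continuous_map_rad[OF continuous_map_id[of "disc n", unfolded id_def]] by simp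
  then have "openin (disc n) {d \<in> ball_pts n. rad n d \<in> {..<1}}"
    by (rule openin_continuous_map_preimage) auto
  moreover have "{d \<in> ball_pts n. rad n d \<in> {..<1}} = int_pts"
    by (auto simp: int_pts_iff ball_pts_iff disc_boundary_iff)
  ultimately show ?thesis by simp
qed

definition cell_coord :: "'j \<Rightarrow> 'x \<Rightarrow> nat \<Rightarrow> real" where
  "cell_coord j = inv_into int_pts (q j)"

lemma cell_coord_q: "j \<in> J \<Longrightarrow> d \<in> int_pts \<Longrightarrow> cell_coord j (q j d) = d"
  unfolding cell_coord_def by (rule inv_into_f_f) (auto intro!: inj_onI dest: q_inj)

lemma cell_coord_continuous:
  assumes j: "j \<in> J"
  shows "continuous_map (subtopology X (q j ` int_pts)) (disc n) (cell_coord j)"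
  unfolding continuous_map_def
proof (intro conjI allI impI)
  have sub: "q j ` int_pts \<subseteq> B" using q_interior[OF j] by blast
  then have top: "topspace (subtopology X (q j ` int_pts)) = q j ` int_pts" using BX by auto
  show "cell_coord j \<in> topspace (subtopology X (q j ` int_pts)) \<rightarrow> ball_pts n"
    using cell_coord_q[OF j] by (auto simp: top)
  fix U assume U: "openin (disc n) U"
  have "{x \<in> topspace (subtopology X (q j ` int_pts)). cell_coord j x \<in> U} = q j ` (U \<inter> int_pts)"
    unfolding top using cell_coord_q[OF j] by auto
  moreover have "openin (subtopology X B) (q j ` (U \<inter> int_pts))"
    by (rule q_open[OF j openin_Int[OF U openin_int_pts]]) auto
  then have "openin (subtopology X (q j ` int_pts)) (q j ` (U \<inter> int_pts))"
    using sub by (metis (no_types, lifting) Int_lower2 image_mono inf.absorb_iff2 openin_subtopology_Int2 subtopology_subtopology)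
  ultimately show "openin (subtopology X (q j ` int_pts)) {x \<in> topspace (subtopology X (q j ` int_pts)). cell_coord j x \<in> U}"
    by simp
qed

text \<open>Each cell is expanded radially until the disc of radius \<open>\<epsilon> j\<close> fills it. The centres
  are not removed, so the homotopy is defined on all of \<open>B\<close>; in the end everything outside the
  small discs lies in \<open>A\<close>.\<close>

lemma radial_expansion:
  fixes \<epsilon> :: "'j \<Rightarrow> real"
  assumes eps: "\<And>j. j \<in> J \<Longrightarrow> 0 < \<epsilon> j \<and> \<epsilon> j \<le> 1"
  obtains P where "continuous_map (prod_topology I01 (subtopology X B)) (subtopology X B) P"
    "\<And>t a. t \<in> {0..1} \<Longrightarrow> a \<in> A \<Longrightarrow> P (t, a) = a"
    "\<And>j t d. j \<in> J \<Longrightarrow> t \<in> {0..1} \<Longrightarrow> d \<in> ball_pts n \<Longrightarrow>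
       P (t, q j d) = q j (\<lambda>i. ((1 - t) + t / max (rad n d) (\<epsilon> j)) * d i)"
    "\<And>b. b \<in> B \<Longrightarrow> P (0, b) = b"
    "\<And>j d. j \<in> J \<Longrightarrow> d \<in> ball_pts n \<Longrightarrow> \<epsilon> j \<le> rad n d \<Longrightarrow> P (1, q j d) \<in> A"
proof -
  define m where "m j t d = (\<lambda>i. ((1 - t) + t / max (rad n d) (\<epsilon> j)) * d i)" for j and t :: real and d
  have nn: "0 \<le> (1 - t) + t / max (rad n d) (\<epsilon> j)" if "j \<in> J" "t \<in> {0..1}" for j t d
    using eps[OF that(1)] that(2) by (intro add_nonneg_nonneg divide_nonneg_nonneg) (auto simp: le_max_iff_disj)
  have rm: "rad n (m j t d) = ((1 - t) + t / max (rad n d) (\<epsilon> j)) * rad n d" if "j \<in> J" "t \<in> {0..1}" for j t d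
    unfolding m_def rad_scale using nn[OF that] by simp
  have mB: "m j t d \<in> ball_pts n" if j: "j \<in> J" and t: "t \<in> {0..1}" and d: "d \<in> ball_pts n" for j t d
  proof -
    have "rad n d / max (rad n d) (\<epsilon> j) \<le> 1" using eps[OF j] by (simp add: divide_le_eq_1 less_max_iff_disj)
    then have "t * (rad n d / max (rad n d) (\<epsilon> j)) \<le> t * 1" using t by (intro mult_left_mono) auto
    moreover have "(1 - t) * rad n d \<le> (1 - t) * 1" using t d by (intro mult_left_mono) (auto simp: ball_pts_iff)
    ultimately have "rad n (m j t d) \<le> 1" unfolding rm[OF j t] by (simp add: algebra_simps)
    moreover have "\<forall>i\<ge>n. m j t d i = 0" using d by (auto simp: m_def ball_pts_iff)
    ultimately show ?thesis by (simp add: ball_pts_iff)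
  qed
  have cont: "continuous_map (prod_topology I01 (disc n)) (subtopology X B) (\<lambda>(t, d). q j (m j t d))" if j: "j \<in> J" for j
  proof -
    have "continuous_on ({0..1} \<times> ball_pts n) (\<lambda>p. m j (fst p) (snd p))"
      unfolding m_def using eps[OF j]
      by (intro continuous_on_coordinatewise_then_product continuous_intros continuous_on_coord[OF continuous_on_snd]
          continuous_on_rad) (auto simp: max_def)
    then have "continuous_map (prod_topology I01 (disc n)) (disc n) (\<lambda>p. m j (fst p) (snd p))"
      unfolding I01_disc_eq by (subst (2) disc_eq) (use mB[OF j] in \<open>auto simp: continuous_map_in_subtopology continuous_map_iff_continuous\<close>)
    from continuous_map_compose[OF this q_cont[OF j]] show ?thesis by (simp add: o_def case_prod_unfold)
  qed
  have idA: "continuous_map (prod_topology I01 (subtopology X A)) (subtopology X B) (\<lambda>(t, a). a)"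
  proof -
    have "continuous_map (subtopology X A) (subtopology X B) (\<lambda>a. a)"
      using AB AX by (auto simp: continuous_map_in_subtopology intro: continuous_map_from_subtopology)
    from continuous_map_compose[OF continuous_map_snd this] show ?thesis by (simp add: o_def case_prod_unfold)
  qed
  have bd: "m j t d = d" if "j \<in> J" "d \<in> disc_boundary n" for j t d
  proof -
    have "max (rad n d) (\<epsilon> j) = 1" using eps[OF that(1)] that(2) by (simp add: disc_boundary_iff)
    then show ?thesis by (simp add: m_def)
  qed
  obtain P where P: "continuous_map (prod_topology I01 (subtopology X B)) (subtopology X B) P"
    "\<And>t a. t \<in> {0..1} \<Longrightarrow> a \<in> A \<Longrightarrow> P (t, a) = (\<lambda>(t, a). a) (t, a)"
    "\<And>j t d. j \<in> J \<Longrightarrow> t \<in> {0..1} \<Longrightarrow> d \<in> ball_pts n \<Longrightarrow> P (t, q j d) = (\<lambda>(t, d). q j (m j t d)) (t, d)"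
    by (rule continuous_extension[OF idA, of "\<lambda>j (t, d). q j (m j t d)"]) (use cont bd in auto)
  show ?thesis
  proof (rule that[OF P(1)])
    show "P (0, b) = b" if "b \<in> B" for b
      using that by (cases rule: B_cases) (use P in \<open>auto simp: m_def\<close>)
    show "P (1, q j d) \<in> A" if "j \<in> J" "d \<in> ball_pts n" "\<epsilon> j \<le> rad n d" for j d
    proof -
      have "rad n (m j 1 d) = 1" using rm[OF that(1), of 1 d] that(3) eps[OF that(1)] by (simp add: max_def)
      then have "m j 1 d \<in> disc_boundary n" using mB[OF that(1), of 1 d] that(2) by (simp add: ball_pts_iff disc_boundary_iff)
      then show ?thesis using P(3)[OF that(1), of 1 d] that q_boundary by simp
    qed
  qed (use P in \<open>auto simp: m_def\<close>)
qed

end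

section \<open>Cellular approximation\<close>

lemma continuous_map_prod_I01:
  assumes "continuous_map X Y f"
  shows "continuous_map (prod_topology I01 X) (prod_topology I01 Y) (\<lambda>x. (fst x, f (snd x)))"
proof (rule continuous_map_pairedI)
  show "continuous_map (prod_topology I01 X) I01 fst" by (rule continuous_map_fst)
  show "continuous_map (prod_topology I01 X) Y (\<lambda>x. f (snd x))"
    using continuous_map_compose[OF continuous_map_snd assms] by (simp add: o_def)
qed

text \<open>Cellular approximation for one attachment. In every cell the coordinate of \<open>f\<close> is perturbed
  near the centre so that it misses the centre, which is possible as \<open>K\<close> has dimension less than
  \<open>n\<close>. By compactness it then stays away from the centre by some \<open>\<epsilon> j\<close>, and
  a radial expansion pushes the image into \<open>A\<close>. Points that \<open>f\<close> maps to \<open>A\<close> do not move.\<close>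

lemma (in cell_attachment) compress_into_lower_stage:
  fixes K :: "'k::metric_space set"
  assumes K: "compact K" "box_dim_le l K" "l < n"
    and f: "continuous_map (top_of_set K) (subtopology X B) f"
  obtains f' where "homotopic_with (\<lambda>h. \<forall>k\<in>K. f k \<in> A \<longrightarrow> h k = f k) (top_of_set K) (subtopology X B) f f'"
    "f' ` K \<subseteq> A"
proof -
  have fB: "f k \<in> B" if "k \<in> K" for k using continuous_map_funspace[OF f] that by auto
  have n0: "n > 0" using K(3) by simp
  define U where "U j = {k \<in> K. f k \<in> q j ` int_pts}" for j
  define c where "c j k = cell_coord j (f k)" for j k
  \<comment> \<open>\<open>f\<close> is perturbed only where the radius is below 3/4; \<open>V\<close> is an open part of \<open>K\<close> that does not move\<close>
  define V where "V = {k \<in> K. f k \<in> B - (\<Union>j\<in>J. q j ` {d \<in> ball_pts n. rad n d \<le> 3/4})}"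
  have UK: "U j \<subseteq> K" for j by (auto simp: U_def)
  have openU: "openin (top_of_set K) (U j)" if "j \<in> J" for j
    using openin_continuous_map_preimage[OF f q_open[OF that openin_int_pts order_refl]] by (simp add: U_def)
  have openV: "openin (top_of_set K) V"
    using openin_continuous_map_preimage[OF f openin_avoiding_inner_discs[of "3/4" J]] by (simp add: V_def)
  have c: "c j k \<in> int_pts" "f k = q j (c j k)" if "j \<in> J" "k \<in> U j" for j k
    using that cell_coord_q by (auto simp: c_def U_def)
  have Udisj: "j = j'" if "j \<in> J" "j' \<in> J" "k \<in> U j" "k \<in> U j'" for j j' k
    using c[OF that(1,3)] c[OF that(2,4)] q_inj[OF that(1,2)] by metis
  have c_cont: "continuous_on (U j) (c j)" if j: "j \<in> J" for j
  proof -
    have "continuous_map (top_of_set (U j)) (subtopology X (q j ` int_pts)) f"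
    proof -
      have "continuous_map (subtopology (top_of_set K) (U j)) (subtopology X B) f"
        using f by (rule continuous_map_from_subtopology)
      moreover have "subtopology (top_of_set K) (U j) = top_of_set (U j)"
        using UK by (simp add: subtopology_subtopology Int_absorb1)
      ultimately have "continuous_map (top_of_set (U j)) X f" by (simp add: continuous_map_in_subtopology)
      then show ?thesis by (auto simp: continuous_map_in_subtopology U_def)
    qed
    from continuous_map_compose[OF this cell_coord_continuous[OF j]]
    have "continuous_map (top_of_set (U j)) (disc n) (c j)" by (simp add: o_def c_def[abs_def])
    then have "continuous_on (U j) (\<lambda>k. c j k i)" for i
      by (simp add: continuous_map_into_disc)
    then show ?thesis by (rule continuous_on_coordinatewise_then_product)
  qed
  \<comment> \<open>the coordinate of \<open>f\<close> in the cell \<open>j\<close>, cut off between the radii 3/4 and 7/8 to be defined on all of \<open>K\<close>\<close>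
  define \<phi> where "\<phi> j i k = (if k \<in> U j then max 0 (min 1 (7 - 8 * rad n (c j k))) * c j k i else 0)" for j i k
  have \<phi>_cont: "continuous_on K (\<phi> j i)" if j: "j \<in> J" for i j
  proof -
    define W where "W = {k \<in> K. f k \<in> B - (\<Union>j\<in>{j}. q j ` {d \<in> ball_pts n. rad n d \<le> 7/8})}"
    have W: "openin (top_of_set K) W"
      using openin_continuous_map_preimage[OF f openin_avoiding_inner_discs[of "7/8" "{j}"]] j by (simp add: W_def)
    have KUW: "K = U j \<union> W"
    proof -
      have "k \<in> U j \<union> W" if "k \<in> K" for k
        using fB[OF that] that by (auto simp: U_def W_def disc_boundary_iff)
      then show ?thesis using UK by (auto simp: W_def)
    qed
    have "continuous_on (U j) (\<lambda>k. max 0 (min 1 (7 - 8 * rad n (c j k))) * c j k i)"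
      by (intro continuous_intros continuous_on_coord[OF c_cont[OF j]] c_cont[OF j])
    then have 1: "continuous_on (U j) (\<phi> j i)"
      by (rule continuous_on_eq) (simp add: \<phi>_def)
    have "\<phi> j i k = 0" if k: "k \<in> W" for k
    proof (cases "k \<in> U j")
      case True
      have "rad n (c j k) > 7/8"
      proof (rule ccontr)
        assume "\<not> rad n (c j k) > 7/8"
        then have "f k \<in> q j ` {d \<in> ball_pts n. rad n d \<le> 7/8}" using c[OF j True] by auto
        then show False using k by (simp add: W_def)
      qed
      then show ?thesis by (simp add: \<phi>_def)
    qed (simp add: \<phi>_def)
    then have 2: "continuous_on W (\<phi> j i)"
      by (intro continuous_on_eq[OF continuous_on_const[of W 0]]) simp
    have "continuous_on (U j \<union> W) (\<phi> j i)"
      by (rule continuous_on_Un_local_open[OF _ _ 1 2]) (use openU[OF j] W in \<open>simp_all only: KUW[symmetric]\<close>)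
    then show ?thesis by (simp only: KUW[symmetric])
  qed
  \<comment> \<open>coordinatewise error \<open>e\<close> means distance at most 1/4\<close>
  define e where "e = 1 / (4 * real n)"
  have e: "e > 0" using n0 by (simp add: e_def)
  have "\<exists>g. (\<forall>i<n. continuous_on K (g i)) \<and> (\<forall>i<n. \<forall>x\<in>K. \<bar>g i x - \<phi> j i x\<bar> < e) \<and> (\<forall>x\<in>K. \<exists>i<n. g i x \<noteq> 0)"
    if j: "j \<in> J" for j
  proof -
    obtain g where "\<And>i. i < n \<Longrightarrow> continuous_on K (g i)"
      "\<And>i x. i < n \<Longrightarrow> x \<in> K \<Longrightarrow> \<bar>g i x - \<phi> j i x\<bar> < e" "\<And>x. x \<in> K \<Longrightarrow> \<exists>i<n. g i x \<noteq> 0"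
      using approximation_avoiding_origin[OF K e, of "\<phi> j"] \<phi>_cont[OF j] by blast
    then show ?thesis by blast
  qed
  then obtain G where G: "\<And>j i. j \<in> J \<Longrightarrow> i < n \<Longrightarrow> continuous_on K (G j i)"
    "\<And>j i x. j \<in> J \<Longrightarrow> i < n \<Longrightarrow> x \<in> K \<Longrightarrow> \<bar>G j i x - \<phi> j i x\<bar> < e"
    "\<And>j x. j \<in> J \<Longrightarrow> x \<in> K \<Longrightarrow> \<exists>i<n. G j i x \<noteq> 0" by metis
  \<comment> \<open>\<open>\<alpha>\<close> is 1 up to radius 1/2 and 0 from radius 3/4 on; \<open>p j s k\<close> moves the coordinate towards its approximation \<open>G\<close>\<close>
  define \<alpha> where "\<alpha> \<rho> = max 0 (min 1 (3 - 4 * \<rho>))" for \<rho> :: real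
  have \<alpha>01: "0 \<le> \<alpha> \<rho>" "\<alpha> \<rho> \<le> 1" for \<rho> by (auto simp: \<alpha>_def)
  define p where "p j s k = (\<lambda>i. if i < n then c j k i + s * \<alpha> (rad n (c j k)) * (G j i k - c j k i) else 0)" for j k and s :: real
  have near: "rad n (\<lambda>i. G j i k - c j k i) \<le> 1/4" if j: "j \<in> J" and k: "k \<in> U j" and a: "rad n (c j k) \<le> 3/4" for j k
  proof -
    have "rad n (\<lambda>i. G j i k - c j k i) \<le> (\<Sum>i<n. \<bar>G j i k - c j k i\<bar>)" by (rule L2_set_le_sum_abs)
    also have "\<dots> \<le> (\<Sum>i<n. e)"
    proof (rule sum_mono)
      fix i assume "i \<in> {..<n}"
      moreover have "\<phi> j i k = c j k i" using k a by (simp add: \<phi>_def)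
      ultimately show "\<bar>G j i k - c j k i\<bar> \<le> e" using G(2)[OF j, of i k] UK k by (auto intro: less_imp_le)
    qed
    also have "\<dots> = 1/4" using n0 by (simp add: e_def)
    finally show ?thesis .
  qed
  have \<alpha>0: "\<alpha> \<rho> = 0" if "\<rho> \<ge> 3/4" for \<rho> using that by (simp add: \<alpha>_def)
  have disp: "\<bar>s * \<alpha> (rad n (c j k))\<bar> * rad n (\<lambda>i. G j i k - c j k i) \<le> 1/4"
    if j: "j \<in> J" and k: "k \<in> U j" and s: "s \<in> {0..1}" for j k s
  proof (cases "rad n (c j k) \<le> 3/4")
    case True
    have "\<bar>s * \<alpha> (rad n (c j k))\<bar> \<le> 1" using s \<alpha>01[of "rad n (c j k)"] by (simp add: abs_mult mult_le_one)
    then have "\<bar>s * \<alpha> (rad n (c j k))\<bar> * rad n (\<lambda>i. G j i k - c j k i) \<le> 1 * (1/4)"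
      using near[OF j k True] by (intro mult_mono) auto
    then show ?thesis by simp
  qed (simp add: \<alpha>0)
  have p_eq: "rad n (p j s k) = rad n (\<lambda>i. c j k i + s * \<alpha> (rad n (c j k)) * (G j i k - c j k i))" for j s k
    by (rule L2_set_cong) (auto simp: p_def)
  \<comment> \<open>a point of radius below 3/4 moves by at most 1/4, so it stays in the open disc\<close>
  have p_int: "p j s k \<in> int_pts" if j: "j \<in> J" and k: "k \<in> U j" and s: "s \<in> {0..1}" for j k s
  proof -
    have le: "rad n (p j s k) \<le> rad n (c j k) + \<bar>s * \<alpha> (rad n (c j k))\<bar> * rad n (\<lambda>i. G j i k - c j k i)"
      unfolding p_eq using rad_triangle[of "c j k" "\<lambda>i. s * \<alpha> (rad n (c j k)) * (G j i k - c j k i)" n]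
      by (simp only: rad_scale)
    have "rad n (p j s k) < 1"
    proof (cases "rad n (c j k) < 3/4")
      case True then show ?thesis using le disp[OF that] by linarith
    next
      case False then show ?thesis using le c(1)[OF j k] unfolding int_pts_iff by (simp add: \<alpha>0)
    qed
    then show ?thesis unfolding int_pts_iff by (simp add: p_def)
  qed
  have p_c: "p j s k = c j k" if j: "j \<in> J" and k: "k \<in> U j" and "s = 0 \<or> rad n (c j k) \<ge> 3/4" for j k s
    using c(1)[OF j k] that(3) unfolding int_pts_iff by (auto simp: p_def \<alpha>0)
  have "\<exists>\<mu>>0. \<forall>k\<in>K. \<mu> \<le> rad n (\<lambda>i. if i < n then G j i k else 0)" if j: "j \<in> J" for j
  proof (cases "K = {}")
    case False
    have "continuous_on K (\<lambda>k. rad n (\<lambda>i. if i < n then G j i k else 0))"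
    proof (rule continuous_on_rad, rule continuous_on_coordinatewise_then_product)
      fix i show "continuous_on K (\<lambda>k. if i < n then G j i k else 0)"
        by (cases "i < n") (use G(1)[OF j] in auto)
    qed
    then obtain k0 where k0: "k0 \<in> K" "\<And>k. k \<in> K \<Longrightarrow> rad n (\<lambda>i. if i < n then G j i k0 else 0) \<le> rad n (\<lambda>i. if i < n then G j i k else 0)"
      using continuous_attains_inf[OF K(1) False] by blast
    have "rad n (\<lambda>i. if i < n then G j i k0 else 0) \<noteq> 0" using G(3)[OF j k0(1)] by (auto simp: rad_eq_0)
    then have "rad n (\<lambda>i. if i < n then G j i k0 else 0) > 0" using rad_nonneg by (metis less_eq_real_def)
    then show ?thesis using k0 by blast
  qed (auto intro: exI[of _ 1])
  then obtain \<mu> where \<mu>: "\<And>j. j \<in> J \<Longrightarrow> \<mu> j > (0::real)"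
    "\<And>j k. j \<in> J \<Longrightarrow> k \<in> K \<Longrightarrow> \<mu> j \<le> rad n (\<lambda>i. if i < n then G j i k else 0)" by metis
  \<comment> \<open>inside radius 1/2 the perturbed coordinate is \<open>G\<close>, outside it has moved by at most 1/4\<close>
  define \<epsilon> where "\<epsilon> j = min (\<mu> j) (1/4)" for j
  have p_low: "\<epsilon> j \<le> rad n (p j 1 k)" if j: "j \<in> J" and k: "k \<in> U j" for j k
  proof (cases "rad n (c j k) \<le> 1/2")
    case True
    then have "\<alpha> (rad n (c j k)) = 1" by (simp add: \<alpha>_def)
    then have "p j 1 k = (\<lambda>i. if i < n then G j i k else 0)" by (auto simp: p_def)
    moreover have "k \<in> K" using UK k by blast
    ultimately show ?thesis using \<mu>(2)[OF j, of k] by (simp add: \<epsilon>_def)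
  next
    case False
    have "rad n (c j k) = rad n (\<lambda>i. p j 1 k i + (- \<alpha> (rad n (c j k))) * (G j i k - c j k i))"
      by (rule L2_set_cong) (auto simp: p_def algebra_simps)
    also have "\<dots> \<le> rad n (p j 1 k) + \<bar>1 * \<alpha> (rad n (c j k))\<bar> * rad n (\<lambda>i. G j i k - c j k i)"
      using rad_triangle[of "p j 1 k" "\<lambda>i. (- \<alpha> (rad n (c j k))) * (G j i k - c j k i)" n]
      unfolding rad_scale by simp
    finally have "1/4 \<le> rad n (p j 1 k)" using disp[OF j k, of 1] False by simp
    then show ?thesis by (simp add: \<epsilon>_def)
  qed
  \<comment> \<open>the perturbation homotopy, glued over the open sets \<open>U j\<close> and \<open>V\<close>\<close>
  define piece where "piece = (\<lambda>oj. case oj of None \<Rightarrow> (\<lambda>(s::real, k). f k) | Some j \<Rightarrow> (\<lambda>(s, k). q j (p j s k)))"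
  define region where "region = (\<lambda>oj. case oj of None \<Rightarrow> {0..1::real} \<times> V | Some j \<Rightarrow> {0..1} \<times> U j)"
  have VK: "V \<subseteq> K" by (auto simp: V_def)
  have A_V: "k \<in> V" if "k \<in> K" "f k \<in> A" for k
  proof -
    have "f k \<noteq> q j d" if "j \<in> J" "d \<in> ball_pts n" "rad n d \<le> 3/4" for j d
      using q_interior[OF that(1), of d] that \<open>f k \<in> A\<close> by (auto simp: disc_boundary_iff)
    then show ?thesis using that fB by (auto simp: V_def)
  qed
  have cover: "k \<in> V \<or> (\<exists>j\<in>J. k \<in> U j)" if "k \<in> K" for k
    using fB[OF that] by (cases rule: B_cases) (use A_V that in \<open>auto simp: U_def\<close>)
  have compat: "f k = q j (p j s k)" if "j \<in> J" "k \<in> V" "k \<in> U j" for j k s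
  proof -
    have "rad n (c j k) > 3/4"
    proof (rule ccontr)
      assume "\<not> rad n (c j k) > 3/4"
      then have "f k \<in> q j ` {d \<in> ball_pts n. rad n d \<le> 3/4}" using c[OF that(1,3)] by auto
      then show False using that by (auto simp: V_def)
    qed
    then show ?thesis using p_c[OF that(1,3)] c(2)[OF that(1,3)] by simp
  qed
  have sub: "subtopology (prod_topology I01 (top_of_set K)) ({0..1} \<times> S) = top_of_set ({0..1} \<times> S)" if "S \<subseteq> K" for S
  proof -
    have "({0..1::real} \<times> K) \<inter> ({0..1} \<times> S) = {0..1} \<times> S" using that by auto
    then show ?thesis by (simp add: subtopology_subtopology)
  qed
  obtain H where H: "continuous_map (prod_topology I01 (top_of_set K)) (subtopology X B) H"
    "\<And>x oj. oj \<in> insert None (Some ` J) \<Longrightarrow> x \<in> topspace (prod_topology I01 (top_of_set K)) \<inter> region oj \<Longrightarrow> H x = piece oj x"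
  proof (rule pasting_lemma_exists[where X = "prod_topology I01 (top_of_set K)" and Y = "subtopology X B"
        and I = "insert None (Some ` J)" and T = region and f = piece])
    show "topspace (prod_topology I01 (top_of_set K)) \<subseteq> (\<Union>i\<in>insert None (Some ` J). region i)"
      using cover by (force simp: region_def)
    show "openin (prod_topology I01 (top_of_set K)) (region i)" if "i \<in> insert None (Some ` J)" for i
      using that openU openV by (auto simp: region_def openin_prod_Times_iff simp del: prod_topology_subtopology_eu)
    show "continuous_map (subtopology (prod_topology I01 (top_of_set K)) (region i)) (subtopology X B) (piece i)"
      if "i \<in> insert None (Some ` J)" for i
    proof (cases i)
      case None
      have "continuous_map (prod_topology I01 (top_of_set K)) (subtopology X B) (f \<circ> snd)"
        by (rule continuous_map_compose[OF continuous_map_snd f])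
      then show ?thesis unfolding None
        by (auto simp: piece_def o_def case_prod_unfold intro: continuous_map_from_subtopology)
    next
      case (Some j)
      then have j: "j \<in> J" using that by auto
      have "continuous_on ({0..1} \<times> U j) (\<lambda>x. p j (fst x) (snd x))"
      proof (rule continuous_on_coordinatewise_then_product)
        fix i
        have cs: "continuous_on ({0..1} \<times> U j) (\<lambda>x. c j (snd x))"
          by (rule continuous_on_compose2[OF c_cont[OF j] continuous_on_snd[OF continuous_on_id]]) auto
        have Gs: "continuous_on ({0..1} \<times> U j) (\<lambda>x. G j i (snd x))" if "i < n"
          by (rule continuous_on_compose2[OF G(1)[OF j that] continuous_on_snd[OF continuous_on_id]]) (use UK in auto)
        show "continuous_on ({0..1} \<times> U j) (\<lambda>x. p j (fst x) (snd x) i)"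
        proof (cases "i < n")
          case True
          then show ?thesis unfolding p_def \<alpha>_def
            by (simp, intro continuous_intros continuous_on_rad cs continuous_on_coord[OF cs] Gs)
        qed (simp add: p_def)
      qed
      moreover have "p j (fst x) (snd x) \<in> ball_pts n" if "x \<in> {0..1} \<times> U j" for x
        using p_int[OF j] that by (metis DiffD1 mem_Times_iff)
      ultimately have "continuous_map (top_of_set ({0..1} \<times> U j)) (disc n) (\<lambda>x. p j (fst x) (snd x))"
        by (subst disc_eq) (auto simp: continuous_map_in_subtopology continuous_map_iff_continuous)
      from continuous_map_compose[OF this q_cont[OF j]] show ?thesis
        unfolding Some using sub[OF UK] by (simp add: piece_def region_def o_def case_prod_unfold)
    qed
    show "piece i x = piece j x" if "i \<in> insert None (Some ` J)" "j \<in> insert None (Some ` J)"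
      "x \<in> topspace (prod_topology I01 (top_of_set K)) \<inter> region i \<inter> region j" for i j x
      using that by (auto simp: piece_def region_def compat[symmetric] dest: Udisj)
  qed blast
  have HV: "H (s, k) = f k" if "k \<in> V" "s \<in> {0..1}" for s k
    using H(2)[of None "(s, k)"] that VK by (auto simp: piece_def region_def)
  have HU: "H (s, k) = q j (p j s k)" if "j \<in> J" "k \<in> U j" "s \<in> {0..1}" for j s k
    using H(2)[of "Some j" "(s, k)"] that UK by (auto simp: piece_def region_def)
  define f1 where "f1 k = H (1, k)" for k
  have hom1: "homotopic_with (\<lambda>h. \<forall>k\<in>K. f k \<in> A \<longrightarrow> h k = f k) (top_of_set K) (subtopology X B) f f1"
  proof (rule homotopic_withI[OF H(1)])
    show "H (0, k) = f k" if "k \<in> topspace (top_of_set K)" for k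
    proof -
      have "k \<in> V \<or> (\<exists>j\<in>J. k \<in> U j)" using cover that by simp
      then show ?thesis using HV[of k 0] HU[of _ k 0] p_c c(2) by fastforce
    qed
    show "\<forall>k\<in>K. f k \<in> A \<longrightarrow> H (t, k) = f k" if "t \<in> {0..1}" for t
      using HV A_V that by blast
  qed (auto simp: f1_def)
  then have f1: "continuous_map (top_of_set K) (subtopology X B) f1" by (simp add: homotopic_with_imp_continuous_maps)
  have "0 < \<epsilon> j \<and> \<epsilon> j \<le> 1" if "j \<in> J" for j using \<mu>(1)[OF that] by (simp add: \<epsilon>_def)
  then obtain P where P: "continuous_map (prod_topology I01 (subtopology X B)) (subtopology X B) P"
    "\<And>t a. t \<in> {0..1} \<Longrightarrow> a \<in> A \<Longrightarrow> P (t, a) = a" "\<And>b. b \<in> B \<Longrightarrow> P (0, b) = b"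
    "\<And>j d. j \<in> J \<Longrightarrow> d \<in> ball_pts n \<Longrightarrow> \<epsilon> j \<le> rad n d \<Longrightarrow> P (1, q j d) \<in> A"
    using radial_expansion[of \<epsilon>] by metis
  have f1A: "f1 k = f k" if "k \<in> K" "f k \<in> A" for k using HV[OF A_V[OF that]] by (simp add: f1_def)
  have hom2: "homotopic_with (\<lambda>h. \<forall>k\<in>K. f k \<in> A \<longrightarrow> h k = f k) (top_of_set K) (subtopology X B) f1 (\<lambda>k. P (1, f1 k))"
  proof (rule homotopic_withI[where h = "\<lambda>(t, k). P (t, f1 k)"])
    have "continuous_map (prod_topology I01 (top_of_set K)) (prod_topology I01 (subtopology X B)) (\<lambda>x. (fst x, f1 (snd x)))"
      by (rule continuous_map_prod_I01[OF f1])
    from continuous_map_compose[OF this P(1)]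
    show "continuous_map (prod_topology I01 (top_of_set K)) (subtopology X B) (\<lambda>(t, k). P (t, f1 k))"
      by (simp add: o_def case_prod_unfold)
    show "(case (0, k) of (t, k) \<Rightarrow> P (t, f1 k)) = f1 k" if "k \<in> topspace (top_of_set K)" for k
      using continuous_map_funspace[OF f1] that P(3) by auto
    show "\<forall>k\<in>K. f k \<in> A \<longrightarrow> (case (t, k) of (t, k) \<Rightarrow> P (t, f1 k)) = f k" if "t \<in> {0..1}" for t
      using P(2) that f1A by auto
  qed auto
  have "P (1, f1 k) \<in> A" if k: "k \<in> K" for k
  proof (cases "\<exists>j\<in>J. k \<in> U j")
    case True
    then obtain j where j: "j \<in> J" "k \<in> U j" by blast
    then have "f1 k = q j (p j 1 k)" using HU by (simp add: f1_def)
    then show ?thesis using P(4)[OF j(1)] p_int[OF j, of 1] p_low[OF j] by simp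
  next
    case False
    then have "f k \<in> A" using fB[OF k] k q_surj by (metis (mono_tags, lifting) U_def image_eqI mem_Collect_eq)
    then show ?thesis using P(2) f1A[OF k] by simp
  qed
  then show ?thesis using that homotopic_with_trans[OF hom1 hom2] by blast
qed

text \<open>Otherwise there is a sequence in \<open>K\<close> that leaves every stage. It meets each stage in a
  finite set, so all its tails are closed, and the complements of the tails cover \<open>K\<close> without a
  finite subcover.\<close>

lemma compactin_subset_stage:
  assumes col: "colimit_topology X Fs" and mono: "\<And>k. Fs k \<subseteq> Fs (Suc k)"
    and T1: "\<And>x. x \<in> topspace X \<Longrightarrow> closedin X {x}" and K: "compactin X K"
  obtains N where "K \<subseteq> Fs N"
proof (rule ccontr)
  assume "\<not> thesis"
  then have "\<forall>N. \<exists>x. x \<in> K - Fs N" using that by blast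
  then obtain x where x: "\<And>N. x N \<in> K - Fs N" by metis
  have le: "Fs j \<subseteq> Fs k" if "j \<le> k" for j k using lift_Suc_mono_le[of Fs, OF mono that] .
  have Fsub: "Fs k \<subseteq> topspace X" for k using col by (auto simp: colimit_topology_def)
  have xX: "x N \<in> topspace X" for N using x compactin_subset_topspace[OF K] by blast
  define U where "U n = topspace X - x ` {n..}" for n
  have openU: "openin X (U n)" for n
  proof -
    have "openin (subtopology X (Fs m)) (U n \<inter> Fs m)" for m
    proof -
      have "closedin X (\<Union>y\<in>x ` {n..<m}. {y})"
        by (rule closedin_Union) (auto intro!: T1 xX)
      then have "openin X (topspace X - x ` {n..<m})" by auto
      moreover have "U n \<inter> Fs m = (topspace X - x ` {n..<m}) \<inter> Fs m"
      proof -
        have "j < m" if "x j \<in> Fs m" for j using x[of j] le[of m j] that by (meson DiffD2 linorder_not_le subsetD)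
        then show ?thesis by (auto simp: U_def)
      qed
      ultimately show ?thesis by (auto simp: openin_subtopology)
    qed
    moreover have "U n \<subseteq> topspace X" by (auto simp: U_def)
    ultimately show ?thesis using col by (simp add: colimit_topology_def)
  qed
  have cov: "K \<subseteq> \<Union>(range U)"
  proof
    fix y assume "y \<in> K"
    then have y: "y \<in> topspace X" using compactin_subset_topspace[OF K] by blast
    then obtain m where m: "y \<in> Fs m" using col by (auto simp: colimit_topology_def)
    have "y \<notin> x ` {m..}" using x le m by fastforce
    then show "y \<in> \<Union>(range U)" using y by (auto simp: U_def)
  qed
  have "\<exists>\<F>. finite \<F> \<and> \<F> \<subseteq> range U \<and> K \<subseteq> \<Union>\<F>"
    using K cov openU unfolding compactin_def by (metis (no_types, lifting) imageE)
  then obtain M where M: "finite M" "K \<subseteq> \<Union>(U ` M)" by (metis finite_subset_image)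
  define n where "n = Max (insert 0 M)"
  have "U k \<subseteq> U n" if "k \<in> M" for k
  proof -
    have "k \<le> n" using M(1) that by (simp add: n_def)
    then show ?thesis by (auto simp: U_def)
  qed
  then have "x n \<in> U n" using M(2) x[of n] by blast
  then show False by (auto simp: U_def)
qed

text \<open>Stages are intersected with a set \<open>C\<close> because the result is applied to fixed point sets.\<close>

lemma compress_into_first_stage:
  fixes K :: "'k::metric_space set" and X :: "'x topology"
  assumes K: "compact K" "box_dim_le l K"
    and cells: "\<And>k. \<exists>d>l. \<exists>(J :: 'j set) q. cell_attachment X d (Fs k \<inter> C) (Fs (Suc k) \<inter> C) J q"
    and f: "continuous_map (top_of_set K) (subtopology X C) f" and N: "f ` K \<subseteq> Fs N"
  obtains f' where "homotopic_with (\<lambda>h. \<forall>k\<in>K. f k \<in> Fs 0 \<longrightarrow> h k = f k) (top_of_set K) (subtopology X C) f f'"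
    "f' ` K \<subseteq> Fs 0"
proof -
  have mono: "Fs k \<inter> C \<subseteq> Fs (Suc k) \<inter> C" for k using cells[of k] cell_attachment.AB by blast
  have mono0: "Fs 0 \<inter> C \<subseteq> Fs k \<inter> C" for k using lift_Suc_mono_le[of "\<lambda>k. Fs k \<inter> C", OF mono] by blast
  have "\<exists>f'. homotopic_with (\<lambda>h. \<forall>k\<in>K. f k \<in> Fs 0 \<longrightarrow> h k = f k) (top_of_set K) (subtopology X C) f f' \<and> f' ` K \<subseteq> Fs 0"
    using f N
  proof (induction N arbitrary: f)
    case 0
    then show ?case by (intro exI[of _ f]) simp
  next
    case (Suc N)
    obtain d J q where c: "d > l" "cell_attachment X d (Fs N \<inter> C) (Fs (Suc N) \<inter> C) (J :: 'j set) q"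
      using cells by blast
    then interpret cell_attachment X d "Fs N \<inter> C" "Fs (Suc N) \<inter> C" J q by simp
    have fC: "f k \<in> C" if "k \<in> K" for k using continuous_map_funspace[OF Suc.prems(1)] that by auto
    have "continuous_map (top_of_set K) (subtopology X (Fs (Suc N) \<inter> C)) f"
      using Suc.prems fC by (auto simp: continuous_map_in_subtopology)
    from compress_into_lower_stage[OF K c(1) this]
    obtain g where g: "homotopic_with (\<lambda>h. \<forall>k\<in>K. f k \<in> Fs N \<inter> C \<longrightarrow> h k = f k) (top_of_set K) (subtopology X (Fs (Suc N) \<inter> C)) f g"
       "g ` K \<subseteq> Fs N \<inter> C" .
    have cont: "continuous_map (subtopology X (Fs (Suc N) \<inter> C)) (subtopology X C) id"
      by (auto simp: continuous_map_in_subtopology intro: continuous_map_from_subtopology[OF continuous_map_id])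
    have fg: "homotopic_with (\<lambda>h. \<forall>k\<in>K. f k \<in> Fs 0 \<longrightarrow> h k = f k) (top_of_set K) (subtopology X C) f g"
      using homotopic_with_compose_continuous_map_left[OF g(1) cont, of "\<lambda>h. \<forall>k\<in>K. f k \<in> Fs 0 \<longrightarrow> h k = f k"]
        mono0 fC by (auto simp: subset_iff)
    have g': "continuous_map (top_of_set K) (subtopology X C) g" "g ` K \<subseteq> Fs N"
      using fg g(2) by (auto simp: homotopic_with_imp_continuous_maps)
    from Suc.IH[OF this] obtain f' where f': "homotopic_with (\<lambda>h. \<forall>k\<in>K. g k \<in> Fs 0 \<longrightarrow> h k = g k) (top_of_set K) (subtopology X C) g f'" "f' ` K \<subseteq> Fs 0"
      by blast
    have "homotopic_with (\<lambda>h. \<forall>k\<in>K. f k \<in> Fs 0 \<longrightarrow> h k = f k) (top_of_set K) (subtopology X C) g f'"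
      by (rule homotopic_with_mono[OF f'(1)]) (use homotopic_with_imp_property[OF fg] in fastforce)
    then show ?case using homotopic_with_trans[OF fg] f'(2) by blast
  qed
  then show ?thesis using that by blast
qed

section \<open>Filling spheres\<close>

text \<open>A continuous surjection from a compact space to a Hausdorff space is a quotient map.\<close>

lemma compact_quotient_lift:
  fixes f :: "'a::metric_space \<Rightarrow> 'b::metric_space"
  assumes "compact S" "continuous_on S f" "f ` S = T"
    and h: "continuous_map (top_of_set S) X h"
    and fib: "\<And>x y. x \<in> S \<Longrightarrow> y \<in> S \<Longrightarrow> f x = f y \<Longrightarrow> h x = h y"
  shows "\<exists>g. continuous_map (top_of_set T) X g \<and> (\<forall>x\<in>S. g (f x) = h x)"
proof -
  have c: "continuous_map (top_of_set S) (top_of_set T) f"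
  proof -
    have "f \<in> S \<rightarrow> T" using assms(3) by blast
    then show ?thesis using assms(2) by (simp only: continuous_map_subtopology_eu)
  qed
  have fib': "h x = h y" if "x \<in> topspace (top_of_set S)" "y \<in> topspace (top_of_set S)" "f x = f y" for x y
    by (rule fib) (use that in auto)
  have "compact_space (top_of_set S)" using assms(1) by (simp add: compact_space_subtopology)
  moreover have "Hausdorff_space (top_of_set T)" by (simp add: Hausdorff_space_subtopology)
  ultimately have "closed_map (top_of_set S) (top_of_set T) f"
    using c by (intro T1_Spaces.continuous_imp_closed_map)
  with c have "quotient_map (top_of_set S) (top_of_set T) f"
    using assms(3) by (intro continuous_closed_imp_quotient_map) auto
  then show ?thesis
  proof (rule quotient_map_lift_exists[OF _ h fib'])
    fix g assume "continuous_map (top_of_set T) X g" "\<And>x. x \<in> topspace (top_of_set S) \<Longrightarrow> g (f x) = h x"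
    then show ?thesis by (intro exI[of _ g]) simp
  qed
qed

text \<open>The point of the sphere to which the boundary of the disc is collapsed.\<close>

definition pole :: "nat \<Rightarrow> nat \<Rightarrow> real" where
  "pole n = (\<lambda>i. if i = n then 1 else 0)"

text \<open>The homeomorphism from the disc modulo its boundary to the sphere: the radius \<open>r\<close> determines the
  height \<open>2r\<^sup>2 - 1\<close>. It turns spheres in \<open>X\<close> into the maps of pairs that represent elements of
  homotopy groups.\<close>

definition collapse :: "nat \<Rightarrow> (nat \<Rightarrow> real) \<Rightarrow> nat \<Rightarrow> real" where
  "collapse n x = (\<lambda>i. if i < n then 2 * sqrt (1 - (rad n x)\<^sup>2) * x i else if i = n then 2 * (rad n x)\<^sup>2 - 1 else 0)"

lemma rad_sq: "(rad n x)\<^sup>2 = (\<Sum>i<n. (x i)\<^sup>2)"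
  by (simp add: L2_set_def sum_nonneg)

lemma rad_Suc_sq: "(rad (Suc n) x)\<^sup>2 = (rad n x)\<^sup>2 + (x n)\<^sup>2"
  by (simp add: rad_sq)

lemma rad_eq_1: "rad n x = 1 \<longleftrightarrow> (rad n x)\<^sup>2 = 1"
proof -
  have "rad n x \<noteq> -1" using rad_nonneg[of x n] by linarith
  then show ?thesis by (simp add: power2_eq_1_iff)
qed

lemma eq_0_if_rad_eq_0:
  assumes "\<forall>i\<ge>n. v i = 0" "rad n v = 0" shows "v = (\<lambda>i. 0)"
proof
  fix i show "v i = 0" using assms unfolding rad_eq_0 by (cases "i < n") auto
qed

lemma rad_collapse_below:
  assumes "(rad n x)\<^sup>2 \<le> 1"
  shows "rad n (collapse n x) = 2 * sqrt (1 - (rad n x)\<^sup>2) * rad n x"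
proof -
  have "rad n (collapse n x) = rad n (\<lambda>i. (2 * sqrt (1 - (rad n x)\<^sup>2)) * x i)"
    by (rule L2_set_cong) (auto simp: collapse_def)
  also have "\<dots> = \<bar>2 * sqrt (1 - (rad n x)\<^sup>2)\<bar> * rad n x" by (rule rad_scale)
  finally show ?thesis using assms by simp
qed

lemma collapse_in_sphere:
  assumes "x \<in> ball_pts n" shows "collapse n x \<in> disc_boundary (Suc n)"
proof -
  define r where "r = rad n x"
  have "r\<^sup>2 \<le> 1" using assms by (simp add: r_def ball_pts_iff power_le_one)
  have "(rad (Suc n) (collapse n x))\<^sup>2 = (2 * sqrt (1 - r\<^sup>2) * r)\<^sup>2 + (2 * r\<^sup>2 - 1)\<^sup>2"
    using rad_collapse_below[of x n] \<open>r\<^sup>2 \<le> 1\<close> unfolding rad_Suc_sq r_def by (simp add: collapse_def)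
  also have "\<dots> = 4 * (1 - r\<^sup>2) * r\<^sup>2 + (2 * r\<^sup>2 - 1)\<^sup>2" using \<open>r\<^sup>2 \<le> 1\<close> by (simp add: power_mult_distrib)
  also have "\<dots> = 1" by (simp add: power2_eq_square algebra_simps)
  finally have "rad (Suc n) (collapse n x) = 1" unfolding rad_eq_1 .
  then show ?thesis by (auto simp: disc_boundary_iff collapse_def)
qed

lemma collapse_boundary: "x \<in> disc_boundary n \<Longrightarrow> collapse n x = pole n"
  by (auto simp: collapse_def pole_def disc_boundary_iff)

lemma collapse_eqD:
  assumes x: "x \<in> ball_pts n" and y: "y \<in> ball_pts n" and eq: "collapse n x = collapse n y"
  shows "x = y \<or> x \<in> disc_boundary n \<and> y \<in> disc_boundary n"
proof -
  have "2 * (rad n x)\<^sup>2 - 1 = 2 * (rad n y)\<^sup>2 - 1" using fun_cong[OF eq, of n] by (simp add: collapse_def)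
  then have r: "rad n x = rad n y" by simp
  show ?thesis
  proof (cases "rad n x = 1")
    case True
    then show ?thesis using x y r by (auto simp: ball_pts_iff disc_boundary_iff)
  next
    case False
    then have "rad n x < 1" using x by (simp add: ball_pts_iff)
    then have "(rad n x)\<^sup>2 < 1" by (simp add: power_less_one_iff abs_square_less_1)
    then have s: "sqrt (1 - (rad n x)\<^sup>2) \<noteq> 0" by simp
    have "x i = y i" for i
    proof (cases "i < n")
      case True
      then show ?thesis using fun_cong[OF eq, of i] s r by (simp add: collapse_def)
    next
      case False
      then show ?thesis using x y by (simp add: ball_pts_iff)
    qed
    then show ?thesis by blast
  qed
qed

lemma collapse_surj:
  assumes n: "n > 0" and w: "w \<in> disc_boundary (Suc n)"
  shows "w \<in> collapse n ` ball_pts n"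
proof -
  have w1: "(rad n w)\<^sup>2 + (w n)\<^sup>2 = 1" and w0: "\<And>i. i > n \<Longrightarrow> w i = 0"
    using w rad_Suc_sq[of w n] by (auto simp: disc_boundary_iff)
  then have "(w n)\<^sup>2 \<le> 1" by (metis le_add_same_cancel2 zero_le_power2)
  then have wn: "-1 \<le> w n" "w n \<le> 1" by (auto simp: abs_square_le_1 abs_le_iff)
  show ?thesis
  proof (cases "w n = 1")
    case True
    then have "rad n w = 0" using w1 by simp
    then have "w i = 0" if "i < n" for i using that by (simp only: rad_eq_0)
    then have "w = pole n" using True w0 by (auto simp: pole_def linorder_neq_iff)
    moreover have "pole 0 \<in> disc_boundary n"
    proof -
      have "rad n (pole 0) = 1" unfolding rad_eq_1 rad_sq using n by (simp add: pole_def if_distrib[of "\<lambda>a. a\<^sup>2"] cong: if_cong)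
      then show ?thesis using n by (auto simp: disc_boundary_iff pole_def)
    qed
    ultimately show ?thesis using collapse_boundary disc_boundary_subset by (metis image_eqI subsetD)
  next
    case False
    define s where "s = sqrt ((1 - w n) / 2)"
    have s: "s > 0" "s\<^sup>2 = (1 - w n) / 2" using False wn by (auto simp: s_def)
    define x where "x = (\<lambda>i. if i < n then w i / (2 * s) else 0)"
    have "rad n x = rad n (\<lambda>i. (1 / (2 * s)) * w i)" by (rule L2_set_cong) (auto simp: x_def)
    also have "\<dots> = rad n w / (2 * s)" unfolding rad_scale using s by simp
    finally have rx: "rad n x = rad n w / (2 * s)" .
    have rw: "(rad n w)\<^sup>2 = 1 - (w n)\<^sup>2" using w1 by simp
    have "(rad n x)\<^sup>2 = (1 - (w n)\<^sup>2) / (2\<^sup>2 * ((1 - w n) / 2))"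
      unfolding rx power_divide power_mult_distrib rw s(2) ..
    also have "\<dots> = (1 + w n) / 2" using False by (simp add: field_simps power2_eq_square)
    finally have r: "(rad n x)\<^sup>2 = (1 + w n) / 2" .
    then have "(rad n x)\<^sup>2 \<le> 1" using wn by simp
    then have "x \<in> ball_pts n" by (auto simp: ball_pts_iff x_def abs_square_le_1)
    moreover have "collapse n x = w"
    proof
      fix i
      have "sqrt (1 - (rad n x)\<^sup>2) = s" unfolding r s_def by (rule arg_cong[of _ _ sqrt]) (simp add: field_simps)
      then show "collapse n x i = w i"
        using s w0[of i] r by (auto simp: collapse_def x_def linorder_neq_iff)
    qed
    ultimately show ?thesis by blast
  qed
qed

lemma continuous_on_collapse: "continuous_on S (collapse n)"
proof (rule continuous_on_coordinatewise_then_product)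
  fix i
  have "continuous_on S (\<lambda>x. 2 * sqrt (1 - (rad n x)\<^sup>2) * x i)" "continuous_on S (\<lambda>x. 2 * (rad n x)\<^sup>2 - 1)"
    by (intro continuous_intros continuous_on_coord[OF continuous_on_id])+
  then show "continuous_on S (\<lambda>x. collapse n x i)"
    by (cases "i < n"; cases "i = n") (auto simp: collapse_def)
qed

lemma compact_sphere_pts: "compact (disc_boundary n)"
proof -
  have "disc_boundary n = ball_pts n \<inter> {x. rad n x = 1}" by (auto simp: disc_boundary_iff ball_pts_iff)
  moreover have "closed {x. rad n x = 1}" by (intro closed_Collect_eq continuous_intros)
  ultimately show ?thesis using compact_ball_pts by (metis compact_Int_closed)
qed

text \<open>A homotopy on the disc that is constant on the boundary factors through the sphere.\<close>

lemma nullhomotopic_of_collapse: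
  assumes n: "n > 0"
    and null: "homotopic_with (\<lambda>h. \<forall>d\<in>disc_boundary n. h d = x0) (disc n) X (b \<circ> collapse n) (\<lambda>_. x0)"
  obtains N where "continuous_map (prod_topology I01 (top_of_set (disc_boundary (Suc n)))) X N"
    "\<And>z. z \<in> disc_boundary (Suc n) \<Longrightarrow> N (0, z) = b z" "\<And>z. z \<in> disc_boundary (Suc n) \<Longrightarrow> N (1, z) = x0"
proof -
  obtain h where h: "continuous_map (prod_topology I01 (disc n)) X h"
    "\<And>x. h (0, x) = (b \<circ> collapse n) x" "\<And>x. h (1, x) = x0"
    "\<And>t. t \<in> {0..1} \<Longrightarrow> \<forall>d\<in>disc_boundary n. h (t, d) = x0"
    using homotopic_withE[OF null] by blast
  have "compact ({0..1::real} \<times> ball_pts n)" by (intro compact_Times compact_ball_pts) auto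
  moreover have "continuous_on ({0..1::real} \<times> ball_pts n) (\<lambda>x. (fst x, collapse n (snd x)))"
    by (intro continuous_intros continuous_on_compose2[OF continuous_on_collapse[of UNIV n]]) auto
  moreover have "(\<lambda>x. (fst x, collapse n (snd x))) ` ({0..1::real} \<times> ball_pts n) = {0..1} \<times> disc_boundary (Suc n)"
    using collapse_in_sphere collapse_surj[OF n] by (fastforce simp: image_iff)
  moreover have "continuous_map (top_of_set ({0..1::real} \<times> ball_pts n)) X h" using h(1) by (simp add: I01_disc_eq)
  moreover have "h x = h y" if "x \<in> {0..1} \<times> ball_pts n" "y \<in> {0..1} \<times> ball_pts n"
    "(fst x, collapse n (snd x)) = (fst y, collapse n (snd y))" for x y
  proof -
    have "snd x = snd y \<or> snd x \<in> disc_boundary n \<and> snd y \<in> disc_boundary n"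
      by (rule collapse_eqD) (use that in auto)
    then show ?thesis using that h(4)[of "fst x"] by (cases x; cases y) auto
  qed
  ultimately have "\<exists>N. continuous_map (top_of_set ({0..1::real} \<times> disc_boundary (Suc n))) X N \<and>
    (\<forall>x\<in>{0..1} \<times> ball_pts n. N (fst x, collapse n (snd x)) = h x)"
    by (rule compact_quotient_lift)
  then obtain N where N: "continuous_map (top_of_set ({0..1::real} \<times> disc_boundary (Suc n))) X N"
    "\<And>x. x \<in> {0..1} \<times> ball_pts n \<Longrightarrow> N (fst x, collapse n (snd x)) = h x" by blast
  have NN: "N (t, collapse n x) = h (t, x)" if "t \<in> {0..1}" "x \<in> ball_pts n" for t x using N(2)[of "(t, x)"] that by simp
  show ?thesis
  proof (rule that)
    show "continuous_map (prod_topology I01 (top_of_set (disc_boundary (Suc n)))) X N" using N(1) by simp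
    fix z assume "z \<in> disc_boundary (Suc n)"
    then obtain x where x: "x \<in> ball_pts n" "z = collapse n x" using collapse_surj[OF n] by blast
    then show "N (0, z) = b z" "N (1, z) = x0" using NN h by auto
  qed
qed

text \<open>The unit ball of a gauge \<open>\<gamma>\<close> is the cone over the sphere, so a null homotopy of \<open>b\<close> fills it.
  The gauge is a parameter because two shapes are needed, the round disc and the cylinder
  \<open>[0,1] \<times> D\<^sup>n\<close>.\<close>

lemma fill_star_body:
  assumes n: "n > 0"
    and null: "homotopic_with (\<lambda>h. \<forall>d\<in>disc_boundary n. h d = x0) (disc n) X (b \<circ> collapse n) (\<lambda>_. x0)"
    and gauge: "continuous_on UNIV \<gamma>" "\<And>c v. \<gamma> (\<lambda>i. c * v i) = \<bar>c\<bar> * \<gamma> v"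
       "\<And>v. (\<forall>i\<ge>Suc n. v i = 0) \<Longrightarrow> rad (Suc n) v \<noteq> 0 \<Longrightarrow> \<gamma> v > (0::real)"
  obtains F where "continuous_map (top_of_set {v. (\<forall>i\<ge>Suc n. v i = 0) \<and> \<gamma> v \<le> 1}) X F"
    "\<And>v. (\<forall>i\<ge>Suc n. v i = 0) \<Longrightarrow> \<gamma> v = 1 \<Longrightarrow> F v = b (\<lambda>i. v i / rad (Suc n) v)"
proof -
  define Z where "Z = disc_boundary (Suc n)"
  define W where "W = {v. (\<forall>i\<ge>Suc n. v i = 0) \<and> \<gamma> v \<le> 1}"
  \<comment> \<open>the time \<open>s\<close> of the null homotopy becomes the gauge \<open>1 - s\<close>, so the end of the homotopy is the cone point\<close>
  define Q where "Q = (\<lambda>x. (\<lambda>i. ((1 - fst x) / \<gamma> (snd x)) * snd x i))"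
  have gZ: "\<gamma> z > 0" if "z \<in> Z" for z using gauge(3)[of z] that by (simp add: Z_def disc_boundary_iff)
  have g0: "\<gamma> (\<lambda>i. 0) = 0" using gauge(2)[of 0 "\<lambda>i. 0"] by simp
  have gQ: "\<gamma> (Q (s, z)) = 1 - s" if "s \<in> {0..1}" "z \<in> Z" for s z
  proof -
    have "\<gamma> (\<lambda>i. ((1 - s) / \<gamma> z) * z i) = \<bar>(1 - s) / \<gamma> z\<bar> * \<gamma> z" by (rule gauge(2))
    then show ?thesis using gZ[OF that(2)] that(1) by (simp add: Q_def)
  qed
  have radQ: "rad (Suc n) (Q (s, z)) = (1 - s) / \<gamma> z" if "s \<in> {0..1}" "z \<in> Z" for s z
    using gZ[OF that(2)] that unfolding Q_def rad_scale by (simp add: Z_def disc_boundary_iff)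
  have norm_Z: "(\<lambda>i. v i / rad (Suc n) v) \<in> Z" if "\<forall>i\<ge>Suc n. v i = 0" "rad (Suc n) v \<noteq> 0" for v
  proof -
    have "rad (Suc n) (\<lambda>i. (1 / rad (Suc n) v) * v i) = 1" unfolding rad_scale using that(2) rad_nonneg[of v "Suc n"] by simp
    then show ?thesis using that(1) by (simp add: Z_def disc_boundary_iff)
  qed
  have Q_norm: "Q (1 - \<gamma> v, \<lambda>i. v i / rad (Suc n) v) = v" if "\<forall>i\<ge>Suc n. v i = 0" "rad (Suc n) v \<noteq> 0" for v
  proof -
    have "\<gamma> (\<lambda>i. (1 / rad (Suc n) v) * v i) = \<bar>1 / rad (Suc n) v\<bar> * \<gamma> v" by (rule gauge(2))
    then have "\<gamma> (\<lambda>i. v i / rad (Suc n) v) = \<gamma> v / rad (Suc n) v" using rad_nonneg[of v "Suc n"] by simp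
    then show ?thesis using gauge(3)[OF that] that(2) by (auto simp: Q_def)
  qed
  obtain N where N: "continuous_map (prod_topology I01 (top_of_set Z)) X N"
    "\<And>z. z \<in> Z \<Longrightarrow> N (0, z) = b z" "\<And>z. z \<in> Z \<Longrightarrow> N (1, z) = x0"
    using nullhomotopic_of_collapse[OF n null] unfolding Z_def by blast
  have "compact ({0..1::real} \<times> Z)" unfolding Z_def by (intro compact_Times compact_sphere_pts) auto
  moreover have "continuous_on ({0..1::real} \<times> Z) Q" unfolding Q_def
  proof (rule continuous_on_coordinatewise_then_product)
    fix i
    have "continuous_on ({0..1::real} \<times> Z) (\<lambda>x. \<gamma> (snd x))"
      by (rule continuous_on_compose2[OF gauge(1) continuous_on_snd[OF continuous_on_id]]) auto
    then show "continuous_on ({0..1::real} \<times> Z) (\<lambda>x. ((1 - fst x) / \<gamma> (snd x)) * snd x i)"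
      using gZ by (intro continuous_intros continuous_on_coord[OF continuous_on_snd[OF continuous_on_id]]) fastforce+
  qed
  moreover have "Q ` ({0..1::real} \<times> Z) = W"
  proof (intro equalityI subsetI)
    fix v assume "v \<in> Q ` ({0..1::real} \<times> Z)"
    then obtain s z where sz: "s \<in> {0..1}" "z \<in> Z" "v = Q (s, z)" by auto
    then show "v \<in> W" using gQ[OF sz(1,2)] by (auto simp: W_def Q_def Z_def disc_boundary_iff)
  next
    fix v assume v: "v \<in> W"
    show "v \<in> Q ` ({0..1::real} \<times> Z)"
    proof (cases "rad (Suc n) v = 0")
      case True
      then have "v = (\<lambda>i. 0)" using v by (intro eq_0_if_rad_eq_0[of "Suc n"]) (auto simp: W_def)
      moreover obtain z where "z \<in> Z"
      proof -
        have "rad (Suc n) (pole n) = 1" unfolding rad_eq_1 rad_sq by (simp add: pole_def)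
        then have "pole n \<in> Z" by (auto simp: Z_def disc_boundary_iff pole_def)
        then show ?thesis using that by blast
      qed
      ultimately show ?thesis by (intro image_eqI[of _ _ "(1, z)"]) (auto simp: Q_def)
    next
      case False
      have "\<gamma> v > 0" using gauge(3) v False by (simp add: W_def)
      then show ?thesis using Q_norm[of v] norm_Z[of v] v False
        by (intro image_eqI[of _ _ "(1 - \<gamma> v, \<lambda>i. v i / rad (Suc n) v)"]) (auto simp: W_def)
    qed
  qed
  moreover have "continuous_map (top_of_set ({0..1::real} \<times> Z)) X N" using N(1) by simp
  moreover have "N x = N y" if x: "x \<in> {0..1::real} \<times> Z" and y: "y \<in> {0..1} \<times> Z" and eq: "Q x = Q y" for x y
  proof -
    obtain s z s' z' where sz: "x = (s, z)" "y = (s', z')" "s \<in> {0..1}" "s' \<in> {0..1}" "z \<in> Z" "z' \<in> Z" using x y by auto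
    have s: "s = s'" using gQ sz eq by (metis add_diff_cancel_left' diff_add_cancel diff_diff_eq2)
    show ?thesis
    proof (cases "s = 1")
      case True then show ?thesis using s sz N(3) by simp
    next
      case False
      have "(1 - s) / \<gamma> z = (1 - s) / \<gamma> z'" using radQ sz eq s by metis
      then have g: "\<gamma> z = \<gamma> z'" using False gZ sz by (simp add: frac_eq_eq)
      have "z i = z' i" for i
        using fun_cong[OF eq, of i] sz s g False gZ[OF sz(5)] by (simp add: Q_def)
      then have "z = z'" by blast
      then show ?thesis using s sz by simp
    qed
  qed
  ultimately have "\<exists>F. continuous_map (top_of_set W) X F \<and> (\<forall>x\<in>{0..1} \<times> Z. F (Q x) = N x)"
    by (rule compact_quotient_lift)
  then obtain F where F: "continuous_map (top_of_set W) X F" "\<And>x. x \<in> {0..1} \<times> Z \<Longrightarrow> F (Q x) = N x"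
    by blast
  show ?thesis
  proof (rule that)
    show "continuous_map (top_of_set {v. (\<forall>i\<ge>Suc n. v i = 0) \<and> \<gamma> v \<le> 1}) X F" using F(1) by (simp add: W_def)
    fix v assume v: "\<forall>i\<ge>Suc n. v i = 0" "\<gamma> v = 1"
    have "rad (Suc n) v \<noteq> 0"
    proof
      assume "rad (Suc n) v = 0"
      then have "v = (\<lambda>i. 0)" using v by (intro eq_0_if_rad_eq_0[of "Suc n"]) auto
      then show False using v g0 by simp
    qed
    then show "F v = b (\<lambda>i. v i / rad (Suc n) v)"
      using Q_norm[OF v(1)] norm_Z[OF v(1)] F(2)[of "(0, \<lambda>i. v i / rad (Suc n) v)"] N(2) v by simp
  qed
qed

lemma sphere_extends_over_disc:
  assumes n: "n > 0"
    and null: "homotopic_with (\<lambda>h. \<forall>d\<in>disc_boundary n. h d = x0) (disc n) X (b \<circ> collapse n) (\<lambda>_. x0)"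
  obtains F where "continuous_map (disc (Suc n)) X F" "\<And>z. z \<in> disc_boundary (Suc n) \<Longrightarrow> F z = b z"
proof -
  obtain F where F: "continuous_map (top_of_set {v. (\<forall>i\<ge>Suc n. v i = 0) \<and> rad (Suc n) v \<le> 1}) X F"
    "\<And>v. (\<forall>i\<ge>Suc n. v i = 0) \<Longrightarrow> rad (Suc n) v = 1 \<Longrightarrow> F v = b (\<lambda>i. v i / rad (Suc n) v)"
    by (rule fill_star_body[OF n null, of "rad (Suc n)"])
      (auto simp: rad_scale less_le simp del: L2_set_eq_0_iff intro!: continuous_on_rad continuous_on_id)
  moreover have "{v. (\<forall>i\<ge>Suc n. v i = 0) \<and> rad (Suc n) v \<le> 1} = ball_pts (Suc n)" by (auto simp: ball_pts_iff)
  ultimately have "continuous_map (disc (Suc n)) X F" by (subst disc_eq) (simp only:)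
  moreover have "F z = b z" if "z \<in> disc_boundary (Suc n)" for z using F(2)[of z] that by (simp add: disc_boundary_iff)
  ultimately show ?thesis using that by blast
qed

text \<open>Every sphere is null homotopic relative to its base point. The condition makes no reference to a
  choice of base points in \<open>X\<close> and is the form in which vanishing homotopy groups are used.\<close>

definition spheres_null :: "nat \<Rightarrow> 'x topology \<Rightarrow> bool" where
  "spheres_null n X \<longleftrightarrow> (\<forall>b. continuous_map (top_of_set (disc_boundary (Suc n))) X b \<longrightarrow>
     homotopic_with (\<lambda>h. \<forall>d\<in>disc_boundary n. h d = b (pole n)) (disc n) X (b \<circ> collapse n) (\<lambda>_. b (pole n)))"

lemma spheres_null_if_homotopy_group_vanishes:
  assumes "\<And>x. x \<in> topspace X \<Longrightarrow> homotopy_group_vanishes n X x"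
  shows "spheres_null n X"
  unfolding spheres_null_def
proof (intro allI impI)
  fix b assume b: "continuous_map (top_of_set (disc_boundary (Suc n))) X b"
  define x where "x = b (pole n)"
  have "rad (Suc n) (pole n) = 1" unfolding rad_eq_1 rad_sq by (simp add: pole_def)
  then have "pole n \<in> disc_boundary (Suc n)" by (auto simp: disc_boundary_iff pole_def)
  then have x: "x \<in> topspace X" using continuous_map_funspace[OF b] by (auto simp: x_def)
  have "continuous_map (disc n) (top_of_set (disc_boundary (Suc n))) (collapse n)"
    by (subst disc_eq) (use collapse_in_sphere continuous_on_collapse in
        \<open>auto simp: continuous_map_in_subtopology continuous_map_iff_continuous\<close>)
  then have c: "continuous_map (disc n) X (b \<circ> collapse n)" using b by (rule continuous_map_compose)
  then have m: "b \<circ> collapse n \<in> disc_maps n X x" by (auto simp: disc_maps_def collapse_boundary x_def)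
  have "disc_class n X x (b \<circ> collapse n) \<in> homotopy_group_set n X x" using m by (auto simp: homotopy_group_set_def)
  then have "disc_class n X x (b \<circ> collapse n) = disc_class n X x (\<lambda>d. x)"
    using assms[OF x] by (simp add: homotopy_group_vanishes_def)
  moreover have "b \<circ> collapse n \<in> disc_class n X x (b \<circ> collapse n)"
    using m c by (auto simp: disc_class_def disc_maps_def)
  ultimately have "homotopic_with (\<lambda>h. \<forall>d\<in>disc_boundary n. h d = x) (disc n) X (\<lambda>d. x) (b \<circ> collapse n)"
    by (simp add: disc_class_def)
  then show "homotopic_with (\<lambda>h. \<forall>d\<in>disc_boundary n. h d = b (pole n)) (disc n) X (b \<circ> collapse n) (\<lambda>_. b (pole n))"
    by (simp add: homotopic_with_sym x_def)
qed

text \<open>The cylinder over \<open>D\<^sup>n\<close> is the unit ball of the gauge that is the maximum of the radius in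
  \<open>D\<^sup>n\<close> and the absolute height.\<close>

lemma box_boundary_extends:
  assumes n: "n > 0" and null: "spheres_null n X"
    and k: "continuous_map (subtopology (prod_topology I01 (disc n)) {(t, x). t = 0 \<or> t = 1 \<or> x \<in> disc_boundary n}) X k"
  obtains F where "continuous_map (prod_topology I01 (disc n)) X F"
    "\<And>t x. t \<in> {0..1} \<Longrightarrow> x \<in> ball_pts n \<Longrightarrow> t = 0 \<or> t = 1 \<or> x \<in> disc_boundary n \<Longrightarrow> F (t, x) = k (t, x)"
proof -
  define \<gamma> where "\<gamma> v = max (rad n v) \<bar>v n\<bar>" for v
  \<comment> \<open>\<open>E\<close> and \<open>E'\<close> identify the unit ball of \<open>\<gamma>\<close> with the cylinder, turning the height in \<open>[-1,1]\<close> into the time in \<open>[0,1]\<close>\<close>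
  define E where "E v = ((1 + v n) / 2, (\<lambda>i. if i < n then v i else 0))" for v :: "nat \<Rightarrow> real"
  define E' where "E' p = (\<lambda>i. if i < n then snd p i else if i = n then 2 * fst p - 1 else 0)" for p :: "real \<times> (nat \<Rightarrow> real)"
  define Bd where "Bd = {(t::real, x). (t = 0 \<or> t = 1 \<or> x \<in> disc_boundary n)} \<inter> ({0..1} \<times> ball_pts n)"
  define Z where "Z = disc_boundary (Suc n)"
  have g_cont: "continuous_on UNIV \<gamma>" unfolding \<gamma>_def
    by (intro continuous_intros continuous_on_coord[OF continuous_on_id])
  have g_scale: "\<gamma> (\<lambda>i. c * v i) = \<bar>c\<bar> * \<gamma> v" for c v
    by (simp add: \<gamma>_def rad_scale abs_mult max_mult_distrib_left)
  have g_pos: "\<gamma> v > 0" if "\<forall>i\<ge>Suc n. v i = 0" "rad (Suc n) v \<noteq> 0" for v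
  proof (rule ccontr)
    assume "\<not> \<gamma> v > 0"
    then have "rad n v = 0" "v n = 0" unfolding \<gamma>_def using rad_nonneg[of v n] by linarith+
    then have "(rad (Suc n) v)\<^sup>2 = 0" unfolding rad_Suc_sq by simp
    then show False using that by simp
  qed
  have rE: "rad n (snd (E v)) = rad n v" for v by (rule L2_set_cong) (auto simp: E_def)
  have rE': "rad n (E' p) = rad n (snd p)" for p by (rule L2_set_cong) (auto simp: E'_def)
  have E_Bd: "E v \<in> Bd" if "\<gamma> v = 1" for v
  proof -
    have "rad n v \<le> 1" "\<bar>v n\<bar> \<le> 1" "rad n v = 1 \<or> v n = 1 \<or> v n = -1" using that unfolding \<gamma>_def by linarith+
    then show ?thesis using rE[of v] by (auto simp: Bd_def ball_pts_iff disc_boundary_iff E_def abs_le_iff field_simps)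
  qed
  define b where "b z = k (E (\<lambda>i. z i / \<gamma> z))" for z
  have gZ: "\<gamma> z > 0" if "z \<in> Z" for z using g_pos[of z] that by (simp add: Z_def disc_boundary_iff)
  have g1: "\<gamma> (\<lambda>i. z i / \<gamma> z) = 1" if "\<gamma> z > 0" for z
    using g_scale[of "1 / \<gamma> z" z] that by simp
  have cb: "continuous_map (top_of_set Z) X b"
  proof -
    have "continuous_on Z (\<lambda>z. E (\<lambda>i. z i / \<gamma> z))"
      unfolding E_def
    proof (rule continuous_on_Pair)
      have gc: "continuous_on Z \<gamma>" using g_cont continuous_on_subset by blast
      have c: "continuous_on Z (\<lambda>z. z i / \<gamma> z)" for i
        using gZ by (intro continuous_intros continuous_on_coord[OF continuous_on_id] gc) fastforce
      show "continuous_on Z (\<lambda>z. (1 + z n / \<gamma> z) / 2)" by (intro continuous_intros c) auto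
      show "continuous_on Z (\<lambda>z i. if i < n then z i / \<gamma> z else 0)"
      proof (rule continuous_on_coordinatewise_then_product)
        fix i show "continuous_on Z (\<lambda>z. if i < n then z i / \<gamma> z else 0)"
          by (cases "i < n") (use c in auto)
      qed
    qed
    moreover have "E (\<lambda>i. z i / \<gamma> z) \<in> Bd" if "z \<in> Z" for z using E_Bd g1 gZ[OF that] by blast
    moreover have "subtopology (prod_topology I01 (disc n)) {(t, x). t = 0 \<or> t = 1 \<or> x \<in> disc_boundary n} = top_of_set Bd"
      unfolding I01_disc_eq subtopology_subtopology by (simp add: Bd_def Int_commute)
    ultimately have "continuous_map (top_of_set Z) (subtopology (prod_topology I01 (disc n)) {(t, x). t = 0 \<or> t = 1 \<or> x \<in> disc_boundary n}) (\<lambda>z. E (\<lambda>i. z i / \<gamma> z))"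
      by (auto simp: continuous_map_in_subtopology continuous_map_iff_continuous)
    from continuous_map_compose[OF this k] show ?thesis by (simp add: o_def b_def[abs_def])
  qed
  then have nb: "homotopic_with (\<lambda>h. \<forall>d\<in>disc_boundary n. h d = b (pole n)) (disc n) X (b \<circ> collapse n) (\<lambda>_. b (pole n))"
    using null by (simp add: spheres_null_def Z_def)
  obtain F where F: "continuous_map (top_of_set {v. (\<forall>i\<ge>Suc n. v i = 0) \<and> \<gamma> v \<le> 1}) X F"
    "\<And>v. (\<forall>i\<ge>Suc n. v i = 0) \<Longrightarrow> \<gamma> v = 1 \<Longrightarrow> F v = b (\<lambda>i. v i / rad (Suc n) v)"
    using fill_star_body[OF n nb g_cont g_scale g_pos] by blast
  have E'c: "continuous_on ({0..1} \<times> ball_pts n) E'" unfolding E'_def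
  proof (rule continuous_on_coordinatewise_then_product)
    fix i
    have "continuous_on ({0..1::real} \<times> ball_pts n) (\<lambda>p. snd p i)" "continuous_on ({0..1::real} \<times> ball_pts n) (\<lambda>p. 2 * fst p - 1)"
      by (intro continuous_intros continuous_on_coord[OF continuous_on_snd[OF continuous_on_id]])+
    then show "continuous_on ({0..1} \<times> ball_pts n) (\<lambda>p. if i < n then snd p i else if i = n then 2 * fst p - 1 else 0)"
      by (cases "i < n"; cases "i = n") auto
  qed
  have E'W: "E' p \<in> {v. (\<forall>i\<ge>Suc n. v i = 0) \<and> \<gamma> v \<le> 1}" if "p \<in> {0..1} \<times> ball_pts n" for p
    using that rE'[of p] by (auto simp: \<gamma>_def E'_def ball_pts_iff abs_le_iff)
  have "continuous_map (prod_topology I01 (disc n)) (top_of_set {v. (\<forall>i\<ge>Suc n. v i = 0) \<and> \<gamma> v \<le> 1}) E'"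
    unfolding I01_disc_eq using E'c E'W by (auto simp: continuous_map_in_subtopology continuous_map_iff_continuous)
  from continuous_map_compose[OF this F(1)]
  have c: "continuous_map (prod_topology I01 (disc n)) X (F \<circ> E')" .
  have "(F \<circ> E') (t, x) = k (t, x)" if t: "t \<in> {0..1}" and x: "x \<in> ball_pts n" and bd: "t = 0 \<or> t = 1 \<or> x \<in> disc_boundary n" for t x
  proof -
    define v where "v = E' (t, x)"
    have vn: "v n = 2 * t - 1" and rv: "rad n v = rad n x" using rE'[of "(t, x)"] by (auto simp: v_def E'_def)
    have g: "\<gamma> v = 1" using bd t x vn rv by (auto simp: \<gamma>_def ball_pts_iff disc_boundary_iff abs_le_iff max_def)
    have v0: "\<forall>i\<ge>Suc n. v i = 0" by (auto simp: v_def E'_def)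
    define r where "r = rad (Suc n) v"
    have r: "r > 0"
    proof -
      have "r \<noteq> 0"
      proof
        assume "r = 0"
        then have "v = (\<lambda>i. 0 * v i)" using eq_0_if_rad_eq_0[OF v0] by (simp add: r_def)
        then have "\<gamma> v = 0" using g_scale[of 0 v] by simp
        then show False using g by simp
      qed
      then show ?thesis unfolding r_def using rad_nonneg less_eq_real_def by metis
    qed
    have gr: "\<gamma> (\<lambda>i. v i / r) = 1 / r" using g_scale[of "1/r" v] g r by simp
    have "F v = b (\<lambda>i. v i / r)" using F(2)[OF v0 g] by (simp add: r_def)
    also have "\<dots> = k (E v)" using r by (simp add: b_def gr)
    also have "E v = (t, x)" using x by (auto simp: E_def vn fun_eq_iff v_def E'_def ball_pts_iff)
    finally show ?thesis by (simp add: v_def)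
  qed
  then show ?thesis using that c by blast
qed

section \<open>Path classes\<close>

definition path_homotopic :: "'x topology \<Rightarrow> (real \<Rightarrow> 'x) \<Rightarrow> (real \<Rightarrow> 'x) \<Rightarrow> bool" where
  "path_homotopic X p q \<longleftrightarrow> homotopic_with (\<lambda>r. r 0 = p 0 \<and> r 1 = p 1) I01 X p q"

lemma path_homotopic_imp:
  assumes "path_homotopic X p q"
  shows "pathin X p" "pathin X q" "q 0 = p 0" "q 1 = p 1"
  using assms homotopic_with_imp_continuous_maps[OF assms[unfolded path_homotopic_def]]
    homotopic_with_imp_property[OF assms[unfolded path_homotopic_def]] by (auto simp: pathin_def)

lemma path_homotopic_refl: "pathin X p \<Longrightarrow> path_homotopic X p p"
  by (simp add: path_homotopic_def pathin_def)

lemma path_homotopic_sym: "path_homotopic X p q \<Longrightarrow> path_homotopic X q p"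
  using path_homotopic_imp[of X p q] unfolding path_homotopic_def by (simp add: homotopic_with_sym)

lemma path_homotopic_trans [trans]: "path_homotopic X p q \<Longrightarrow> path_homotopic X q r \<Longrightarrow> path_homotopic X p r"
  using path_homotopic_imp[of X p q] unfolding path_homotopic_def by (auto intro: homotopic_with_trans)

lemma path_homotopic_eq_on:
  assumes "pathin X p" "\<And>t. t \<in> {0..1} \<Longrightarrow> p t = q t"
  shows "path_homotopic X p q"
  unfolding path_homotopic_def
  by (rule homotopic_with_equal) (use assms in \<open>auto simp: pathin_def\<close>)

lemma path_class_eq_iff:
  assumes "pathin X p" "pathin X q"
  shows "path_class X p = path_class X q \<longleftrightarrow> path_homotopic X p q"
proof -
  have m: "r \<in> path_class X p \<longleftrightarrow> path_homotopic X p r" for p r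
    using path_homotopic_imp(2)[of X p r] by (auto simp: path_class_def path_homotopic_def)
  show ?thesis
    using m path_homotopic_refl path_homotopic_sym path_homotopic_trans assms by blast
qed

lemma path_class_eqI: "path_homotopic X p q \<Longrightarrow> path_class X p = path_class X q"
  using path_class_eq_iff path_homotopic_imp by blast

text \<open>The groupoid structure is defined through chosen representatives; this removes the choice.\<close>

lemma path_rep_homotopic:
  assumes "pathin X p" shows "path_homotopic X p (path_rep (path_class X p))"
proof -
  have "p \<in> path_class X p" using assms path_homotopic_refl[OF assms] by (simp add: path_class_def path_homotopic_def)
  then have "path_rep (path_class X p) \<in> path_class X p"
    using someI[of "\<lambda>r. r \<in> path_class X p" p] by (simp add: path_rep_def)
  then show ?thesis by (simp add: path_class_def path_homotopic_def)
qed

lemmas path_rep_path_class = path_homotopic_imp(2-4)[OF path_rep_homotopic]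

lemma path_homotopic_compose:
  assumes "path_homotopic X p q" "continuous_map X Y f"
  shows "path_homotopic Y (f \<circ> p) (f \<circ> q)"
  unfolding path_homotopic_def
  by (rule homotopic_with_compose_continuous_map_left[OF assms(1)[unfolded path_homotopic_def] assms(2)]) auto

lemma path_homotopic_subtopology:
  assumes "path_homotopic (subtopology X A) p q" "A \<subseteq> B"
  shows "path_homotopic (subtopology X B) p q"
proof -
  have "continuous_map (subtopology X A) (subtopology X B) id"
    using assms(2) by (auto simp: continuous_map_in_subtopology intro: continuous_map_from_subtopology[OF continuous_map_id])
  from path_homotopic_compose[OF assms(1) this] show ?thesis by simp
qed

lemma pathin_mono: "pathin (subtopology X A) p \<Longrightarrow> A \<subseteq> B \<Longrightarrow> pathin (subtopology X B) p"
  by (auto simp: pathin_subtopology)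

text \<open>The interval is convex, so reparametrisations are homotopic; inverses, units and associativity are
  instances.\<close>

lemma path_homotopic_reparam:
  assumes p: "pathin X p" and f: "continuous_on {0..1} f" "f \<in> {0..1} \<rightarrow> {0..1::real}"
    and g: "continuous_on {0..1} g" "g \<in> {0..1} \<rightarrow> {0..1}" and eq: "f 0 = g 0" "f 1 = g 1"
  shows "path_homotopic X (p \<circ> f) (p \<circ> g)"
proof -
  have "homotopic_with (\<lambda>r. r 0 = f 0 \<and> r 1 = f 1) I01 I01 f g"
  proof (rule homotopic_withI[where h = "\<lambda>(s, t). (1 - s) * f t + s * g t"])
    have "continuous_on ({0..1} \<times> {0..1}) (\<lambda>x. (1 - fst x) * f (snd x) + fst x * g (snd x))"
      by (intro continuous_intros continuous_on_compose2[OF f(1)] continuous_on_compose2[OF g(1)]) auto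
    moreover have "(1 - s) * f t + s * g t \<in> {0..1}" if "s \<in> {0..1}" "t \<in> {0..1}" for s t
    proof -
      have "f t \<in> {0..1}" "g t \<in> {0..1}" using f g that by auto
      then show ?thesis using that convex_bound_le[of "f t" 1 "g t" "1 - s" s] by auto
    qed
    ultimately show "continuous_map (prod_topology I01 I01) I01 (\<lambda>(s, t). (1 - s) * f t + s * g t)"
      by (auto simp: continuous_map_in_subtopology continuous_map_iff_continuous case_prod_unfold)
  qed (use eq in \<open>auto simp: algebra_simps\<close>)
  from homotopic_with_compose_continuous_map_left[OF this p[unfolded pathin_def], of "\<lambda>r. r 0 = (p \<circ> f) 0 \<and> r 1 = (p \<circ> f) 1"]
  show ?thesis by (auto simp: path_homotopic_def)
qed

definition path_rev :: "(real \<Rightarrow> 'x) \<Rightarrow> real \<Rightarrow> 'x" where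
  "path_rev p = (\<lambda>t. p (1 - t))"

lemma path_rev_ends [simp]: "path_rev p 0 = p 1" "path_rev p 1 = p 0"
  by (auto simp: path_rev_def)

lemma path_join_ends [simp]: "path_join p q 0 = p 0" "path_join p q 1 = q 1"
  by (auto simp: path_join_def)

lemma path_join_compose: "f \<circ> path_join p q = path_join (f \<circ> p) (f \<circ> q)"
  by (auto simp: path_join_def)

lemma path_rev_compose: "f \<circ> path_rev p = path_rev (f \<circ> p)"
  by (auto simp: path_rev_def)

lemma pathin_compose_interval:
  assumes "pathin X p" "continuous_on {0..1} f" "f \<in> {0..1} \<rightarrow> {0..1}" shows "pathin X (p \<circ> f)"
proof -
  have "continuous_map I01 I01 f" using assms by (auto simp: continuous_map_in_subtopology continuous_map_iff_continuous)
  then show ?thesis using assms(1) unfolding pathin_def by (rule continuous_map_compose)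
qed

lemma pathin_rev: assumes "pathin X p" shows "pathin X (path_rev p)"
proof -
  have "path_rev p = p \<circ> (\<lambda>t. 1 - t)" by (auto simp: path_rev_def)
  moreover have "continuous_on {0..1} (\<lambda>t. 1 - t :: real)" by (intro continuous_intros)
  ultimately show ?thesis using pathin_compose_interval[OF assms, of "\<lambda>t. 1 - t"] by auto
qed

lemma continuous_map_join:
  assumes h: "continuous_map (prod_topology I01 I01) X h" and k: "continuous_map (prod_topology I01 I01) X k"
    and eq: "\<And>s. s \<in> {0..1} \<Longrightarrow> h (s, 1) = k (s, 0)"
  shows "continuous_map (prod_topology I01 I01) X (\<lambda>(s, t). path_join (\<lambda>t. h (s, t)) (\<lambda>t. k (s, t)) t)"
proof -
  define S where "S = {0..1::real} \<times> {0..1::real}"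
  have S: "prod_topology I01 I01 = top_of_set S" by (simp add: S_def)
  have "continuous_map (top_of_set S) X (\<lambda>x. if snd x \<le> 1/2 then h (fst x, 2 * snd x) else k (fst x, 2 * snd x - 1))"
  proof (rule continuous_map_cases_le)
    show "continuous_map (top_of_set S) euclideanreal snd" "continuous_map (top_of_set S) euclideanreal (\<lambda>x. 1/2)"
      by (auto simp: continuous_map_iff_continuous intro!: continuous_intros)
    have "continuous_map (top_of_set {x \<in> S. snd x \<le> 1/2}) (top_of_set S) (\<lambda>x. (fst x, 2 * snd x))"
      by (auto simp: continuous_map_in_subtopology continuous_map_iff_continuous S_def intro!: continuous_intros)
    from continuous_map_compose[OF this h[unfolded S]]
    show "continuous_map (subtopology (top_of_set S) {x \<in> topspace (top_of_set S). snd x \<le> 1/2}) X (\<lambda>x. h (fst x, 2 * snd x))"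
      by (simp add: o_def subtopology_subtopology Int_absorb1 subset_iff Collect_conj_eq[symmetric] conj_commute)
    have "continuous_map (top_of_set {x \<in> S. 1/2 \<le> snd x}) (top_of_set S) (\<lambda>x. (fst x, 2 * snd x - 1))"
      by (auto simp: continuous_map_in_subtopology continuous_map_iff_continuous S_def intro!: continuous_intros)
    from continuous_map_compose[OF this k[unfolded S]]
    show "continuous_map (subtopology (top_of_set S) {x \<in> topspace (top_of_set S). 1/2 \<le> snd x}) X (\<lambda>x. k (fst x, 2 * snd x - 1))"
      by (simp add: o_def subtopology_subtopology Int_absorb1 subset_iff)
    show "h (fst x, 2 * snd x) = k (fst x, 2 * snd x - 1)" if "x \<in> topspace (top_of_set S)" "snd x = 1/2" for x
    proof -
      have e: "2 * snd x = 1" using that by simp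
      show ?thesis unfolding e using that eq[of "fst x"] by (simp add: S_def mem_Times_iff)
    qed
  qed
  then show ?thesis unfolding S by (simp add: path_join_def case_prod_unfold)
qed

lemma path_homotopic_join:
  assumes p: "path_homotopic X p p'" and q: "path_homotopic X q q'" and pq: "p 1 = q 0"
  shows "path_homotopic X (path_join p q) (path_join p' q')"
proof -
  obtain h where h: "continuous_map (prod_topology I01 I01) X h"
    "\<And>x. h (0, x) = p x" "\<And>x. h (1, x) = p' x" "\<And>t. t \<in> {0..1} \<Longrightarrow> h (t, 0) = p 0 \<and> h (t, 1) = p 1"
    using homotopic_withE[OF p[unfolded path_homotopic_def]] by blast
  obtain k where k: "continuous_map (prod_topology I01 I01) X k"
    "\<And>x. k (0, x) = q x" "\<And>x. k (1, x) = q' x" "\<And>t. t \<in> {0..1} \<Longrightarrow> k (t, 0) = q 0 \<and> k (t, 1) = q 1"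
    using homotopic_withE[OF q[unfolded path_homotopic_def]] by blast
  show ?thesis unfolding path_homotopic_def
  proof (rule homotopic_withI[OF continuous_map_join[OF h(1) k(1)]])
    show "h (s, 1) = k (s, 0)" if "s \<in> {0..1}" for s using h(4)[OF that] k(4)[OF that] pq by simp
  qed (use h k in \<open>auto simp: path_join_def\<close>)
qed

lemma pathin_join:
  assumes "pathin X p" "pathin X q" "p 1 = q 0" shows "pathin X (path_join p q)"
  using path_homotopic_imp(1)[OF path_homotopic_join[OF path_homotopic_refl path_homotopic_refl]] assms by blast

lemma path_homotopic_rev:
  assumes "path_homotopic X p q" shows "path_homotopic X (path_rev p) (path_rev q)"
proof -
  have c: "continuous_map I01 I01 (\<lambda>t. 1 - t)"
    by (auto simp: continuous_map_in_subtopology continuous_map_iff_continuous intro!: continuous_intros)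
  have "path_rev r = r \<circ> (\<lambda>t. 1 - t)" for r :: "real \<Rightarrow> 'a" by (auto simp: path_rev_def)
  then show ?thesis unfolding path_homotopic_def
    using homotopic_with_compose_continuous_map_right[OF assms[unfolded path_homotopic_def] c, of "\<lambda>r. r 0 = path_rev p 0 \<and> r 1 = path_rev p 1"]
    by simp
qed

lemma path_homotopic_rev_right:
  assumes p: "pathin X p" shows "path_homotopic X (path_join p (path_rev p)) (\<lambda>t. p 0)"
proof -
  have "path_join p (path_rev p) = p \<circ> (\<lambda>t. if t \<le> 1/2 then 2 * t else 2 - 2 * t)"
    by (auto simp: path_join_def path_rev_def fun_eq_iff algebra_simps)
  moreover have "continuous_on {0..1} (\<lambda>t::real. if t \<le> 1/2 then 2 * t else 2 - 2 * t)"
    by (intro continuous_on_cases_le continuous_intros) auto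
  ultimately have "path_homotopic X (path_join p (path_rev p)) (p \<circ> (\<lambda>t. 0))"
    using path_homotopic_reparam[OF p, of "\<lambda>t. if t \<le> 1/2 then 2 * t else 2 - 2 * t" "\<lambda>t. 0"] by auto
  then show ?thesis by (simp add: o_def)
qed

lemma path_homotopic_rev_left:
  assumes p: "pathin X p" shows "path_homotopic X (path_join (path_rev p) p) (\<lambda>t. p 1)"
proof -
  have "path_rev (path_rev p) = p" by (simp add: path_rev_def)
  then show ?thesis using path_homotopic_rev_right[OF pathin_rev[OF p]] by simp
qed

lemma path_homotopic_const_left:
  assumes p: "pathin X p" shows "path_homotopic X (path_join (\<lambda>t. p 0) p) p"
proof -
  have "path_join (\<lambda>t. p 0) p = p \<circ> (\<lambda>t. if t \<le> 1/2 then 0 else 2 * t - 1)"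
    by (auto simp: path_join_def fun_eq_iff)
  moreover have "continuous_on {0..1} (\<lambda>t::real. if t \<le> 1/2 then 0 else 2 * t - 1)"
    by (intro continuous_on_cases_le continuous_intros) auto
  ultimately have "path_homotopic X (path_join (\<lambda>t. p 0) p) (p \<circ> (\<lambda>t. t))"
    using path_homotopic_reparam[OF p, of "\<lambda>t. if t \<le> 1/2 then 0 else 2 * t - 1" "\<lambda>t. t"] by auto
  then show ?thesis by (simp add: o_def)
qed

lemma path_homotopic_const_right:
  assumes p: "pathin X p" shows "path_homotopic X (path_join p (\<lambda>t. p 1)) p"
proof -
  have "path_join p (\<lambda>t. p 1) = p \<circ> (\<lambda>t. if t \<le> 1/2 then 2 * t else 1)"
    by (auto simp: path_join_def fun_eq_iff)
  moreover have "continuous_on {0..1} (\<lambda>t::real. if t \<le> 1/2 then 2 * t else 1)"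
    by (intro continuous_on_cases_le continuous_intros) auto
  ultimately have "path_homotopic X (path_join p (\<lambda>t. p 1)) (p \<circ> (\<lambda>t. t))"
    using path_homotopic_reparam[OF p, of "\<lambda>t. if t \<le> 1/2 then 2 * t else 1" "\<lambda>t. t"] by auto
  then show ?thesis by (simp add: o_def)
qed

lemma path_homotopic_assoc:
  assumes p: "pathin X p" and q: "pathin X q" and r: "pathin X r" and pq: "p 1 = q 0" and qr: "q 1 = r 0"
  shows "path_homotopic X (path_join (path_join p q) r) (path_join p (path_join q r))"
proof -
  let ?w = "path_join (path_join p q) r"
  let ?f = "\<lambda>t::real. if t \<le> 1/2 then t / 2 else (if t \<le> 3/4 then t - 1/4 else 2 * t - 1)"
  have w: "pathin X ?w" using assms by (intro pathin_join) auto
  have f1: "path_join p (path_join q r) t = (?w \<circ> ?f) t" for t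
  proof -
    consider "t \<le> 1/2" | "1/2 < t" "t \<le> 3/4" | "t > 3/4" by linarith
    then show ?thesis by cases (auto simp: path_join_def algebra_simps)
  qed
  have f2: "continuous_on {0..1} ?f"
  proof (rule continuous_on_cases_le)
    show "continuous_on {t \<in> {0..1}. 1/2 \<le> t} (\<lambda>t::real. if t \<le> 3/4 then t - 1/4 else 2 * t - 1)"
      by (rule continuous_on_cases_le) (auto intro!: continuous_intros)
  qed (auto intro!: continuous_intros)
  have "path_homotopic X (?w \<circ> (\<lambda>t. t)) (?w \<circ> ?f)"
    by (rule path_homotopic_reparam[OF w _ _ f2]) auto
  moreover have "?w \<circ> ?f = path_join p (path_join q r)" using f1 by (intro ext) simp
  ultimately show ?thesis by (simp add: o_def)
qed

text \<open>Subdividing a path and inserting a detour at the point of subdivision does not change its class.\<close>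

lemma path_homotopic_cancel_middle:
  assumes p: "pathin X p" and q: "pathin X q" and g: "pathin X g" and "p 1 = g 0" "g 0 = q 0"
  shows "path_homotopic X (path_join (path_join p g) (path_join (path_rev g) q)) (path_join p q)"
proof -
  have r: "pathin X (path_rev g)" by (rule pathin_rev[OF g])
  have "pathin X (path_join (path_rev g) q)" "pathin X (path_join g (path_rev g))" "pathin X (path_join p g)"
    using r p q g assms by (auto intro!: pathin_join)
  then have "pathin X (path_join g (path_join (path_rev g) q))" "pathin X (path_join (path_join g (path_rev g)) q)"
    using p q g assms by (auto intro!: pathin_join)
  note ps = this r p q g assms(4,5) \<open>pathin X (path_join (path_rev g) q)\<close> \<open>pathin X (path_join g (path_rev g))\<close> \<open>pathin X (path_join p g)\<close>
  have "path_homotopic X (path_join (path_join p g) (path_join (path_rev g) q)) (path_join p (path_join g (path_join (path_rev g) q)))"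
    by (rule path_homotopic_assoc) (use ps in auto)
  also have "path_homotopic X (path_join g (path_join (path_rev g) q)) (path_join (path_join g (path_rev g)) q)"
    by (rule path_homotopic_sym[OF path_homotopic_assoc]) (use ps in auto)
  then have "path_homotopic X (path_join p (path_join g (path_join (path_rev g) q))) (path_join p (path_join (path_join g (path_rev g)) q))"
    by (rule path_homotopic_join[OF path_homotopic_refl[OF p]]) (use ps in auto)
  also have "path_homotopic X (path_join (path_join g (path_rev g)) q) (path_join (\<lambda>t. q 0) q)"
    using path_homotopic_join[OF path_homotopic_rev_right[OF g] path_homotopic_refl[OF q]] assms(5) by simp
  then have "path_homotopic X (path_join p (path_join (path_join g (path_rev g)) q)) (path_join p (path_join (\<lambda>t. q 0) q))"
    by (rule path_homotopic_join[OF path_homotopic_refl[OF p]]) (use ps in auto)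
  also have "path_homotopic X (path_join p (path_join (\<lambda>t. q 0) q)) (path_join p q)"
    by (rule path_homotopic_join[OF path_homotopic_refl[OF p] path_homotopic_const_left[OF q]]) (use ps in auto)
  finally show ?thesis .
qed

text \<open>The two ways around the boundary of a square are homotopic by convexity of the square.\<close>

lemma path_homotopic_square:
  assumes h: "continuous_map (prod_topology I01 I01) X h"
  shows "path_homotopic X (path_join (\<lambda>t. h (t, 0)) (\<lambda>t. h (1, t))) (path_join (\<lambda>t. h (0, t)) (\<lambda>t. h (t, 1)))"
proof -
  let ?f = "\<lambda>t::real. if t \<le> 1/2 then (2 * t, 0) else (1, 2 * t - 1)"
  let ?g = "\<lambda>t::real. if t \<le> 1/2 then (0, 2 * t) else (2 * t - 1, 1)"
  have f: "continuous_on {0..1} ?f" "continuous_on {0..1} ?g"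
    by (intro continuous_on_cases_le continuous_intros; force)+
  have hom: "homotopic_with (\<lambda>r. r 0 = ?f 0 \<and> r 1 = ?f 1) I01 (prod_topology I01 I01) ?f ?g"
  proof (rule homotopic_withI[where h = "\<lambda>(s, t). ((1 - s) * fst (?f t) + s * fst (?g t), (1 - s) * snd (?f t) + s * snd (?g t))"])
    have cs: "continuous_on ({0..1::real} \<times> {0..1::real}) snd" by (intro continuous_intros)
    have "continuous_on ({0..1::real} \<times> {0..1}) (\<lambda>x. ?f (snd x))" "continuous_on ({0..1::real} \<times> {0..1}) (\<lambda>x. ?g (snd x))"
      by (rule continuous_on_compose2[OF f(1) cs], force, rule continuous_on_compose2[OF f(2) cs], force)
    then have "continuous_on ({0..1} \<times> {0..1}) (\<lambda>x. ((1 - fst x) * fst (?f (snd x)) + fst x * fst (?g (snd x)),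
        (1 - fst x) * snd (?f (snd x)) + fst x * snd (?g (snd x))))"
      by (intro continuous_intros)
    then have c: "continuous_on ({0..1} \<times> {0..1}) (\<lambda>(s, t). ((1 - s) * fst (?f t) + s * fst (?g t), (1 - s) * snd (?f t) + s * snd (?g t)))"
      by (simp only: case_prod_unfold)
    have conv: "(1 - s) * a + s * b \<in> {0..1}" if "s \<in> {0..1}" "a \<in> {0..1}" "b \<in> {0..1}" for s a b :: real
      using that convex_bound_le[of a 1 b "1 - s" s] by auto
    have coords: "fst (?f t) \<in> {0..1}" "snd (?f t) \<in> {0..1}" "fst (?g t) \<in> {0..1}" "snd (?g t) \<in> {0..1}" if "t \<in> {0..1}" for t
      using that by auto
    have "(\<lambda>(s, t). ((1 - s) * fst (?f t) + s * fst (?g t), (1 - s) * snd (?f t) + s * snd (?g t)))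
        \<in> {0..1} \<times> {0..1} \<rightarrow> {0..1} \<times> {0..1}"
    proof (intro Pi_I, elim SigmaE, hypsubst, unfold case_prod_conv, intro SigmaI)
      fix s t :: real assume st: "s \<in> {0..1}" "t \<in> {0..1}"
      show "(1 - s) * fst (?f t) + s * fst (?g t) \<in> {0..1}" by (rule conv[OF st(1) coords(1)[OF st(2)] coords(3)[OF st(2)]])
      show "(1 - s) * snd (?f t) + s * snd (?g t) \<in> {0..1}" by (rule conv[OF st(1) coords(2)[OF st(2)] coords(4)[OF st(2)]])
    qed
    with c show "continuous_map (prod_topology I01 I01) (prod_topology I01 I01)
       (\<lambda>(s, t). ((1 - s) * fst (?f t) + s * fst (?g t), (1 - s) * snd (?f t) + s * snd (?g t)))"
      unfolding prod_top_of_set continuous_map_subtopology_eu by (rule conjI)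
  qed auto
  have "homotopic_with (\<lambda>r. r 0 = (h \<circ> ?f) 0 \<and> r 1 = (h \<circ> ?f) 1) I01 X (h \<circ> ?f) (h \<circ> ?g)"
    by (rule homotopic_with_compose_continuous_map_left[OF hom h]) auto
  moreover have "h \<circ> ?f = path_join (\<lambda>t. h (t, 0)) (\<lambda>t. h (1, t))" "h \<circ> ?g = path_join (\<lambda>t. h (0, t)) (\<lambda>t. h (t, 1))"
    by (auto simp: path_join_def fun_eq_iff)
  ultimately show ?thesis by (simp add: path_homotopic_def)
qed

section \<open>The fundamental groupoid\<close>

lemma Ob_fund [simp]: "Ob (fund_groupoid X A) = topspace X \<inter> A"
  by (simp add: fund_groupoid_def)

lemma Mor_fund: "c \<in> Mor (fund_groupoid X A) \<longleftrightarrow> (\<exists>p. c = path_class X p \<and> pathin X p \<and> p 0 \<in> A \<and> p 1 \<in> A)"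
  by (auto simp: fund_groupoid_def)

lemma Mor_fundI: "pathin X p \<Longrightarrow> p 0 \<in> A \<Longrightarrow> p 1 \<in> A \<Longrightarrow> path_class X p \<in> Mor (fund_groupoid X A)"
  by (auto simp: Mor_fund)

lemma src_fund: "pathin X p \<Longrightarrow> src (fund_groupoid X A) (path_class X p) = p 0"
  using path_rep_path_class by (simp add: fund_groupoid_def)

lemma tgt_fund: "pathin X p \<Longrightarrow> tgt (fund_groupoid X A) (path_class X p) = p 1"
  using path_rep_path_class by (simp add: fund_groupoid_def)

lemma idm_fund: "idm (fund_groupoid X A) x = path_class X (\<lambda>t. x)"
  by (simp add: fund_groupoid_def)

lemma cmp_fund:
  assumes "pathin X p" "pathin X q" "p 1 = q 0"
  shows "cmp (fund_groupoid X A) (path_class X p) (path_class X q) = path_class X (path_join p q)"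
  unfolding fund_groupoid_def using assms
  by (auto intro!: path_class_eqI path_homotopic_join path_homotopic_sym[OF path_rep_homotopic] simp: path_rep_path_class)

lemma on_ob_fund_map [simp]: "on_ob (fund_groupoid_map Y f) = f"
  by (simp add: fund_groupoid_map_def)

lemma on_mor_fund_map:
  assumes "continuous_map X Y f" "pathin X p"
  shows "on_mor (fund_groupoid_map Y f) (path_class X p) = path_class Y (f \<circ> p)"
  unfolding fund_groupoid_map_def
  using path_class_eqI[OF path_homotopic_sym[OF path_homotopic_compose[OF path_rep_homotopic[OF assms(2)] assms(1)]]] by simp

section \<open>Cells of fixed point sets\<close>

context cell_attachment
begin

lemma topspace_sub_A: "topspace (subtopology X A) = A" using AX by auto
lemma topspace_sub_B: "topspace (subtopology X B) = B" using BX by auto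

lemma boundary_preimage_closed:
  assumes j: "j \<in> J" and M: "closedin (subtopology X A) M"
  shows "closedin (disc n) {d \<in> disc_boundary n. q j d \<in> M}"
proof -
  have bd: "closedin (disc n) (disc_boundary n)"
  proof -
    have "disc_boundary n = ball_pts n - int_pts" using disc_boundary_subset by auto
    then show ?thesis using closedin_diff[OF closedin_topspace openin_int_pts] by simp
  qed
  have "continuous_map (subtopology (disc n) (disc_boundary n)) (subtopology X A) (q j)"
    using continuous_map_from_subtopology[OF q_cont[OF j], of "disc_boundary n"] q_boundary[OF j]
    by (auto simp: continuous_map_in_subtopology)
  from closedin_continuous_map_preimage[OF this M]
  have "closedin (subtopology (disc n) (disc_boundary n)) {d \<in> disc_boundary n. q j d \<in> M}"
    using disc_boundary_subset by (simp add: Int_absorb1)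
  then show ?thesis using bd closedin_trans_full by blast
qed

text \<open>Part of the preimage of \<open>N\<close> in a disc comes from the boundary and is closed because
  \<open>N \<inter> A\<close> is; only the rest has to be considered in applications.\<close>

lemma closedin_if_cellwise:
  assumes N: "N \<subseteq> B" and NA: "closedin (subtopology X A) (N \<inter> A)"
    and cells: "\<And>j. j \<in> J \<Longrightarrow> \<exists>E. closedin (disc n) E \<and> {d \<in> ball_pts n. q j d \<in> N} = E \<union> {d \<in> disc_boundary n. q j d \<in> N \<inter> A}"
  shows "closedin (subtopology X B) N"
proof -
  have "openin (subtopology X B) (B - N)"
  proof (subst openin_iff)
    have "(B - N) \<inter> A = A - N \<inter> A" using AB by auto
    then have "openin (subtopology X A) ((B - N) \<inter> A)"
      using openin_diff[OF openin_topspace NA] unfolding topspace_sub_A by simp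
    moreover have "openin (disc n) {d \<in> ball_pts n. q j d \<in> B - N}" if j: "j \<in> J" for j
    proof -
      obtain E where E: "closedin (disc n) E" "{d \<in> ball_pts n. q j d \<in> N} = E \<union> {d \<in> disc_boundary n. q j d \<in> N \<inter> A}"
        using cells[OF j] by blast
      then have "closedin (disc n) {d \<in> ball_pts n. q j d \<in> N}"
        using boundary_preimage_closed[OF j NA] by auto
      moreover have "{d \<in> ball_pts n. q j d \<in> B - N} = ball_pts n - {d \<in> ball_pts n. q j d \<in> N}"
        using q_in_B[OF j] by auto
      ultimately show ?thesis by (simp only: openin_diff openin_topspace)
    qed
    ultimately show "openin (subtopology X A) ((B - N) \<inter> A) \<and> (\<forall>j\<in>J. openin (disc n) {d \<in> ball_pts n. q j d \<in> B - N})"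
      by blast
  qed auto
  then show ?thesis using N unfolding closedin_def topspace_sub_B by blast
qed

lemma closedin_point:
  assumes T1: "\<And>a. a \<in> A \<Longrightarrow> closedin (subtopology X A) {a}" and x: "x \<in> B"
  shows "closedin (subtopology X B) {x}"
proof (rule closedin_if_cellwise)
  show "closedin (subtopology X A) ({x} \<inter> A)" using T1 by (cases "x \<in> A") auto
  fix j assume j: "j \<in> J"
  have int: "{d \<in> ball_pts n. q j d \<in> {x}} = {d \<in> int_pts. q j d = x} \<union> {d \<in> disc_boundary n. q j d \<in> {x} \<inter> A}"
    using q_boundary[OF j] disc_boundary_subset by auto
  have "closedin (disc n) {d \<in> int_pts. q j d = x}"
  proof (cases "\<exists>d0\<in>int_pts. q j d0 = x")
    case True
    then obtain d0 where d0: "d0 \<in> int_pts" "q j d0 = x" by blast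
    then have "{d \<in> int_pts. q j d = x} = {d0}" using q_inj[OF j j] by auto
    moreover have "closedin (disc n) {d0}" using d0 by (subst disc_eq) auto
    ultimately show ?thesis by simp
  next
    case False
    then have "{d \<in> int_pts. q j d = x} = {}" by blast
    then show ?thesis by (metis closedin_empty)
  qed
  then show "\<exists>E. closedin (disc n) E \<and> {d \<in> ball_pts n. q j d \<in> {x}} = E \<union> {d \<in> disc_boundary n. q j d \<in> {x} \<inter> A}"
    using int by blast
qed (use x in auto)

text \<open>The cells contained in a set \<open>F\<close> that contains every cell it meets in the interior build
  \<open>B \<inter> F\<close> from \<open>A \<inter> F\<close>. That \<open>F\<close> is closed in \<open>A\<close> ensures that the subspace topology is the
  one determined by these cells.\<close>

lemma subattachment:
  assumes J': "J' \<subseteq> J" and FA: "closedin (subtopology X A) (A \<inter> F)"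
    and inF: "\<And>j d. j \<in> J' \<Longrightarrow> d \<in> ball_pts n \<Longrightarrow> q j d \<in> F"
    and outF: "\<And>j d. j \<in> J \<Longrightarrow> j \<notin> J' \<Longrightarrow> d \<in> int_pts \<Longrightarrow> q j d \<notin> F"
  shows "cell_attachment X n (A \<inter> F) (B \<inter> F) J' q" and "closedin (subtopology X B) (B \<inter> F)"
proof -
  \<comment> \<open>a set in \<open>B \<inter> F\<close> is closed if its parts in \<open>A \<inter> F\<close> and in the cells of \<open>J'\<close> are; the other cells meet it only in their boundary\<close>
  have crit: "closedin (subtopology X B) N" if N: "N \<subseteq> B \<inter> F" "closedin (subtopology X (A \<inter> F)) (N \<inter> (A \<inter> F))"
    and cl: "\<And>j. j \<in> J' \<Longrightarrow> closedin (disc n) {d \<in> ball_pts n. q j d \<in> N}" for N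
  proof (rule closedin_if_cellwise)
    have "N \<inter> (A \<inter> F) = N \<inter> A" using N by auto
    moreover have "closedin (subtopology (subtopology X A) (A \<inter> F)) (N \<inter> (A \<inter> F))"
      using N(2) by (simp add: subtopology_subtopology)
    ultimately show "closedin (subtopology X A) (N \<inter> A)" using FA by (metis closedin_trans_full)
    fix j assume j: "j \<in> J"
    show "\<exists>E. closedin (disc n) E \<and> {d \<in> ball_pts n. q j d \<in> N} = E \<union> {d \<in> disc_boundary n. q j d \<in> N \<inter> A}"
    proof (cases "j \<in> J'")
      case True
      show ?thesis using cl[OF True] disc_boundary_subset
        by (intro exI[of _ "{d \<in> ball_pts n. q j d \<in> N}"]) auto
    next
      case False
      have "{d \<in> ball_pts n. q j d \<in> N} = {} \<union> {d \<in> disc_boundary n. q j d \<in> N \<inter> A}"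
      proof -
        have "d \<in> disc_boundary n" if "d \<in> ball_pts n" "q j d \<in> N" for d
          using outF[OF j False, of d] that N(1) by blast
        then show ?thesis using q_boundary[OF j] disc_boundary_subset by blast
      qed
      then show ?thesis using closedin_empty by blast
    qed
  qed (use N in auto)
  have tAF: "topspace (subtopology X (A \<inter> F)) = A \<inter> F" and tBF: "topspace (subtopology X (B \<inter> F)) = B \<inter> F"
    using AX BX by auto
  show "closedin (subtopology X B) (B \<inter> F)"
  proof (rule crit)
    show "closedin (subtopology X (A \<inter> F)) (B \<inter> F \<inter> (A \<inter> F))"
      using AB tAF by (metis (no_types, lifting) closedin_topspace inf.absorb2 inf_mono order_refl)
    fix j assume j: "j \<in> J'"
    then have "{d \<in> ball_pts n. q j d \<in> B \<inter> F} = ball_pts n" using inF[OF j] q_in_B J' by blast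
    then show "closedin (disc n) {d \<in> ball_pts n. q j d \<in> B \<inter> F}" by (metis closedin_topspace)
  qed auto
  have qF: "continuous_map (disc n) (subtopology X (B \<inter> F)) (q j)" if j: "j \<in> J'" for j
    using q_cont[of j] inF[OF j] J' j by (auto simp: continuous_map_in_subtopology)
  have bd: "q j d \<in> A \<inter> F" if "j \<in> J'" "d \<in> disc_boundary n" for j d
    using inF[of j d] q_boundary[of j d] that J' disc_boundary_subset by blast
  show "cell_attachment X n (A \<inter> F) (B \<inter> F) J' q"
  proof
    show "bij_betw (\<lambda>(j, d). q j d) (J' \<times> int_pts) (B \<inter> F - A \<inter> F)"
    proof (rule bij_betw_imageI)
      show "inj_on (\<lambda>(j, d). q j d) (J' \<times> int_pts)"
        using bij_betw_imp_inj_on[OF q_bij] J' by (auto intro: inj_on_subset)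
      show "(\<lambda>(j, d). q j d) ` (J' \<times> int_pts) = B \<inter> F - A \<inter> F"
      proof (intro equalityI subsetI)
        fix x assume "x \<in> (\<lambda>(j, d). q j d) ` (J' \<times> int_pts)"
        then obtain j d where jd: "j \<in> J'" "d \<in> int_pts" "x = q j d" by auto
        then show "x \<in> B \<inter> F - A \<inter> F" using q_interior[of j d] inF[of j d] J' by auto
      next
        fix x assume x: "x \<in> B \<inter> F - A \<inter> F"
        then obtain j d where jd: "j \<in> J" "d \<in> int_pts" "x = q j d" using q_surj[of x] by auto
        then have "j \<in> J'" using outF x by auto
        then show "x \<in> (\<lambda>(j, d). q j d) ` (J' \<times> int_pts)" using jd by (auto simp: image_iff)
      qed
    qed
    fix U assume U: "U \<subseteq> B \<inter> F"
    show "openin (subtopology X (B \<inter> F)) U =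
         (openin (subtopology X (A \<inter> F)) (U \<inter> (A \<inter> F)) \<and> (\<forall>j\<in>J'. openin (disc n) {d \<in> ball_pts n. q j d \<in> U}))"
    proof (intro iffI conjI ballI)
      assume o: "openin (subtopology X (B \<inter> F)) U"
      then obtain V where V: "openin X V" "U = V \<inter> (B \<inter> F)" by (auto simp: openin_subtopology)
      have "U \<inter> (A \<inter> F) = V \<inter> (A \<inter> F)" using V AB by auto
      then show "openin (subtopology X (A \<inter> F)) (U \<inter> (A \<inter> F))" using V by (auto simp: openin_subtopology)
      show "openin (disc n) {d \<in> ball_pts n. q j d \<in> U}" if "j \<in> J'" for j
        by (rule openin_continuous_map_preimage[OF qF[OF that] o])
    next
      assume o: "openin (subtopology X (A \<inter> F)) (U \<inter> (A \<inter> F)) \<and> (\<forall>j\<in>J'. openin (disc n) {d \<in> ball_pts n. q j d \<in> U})"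
      have "closedin (subtopology X B) (B \<inter> F - U)"
      proof (rule crit)
        have "(B \<inter> F - U) \<inter> (A \<inter> F) = A \<inter> F - U \<inter> (A \<inter> F)" using AB by auto
        then show "closedin (subtopology X (A \<inter> F)) ((B \<inter> F - U) \<inter> (A \<inter> F))"
          using closedin_diff[OF closedin_topspace conjunct1[OF o]] unfolding tAF by simp
        fix j assume j: "j \<in> J'"
        have "closedin (disc n) (ball_pts n - {d \<in> ball_pts n. q j d \<in> U})"
          by (rule closedin_diff[OF closedin_topspace]) (use o j in blast)
        moreover have "{d \<in> ball_pts n. q j d \<in> B \<inter> F - U} = ball_pts n - {d \<in> ball_pts n. q j d \<in> U}"
          using inF[OF j] q_in_B J' j by auto
        ultimately show "closedin (disc n) {d \<in> ball_pts n. q j d \<in> B \<inter> F - U}" by (simp only:)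
      qed auto
      then obtain D where D: "closedin X D" "B \<inter> F - U = D \<inter> B" by (auto simp: closedin_subtopology)
      then have "U = (topspace X - D) \<inter> (B \<inter> F)" using U BX by auto
      then show "openin (subtopology X (B \<inter> F)) U" using D by (auto simp: openin_subtopology)
    qed
  qed (use AB BX bd qF in auto)
qed

end

section \<open>Groups, cosets and actions\<close>

lemma (in group) self_lcoset: "subgroup S G \<Longrightarrow> S \<in> lcosets S"
  using lcos_mult_one[OF subgroup.subset] one_closed by (force simp: LCOSETS_def)

lemma (in group) lcosetE: assumes "C \<in> lcosets S" obtains g where "g \<in> carrier G" "C = g <# S"
  using assms by (auto simp: LCOSETS_def)

lemma (in group) lcosetI: "g \<in> carrier G \<Longrightarrow> g <# S \<in> lcosets S"
  by (auto simp: LCOSETS_def)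

lemma (in group) translate_lcoset:
  assumes S: "subgroup S G" and C: "C \<in> lcosets S" and g: "g \<in> carrier G" shows "g <# C \<in> lcosets S"
proof -
  obtain a where a: "a \<in> carrier G" "C = a <# S" using C by (rule lcosetE)
  then have "g <# C = (g \<otimes> a) <# S" using g subgroup.subset[OF S] by (simp add: lcos_m_assoc)
  then show ?thesis using a g by (simp add: lcosetI)
qed

lemma (in group) lcoset_eqD:
  assumes S: "subgroup S G" and g: "g \<in> carrier G" "g' \<in> carrier G" and eq: "g <# S = g' <# S"
  obtains s where "s \<in> S" "g' = g \<otimes> s"
proof -
  have "g' \<in> g <# S" unfolding eq by (rule lcos_self[OF g(2) S])
  then show ?thesis using that by (auto simp: l_coset_def)
qed

locale G_space_loc = group G for G :: "('g, 'z) monoid_scheme" (structure) +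
  fixes X :: "('g, 'x) gcw_data"
  assumes G_space: "G_space G X"
begin

lemma action: "group_action G (topspace (spc X)) (act X)"
  using G_space by (simp add: G_space_def)

lemma act_closed: "g \<in> carrier G \<Longrightarrow> x \<in> topspace (spc X) \<Longrightarrow> act X g x \<in> topspace (spc X)"
  using group_action.element_image[OF action] by blast

lemma act_mult: "g \<in> carrier G \<Longrightarrow> h \<in> carrier G \<Longrightarrow> x \<in> topspace (spc X) \<Longrightarrow> act X (g \<otimes> h) x = act X g (act X h x)"
  using group_action.composition_rule[OF action] by blast

lemma act_one: "x \<in> topspace (spc X) \<Longrightarrow> act X \<one> x = x"
  using group_action.id_eq_one[OF action] by (metis restrict_apply')

lemma act_cont: "g \<in> carrier G \<Longrightarrow> continuous_map (spc X) (spc X) (act X g)"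
  using G_space by (simp add: G_space_def)

lemma fixed_subset: "fixed_set X H \<subseteq> topspace (spc X)"
  by (auto simp: fixed_set_def)

lemma topspace_fixed [simp]: "topspace (fixed_space X H) = fixed_set X H"
  using fixed_subset by (auto simp: fixed_space_def)

lemma fixed_one: "fixed_set X {\<one>} = topspace (spc X)"
  using act_one by (auto simp: fixed_set_def)

text \<open>The condition on \<open>g\<close> says \<open>g\<^sup>-\<^sup>1 H g \<subseteq> K\<close>, expressed through the coset that a map of orbits
  provides.\<close>

lemma act_fixed:
  assumes K: "subgroup K G" and H: "subgroup H G" and g: "g \<in> carrier G"
    and sub: "\<forall>h\<in>H. h <# (g <# K) = g <# K" and x: "x \<in> fixed_set X K"
  shows "act X g x \<in> fixed_set X H"
proof -
  have xX: "x \<in> topspace (spc X)" using x by (simp add: fixed_set_def)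
  have "act X h (act X g x) = act X g x" if h: "h \<in> H" for h
  proof -
    have hG: "h \<in> carrier G" using H h by (rule subgroup.mem_carrier)
    have "(h \<otimes> g) <# K = g <# K" using bspec[OF sub h] lcos_m_assoc[OF subgroup.subset[OF K] hG g] by simp
    then obtain k where k: "k \<in> K" "h \<otimes> g = g \<otimes> k"
      using lcoset_eqD[OF K g, of "h \<otimes> g"] g hG by (metis m_closed)
    have kG: "k \<in> carrier G" using K k by (simp add: subgroup.mem_carrier)
    have "act X h (act X g x) = act X (h \<otimes> g) x" using act_mult[OF hG g xX] by simp
    also have "\<dots> = act X g (act X k x)" unfolding k(2) using act_mult[OF g kG xX] by simp
    finally show ?thesis using x k by (simp add: fixed_set_def)
  qed
  then show ?thesis using act_closed[OF g xX] by (simp add: fixed_set_def)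
qed

lemma act_fixed_cont:
  assumes "subgroup K G" "subgroup H G" "g \<in> carrier G" "\<forall>h\<in>H. h <# (g <# K) = g <# K"
  shows "continuous_map (fixed_space X K) (fixed_space X H) (act X g)"
  unfolding fixed_space_def
  using continuous_map_from_subtopology[OF act_cont[OF assms(3)], of "fixed_set X K"] act_fixed[OF assms]
  by (auto simp: continuous_map_in_subtopology)

end

section \<open>Equivariant cells\<close>

text \<open>The data of \<open>attach_G_cells\<close> with chosen characteristic maps.\<close>

locale G_attachment = G_space_loc G X for G :: "('g, 'z) monoid_scheme" (structure) and X :: "('g, 'x) gcw_data" +
  fixes n :: nat and A B :: "'x set" and I :: "'x set" and S :: "'x \<Rightarrow> 'g set"
    and q :: "'x \<Rightarrow> 'g set \<times> (nat \<Rightarrow> real) \<Rightarrow> 'x"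
  assumes AB: "A \<subseteq> B" and BX: "B \<subseteq> topspace (spc X)"
    and S: "\<And>i. i \<in> I \<Longrightarrow> subgroup (S i) G"
    and q_cont: "\<And>i. i \<in> I \<Longrightarrow> continuous_map (G_cell G (S i) n) (subtopology (spc X) B) (q i)"
    and q_act: "\<And>i g C d. i \<in> I \<Longrightarrow> g \<in> carrier G \<Longrightarrow> C \<in> lcosets (S i) \<Longrightarrow> d \<in> ball_pts n \<Longrightarrow>
           q i (g <# C, d) = act X g (q i (C, d))"
    and q_boundary: "\<And>i C d. i \<in> I \<Longrightarrow> C \<in> lcosets (S i) \<Longrightarrow> d \<in> disc_boundary n \<Longrightarrow> q i (C, d) \<in> A"
    and q_bij: "bij_betw (\<lambda>(i, z). q i z) (SIGMA i:I. (lcosets (S i)) \<times> (ball_pts n - disc_boundary n)) (B - A)"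
    and openin_iff: "\<And>U. U \<subseteq> B \<Longrightarrow> openin (subtopology (spc X) B) U \<longleftrightarrow> openin (subtopology (spc X) A) (U \<inter> A) \<and>
          (\<forall>i\<in>I. openin (G_cell G (S i) n) {z \<in> topspace (G_cell G (S i) n). q i z \<in> U})"
begin

abbreviation cells :: "('x \<times> 'g set) set" where "cells \<equiv> SIGMA i:I. lcosets (S i)"

text \<open>The stabilizer of the coset \<open>C = gS\<close> is \<open>g S g\<^sup>-\<^sup>1\<close>, so these are the cells on which
  \<open>H\<close> acts trivially.\<close>

definition fixed_cells :: "'g set \<Rightarrow> ('x \<times> 'g set) set" where
  "fixed_cells H = {(i, C). i \<in> I \<and> C \<in> lcosets (S i) \<and> (\<forall>h\<in>H. h <# C = C)}"

definition char_map :: "('x \<times> 'g set) \<Rightarrow> (nat \<Rightarrow> real) \<Rightarrow> 'x" where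
  "char_map = (\<lambda>(i, C) d. q i (C, d))"

lemma char_map [simp]: "char_map (i, C) d = q i (C, d)"
  by (simp add: char_map_def)

sublocale all: cell_attachment "spc X" n A B cells char_map
proof
  show "continuous_map (disc n) (subtopology (spc X) B) (char_map j)" if j: "j \<in> cells" for j
  proof -
    obtain i C where iC: "j = (i, C)" "i \<in> I" "C \<in> lcosets (S i)" using j by auto
    have "continuous_map (disc n) (G_cell G (S i) n) (\<lambda>d. (C, d))"
      unfolding G_cell_def using iC by (intro continuous_map_pairedI) auto
    from continuous_map_compose[OF this q_cont[OF iC(2)]] show ?thesis by (simp add: iC o_def char_map_def)
  qed
  show "char_map j d \<in> A" if "j \<in> cells" "d \<in> disc_boundary n" for j d using that q_boundary by auto
  show "bij_betw (\<lambda>(j, d). char_map j d) (cells \<times> (ball_pts n - disc_boundary n)) (B - A)"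
  proof -
    have "bij_betw (\<lambda>((i, C), d). (i, (C, d))) (cells \<times> (ball_pts n - disc_boundary n))
      (SIGMA i:I. (lcosets (S i)) \<times> (ball_pts n - disc_boundary n))"
      by (rule bij_betw_byWitness[where f' = "\<lambda>(i, (C, d)). ((i, C), d)"]) auto
    from bij_betw_trans[OF this q_bij] show ?thesis by (simp add: o_def case_prod_unfold char_map_def)
  qed
  fix U assume U: "U \<subseteq> B"
  have "openin (G_cell G (S i) n) {z \<in> topspace (G_cell G (S i) n). q i z \<in> U} \<longleftrightarrow>
      (\<forall>C\<in>lcosets (S i). openin (disc n) {d \<in> ball_pts n. q i (C, d) \<in> U})" if i: "i \<in> I" for i
  proof
    assume o: "openin (G_cell G (S i) n) {z \<in> topspace (G_cell G (S i) n). q i z \<in> U}"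
    show "\<forall>C\<in>lcosets (S i). openin (disc n) {d \<in> ball_pts n. q i (C, d) \<in> U}"
    proof
      fix C assume C: "C \<in> lcosets (S i)"
      have "continuous_map (disc n) (G_cell G (S i) n) (\<lambda>d. (C, d))"
        unfolding G_cell_def using C by (intro continuous_map_pairedI) auto
      from openin_continuous_map_preimage[OF this o]
      show "openin (disc n) {d \<in> ball_pts n. q i (C, d) \<in> U}" using C by (simp add: G_cell_def cong: conj_cong)
    qed
  next
    assume o: "\<forall>C\<in>lcosets (S i). openin (disc n) {d \<in> ball_pts n. q i (C, d) \<in> U}"
    have "{z \<in> topspace (G_cell G (S i) n). q i z \<in> U} = (\<Union>C\<in>lcosets (S i). {C} \<times> {d \<in> ball_pts n. q i (C, d) \<in> U})"
      by (auto simp: G_cell_def)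
    moreover have "openin (G_cell G (S i) n) (\<Union>C\<in>lcosets (S i). {C} \<times> {d \<in> ball_pts n. q i (C, d) \<in> U})"
      unfolding G_cell_def using o by (intro openin_Union) (auto simp: openin_prod_Times_iff)
    ultimately show "openin (G_cell G (S i) n) {z \<in> topspace (G_cell G (S i) n). q i z \<in> U}" by simp
  qed
  then show "openin (subtopology (spc X) B) U = (openin (subtopology (spc X) A) (U \<inter> A) \<and>
        (\<forall>j\<in>cells. openin (disc n) {d \<in> ball_pts n. char_map j d \<in> U}))"
    unfolding openin_iff[OF U] by auto
qed (use AB BX in auto)

lemma q_in_X: "i \<in> I \<Longrightarrow> C \<in> lcosets (S i) \<Longrightarrow> d \<in> ball_pts n \<Longrightarrow> q i (C, d) \<in> topspace (spc X)"
  using all.q_in_B[of "(i, C)" d] BX by auto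

lemma fixed_cells_fixed:
  assumes H: "subgroup H G" and j: "j \<in> fixed_cells H" and d: "d \<in> ball_pts n"
  shows "char_map j d \<in> fixed_set X H"
proof -
  obtain i C where iC: "j = (i, C)" "i \<in> I" "C \<in> lcosets (S i)" "\<And>h. h \<in> H \<Longrightarrow> h <# C = C"
    using j by (auto simp: fixed_cells_def)
  have "act X h (q i (C, d)) = q i (C, d)" if "h \<in> H" for h
    using q_act[OF iC(2) subgroup.mem_carrier[OF H that] iC(3) d] iC(4)[OF that] by simp
  then show ?thesis using q_in_X[OF iC(2,3) d] by (simp add: fixed_set_def iC)
qed

text \<open>An element of \<open>H\<close> that moves the coset moves the cell to a different one, and different cells
  are disjoint.\<close>

lemma unfixed_cells:
  assumes H: "subgroup H G" and j: "j \<in> cells" "j \<notin> fixed_cells H" and d: "d \<in> all.int_pts"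
  shows "char_map j d \<notin> fixed_set X H"
proof
  assume f: "char_map j d \<in> fixed_set X H"
  obtain i C where iC: "j = (i, C)" "i \<in> I" "C \<in> lcosets (S i)" using j by auto
  then obtain h where h: "h \<in> H" "h <# C \<noteq> C" using j by (auto simp: fixed_cells_def)
  have hG: "h \<in> carrier G" using H h by (simp add: subgroup.mem_carrier)
  have hC: "h <# C \<in> lcosets (S i)" by (rule translate_lcoset[OF S[OF iC(2)] iC(3) hG])
  have "char_map (i, h <# C) d = char_map (i, C) d"
    using q_act[OF iC(2) hG iC(3)] d f h by (simp add: iC fixed_set_def)
  then have "(i, h <# C) = (i, C)" using all.q_inj[of "(i, h <# C)" "(i, C)" d d] iC hC d by auto
  then show False using h by simp
qed

text \<open>Fixed points of equivariant complexes are ordinary cell complexes, so that the approximation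
  theorem for a single attachment applies to them. Closedness is part of the conclusion because the
  next attachment needs it as a hypothesis.\<close>

lemma fixed_attachment:
  assumes H: "subgroup H G" and cl: "closedin (subtopology (spc X) A) (A \<inter> fixed_set X H)"
  shows "cell_attachment (spc X) n (A \<inter> fixed_set X H) (B \<inter> fixed_set X H) (fixed_cells H) char_map"
    and "closedin (subtopology (spc X) B) (B \<inter> fixed_set X H)"
proof -
  have sub: "fixed_cells H \<subseteq> cells" by (auto simp: fixed_cells_def)
  note * = all.subattachment[OF sub cl fixed_cells_fixed[OF H] unfixed_cells[OF H]]
  show "cell_attachment (spc X) n (A \<inter> fixed_set X H) (B \<inter> fixed_set X H) (fixed_cells H) char_map" by (rule *(1))
  show "closedin (subtopology (spc X) B) (B \<inter> fixed_set X H)" by (rule *(2))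
qed

lemma act_in_B:
  assumes A: "\<And>g a. g \<in> carrier G \<Longrightarrow> a \<in> A \<Longrightarrow> act X g a \<in> A" and g: "g \<in> carrier G" and b: "b \<in> B"
  shows "act X g b \<in> B"
proof (cases "b \<in> A")
  case True then show ?thesis using A[OF g] AB by blast
next
  case False
  then obtain j d where jd: "j \<in> cells" "d \<in> all.int_pts" "b = char_map j d" using all.q_surj[OF b] by blast
  then obtain i C where iC: "j = (i, C)" "i \<in> I" "C \<in> lcosets (S i)" by auto
  have "act X g b = char_map (i, g <# C) d" using q_act[OF iC(2) g iC(3)] jd iC by simp
  moreover have "(i, g <# C) \<in> cells" using translate_lcoset[OF S[OF iC(2)] iC(3) g] iC by simp
  ultimately show ?thesis using all.q_in_B[of "(i, g <# C)" d] jd by simp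
qed

end

lemma attach_G_cellsE:
  fixes X :: "('g, 'x) gcw_data"
  assumes "group G" "G_space G X" "attach_G_cells G X n A B"
  obtains I S q where "G_attachment G X n A B I S q"
proof -
  show ?thesis using assms(3) unfolding attach_G_cells_def
  proof (elim conjE exE)
    fix I :: "'x set" and S q
    assume "A \<subseteq> B" "B \<subseteq> topspace (spc X)"
      "\<forall>i\<in>I. subgroup (S i) G" "\<forall>i\<in>I. continuous_map (G_cell G (S i) n) (subtopology (spc X) B) (q i)"
      "\<forall>i\<in>I. \<forall>g\<in>carrier G. \<forall>C\<in>lcosets\<^bsub>G\<^esub> S i. \<forall>d\<in>ball_pts n. q i (g <#\<^bsub>G\<^esub> C, d) = act X g (q i (C, d))"
      "\<forall>i\<in>I. \<forall>C\<in>lcosets\<^bsub>G\<^esub> S i. \<forall>d\<in>disc_boundary n. q i (C, d) \<in> A"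
      "bij_betw (\<lambda>(i, z). q i z) (SIGMA i:I. (lcosets\<^bsub>G\<^esub> S i) \<times> (ball_pts n - disc_boundary n)) (B - A)"
      "\<forall>U. U \<subseteq> B \<longrightarrow> openin (subtopology (spc X) B) U = (openin (subtopology (spc X) A) (U \<inter> A) \<and>
         (\<forall>i\<in>I. openin (G_cell G (S i) n) {z \<in> topspace (G_cell G (S i) n). q i z \<in> U}))"
    then have "G_attachment G X n A B I S q"
      by (intro G_attachment.intro G_space_loc.intro G_space_loc_axioms.intro G_attachment_axioms.intro assms(1,2)) simp_all
    then show ?thesis by (rule that)
  qed
qed

section \<open>Equivariant complexes\<close>

locale G_CW = group G for G :: "('g, 'z) monoid_scheme" (structure) +
  fixes X :: "('g, 'x) gcw_data"
  assumes cw: "G_CW_complex G X"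

sublocale G_CW \<subseteq> G_space_loc G X
  by unfold_locales (use cw in \<open>simp add: G_CW_complex_def\<close>)

context G_CW
begin

lemma colimit: "colimit_topology (spc X) (skel X)"
  using cw by (simp add: G_CW_complex_def)

lemma attach_SucE: obtains I S q where "G_attachment G X (Suc n) (skel X n) (skel X (Suc n)) I S q"
  using attach_G_cellsE[OF is_group G_space] cw unfolding G_CW_complex_def by metis

lemma attach_0E: obtains I S q where "G_attachment G X 0 {} (skel X 0) I S q"
  using attach_G_cellsE[OF is_group G_space] cw unfolding G_CW_complex_def by metis

lemma skel_Suc: "skel X n \<subseteq> skel X (Suc n)"
  using attach_SucE[of n] G_attachment.AB by metis

lemma skel_mono: "m \<le> n \<Longrightarrow> skel X m \<subseteq> skel X n"
  using lift_Suc_mono_le[of "skel X", OF skel_Suc] .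

lemma skel_topspace: "skel X n \<subseteq> topspace (spc X)"
  using colimit by (auto simp: colimit_topology_def)

lemma topspace_skel: "topspace (spc X) = (\<Union>n. skel X n)"
  using colimit by (simp add: colimit_topology_def)

lemma act_skel: "g \<in> carrier G \<Longrightarrow> x \<in> skel X n \<Longrightarrow> act X g x \<in> skel X n"
proof (induction n arbitrary: g x)
  case 0
  obtain I S q where "G_attachment G X 0 {} (skel X 0) I S q" by (rule attach_0E)
  then interpret a: G_attachment G X 0 "{}" "skel X 0" I S q .
  show ?case by (rule a.act_in_B) (use 0 in auto)
next
  case (Suc n)
  obtain I S q where "G_attachment G X (Suc n) (skel X n) (skel X (Suc n)) I S q" by (rule attach_SucE)
  then interpret a: G_attachment G X "Suc n" "skel X n" "skel X (Suc n)" I S q .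
  show ?case by (rule a.act_in_B) (use Suc in auto)
qed

lemma skel_0_discrete:
  assumes "U \<subseteq> skel X 0" shows "openin (subtopology (spc X) (skel X 0)) U"
proof -
  obtain I S q where "G_attachment G X 0 {} (skel X 0) I S q" by (rule attach_0E)
  then interpret a: G_attachment G X 0 "{}" "skel X 0" I S q .
  have "openin (disc 0) {d \<in> ball_pts 0. P d}" for P
  proof -
    have "ball_pts 0 = {\<lambda>i. 0}" by (auto simp: ball_pts_iff)
    then have "{d \<in> ball_pts 0. P d} = {} \<or> {d \<in> ball_pts 0. P d} = ball_pts 0" by auto
    then show ?thesis by (metis openin_empty openin_topspace)
  qed
  then show ?thesis using a.all.openin_iff[OF assms] by simp
qed

lemma closedin_if_skelwise:
  assumes "N \<subseteq> topspace (spc X)" "\<And>n. closedin (subtopology (spc X) (skel X n)) (skel X n \<inter> N)"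
  shows "closedin (spc X) N"
proof -
  have "openin (subtopology (spc X) (skel X n)) ((topspace (spc X) - N) \<inter> skel X n)" for n
  proof -
    have "(topspace (spc X) - N) \<inter> skel X n = topspace (subtopology (spc X) (skel X n)) - (skel X n \<inter> N)"
      using skel_topspace by auto
    then show ?thesis using openin_diff[OF openin_topspace assms(2)[of n]] by simp
  qed
  then have "openin (spc X) (topspace (spc X) - N)" using colimit by (auto simp: colimit_topology_def)
  then show ?thesis using assms(1) by (simp add: closedin_def)
qed

lemma closedin_fixed:
  assumes H: "subgroup H G" shows "closedin (spc X) (fixed_set X H)"
proof (rule closedin_if_skelwise[OF fixed_subset])
  fix n show "closedin (subtopology (spc X) (skel X n)) (skel X n \<inter> fixed_set X H)"
  proof (induction n)
    case 0
    have "openin (subtopology (spc X) (skel X 0)) (skel X 0 - skel X 0 \<inter> fixed_set X H)" by (rule skel_0_discrete) auto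
    then show ?case using skel_topspace[of 0] by (simp add: closedin_def Int_absorb1)
  next
    case (Suc n)
    obtain I S q where "G_attachment G X (Suc n) (skel X n) (skel X (Suc n)) I S q" by (rule attach_SucE)
    then show ?case using G_attachment.fixed_attachment(2)[OF _ H Suc.IH] by blast
  qed
qed

lemma closedin_point:
  assumes x: "x \<in> topspace (spc X)" shows "closedin (spc X) {x}"
proof (rule closedin_if_skelwise)
  have pt: "closedin (subtopology (spc X) (skel X n)) {y}" if "y \<in> skel X n" for n y
    using that
  proof (induction n arbitrary: y)
    case 0
    have "openin (subtopology (spc X) (skel X 0)) (skel X 0 - {y})" by (rule skel_0_discrete) auto
    then show ?case using skel_topspace[of 0] 0 by (simp add: closedin_def Int_absorb1 subset_iff)
  next
    case (Suc n)
    obtain I S q where "G_attachment G X (Suc n) (skel X n) (skel X (Suc n)) I S q" by (rule attach_SucE)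
    then interpret a: G_attachment G X "Suc n" "skel X n" "skel X (Suc n)" I S q .
    show ?case using a.all.closedin_point[OF Suc.IH Suc.prems] by blast
  qed
  show "closedin (subtopology (spc X) (skel X n)) (skel X n \<inter> {x})" for n using pt by (cases "x \<in> skel X n") auto
qed (use x in auto)

lemma closedin_sub_fixed:
  assumes "subgroup H G" shows "closedin (subtopology (spc X) A) (A \<inter> fixed_set X H)"
  using closedin_fixed[OF assms] by (metis closedin_subtopology_Int_closed)

lemma compactin_skel:
  assumes "compactin (spc X) K" obtains N where "K \<subseteq> skel X N"
  using compactin_subset_stage[OF colimit skel_Suc closedin_point assms] by blast

text \<open>The equivariant cells of dimension above \<open>n\<close> are removed one skeleton at a time.\<close>

lemma compress_into_skel:
  fixes K :: "'k::metric_space set"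
  assumes H: "subgroup H G" and K: "compact K" "box_dim_le l K" "l \<le> n"
    and f: "continuous_map (top_of_set K) (fixed_space X H) f"
  obtains f' where "homotopic_with (\<lambda>h. \<forall>k\<in>K. f k \<in> skel X n \<longrightarrow> h k = f k) (top_of_set K) (fixed_space X H) f f'"
    "f' ` K \<subseteq> skel X n"
proof -
  have "compactin (spc X) (f ` K)"
  proof (rule image_compactin)
    show "compactin (top_of_set K) K" using K(1) by (simp add: compactin_subtopology)
    show "continuous_map (top_of_set K) (spc X) f" using f by (simp add: fixed_space_def continuous_map_in_subtopology)
  qed
  then obtain N where "f ` K \<subseteq> skel X N" by (rule compactin_skel)
  also have "skel X N \<subseteq> skel X (n + N)" by (rule skel_mono) simp
  finally have N: "f ` K \<subseteq> skel X (n + N)" .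
  have cells: "\<exists>d>l. \<exists>(J :: ('x \<times> 'g set) set) q. cell_attachment (spc X) d (skel X (n + k) \<inter> fixed_set X H) (skel X (n + Suc k) \<inter> fixed_set X H) J q" for k
  proof -
    obtain I S q where "G_attachment G X (Suc (n + k)) (skel X (n + k)) (skel X (Suc (n + k))) I S q" by (rule attach_SucE)
    from G_attachment.fixed_attachment(1)[OF this H closedin_sub_fixed[OF H]] show ?thesis
      using K(3) by (intro exI[of _ "Suc (n + k)"] conjI) auto
  qed
  show ?thesis
    by (rule compress_into_first_stage[where Fs = "\<lambda>k. skel X (n + k)" and X = "spc X" and C = "fixed_set X H" and K = K and l = l and N = N and f = f])
      (use cells f N K that in \<open>auto simp: fixed_space_def\<close>)
qed

end

section \<open>Paths in a graph\<close>

text \<open>The one-dimensional disc consists of sequences supported at 0; paths on \<open>[0,1]\<close> correspond to maps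
  on it via \<open>u = 2t - 1\<close>.\<close>

definition axis_pt :: "real \<Rightarrow> nat \<Rightarrow> real" where
  "axis_pt u = (\<lambda>i. if i = 0 then u else 0)"

lemma rad_1: "rad 1 d = \<bar>d 0\<bar>"
  by (simp add: L2_set_def)

lemma rad_Suc_0 [simp]: "rad (Suc 0) d = \<bar>d 0\<bar>"
  by (simp add: L2_set_def)

lemma axis_pt_in_ball: "axis_pt u \<in> ball_pts 1 \<longleftrightarrow> \<bar>u\<bar> \<le> 1"
  unfolding ball_pts_iff rad_1 by (auto simp: axis_pt_def)

lemma ball_pts_1: assumes "d \<in> ball_pts 1" shows "d = axis_pt (d 0)" "\<bar>d 0\<bar> \<le> 1"
  using assms unfolding ball_pts_iff rad_1 by (auto simp: axis_pt_def fun_eq_iff)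

lemma disc_boundary_1: "disc_boundary 1 = {axis_pt 1, axis_pt (-1)}"
proof (intro equalityI subsetI)
  fix d assume d: "d \<in> disc_boundary 1"
  then have "d \<in> ball_pts 1" using disc_boundary_subset by blast
  then have "d = axis_pt (d 0)" by (rule ball_pts_1)
  have "\<bar>d 0\<bar> = 1" using d unfolding disc_boundary_iff rad_1 by blast
  then have "d 0 = 1 \<or> d 0 = -1" by linarith
  then show "d \<in> {axis_pt 1, axis_pt (-1)}" using \<open>d = axis_pt (d 0)\<close> by auto
qed (unfold disc_boundary_iff rad_1, auto simp: axis_pt_def)

lemma pathin_disc_1:
  assumes "continuous_on {0..1} u" "\<And>t. t \<in> {0..1} \<Longrightarrow> \<bar>u t\<bar> \<le> 1"
  shows "pathin (disc 1) (\<lambda>t. axis_pt (u t))"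
proof -
  have "continuous_on {0..1} (\<lambda>t. axis_pt (u t) i)" for i
    using assms(1) by (cases "i = 0") (auto simp: axis_pt_def)
  then show ?thesis using assms(2) axis_pt_in_ball
    by (auto simp: pathin_def continuous_map_into_disc)
qed

lemma pathin_disc_iff: "pathin (disc n) w \<longleftrightarrow> continuous_on {0..1} w \<and> w \<in> {0..1} \<rightarrow> ball_pts n"
  unfolding pathin_def by (subst disc_eq) (rule continuous_map_subtopology_eu)

text \<open>The disc is convex.\<close>

lemma path_homotopic_disc:
  assumes w: "pathin (disc n) w" and w': "pathin (disc n) w'" and eq: "w 0 = w' 0" "w 1 = w' 1"
  shows "path_homotopic (disc n) w w'"
  unfolding path_homotopic_def
proof (rule homotopic_withI[where h = "\<lambda>(s, t). \<lambda>i. (1 - s) * w t i + s * w' t i"])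
  have c: "continuous_on {0..1} w" "continuous_on {0..1} w'" and m: "\<And>t. t \<in> {0..1} \<Longrightarrow> w t \<in> ball_pts n \<and> w' t \<in> ball_pts n"
    using w w' unfolding pathin_disc_iff by blast+
  have "continuous_on ({0..1} \<times> {0..1}) (\<lambda>x. (\<lambda>i. (1 - fst x) * w (snd x) i + fst x * w' (snd x) i))"
  proof (rule continuous_on_coordinatewise_then_product)
    fix i
    have cs: "continuous_on ({0..1::real} \<times> {0..1::real}) snd" by (intro continuous_intros)
    have "continuous_on ({0..1::real} \<times> {0..1::real}) (\<lambda>x. w (snd x))" by (rule continuous_on_compose2[OF c(1) cs]) auto
    moreover have "continuous_on ({0..1::real} \<times> {0..1::real}) (\<lambda>x. w' (snd x))" by (rule continuous_on_compose2[OF c(2) cs]) auto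
    ultimately show "continuous_on ({0..1} \<times> {0..1}) (\<lambda>x. (1 - fst x) * w (snd x) i + fst x * w' (snd x) i)"
      by (intro continuous_intros) (auto intro: continuous_on_coord)
  qed
  moreover have "(\<lambda>i. (1 - s) * w t i + s * w' t i) \<in> ball_pts n" if "s \<in> {0..1}" "t \<in> {0..1}" for s t
    using m[OF that(2)] that(1) by (intro ball_pts_convex) auto
  ultimately have "continuous_map (top_of_set ({0..1} \<times> {0..1})) (top_of_set (ball_pts n)) (\<lambda>(s, t). \<lambda>i. (1 - s) * w t i + s * w' t i)"
    unfolding continuous_map_subtopology_eu by (auto simp: case_prod_unfold)
  then show "continuous_map (prod_topology I01 I01) (disc n) (\<lambda>(s, t). \<lambda>i. (1 - s) * w t i + s * w' t i)"
    unfolding prod_top_of_set by (subst disc_eq)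
qed (use eq in \<open>auto simp: fun_eq_iff algebra_simps\<close>)

text \<open>A one-dimensional complex. Its vertices and edges generate its fundamental groupoid, which is
  expressed below as an induction principle for paths.\<close>

locale graph = cell_attachment X 1 A B J q for X :: "'x topology" and A B and J :: "'j set" and q +
  assumes discrete: "\<And>U. U \<subseteq> A \<Longrightarrow> openin (subtopology X A) U"
begin

abbreviation "\<Gamma> \<equiv> subtopology X B"

definition edge :: "'j \<Rightarrow> real \<Rightarrow> 'x" where
  "edge j t = q j (axis_pt (2 * t - 1))"

lemma path_in_vertices_constant:
  assumes r: "pathin (subtopology X A) r" and t: "t \<in> {0..1}"
  shows "r t = r 0"
proof -
  have r0: "r 0 \<in> A" using path_start_in_topspace[OF r] by simp
  have "closedin (subtopology X A) {r 0}"
    unfolding closedin_def topspace_sub_A using r0 discrete[of "A - {r 0}"] by auto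
  moreover have "openin (subtopology X A) {r 0}" using discrete r0 by simp
  ultimately have "openin I01 {t \<in> topspace I01. r t \<in> {r 0}}" "closedin I01 {t \<in> topspace I01. r t \<in> {r 0}}"
    using r unfolding pathin_def by (blast intro: openin_continuous_map_preimage closedin_continuous_map_preimage)+
  moreover have "connected {0..1::real}" by simp
  ultimately have "{t \<in> topspace I01. r t \<in> {r 0}} = {} \<or> {t \<in> topspace I01. r t \<in> {r 0}} = {0..1}"
    unfolding connected_clopen by blast
  moreover have "0 \<in> {t \<in> topspace I01. r t \<in> {r 0}}" by simp
  ultimately have "{t \<in> topspace I01. r t \<in> {r 0}} = {0..1}" by blast
  then have "t \<in> {t \<in> topspace I01. r t \<in> {r 0}}" using t by (simp only:)
  then show ?thesis by simp
qed

text \<open>Up to homotopy a path in a closed edge between boundary points is constant, the edge, or its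
  inverse.\<close>

lemma edge_path_in_cell:
  assumes homot: "\<And>p p'. path_homotopic \<Gamma> p p' \<Longrightarrow> p 0 \<in> A \<Longrightarrow> p 1 \<in> A \<Longrightarrow> E p \<Longrightarrow> E p'"
    and rev: "\<And>p. pathin \<Gamma> p \<Longrightarrow> p 0 \<in> A \<Longrightarrow> p 1 \<in> A \<Longrightarrow> E p \<Longrightarrow> E (path_rev p)"
    and const: "\<And>a. a \<in> A \<Longrightarrow> E (\<lambda>t. a)" and edges: "\<And>j. j \<in> J \<Longrightarrow> E (edge j)"
    and j: "j \<in> J" and w: "pathin (disc 1) w" "w 0 \<in> disc_boundary 1" "w 1 \<in> disc_boundary 1"
  shows "E (q j \<circ> w)"
proof -
  have *: "E (q j \<circ> w)" if w': "pathin (disc 1) w'" "w' 0 = w 0" "w' 1 = w 1" "E (q j \<circ> w')" for w'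
  proof -
    have "path_homotopic \<Gamma> (q j \<circ> w') (q j \<circ> w)"
      by (rule path_homotopic_compose[OF path_homotopic_disc[OF w'(1) w(1) w'(2,3)] q_cont[OF j]])
    then show ?thesis using homot w' w q_boundary[OF j] by (metis comp_apply)
  qed
  have pe: "pathin (disc 1) (\<lambda>t. axis_pt (2 * t - 1))"
    by (rule pathin_disc_1) (auto intro!: continuous_intros)
  have edge: "edge j = q j \<circ> (\<lambda>t. axis_pt (2 * t - 1))" by (auto simp: edge_def)
  have pedge: "pathin \<Gamma> (edge j)" unfolding edge by (rule pathin_compose[OF pe q_cont[OF j]])
  consider "w 0 = w 1" | "w 0 = axis_pt (-1)" "w 1 = axis_pt 1" | "w 0 = axis_pt 1" "w 1 = axis_pt (-1)"
    using w(2,3) unfolding disc_boundary_1 by auto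
  then show ?thesis
  proof cases
    case 1
    show ?thesis
    proof (rule *)
      show "pathin (disc 1) (\<lambda>t. w 0)" using path_start_in_topspace[OF w(1)] by simp
      show "E (q j \<circ> (\<lambda>t. w 0))" using const[OF q_boundary[OF j w(2)]] by (simp add: o_def)
    qed (use 1 in auto)
  next
    case 2
    show ?thesis
      by (rule *[OF pe]) (use 2 edges[OF j] edge in auto)
  next
    case 3
    have "E (path_rev (edge j))"
      by (rule rev[OF pedge _ _ edges[OF j]]) (use q_boundary[OF j] disc_boundary_1 in \<open>auto simp: edge_def\<close>)
    moreover have "path_rev (edge j) = q j \<circ> path_rev (\<lambda>t. axis_pt (2 * t - 1))" by (simp add: edge path_rev_compose)
    ultimately show ?thesis
      by (intro *[OF pathin_rev[OF pe]]) (use 3 in auto)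
  qed
qed

text \<open>A path \<open>\<gamma> b\<close> from each point to a vertex. In general it cannot depend continuously on
  \<open>b\<close>, but it does near the vertices, where it is the track of a radial expansion; on open edges it runs inside the
  edge. These two properties are what the local step of the path induction requires.\<close>

lemma paths_to_vertices:
  obtains P \<gamma> where "continuous_map (prod_topology I01 \<Gamma>) \<Gamma> P"
    "\<And>b. b \<in> B \<Longrightarrow> P (0, b) = b" "\<And>t a. t \<in> {0..1} \<Longrightarrow> a \<in> A \<Longrightarrow> P (t, a) = a"
    "\<And>b. b \<in> B - (\<Union>j\<in>J. q j ` {d \<in> ball_pts 1. rad 1 d \<le> 3/4}) \<Longrightarrow> P (1, b) \<in> A"
    "\<And>b. b \<in> B \<Longrightarrow> pathin \<Gamma> (\<gamma> b)" "\<And>b. b \<in> B \<Longrightarrow> \<gamma> b 0 = b" "\<And>b. b \<in> B \<Longrightarrow> \<gamma> b 1 \<in> A"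
    "\<And>b. b \<in> B \<Longrightarrow> P (1, b) \<in> A \<Longrightarrow> \<gamma> b = (\<lambda>t. P (t, b))"
    "\<And>j d. j \<in> J \<Longrightarrow> d \<in> int_pts \<Longrightarrow> \<exists>c. pathin (disc 1) c \<and> c 0 = d \<and> c 1 \<in> disc_boundary 1 \<and>
       (\<forall>t\<in>{0..1}. \<gamma> (q j d) t = q j (c t))"
proof -
  obtain P where P: "continuous_map (prod_topology I01 \<Gamma>) \<Gamma> P"
    "\<And>t a. t \<in> {0..1} \<Longrightarrow> a \<in> A \<Longrightarrow> P (t, a) = a"
    "\<And>j t d. j \<in> J \<Longrightarrow> t \<in> {0..1} \<Longrightarrow> d \<in> ball_pts 1 \<Longrightarrow> P (t, q j d) = q j (\<lambda>i. ((1 - t) + t / max (rad 1 d) (1/2)) * d i)"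
    "\<And>b. b \<in> B \<Longrightarrow> P (0, b) = b"
    "\<And>j d. j \<in> J \<Longrightarrow> d \<in> ball_pts 1 \<Longrightarrow> 1/2 \<le> rad 1 d \<Longrightarrow> P (1, q j d) \<in> A"
    by (rule radial_expansion[of "\<lambda>_. 1/2"]) auto
  have Pp: "pathin \<Gamma> (\<lambda>t. P (t, b))" if b: "b \<in> B" for b
  proof -
    have "continuous_map I01 (prod_topology I01 \<Gamma>) (\<lambda>t. (t, b))"
      using b topspace_sub_B by (intro continuous_map_pairedI) auto
    from continuous_map_compose[OF this P(1)] show ?thesis by (simp add: pathin_def o_def)
  qed
  define Q where "Q b g \<longleftrightarrow> pathin \<Gamma> g \<and> g 0 = b \<and> g 1 \<in> A \<and> (P (1, b) \<in> A \<longrightarrow> g = (\<lambda>t. P (t, b))) \<and>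
     (\<forall>j\<in>J. \<forall>d\<in>int_pts. b = q j d \<longrightarrow> (\<exists>c. pathin (disc 1) c \<and> c 0 = d \<and> c 1 \<in> disc_boundary 1 \<and> (\<forall>t\<in>{0..1}. g t = q j (c t))))" for b g
  have "\<exists>g. Q b g"
    if b: "b \<in> B" for b
  proof (cases "P (1, b) \<in> A")
    case True
    show ?thesis unfolding Q_def
    proof (intro exI[of _ "\<lambda>t. P (t, b)"] conjI impI ballI)
      fix j d assume jd: "j \<in> J" "d \<in> int_pts" "b = q j d"
      define c where "c t = axis_pt (((1 - t) + t / max (rad 1 d) (1/2)) * d 0)" for t
      have db: "d \<in> ball_pts 1" using jd by blast
      have c: "c t = (\<lambda>i. ((1 - t) + t / max (rad 1 d) (1/2)) * d i)" for t
      proof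
        fix i
        have "d i = 0" if "i \<noteq> 0" using db that by (simp add: ball_pts_iff)
        then show "c t i = ((1 - t) + t / max (rad 1 d) (1/2)) * d i" by (simp add: c_def axis_pt_def)
      qed
      have qc: "P (t, b) = q j (c t)" if "t \<in> {0..1}" for t using P(3)[OF jd(1) that db] jd c by simp
      have "\<bar>((1 - t) + t / max (rad 1 d) (1/2)) * d 0\<bar> \<le> 1" if "t \<in> {0..1}" for t
      proof -
        define r where "r = \<bar>d 0\<bar>"
        have r: "0 \<le> r" "r \<le> 1" using ball_pts_1(2)[OF db] by (auto simp: r_def)
        have "\<bar>((1 - t) + t / max (rad 1 d) (1/2)) * d 0\<bar> = ((1 - t) + t / max r (1/2)) * r"
          using that by (simp add: abs_mult rad_1 r_def le_max_iff_disj)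
        also have "\<dots> = (1 - t) * r + t * (r / max r (1/2))" by (simp add: algebra_simps)
        also have "\<dots> \<le> (1 - t) * 1 + t * 1"
          using that r by (intro add_mono mult_left_mono) (auto simp: divide_le_eq_1 less_max_iff_disj)
        finally show ?thesis by simp
      qed
      then have pc: "pathin (disc 1) c" unfolding c_def
        by (intro pathin_disc_1) (auto intro!: continuous_intros simp: less_max_iff_disj)
      have "c 1 \<in> ball_pts 1" using path_finish_in_topspace[OF pc] .
      moreover have "q j (c 1) \<in> A" using True qc[of 1] by simp
      ultimately have "c 1 \<in> disc_boundary 1" using q_interior[OF jd(1), of "c 1"] by blast
      moreover have "c 0 = d" using c[of 0] by simp
      ultimately show "\<exists>c. pathin (disc 1) c \<and> c 0 = d \<and> c 1 \<in> disc_boundary 1 \<and> (\<forall>t\<in>{0..1}. P (t, b) = q j (c t))"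
        using pc qc by blast
    qed (use True Pp[OF b] P(4)[OF b] in auto)
  next
    case False
    then have "b \<notin> A" using P(2)[of 1 b] by auto
    then obtain j d where jd: "j \<in> J" "d \<in> int_pts" "b = q j d" using q_surj[OF b] by blast
    have db: "d \<in> ball_pts 1" using jd by blast
    \<comment> \<open>near the middle of an edge the path runs straight to the end point 1\<close>
    define c where "c t = axis_pt ((1 - t) * d 0 + t * 1)" for t
    have "\<bar>(1 - t) * d 0 + t * 1\<bar> \<le> 1" if "t \<in> {0..1}" for t
      using ball_pts_1(2)[OF db] convex_bound_le[of "d 0" 1 1 "1 - t" t] convex_bound_le[of "- d 0" 1 "-1" "1 - t" t] that
      by (auto simp: abs_le_iff)
    then have pc: "pathin (disc 1) c" unfolding c_def
      by (intro pathin_disc_1) (auto intro!: continuous_intros)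
    have c0: "c 0 = d" using ball_pts_1(1)[OF db] by (simp add: c_def)
    have c1: "c 1 \<in> disc_boundary 1" unfolding c_def disc_boundary_1 by simp
    show ?thesis unfolding Q_def
    proof (intro exI[of _ "\<lambda>t. q j (c t)"] conjI impI ballI)
      show "pathin \<Gamma> (\<lambda>t. q j (c t))" using pathin_compose[OF pc q_cont[OF jd(1)]] by (simp add: o_def)
      show "q j (c 1) \<in> A" using q_boundary[OF jd(1) c1] .
      fix j' d' assume j': "j' \<in> J" "d' \<in> int_pts" "b = q j' d'"
      then have "j' = j \<and> d' = d" using q_inj[OF j'(1) jd(1) j'(2) jd(2)] jd by metis
      then show "\<exists>c'. pathin (disc 1) c' \<and> c' 0 = d' \<and> c' 1 \<in> disc_boundary 1 \<and> (\<forall>t\<in>{0..1}. q j (c t) = q j' (c' t))"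
        using pc c0 c1 by blast
    qed (use jd c0 False in auto)
  qed
  then obtain \<gamma> where "\<forall>b\<in>B. Q b (\<gamma> b)" using bchoice[of B Q] by blast
  then have \<gamma>: "pathin \<Gamma> (\<gamma> b) \<and> \<gamma> b 0 = b \<and> \<gamma> b 1 \<in> A \<and> (P (1, b) \<in> A \<longrightarrow> \<gamma> b = (\<lambda>t. P (t, b))) \<and>
     (\<forall>j\<in>J. \<forall>d\<in>int_pts. b = q j d \<longrightarrow> (\<exists>c. pathin (disc 1) c \<and> c 0 = d \<and> c 1 \<in> disc_boundary 1 \<and> (\<forall>t\<in>{0..1}. \<gamma> b t = q j (c t))))"
    if "b \<in> B" for b using that unfolding Q_def by blast
  show ?thesis
  proof (rule that[OF P(1,4,2)])
    show "P (1, b) \<in> A" if b: "b \<in> B - (\<Union>j\<in>J. q j ` {d \<in> ball_pts 1. rad 1 d \<le> 3/4})" for b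
    proof (cases "b \<in> A")
      case True then show ?thesis using P(2) by simp
    next
      case False
      then obtain j d where jd: "j \<in> J" "d \<in> int_pts" "b = q j d" using q_surj[of b] b by blast
      then have "\<not> rad 1 d \<le> 3/4" using b by blast
      then show ?thesis using P(5)[OF jd(1), of d] jd by auto
    qed
    show "\<exists>c. pathin (disc 1) c \<and> c 0 = d \<and> c 1 \<in> disc_boundary 1 \<and> (\<forall>t\<in>{0..1}. \<gamma> (q j d) t = q j (c t))"
      if "j \<in> J" "d \<in> int_pts" for j d
      using \<gamma>[of "q j d"] q_interior[OF that] that by blast
  qed (use \<gamma> in auto)
qed

text \<open>A property of paths between vertices holds for all of them if it holds for edges and constant
  paths and is preserved by composition, inversion and homotopy. For a subpath from \<open>a\<close> to \<open>b\<close> consider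
  the path between vertices obtained by adding the paths \<open>\<gamma>\<close> at both ends. The property is
  additive in the interval, so by Bolzano's subdivision principle it suffices to verify it for short
  subpaths, which lie in the star of a vertex or in an open edge.\<close>

lemma path_induct:
  assumes homot: "\<And>p p'. path_homotopic \<Gamma> p p' \<Longrightarrow> p 0 \<in> A \<Longrightarrow> p 1 \<in> A \<Longrightarrow> E p \<Longrightarrow> E p'"
    and join: "\<And>p p'. pathin \<Gamma> p \<Longrightarrow> pathin \<Gamma> p' \<Longrightarrow> p 0 \<in> A \<Longrightarrow> p 1 \<in> A \<Longrightarrow> p' 1 \<in> A \<Longrightarrow> p 1 = p' 0 \<Longrightarrow> E p \<Longrightarrow> E p' \<Longrightarrow> E (path_join p p')"
    and rev: "\<And>p. pathin \<Gamma> p \<Longrightarrow> p 0 \<in> A \<Longrightarrow> p 1 \<in> A \<Longrightarrow> E p \<Longrightarrow> E (path_rev p)"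
    and const: "\<And>a. a \<in> A \<Longrightarrow> E (\<lambda>t. a)" and edges: "\<And>j. j \<in> J \<Longrightarrow> E (edge j)"
    and p: "pathin \<Gamma> p" "p 0 \<in> A" "p 1 \<in> A"
  shows "E p"
proof -
  obtain P \<gamma> where P: "continuous_map (prod_topology I01 \<Gamma>) \<Gamma> P"
    "\<And>b. b \<in> B \<Longrightarrow> P (0, b) = b" "\<And>t a. t \<in> {0..1} \<Longrightarrow> a \<in> A \<Longrightarrow> P (t, a) = a"
    and PV: "\<And>b. b \<in> B - (\<Union>j\<in>J. q j ` {d \<in> ball_pts 1. rad 1 d \<le> 3/4}) \<Longrightarrow> P (1, b) \<in> A"
    and \<gamma>: "\<And>b. b \<in> B \<Longrightarrow> pathin \<Gamma> (\<gamma> b)" "\<And>b. b \<in> B \<Longrightarrow> \<gamma> b 0 = b" "\<And>b. b \<in> B \<Longrightarrow> \<gamma> b 1 \<in> A"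
    and \<gamma>P: "\<And>b. b \<in> B \<Longrightarrow> P (1, b) \<in> A \<Longrightarrow> \<gamma> b = (\<lambda>t. P (t, b))"
    and \<gamma>c: "\<And>j d. j \<in> J \<Longrightarrow> d \<in> int_pts \<Longrightarrow> \<exists>c. pathin (disc 1) c \<and> c 0 = d \<and> c 1 \<in> disc_boundary 1 \<and>
       (\<forall>t\<in>{0..1}. \<gamma> (q j d) t = q j (c t))"
    by (rule paths_to_vertices) blast
  have pB: "p t \<in> B" if "t \<in> {0..1}" for t
    using path_image_subset_topspace[OF p(1)] that topspace_sub_B by auto
  define seg where "seg a b = (\<lambda>t. p (a + (b - a) * t))" for a b
  have aff: "a + (b - a) * t \<in> {a..b}" if "a \<le> b" "t \<in> {0..1}" for a b t :: real
  proof -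
    have "0 \<le> (b - a) * t" "(b - a) * t \<le> b - a" using that mult_left_le[of t "b - a"] by auto
    then show ?thesis by auto
  qed
  have seg: "pathin \<Gamma> (seg a b)" if "0 \<le> a" "a \<le> b" "b \<le> 1" for a b
  proof -
    have "pathin \<Gamma> (p \<circ> (\<lambda>t. a + (b - a) * t))"
      by (rule pathin_compose_interval[OF p(1)]) (use aff[OF that(2)] that in \<open>force intro!: continuous_intros\<close>)+
    then show ?thesis by (simp add: seg_def o_def)
  qed
  have seg_ends [simp]: "seg a b 0 = p a" "seg a b 1 = p b" for a b by (auto simp: seg_def)
  \<comment> \<open>the subpath from \<open>a\<close> to \<open>b\<close>, closed up to a path between vertices\<close>
  define word where "word a b = path_join (path_rev (\<gamma> (p a))) (path_join (seg a b) (\<gamma> (p b)))" for a b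
  have g: "pathin \<Gamma> (\<gamma> (p t))" "\<gamma> (p t) 0 = p t" "\<gamma> (p t) 1 \<in> A" if "0 \<le> t" "t \<le> 1" for t
    using \<gamma> pB that by auto
  have word_ends: "word a b 0 \<in> A" "word a b 1 \<in> A" if "0 \<le> a" "a \<le> b" "b \<le> 1" for a b
    using g that by (auto simp: word_def)
  have word: "pathin \<Gamma> (word a b)" if "0 \<le> a" "a \<le> b" "b \<le> 1" for a b
    unfolding word_def using g seg that by (auto intro!: pathin_join pathin_rev)
  define Good where "Good a b \<longleftrightarrow> (0 \<le> a \<and> a \<le> b \<and> b \<le> 1 \<longrightarrow> E (word a b))" for a b
  have "Good 0 1"
  proof (rule Bolzano)
    show "(0::real) \<le> 1" by simp
  next
    fix a b c assume ab: "Good a b" and bc: "Good b c" and le: "a \<le> b" "b \<le> c"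
    show "Good a c" unfolding Good_def
    proof
      assume ac: "0 \<le> a \<and> a \<le> c \<and> c \<le> 1"
      have E: "E (word a b)" "E (word b c)" using ab bc le ac by (auto simp: Good_def)
      note ps = ac le g[of a] g[of b] g[of c] seg[of a b] seg[of b c] seg[of a c]
      have pr: "pathin \<Gamma> (path_rev (\<gamma> (p a)))" using ps by (auto intro: pathin_rev)
      have p1: "pathin \<Gamma> (path_join (path_rev (\<gamma> (p a))) (seg a b))" using ps pr by (auto intro!: pathin_join)
      have p2: "pathin \<Gamma> (path_join (seg b c) (\<gamma> (p c)))" using ps by (auto intro!: pathin_join)
      have "path_homotopic \<Gamma> (path_join (word a b) (word b c))
         (path_join (path_join (path_join (path_rev (\<gamma> (p a))) (seg a b)) (\<gamma> (p b))) (word b c))"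
        unfolding word_def[of a b]
        by (rule path_homotopic_join[OF path_homotopic_sym[OF path_homotopic_assoc] path_homotopic_refl[OF word]])
          (use ps pr in \<open>auto simp: word_def\<close>)
      also have "path_homotopic \<Gamma> (path_join (path_join (path_join (path_rev (\<gamma> (p a))) (seg a b)) (\<gamma> (p b))) (word b c))
         (path_join (path_join (path_rev (\<gamma> (p a))) (seg a b)) (path_join (seg b c) (\<gamma> (p c))))"
        unfolding word_def by (rule path_homotopic_cancel_middle[OF p1 p2]) (use ps in auto)
      also have "path_homotopic \<Gamma> (path_join (path_join (path_rev (\<gamma> (p a))) (seg a b)) (path_join (seg b c) (\<gamma> (p c))))
         (path_join (path_rev (\<gamma> (p a))) (path_join (seg a b) (path_join (seg b c) (\<gamma> (p c)))))"
        by (rule path_homotopic_assoc[OF pr _ p2]) (use ps in auto)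
      also have "path_homotopic \<Gamma> (path_join (path_rev (\<gamma> (p a))) (path_join (seg a b) (path_join (seg b c) (\<gamma> (p c))))) (word a c)"
        unfolding word_def
      proof (rule path_homotopic_join[OF path_homotopic_refl[OF pr]])
        have "path_homotopic \<Gamma> (path_join (seg a b) (path_join (seg b c) (\<gamma> (p c)))) (path_join (path_join (seg a b) (seg b c)) (\<gamma> (p c)))"
          by (rule path_homotopic_sym[OF path_homotopic_assoc]) (use ps in auto)
        also have "path_homotopic \<Gamma> (path_join (path_join (seg a b) (seg b c)) (\<gamma> (p c))) (path_join (seg a c) (\<gamma> (p c)))"
        proof (rule path_homotopic_join[OF _ path_homotopic_refl])
          let ?f = "\<lambda>t::real. if t \<le> 1/2 then a + (b - a) * (2 * t) else b + (c - b) * (2 * t - 1)"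
          have "continuous_on {0..1} (\<lambda>t. a + (b - a) * min 1 (2 * t) + (c - b) * max 0 (2 * t - 1))"
            by (intro continuous_intros)
          then have fc: "continuous_on {0..1} ?f"
          proof (rule continuous_on_eq)
            fix t :: real
            show "a + (b - a) * min 1 (2 * t) + (c - b) * max 0 (2 * t - 1) = ?f t"
            proof -
              consider "t < 1/2" | "t = 1/2" | "t > 1/2" by linarith
              then show ?thesis
              proof cases
                case 2
                show ?thesis unfolding 2 by simp
              qed (auto simp: min_def max_def)
            qed
          qed
          have "?f \<in> {0..1} \<rightarrow> {0..1}"
          proof
            fix t :: real assume "t \<in> {0..1}"
            then show "?f t \<in> {0..1}" using aff[OF le(1), of "2 * t"] aff[OF le(2), of "2 * t - 1"] ac le by auto
          qed
          moreover have "(\<lambda>t. a + (c - a) * t) \<in> {0..1} \<rightarrow> {0..1}" using aff[of a c] ac by force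
          ultimately have "path_homotopic \<Gamma> (p \<circ> ?f) (p \<circ> (\<lambda>t. a + (c - a) * t))"
            by (intro path_homotopic_reparam[OF p(1) fc]) (auto intro!: continuous_intros)
          moreover have "p \<circ> ?f = path_join (seg a b) (seg b c)" "p \<circ> (\<lambda>t. a + (c - a) * t) = seg a c"
            by (auto simp: path_join_def seg_def fun_eq_iff)
          ultimately show "path_homotopic \<Gamma> (path_join (seg a b) (seg b c)) (seg a c)" by simp
        qed (use ps in auto)
        finally show "path_homotopic \<Gamma> (path_join (seg a b) (path_join (seg b c) (\<gamma> (p c)))) (path_join (seg a c) (\<gamma> (p c)))" .
      qed (use ps in auto)
      finally have h: "path_homotopic \<Gamma> (path_join (word a b) (word b c)) (word a c)" .
      have "E (path_join (word a b) (word b c))"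
        by (rule join) (use E ac le word word_ends in \<open>auto simp: word_def\<close>)
      then show "E (word a c)" using homot[OF h] word_ends[of a b] word_ends[of b c] ac le by auto
    qed
  next
    fix x :: real assume x: "0 \<le> x" "x \<le> 1"
    have near: "\<exists>d>0. \<forall>t\<in>{0..1}. \<bar>t - x\<bar> < d \<longrightarrow> p t \<in> U" if U: "openin \<Gamma> U" "p x \<in> U" for U
    proof -
      have "openin I01 {t \<in> topspace I01. p t \<in> U}"
        using p(1) U(1) unfolding pathin_def by (rule openin_continuous_map_preimage)
      moreover have "x \<in> {t \<in> topspace I01. p t \<in> U}" using x U by simp
      ultimately obtain d where "d > 0" "ball x d \<inter> {0..1} \<subseteq> {t \<in> topspace I01. p t \<in> U}"
        unfolding openin_contains_ball by blast
      then show ?thesis by (intro exI[of _ d]) (auto simp: dist_real_def abs_minus_commute subset_iff)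
    qed
    have px: "p x \<in> B" using pB x by simp
    show "\<exists>d>0. \<forall>a b. a \<le> x \<and> x \<le> b \<and> b - a < d \<longrightarrow> Good a b"
    proof (cases "p x \<in> A")
      case True
      define O' where "O' = B - (\<Union>j\<in>J. q j ` {d \<in> ball_pts 1. rad 1 d \<le> 3/4})"
      have "openin \<Gamma> O'" unfolding O'_def by (rule openin_avoiding_inner_discs) auto
      moreover have "p x \<in> O'"
      proof -
        have "p x \<noteq> q j d" if "j \<in> J" "d \<in> ball_pts 1" "rad 1 d \<le> 3/4" for j d
          using q_interior[OF that(1), of d] that True by (auto simp: disc_boundary_iff)
        then show ?thesis using px by (auto simp: O'_def)
      qed
      ultimately have "\<exists>d>0. \<forall>t\<in>{0..1}. \<bar>t - x\<bar> < d \<longrightarrow> p t \<in> O'" by (rule near)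
      then obtain d where d: "d > 0" "\<And>t. t \<in> {0..1} \<Longrightarrow> \<bar>t - x\<bar> < d \<Longrightarrow> p t \<in> O'" by blast
      show ?thesis
      proof (intro exI[of _ d] conjI allI impI d(1))
        fix a b assume ab: "a \<le> x \<and> x \<le> b \<and> b - a < d"
        show "Good a b" unfolding Good_def
        proof
          assume ab1: "0 \<le> a \<and> a \<le> b \<and> b \<le> 1"
          have inO: "p t \<in> O'" if "t \<in> {a..b}" for t using d(2)[of t] that ab ab1 by auto
          have segO: "seg a b t \<in> O'" if "t \<in> {0..1}" for t
            unfolding seg_def by (rule inO[OF aff]) (use ab1 that in auto)
          have "a \<in> {a..b}" "b \<in> {a..b}" using ab1 by auto
          then have gP: "\<gamma> (p a) = (\<lambda>t. P (t, p a))" "\<gamma> (p b) = (\<lambda>t. P (t, p b))"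
            using \<gamma>P PV inO pB ab1 unfolding O'_def by auto
          \<comment> \<open>the expansion carries the subpath into the discrete set of vertices, where it is constant; this square makes the word null homotopic\<close>
          define h where "h = (\<lambda>(s, t). P (t, seg a b s))"
          have "continuous_map (prod_topology I01 I01) (prod_topology I01 \<Gamma>) (\<lambda>x. (snd x, seg a b (fst x)))"
          proof (rule continuous_map_pairedI)
            show "continuous_map (prod_topology I01 I01) I01 snd" by (rule continuous_map_snd)
            show "continuous_map (prod_topology I01 I01) \<Gamma> (\<lambda>x. seg a b (fst x))"
              using continuous_map_compose[OF continuous_map_fst[of I01 I01] seg[of a b, unfolded pathin_def]] ab1
              unfolding o_def by blast
          qed
          from continuous_map_compose[OF this P(1)] have "continuous_map (prod_topology I01 I01) \<Gamma> h"
            by (simp add: h_def o_def case_prod_unfold)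
          note sq = path_homotopic_square[OF this]
          have segB: "seg a b t \<in> B" if "t \<in> {0..1}" for t using segO[OF that] by (auto simp: O'_def)
          have e1: "path_homotopic \<Gamma> (seg a b) (\<lambda>t. h (t, 0))"
            by (rule path_homotopic_eq_on) (use seg ab1 P(2) segB in \<open>auto simp: h_def\<close>)
          have e2: "(\<lambda>t. h (1, t)) = \<gamma> (p b)" "(\<lambda>t. h (0, t)) = \<gamma> (p a)" by (auto simp: h_def gP)
          have e3: "h (t, 1) = \<gamma> (p a) 1" if t: "t \<in> {0..1}" for t
          proof -
            have "continuous_map I01 (prod_topology I01 I01) (\<lambda>t. (t, 1))" by (intro continuous_map_pairedI) auto
            from continuous_map_compose[OF this \<open>continuous_map (prod_topology I01 I01) \<Gamma> h\<close>]
            have "pathin \<Gamma> (\<lambda>t. h (t, 1))" by (simp add: pathin_def o_def)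
            moreover have "h (t, 1) \<in> A" if "t \<in> {0..1}" for t using PV segO[OF that] by (simp add: h_def O'_def)
            ultimately have "pathin (subtopology X A) (\<lambda>t. h (t, 1))"
              using AX by (auto simp: pathin_subtopology)
            from path_in_vertices_constant[OF this t] show ?thesis by (simp add: h_def gP)
          qed
          have ga: "pathin \<Gamma> (\<gamma> (p a))" "pathin \<Gamma> (\<gamma> (p b))" using g ab1 by auto
          have "path_homotopic \<Gamma> (path_join (seg a b) (\<gamma> (p b))) (path_join (\<lambda>t. h (t, 0)) (\<lambda>t. h (1, t)))"
            unfolding e2 by (rule path_homotopic_join[OF e1 path_homotopic_refl[OF ga(2)]]) (use g ab1 in auto)
          also note sq
          also have "path_homotopic \<Gamma> (path_join (\<lambda>t. h (0, t)) (\<lambda>t. h (t, 1))) (path_join (\<gamma> (p a)) (\<lambda>t. \<gamma> (p a) 1))"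
            unfolding e2
          proof (rule path_homotopic_join[OF path_homotopic_refl[OF ga(1)]])
            show "path_homotopic \<Gamma> (\<lambda>t. h (t, 1)) (\<lambda>t. \<gamma> (p a) 1)"
              by (rule path_homotopic_sym[OF path_homotopic_eq_on]) (use e3 path_finish_in_topspace[OF ga(1)] in auto)
            show "\<gamma> (p a) 1 = h (0, 1)" using e3[of 0] by simp
          qed
          also have "path_homotopic \<Gamma> (path_join (\<gamma> (p a)) (\<lambda>t. \<gamma> (p a) 1)) (\<gamma> (p a))"
            by (rule path_homotopic_const_right[OF ga(1)])
          finally have "path_homotopic \<Gamma> (word a b) (path_join (path_rev (\<gamma> (p a))) (\<gamma> (p a)))"
            unfolding word_def by (intro path_homotopic_join[OF path_homotopic_refl[OF pathin_rev[OF ga(1)]]]) (use g ab1 in auto)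
          also have "path_homotopic \<Gamma> (path_join (path_rev (\<gamma> (p a))) (\<gamma> (p a))) (\<lambda>t. \<gamma> (p a) 1)"
            by (rule path_homotopic_rev_left[OF ga(1)])
          finally have "path_homotopic \<Gamma> (\<lambda>t. \<gamma> (p a) 1) (word a b)" by (rule path_homotopic_sym)
          then show "E (word a b)" by (rule homot) (use const g ab1 in auto)
        qed
      qed
    next
      case False
      then obtain j d0 where jd: "j \<in> J" "d0 \<in> int_pts" "p x = q j d0" using q_surj[OF px] by blast
      have "openin \<Gamma> (q j ` int_pts)" by (rule q_open[OF jd(1) openin_int_pts order_refl])
      moreover have "p x \<in> q j ` int_pts" using jd by blast
      ultimately have "\<exists>d>0. \<forall>t\<in>{0..1}. \<bar>t - x\<bar> < d \<longrightarrow> p t \<in> q j ` int_pts" by (rule near)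
      then obtain d where d: "d > 0" "\<And>t. t \<in> {0..1} \<Longrightarrow> \<bar>t - x\<bar> < d \<Longrightarrow> p t \<in> q j ` int_pts" by blast
      show ?thesis
      proof (intro exI[of _ d] conjI allI impI d(1))
        fix a b assume ab: "a \<le> x \<and> x \<le> b \<and> b - a < d"
        show "Good a b" unfolding Good_def
        proof
          assume ab1: "0 \<le> a \<and> a \<le> b \<and> b \<le> 1"
          have inO: "p t \<in> q j ` int_pts" if "t \<in> {a..b}" for t using d(2)[of t] that ab ab1 by auto
          have segO: "seg a b t \<in> q j ` int_pts" if "t \<in> {0..1}" for t
            unfolding seg_def by (rule inO[OF aff]) (use ab1 that in auto)
          define c where "c = cell_coord j \<circ> seg a b"
          have "pathin (subtopology X (q j ` int_pts)) (seg a b)"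
            using seg[of a b] ab1 segO by (auto simp: pathin_subtopology)
          then have c: "pathin (disc 1) c" unfolding c_def by (rule pathin_compose[OF _ cell_coord_continuous[OF jd(1)]])
          have cq: "c t \<in> int_pts \<and> q j (c t) = seg a b t" if "t \<in> {0..1}" for t
            using segO[OF that] cell_coord_q[OF jd(1)] by (auto simp: c_def)
          obtain ca where ca: "pathin (disc 1) ca" "ca 0 = c 0" "ca 1 \<in> disc_boundary 1" "\<And>t. t \<in> {0..1} \<Longrightarrow> \<gamma> (p a) t = q j (ca t)"
            using \<gamma>c[OF jd(1), of "c 0"] cq[of 0] by auto
          obtain cb where cb: "pathin (disc 1) cb" "cb 0 = c 1" "cb 1 \<in> disc_boundary 1" "\<And>t. t \<in> {0..1} \<Longrightarrow> \<gamma> (p b) t = q j (cb t)"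
            using \<gamma>c[OF jd(1), of "c 1"] cq[of 1] by auto
          \<comment> \<open>in an open edge the whole word lifts to the disc\<close>
          define w where "w = path_join (path_rev ca) (path_join c cb)"
          have w: "pathin (disc 1) w" unfolding w_def using ca cb c by (auto intro!: pathin_join pathin_rev)
          have "E (q j \<circ> w)"
            by (rule edge_path_in_cell[OF homot rev const edges jd(1) w]) (use ca cb in \<open>auto simp: w_def\<close>)
          moreover have "path_homotopic \<Gamma> (q j \<circ> w) (word a b)"
          proof -
            have pq: "pathin \<Gamma> (q j \<circ> r)" if "pathin (disc 1) r" for r by (rule pathin_compose[OF that q_cont[OF jd(1)]])
            have 1: "path_homotopic \<Gamma> (q j \<circ> ca) (\<gamma> (p a))" by (rule path_homotopic_eq_on[OF pq[OF ca(1)]]) (use ca in auto)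
            have 2: "path_homotopic \<Gamma> (q j \<circ> cb) (\<gamma> (p b))" by (rule path_homotopic_eq_on[OF pq[OF cb(1)]]) (use cb in auto)
            have 3: "path_homotopic \<Gamma> (q j \<circ> c) (seg a b)" by (rule path_homotopic_eq_on[OF pq[OF c]]) (use cq in auto)
            show ?thesis unfolding w_def word_def path_join_compose path_rev_compose
              by (intro path_homotopic_join path_homotopic_rev 1 2 3) (use ca cb in auto)
          qed
          ultimately show "E (word a b)"
            using homot q_boundary[OF jd(1)] ca cb by (metis comp_apply path_join_ends path_rev_ends(1) w_def)
        qed
      qed
    qed
  qed
  then have E: "E (word 0 1)" by (simp add: Good_def)
  have seg01: "seg 0 1 = p" by (simp add: seg_def)
  \<comment> \<open>at a vertex the added path is constant, so the word of the whole path is the path\<close>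
  have gc: "path_homotopic \<Gamma> (\<gamma> v) (\<lambda>t. v)" if v: "v \<in> A" for v
  proof -
    have vB: "v \<in> B" using v AB by blast
    have "P (1, v) \<in> A" using P(3) v by simp
    then have "\<gamma> v = (\<lambda>t. P (t, v))" using \<gamma>P vB by blast
    then show ?thesis by (intro path_homotopic_eq_on) (use \<gamma>(1)[OF vB] P(3) v in auto)
  qed
  have "path_homotopic \<Gamma> (word 0 1) (path_join (path_rev (\<lambda>t. p 0)) (path_join p (\<lambda>t. p 1)))"
    unfolding word_def seg01
    by (intro path_homotopic_join path_homotopic_rev gc path_homotopic_refl) (use p g in auto)
  also have "path_homotopic \<Gamma> (path_join (path_rev (\<lambda>t. p 0)) (path_join p (\<lambda>t. p 1))) (path_join (\<lambda>t. p 0) p)"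
    unfolding path_rev_def
    by (rule path_homotopic_join[OF path_homotopic_refl path_homotopic_const_right[OF p(1)]]) (use p AB topspace_sub_B in auto)
  also have "path_homotopic \<Gamma> (path_join (\<lambda>t. p 0) p) p" by (rule path_homotopic_const_left[OF p(1)])
  finally show ?thesis using homot E word_ends[of 0 1] by auto
qed

end

section \<open>Equivariant extension over cells\<close>

context G_attachment
begin

lemma base_in_fixed: "i \<in> I \<Longrightarrow> d \<in> ball_pts n \<Longrightarrow> q i (S i, d) \<in> fixed_set X (S i)"
proof -
  assume i: "i \<in> I" and d: "d \<in> ball_pts n"
  have "(i, S i) \<in> fixed_cells (S i)"
    using i S[OF i] self_lcoset[OF S[OF i]] coset_join3[OF subgroup.mem_carrier[OF S[OF i]] S[OF i]] by (auto simp: fixed_cells_def)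
  from fixed_cells_fixed[OF S[OF i] this d] show ?thesis by simp
qed

lemma base_in_B: "i \<in> I \<Longrightarrow> d \<in> ball_pts n \<Longrightarrow> q i (S i, d) \<in> B"
  using all.q_in_B[of "(i, S i)" d] self_lcoset[OF S] by auto

lemma base_cont:
  assumes i: "i \<in> I"
  shows "continuous_map (disc n) (subtopology (spc X) (B \<inter> fixed_set X (S i))) (\<lambda>d. q i (S i, d))"
proof -
  have "continuous_map (disc n) (subtopology (spc X) B) (\<lambda>d. q i (S i, d))"
    using all.q_cont[of "(i, S i)"] i self_lcoset[OF S[OF i]] by (simp add: char_map_def)
  then show ?thesis using base_in_fixed[OF i] by (auto simp: continuous_map_in_subtopology)
qed

lemma base_boundary: "i \<in> I \<Longrightarrow> d \<in> disc_boundary n \<Longrightarrow> q i (S i, d) \<in> A"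
  using q_boundary[OF _ self_lcoset[OF S]] by blast

lemma q_translate:
  assumes i: "i \<in> I" and g: "g \<in> carrier G" and d: "d \<in> ball_pts n"
  shows "q i (g <# S i, d) = act X g (q i (S i, d))"
  using q_act[OF i g self_lcoset[OF S[OF i]] d] by simp

text \<open>Every equivariant cell is the orbit of its cell over the trivial coset.\<close>

lemma orbit_cases:
  assumes b: "b \<in> B"
  obtains "b \<in> A" | i g d where "i \<in> I" "g \<in> carrier G" "d \<in> ball_pts n" "b = act X g (q i (S i, d))"
proof (cases "b \<in> A")
  case False
  then obtain j d where jd: "j \<in> cells" "d \<in> all.int_pts" "b = char_map j d" using all.q_surj[OF b] by blast
  then obtain i C where iC: "j = (i, C)" "i \<in> I" "C \<in> lcosets (S i)" by auto
  then obtain g where g: "g \<in> carrier G" "C = g <# S i" by (auto elim: lcosetE)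
  have "b = act X g (q i (S i, d))" using q_translate[OF iC(2) g(1), of d] jd iC g by simp
  then show ?thesis using that(2) iC(2) g(1) jd(2) by blast
qed (use that in blast)

text \<open>On an equivariant cell of type \<open>S\<close>, an equivariant homotopy is determined by its restriction to
  the cell over the trivial coset, and that restriction can be any homotopy in the \<open>S\<close>-fixed points.
  This reduces equivariant extension problems to ordinary ones.\<close>

lemma equivariant_homotopy_extension:
  fixes T :: "('g, 't) gcw_data"
  assumes T: "G_space G T"
    and F0: "continuous_map (prod_topology I01 (subtopology (spc X) A)) (spc T) F0"
    and A: "\<And>g a. g \<in> carrier G \<Longrightarrow> a \<in> A \<Longrightarrow> act X g a \<in> A"
    and eq: "\<And>g t a. g \<in> carrier G \<Longrightarrow> t \<in> {0..1} \<Longrightarrow> a \<in> A \<Longrightarrow> F0 (t, act X g a) = act T g (F0 (t, a))"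
    and e: "\<And>i. i \<in> I \<Longrightarrow> continuous_map (prod_topology I01 (disc n)) (fixed_space T (S i)) (e i)"
    and agree: "\<And>i t d. i \<in> I \<Longrightarrow> t \<in> {0..1} \<Longrightarrow> d \<in> disc_boundary n \<Longrightarrow> e i (t, d) = F0 (t, q i (S i, d))"
  obtains F where "continuous_map (prod_topology I01 (subtopology (spc X) B)) (spc T) F"
    "\<And>t a. t \<in> {0..1} \<Longrightarrow> a \<in> A \<Longrightarrow> F (t, a) = F0 (t, a)"
    "\<And>g t b. g \<in> carrier G \<Longrightarrow> t \<in> {0..1} \<Longrightarrow> b \<in> B \<Longrightarrow> F (t, act X g b) = act T g (F (t, b))"
    "\<And>i t d. i \<in> I \<Longrightarrow> t \<in> {0..1} \<Longrightarrow> d \<in> ball_pts n \<Longrightarrow> F (t, q i (S i, d)) = e i (t, d)"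
proof -
  interpret T: G_space_loc G T by unfold_locales (rule T)
  have "\<exists>g. g \<in> carrier G \<and> C = g <# S i" if "C \<in> lcosets (S i)" for i C using that by (auto elim: lcosetE)
  note ex = this
  \<comment> \<open>values on the cell over \<open>C\<close> are translated by a representative of \<open>C\<close>; the choice does not matter since \<open>e i\<close> takes values in the points fixed by \<open>S i\<close>\<close>
  define r where "r i C = (SOME g. g \<in> carrier G \<and> C = g <# S i)" for i C
  have r: "r i C \<in> carrier G \<and> C = r i C <# S i" if "C \<in> lcosets (S i)" for i C
    unfolding r_def by (rule someI_ex[OF ex[OF that]])
  define e' where "e' = (\<lambda>(i, C) x. act T (r i C) (e i x))"
  have e_fix: "e i (t, d) \<in> fixed_set T (S i)" if "i \<in> I" "t \<in> {0..1}" "d \<in> ball_pts n" for i t d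
    using continuous_map_funspace[OF e[OF that(1)]] that by auto
  have e_top: "e i (t, d) \<in> topspace (spc T)" if "i \<in> I" "t \<in> {0..1}" "d \<in> ball_pts n" for i t d
    using e_fix[OF that] by (simp add: fixed_set_def)
  have ee: "act T (r i (g <# S i)) (e i (t, d)) = act T g (e i (t, d))"
    if i: "i \<in> I" and t: "t \<in> {0..1}" and d: "d \<in> ball_pts n" and g: "g \<in> carrier G" for i t d g
  proof -
    have rr: "r i (g <# S i) \<in> carrier G" "g <# S i = r i (g <# S i) <# S i" using r[OF lcosetI[OF g]] by blast+
    obtain s where s: "s \<in> S i" "r i (g <# S i) = g \<otimes> s" using lcoset_eqD[OF S[OF i] g rr(1) rr(2)] by blast
    have "s \<in> carrier G" using subgroup.mem_carrier[OF S[OF i] s(1)] .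
    then show ?thesis using s T.act_mult[OF g _ e_top[OF i t d]] e_fix[OF i t d] by (simp add: fixed_set_def)
  qed
  obtain F where F: "continuous_map (prod_topology I01 (subtopology (spc X) B)) (spc T) F"
    "\<And>t a. t \<in> {0..1} \<Longrightarrow> a \<in> A \<Longrightarrow> F (t, a) = F0 (t, a)"
    "\<And>j t d. j \<in> cells \<Longrightarrow> t \<in> {0..1} \<Longrightarrow> d \<in> ball_pts n \<Longrightarrow> F (t, char_map j d) = e' j (t, d)"
  proof (rule all.continuous_extension[OF F0, of e'])
    fix j assume "j \<in> cells"
    then obtain i C where iC: "j = (i, C)" "i \<in> I" "C \<in> lcosets (S i)" by auto
    have "continuous_map (prod_topology I01 (disc n)) (spc T) (e i)"
      using e[OF iC(2)] by (simp add: fixed_space_def continuous_map_in_subtopology)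
    from continuous_map_compose[OF this T.act_cont[of "r i C"]] r[OF iC(3)]
    show "continuous_map (prod_topology I01 (disc n)) (spc T) (e' j)" by (simp add: e'_def iC o_def)
    fix t :: real and d assume td: "t \<in> {0..1}" "d \<in> disc_boundary n"
    have "d \<in> ball_pts n" using td disc_boundary_subset by blast
    from q_translate[OF iC(2) conjunct1[OF r[OF iC(3)]] this]
    have "act X (r i C) (q i (S i, d)) = q i (C, d)" unfolding conjunct2[OF r[OF iC(3)], symmetric] by (rule sym)
    then show "e' j (t, d) = F0 (t, char_map j d)"
      using agree[OF iC(2) td] eq[of "r i C" t "q i (S i, d)"] r[OF iC(3)] td base_boundary[OF iC(2) td(2)] by (simp add: e'_def iC)
  qed blast
  have Fq: "F (t, act X g (q i (S i, d))) = act T g (e i (t, d))"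
    if "i \<in> I" "t \<in> {0..1}" "d \<in> ball_pts n" "g \<in> carrier G" for i t d g
    using F(3)[of "(i, g <# S i)" t d] q_translate[OF that(1,4,3)] ee[OF that] lcosetI[OF that(4)] that by (simp add: e'_def)
  show ?thesis
  proof (rule that[OF F(1,2)])
    fix g t b assume g: "g \<in> carrier G" and t: "t \<in> {0..1::real}" and b: "b \<in> B"
    from b show "F (t, act X g b) = act T g (F (t, b))"
    proof (cases rule: orbit_cases)
      case 1
      then show ?thesis using F(2)[OF t] eq[OF g t] A[OF g] by simp
    next
      case (2 i h d)
      have qX: "q i (S i, d) \<in> topspace (spc X)" using base_in_B[OF 2(1,3)] BX by blast
      have "act X g b = act X (g \<otimes> h) (q i (S i, d))" using act_mult[OF g 2(2) qX] 2 by simp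
      then have "F (t, act X g b) = act T (g \<otimes> h) (e i (t, d))" using Fq[OF 2(1) t 2(3)] g 2(2) by simp
      also have "\<dots> = act T g (act T h (e i (t, d)))" using T.act_mult[OF g 2(2) e_top[OF 2(1) t 2(3)]] .
      finally show ?thesis using Fq[OF 2(1) t 2(3,2)] 2(4) by simp
    qed
  next
    fix i t d assume "i \<in> I" "t \<in> {0..1::real}" "d \<in> ball_pts n"
    then show "F (t, q i (S i, d)) = e i (t, d)"
      using Fq[of i t d \<one>] act_one T.act_one e_top base_in_B[of i d] BX by auto
  qed blast
qed

lemma continuous_map_const_time:
  assumes "continuous_map Z W f" shows "continuous_map (prod_topology I01 Z) W (\<lambda>x. f (snd x))"
  using continuous_map_compose[OF continuous_map_snd assms] by (simp add: o_def)

text \<open>A map is treated as a homotopy that does not depend on time.\<close>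

lemma equivariant_map_extension:
  fixes T :: "('g, 't) gcw_data"
  assumes T: "G_space G T"
    and f0: "continuous_map (subtopology (spc X) A) (spc T) f0"
    and A: "\<And>g a. g \<in> carrier G \<Longrightarrow> a \<in> A \<Longrightarrow> act X g a \<in> A"
    and eq: "\<And>g a. g \<in> carrier G \<Longrightarrow> a \<in> A \<Longrightarrow> f0 (act X g a) = act T g (f0 a)"
    and e: "\<And>i. i \<in> I \<Longrightarrow> continuous_map (disc n) (fixed_space T (S i)) (e i)"
    and agree: "\<And>i d. i \<in> I \<Longrightarrow> d \<in> disc_boundary n \<Longrightarrow> e i d = f0 (q i (S i, d))"
  obtains f where "continuous_map (subtopology (spc X) B) (spc T) f"
    "\<And>a. a \<in> A \<Longrightarrow> f a = f0 a"
    "\<And>g b. g \<in> carrier G \<Longrightarrow> b \<in> B \<Longrightarrow> f (act X g b) = act T g (f b)"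
    "\<And>i d. i \<in> I \<Longrightarrow> d \<in> ball_pts n \<Longrightarrow> f (q i (S i, d)) = e i d"
proof -
  obtain F where F: "continuous_map (prod_topology I01 (subtopology (spc X) B)) (spc T) F"
    "\<And>t a. t \<in> {0..1} \<Longrightarrow> a \<in> A \<Longrightarrow> F (t, a) = f0 (snd (t, a))"
    "\<And>g t b. g \<in> carrier G \<Longrightarrow> t \<in> {0..1} \<Longrightarrow> b \<in> B \<Longrightarrow> F (t, act X g b) = act T g (F (t, b))"
    "\<And>i t d. i \<in> I \<Longrightarrow> t \<in> {0..1} \<Longrightarrow> d \<in> ball_pts n \<Longrightarrow> F (t, q i (S i, d)) = e i (snd (t, d))"
    by (rule equivariant_homotopy_extension[OF T continuous_map_const_time[OF f0] A, of "\<lambda>i x. e i (snd x)"])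
      (use eq agree continuous_map_const_time[OF e] in auto)
  have c: "continuous_map (subtopology (spc X) B) (prod_topology I01 (subtopology (spc X) B)) (\<lambda>b. (0, b))"
    by (intro continuous_map_pairedI) auto
  show ?thesis
  proof (rule that)
    show "continuous_map (subtopology (spc X) B) (spc T) (\<lambda>b. F (0, b))"
      using continuous_map_compose[OF c F(1)] by (simp add: o_def)
  qed (use F(2)[of 0] F(3)[of _ 0] F(4)[of _ 0] in auto)
qed

end

context G_CW
begin

text \<open>The offset \<open>m\<close> allows the sequence to start at a skeleton on which the first map has been
  constructed by hand.\<close>

lemma glue_over_skeleta:
  assumes F: "\<And>n. continuous_map (prod_topology I01 (subtopology (spc X) (skel X (n + m)))) T (F n)"
    and agree: "\<And>n t x. t \<in> {0..1} \<Longrightarrow> x \<in> skel X (n + m) \<Longrightarrow> F (Suc n) (t, x) = F n (t, x)"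
  obtains H where "continuous_map (prod_topology I01 (spc X)) T H"
    "\<And>n t x. t \<in> {0..1} \<Longrightarrow> x \<in> skel X (n + m) \<Longrightarrow> H (t, x) = F n (t, x)"
proof -
  have agree': "F (n + k) (t, x) = F n (t, x)" if "t \<in> {0..1}" "x \<in> skel X (n + m)" for n k t x
  proof (induction k)
    case (Suc k)
    have "x \<in> skel X (n + k + m)" using that(2) skel_mono[of "n + m" "n + k + m"] by auto
    then show ?case using Suc agree[OF that(1), of x "n + k"] by simp
  qed simp
  define N where "N x = (LEAST n. x \<in> skel X (n + m))" for x
  define H where "H = (\<lambda>(t, x). F (N x) (t, x))"
  have HF: "H (t, x) = F n (t, x)" if "t \<in> {0..1}" "x \<in> skel X (n + m)" for n t x
  proof -
    have "x \<in> skel X (N x + m)" "N x \<le> n" unfolding N_def using that(2) by (auto intro: LeastI Least_le)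
    then show ?thesis using agree'[OF that(1), of x "N x" "n - N x"] by (simp add: H_def)
  qed
  have top: "topspace (subtopology (spc X) (skel X n)) = skel X n" for n using skel_topspace[of n] by auto
  have "continuous_map (prod_topology I01 (spc X)) T H"
  proof (rule continuous_map_I01_final[where X = "subtopology (spc X) (skel X m)" and p = "\<lambda>x. x" and J = UNIV
        and D = "\<lambda>n. subtopology (spc X) (skel X (n + m))" and q = "\<lambda>_ x. x"])
    fix U assume U: "U \<subseteq> topspace (spc X)"
      and o: "\<And>n. n \<in> UNIV \<Longrightarrow> openin (subtopology (spc X) (skel X (n + m))) {x \<in> topspace (subtopology (spc X) (skel X (n + m))). x \<in> U}"
    have "openin (subtopology (spc X) (skel X n)) (U \<inter> skel X n)" for n
    proof -
      have "{x \<in> topspace (subtopology (spc X) (skel X (n + m))). x \<in> U} = U \<inter> skel X (n + m)" unfolding top by auto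
      then have "openin (subtopology (spc X) (skel X (n + m))) (U \<inter> skel X (n + m))" using o[of n] by simp
      then obtain V where "openin (spc X) V" "U \<inter> skel X (n + m) = V \<inter> skel X (n + m)" by (auto simp: openin_subtopology)
      moreover have "skel X n \<subseteq> skel X (n + m)" by (rule skel_mono) simp
      ultimately have "U \<inter> skel X n = V \<inter> skel X n" by blast
      then show ?thesis using \<open>openin (spc X) V\<close> by (auto simp: openin_subtopology)
    qed
    then show "openin (spc X) U" using colimit U by (simp add: colimit_topology_def)
  next
    show "topspace (spc X) \<subseteq> (\<lambda>x. x) ` topspace (subtopology (spc X) (skel X m)) \<union> (\<Union>n\<in>UNIV. (\<lambda>x. x) ` topspace (subtopology (spc X) (skel X (n + m))))"
    proof
      fix x assume "x \<in> topspace (spc X)"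
      then obtain n where "x \<in> skel X n" using topspace_skel by blast
      then have "x \<in> skel X (n + m)" using skel_mono[of n "n + m"] by auto
      then show "x \<in> (\<lambda>x. x) ` topspace (subtopology (spc X) (skel X m)) \<union> (\<Union>n\<in>UNIV. (\<lambda>x. x) ` topspace (subtopology (spc X) (skel X (n + m))))"
        unfolding top by auto
    qed
    have *: "continuous_map (prod_topology I01 (subtopology (spc X) (skel X (n + m)))) T (\<lambda>(t, x). H (t, x))" for n
      by (rule continuous_map_eq[OF F[of n]]) (use HF top in auto)
    show "continuous_map (prod_topology I01 (subtopology (spc X) (skel X m))) T (\<lambda>(t, x). H (t, x))" using *[of 0] by simp
    show "continuous_map (prod_topology I01 (subtopology (spc X) (skel X (n + m)))) T (\<lambda>(t, x). H (t, x))" for n by (rule *)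
  qed auto
  then show ?thesis using that HF by blast
qed

lemma glue_maps_over_skeleta:
  assumes f: "\<And>n. continuous_map (subtopology (spc X) (skel X (n + m))) T (f n)"
    and agree: "\<And>n x. x \<in> skel X (n + m) \<Longrightarrow> f (Suc n) x = f n x"
  obtains h where "continuous_map (spc X) T h" "\<And>n x. x \<in> skel X (n + m) \<Longrightarrow> h x = f n x"
proof -
  have c: "continuous_map (prod_topology I01 (subtopology (spc X) (skel X (n + m)))) T (\<lambda>x. f n (snd x))" for n
    using continuous_map_compose[OF continuous_map_snd f[of n]] by (simp add: o_def)
  obtain H where H: "continuous_map (prod_topology I01 (spc X)) T H"
    "\<And>n t x. t \<in> {0..1} \<Longrightarrow> x \<in> skel X (n + m) \<Longrightarrow> H (t, x) = f n (snd (t, x))"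
    by (rule glue_over_skeleta[of m T "\<lambda>n x. f n (snd x)"]) (use c agree in auto)
  have i: "continuous_map (spc X) (prod_topology I01 (spc X)) (\<lambda>x. (0, x))" by (intro continuous_map_pairedI) auto
  show ?thesis
    by (rule that[of "\<lambda>x. H (0, x)"]) (use continuous_map_compose[OF i H(1)] H(2)[of 0] in \<open>auto simp: o_def\<close>)
qed

end

section \<open>Uniqueness up to equivariant homotopy\<close>

text \<open>On an \<open>n\<close>-cell a homotopy between given maps is prescribed on the boundary of the cylinder, which
  is an \<open>n\<close>-sphere.\<close>

lemma box_extension:
  assumes n: "n > 0" and null: "spheres_null n X"
    and f0: "continuous_map (disc n) X f0" and f1: "continuous_map (disc n) X f1"
    and h: "continuous_map (prod_topology I01 (top_of_set (disc_boundary n))) X h"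
    and h0: "\<And>d. d \<in> disc_boundary n \<Longrightarrow> h (0, d) = f0 d" and h1: "\<And>d. d \<in> disc_boundary n \<Longrightarrow> h (1, d) = f1 d"
  obtains F where "continuous_map (prod_topology I01 (disc n)) X F"
    "\<And>d. d \<in> ball_pts n \<Longrightarrow> F (0, d) = f0 d" "\<And>d. d \<in> ball_pts n \<Longrightarrow> F (1, d) = f1 d"
    "\<And>t d. t \<in> {0..1} \<Longrightarrow> d \<in> disc_boundary n \<Longrightarrow> F (t, d) = h (t, d)"
proof -
  define k where "k = (\<lambda>(t::real, d). if t = 0 then f0 d else if t = 1 then f1 d else h (t, d))"
  define Bd where "Bd = {(t::real, x). t = 0 \<or> t = 1 \<or> x \<in> disc_boundary n}"
  define V where "V = {0..1::real} \<times> ball_pts n"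
  define R where "R = (\<lambda>i::nat. if i = 0 then {0} \<times> ball_pts n else if i = 1 then {1} \<times> ball_pts n else {0..1::real} \<times> disc_boundary n)"
  define f where "f = (\<lambda>i::nat. if i = 0 then (\<lambda>x::real \<times> (nat \<Rightarrow> real). f0 (snd x)) else if i = 1 then (\<lambda>x. f1 (snd x)) else h)"
  have V: "prod_topology I01 (disc n) = top_of_set V" by (simp add: I01_disc_eq V_def)
  have sub: "subtopology (prod_topology I01 (disc n)) Bd = top_of_set (V \<inter> Bd)" unfolding V by (simp add: subtopology_subtopology)
  have RV: "R i \<subseteq> V \<inter> Bd" for i using disc_boundary_subset by (auto simp: R_def V_def Bd_def)
  have clb: "closed (disc_boundary n)" "closed (ball_pts n)"
    using compact_sphere_pts compact_ball_pts by (auto intro: compact_imp_closed)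
  have k: "continuous_map (top_of_set (V \<inter> Bd)) X k"
  proof (rule pasting_lemma_closed[where I = "{0, 1, 2}" and T = R and f = f])
    show "closedin (top_of_set (V \<inter> Bd)) (R i)" if "i \<in> {0, 1, 2}" for i
    proof (rule closed_subset[OF RV])
      show "closed (R i)" using clb by (auto simp: R_def intro!: closed_Times)
    qed
    show "continuous_map (subtopology (top_of_set (V \<inter> Bd)) (R i)) X (f i)" if "i \<in> {0, 1, 2}" for i
    proof -
      have e: "subtopology (top_of_set (V \<inter> Bd)) (R i) = top_of_set (R i)"
        using RV[of i] by (simp add: subtopology_subtopology Int_absorb1)
      have s: "continuous_map (top_of_set (R i)) (disc n) snd"
      proof -
        have "continuous_on (R i) snd" by (intro continuous_on_snd continuous_on_id)
        moreover have "snd \<in> R i \<rightarrow> ball_pts n" using RV[of i] by (auto simp: V_def)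
        ultimately show ?thesis by (subst disc_eq) (simp only: continuous_map_subtopology_eu)
      qed
      have "continuous_map (top_of_set (R i)) X (f i)"
        using that continuous_map_compose[OF s f0] continuous_map_compose[OF s f1] h by (auto simp: f_def R_def o_def)
      then show ?thesis unfolding e .
    qed
    show "f i x = f j x" if "i \<in> {0, 1, 2}" "j \<in> {0, 1, 2}" "x \<in> topspace (top_of_set (V \<inter> Bd)) \<inter> R i \<inter> R j" for i j x
      using that h0 h1 by (auto simp: f_def R_def split: if_splits)
    show "\<exists>j. j \<in> {0, 1, 2} \<and> x \<in> R j \<and> k x = f j x" if "x \<in> topspace (top_of_set (V \<inter> Bd))" for x
    proof -
      obtain t d where x: "x = (t, d)" by (cases x)
      consider "t = 0" | "t = 1" "t \<noteq> 0" | "t \<noteq> 0" "t \<noteq> 1" by blast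
      then show ?thesis
      proof cases
        case 1 then show ?thesis using that by (intro exI[of _ 0]) (auto simp: x R_def V_def k_def f_def)
      next
        case 2 then show ?thesis using that by (intro exI[of _ 1]) (auto simp: x R_def V_def k_def f_def)
      next
        case 3 then show ?thesis using that by (intro exI[of _ 2]) (auto simp: x R_def V_def k_def f_def Bd_def)
      qed
    qed
  qed simp
  then have k': "continuous_map (subtopology (prod_topology I01 (disc n)) {(t, x). t = 0 \<or> t = 1 \<or> x \<in> disc_boundary n}) X k"
    unfolding V subtopology_subtopology Bd_def .
  obtain F where F: "continuous_map (prod_topology I01 (disc n)) X F"
    "\<And>t x. t \<in> {0..1} \<Longrightarrow> x \<in> ball_pts n \<Longrightarrow> t = 0 \<or> t = 1 \<or> x \<in> disc_boundary n \<Longrightarrow> F (t, x) = k (t, x)"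
    using box_boundary_extends[OF n null k'] by blast
  show ?thesis
  proof (rule that[OF F(1)])
    show "F (t, d) = h (t, d)" if "t \<in> {0..1}" "d \<in> disc_boundary n" for t d
    proof -
      have "d \<in> ball_pts n" using that disc_boundary_subset by blast
      then show ?thesis using F(2)[OF that(1), of d] that h0 h1 by (auto simp: k_def)
    qed
  qed (use F(2)[of 0] F(2)[of 1] in \<open>auto simp: k_def\<close>)
qed

locale G_CW_pair = Y: G_CW G Y + T: G_CW G T for G :: "('g, 'z) monoid_scheme" (structure) and Y :: "('g, 'y) gcw_data" and T :: "('g, 't) gcw_data"
begin

lemma equivariant_fixed:
  assumes "\<And>g y. g \<in> carrier G \<Longrightarrow> y \<in> Z \<Longrightarrow> f (act Y g y) = act T g (f y)" "f \<in> Z \<rightarrow> topspace (spc T)"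
    and "subgroup H G" "y \<in> Z" "y \<in> fixed_set Y H"
  shows "f y \<in> fixed_set T H"
  using assms subgroup.mem_carrier[OF assms(3)] unfolding fixed_set_def by (auto simp: Pi_iff) metis

text \<open>Converts homotopies of paths on \<open>[0,1]\<close> into homotopies on the one-dimensional disc.\<close>

lemma interval_coord_cont:
  "continuous_map (prod_topology I01 (disc 1)) (prod_topology I01 I01) (\<lambda>(t, d). (t, (d 0 + 1) / 2))"
proof -
  have "continuous_on ({0..1::real} \<times> ball_pts 1) (\<lambda>x. (fst x, (snd x 0 + 1) / 2))"
    by (intro continuous_intros continuous_on_coord[OF continuous_on_snd[OF continuous_on_id]]) auto
  moreover have "(d 0 + 1) / 2 \<in> {0..1}" if "d \<in> ball_pts 1" for d using ball_pts_1(2)[OF that] by auto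
  ultimately show ?thesis unfolding I01_disc_eq prod_top_of_set continuous_map_subtopology_eu
    by (auto simp: case_prod_unfold simp del: One_nat_def)
qed

text \<open>The maps agree on vertices. On an edge of type \<open>S\<close> they represent the same morphism in the
  fundamental groupoid of the \<open>S\<close>-fixed points, which provides a homotopy relative to the end points.
  On cells of dimension at least 2 the homotopy extends because spheres in fixed point sets of \<open>T\<close>
  are null homotopic.\<close>

lemma equivariant_homotopy_unique:
  assumes f: "cellular_G_map G Y T f" and f': "cellular_G_map G Y T f'"
    and eq: "orb_trans_eq G (Pi1 Y) (Pi1_map T f) (Pi1_map T f')"
    and null: "\<And>H n. subgroup H G \<Longrightarrow> n \<ge> 2 \<Longrightarrow> spheres_null n (fixed_space T H)"
  shows "G_homotopic G Y T f f'"
proof -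
  have fc: "continuous_map (spc Y) (spc T) f" "continuous_map (spc Y) (spc T) f'"
    and feq: "\<And>g y. g \<in> carrier G \<Longrightarrow> y \<in> topspace (spc Y) \<Longrightarrow> f (act Y g y) = act T g (f y)"
      "\<And>g y. g \<in> carrier G \<Longrightarrow> y \<in> topspace (spc Y) \<Longrightarrow> f' (act Y g y) = act T g (f' y)"
    using f f' by (auto simp: cellular_G_map_def G_equivariant_def)
  have ftop: "f \<in> topspace (spc Y) \<rightarrow> topspace (spc T)" "f' \<in> topspace (spc Y) \<rightarrow> topspace (spc T)"
    using fc continuous_map_funspace by auto
  have fixd: "f y \<in> fixed_set T H" "f' y \<in> fixed_set T H" if "subgroup H G" "y \<in> fixed_set Y H" for y H
    using equivariant_fixed[OF feq(1) ftop(1) that(1)] equivariant_fixed[OF feq(2) ftop(2) that(1)] that(2)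
    by (auto simp: fixed_set_def)
  have fH: "continuous_map (fixed_space Y H) (fixed_space T H) f" "continuous_map (fixed_space Y H) (fixed_space T H) f'"
    if "subgroup H G" for H
    using fc fixd[OF that] unfolding fixed_space_def
    by (auto simp: continuous_map_in_subtopology intro: continuous_map_from_subtopology)
  have f0: "f y = f' y" if "y \<in> skel Y 0" for y
  proof -
    have "y \<in> Ob (val (Pi1 Y) {\<one>})"
      using that Y.skel_topspace[of 0] by (auto simp: Pi1_def Y.fixed_one)
    then have "on_ob (Pi1_map T f {\<one>}) y = on_ob (Pi1_map T f' {\<one>}) y"
      using eq Y.triv_subgroup unfolding orb_trans_eq_def gpd_map_eq_def by blast
    then show ?thesis by (simp add: Pi1_map_def)
  qed
  have bpath: "path_homotopic (fixed_space T H) (f \<circ> c) (f' \<circ> c)"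
    if H: "subgroup H G" and c: "pathin (fixed_space Y H) c" "c 0 \<in> skel Y 0" "c 1 \<in> skel Y 0" for H c
  proof -
    have "path_class (fixed_space Y H) c \<in> Mor (val (Pi1 Y) H)" using c by (auto simp: Pi1_def intro: Mor_fundI)
    then have "on_mor (Pi1_map T f H) (path_class (fixed_space Y H) c) = on_mor (Pi1_map T f' H) (path_class (fixed_space Y H) c)"
      using eq H unfolding orb_trans_eq_def gpd_map_eq_def by blast
    then have "path_class (fixed_space T H) (f \<circ> c) = path_class (fixed_space T H) (f' \<circ> c)"
      using on_mor_fund_map[OF fH(1)[OF H] c(1)] on_mor_fund_map[OF fH(2)[OF H] c(1)] by (simp add: Pi1_map_def)
    then show ?thesis
      using path_class_eq_iff[OF pathin_compose[OF c(1) fH(1)[OF H]] pathin_compose[OF c(1) fH(2)[OF H]]] by simp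
  qed
  define good where "good n F \<longleftrightarrow> continuous_map (prod_topology I01 (subtopology (spc Y) (skel Y n))) (spc T) F \<and>
     (\<forall>g\<in>carrier G. \<forall>t\<in>{0..1}. \<forall>y\<in>skel Y n. F (t, act Y g y) = act T g (F (t, y))) \<and>
     (\<forall>y\<in>skel Y n. F (0, y) = f y \<and> F (1, y) = f' y)" for n and F :: "real \<times> 'y \<Rightarrow> 't"
  \<comment> \<open>one step of the induction, given a homotopy on each cell\<close>
  have step: "\<exists>F'. good (Suc n) F' \<and> (\<forall>t\<in>{0..1}. \<forall>y\<in>skel Y n. F' (t, y) = F (t, y))"
    if att: "G_attachment G Y (Suc n) (skel Y n) (skel Y (Suc n)) I S q" and F: "good n F"
      and cell: "\<And>i. i \<in> I \<Longrightarrow> \<exists>e. continuous_map (prod_topology I01 (disc (Suc n))) (fixed_space T (S i)) e \<and>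
          (\<forall>d\<in>ball_pts (Suc n). e (0, d) = f (q i (S i, d)) \<and> e (1, d) = f' (q i (S i, d))) \<and>
          (\<forall>t\<in>{0..1}. \<forall>d\<in>disc_boundary (Suc n). e (t, d) = F (t, q i (S i, d)))"
    for n I S q F
  proof -
    interpret a: G_attachment G Y "Suc n" "skel Y n" "skel Y (Suc n)" I S q by (rule att)
    obtain e where e: "\<And>i. i \<in> I \<Longrightarrow> continuous_map (prod_topology I01 (disc (Suc n))) (fixed_space T (S i)) (e i)"
      "\<And>i d. i \<in> I \<Longrightarrow> d \<in> ball_pts (Suc n) \<Longrightarrow> e i (0, d) = f (q i (S i, d)) \<and> e i (1, d) = f' (q i (S i, d))"
      "\<And>i t d. i \<in> I \<Longrightarrow> t \<in> {0..1} \<Longrightarrow> d \<in> disc_boundary (Suc n) \<Longrightarrow> e i (t, d) = F (t, q i (S i, d))"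
      using cell by metis
    have Fc: "continuous_map (prod_topology I01 (subtopology (spc Y) (skel Y n))) (spc T) F"
      and Feq: "\<And>g t a. g \<in> carrier G \<Longrightarrow> t \<in> {0..1} \<Longrightarrow> a \<in> skel Y n \<Longrightarrow> F (t, act Y g a) = act T g (F (t, a))"
      and Fe: "\<And>y. y \<in> skel Y n \<Longrightarrow> F (0, y) = f y \<and> F (1, y) = f' y" using F by (auto simp: good_def)
    obtain F' where F': "continuous_map (prod_topology I01 (subtopology (spc Y) (skel Y (Suc n)))) (spc T) F'"
      "\<And>t a. t \<in> {0..1} \<Longrightarrow> a \<in> skel Y n \<Longrightarrow> F' (t, a) = F (t, a)"
      "\<And>g t b. g \<in> carrier G \<Longrightarrow> t \<in> {0..1} \<Longrightarrow> b \<in> skel Y (Suc n) \<Longrightarrow> F' (t, act Y g b) = act T g (F' (t, b))"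
      "\<And>i t d. i \<in> I \<Longrightarrow> t \<in> {0..1} \<Longrightarrow> d \<in> ball_pts (Suc n) \<Longrightarrow> F' (t, q i (S i, d)) = e i (t, d)"
      using a.equivariant_homotopy_extension[OF T.G_space Fc Y.act_skel Feq e(1,3)] by blast
    have "F' (0, y) = f y \<and> F' (1, y) = f' y" if y: "y \<in> skel Y (Suc n)" for y
      using y
    proof (cases rule: a.orbit_cases)
      case 1
      then show ?thesis using F'(2) Fe by auto
    next
      case (2 i g d)
      have b: "q i (S i, d) \<in> skel Y (Suc n)" by (rule a.base_in_B[OF 2(1,3)])
      then have "q i (S i, d) \<in> topspace (spc Y)" using Y.skel_topspace by blast
      then show ?thesis using F'(3)[OF 2(2) _ b] F'(4)[OF 2(1) _ 2(3)] e(2)[OF 2(1,3)] feq 2 by auto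
    qed
    then have "good (Suc n) F'" using F'(1,3) by (auto simp: good_def)
    then show ?thesis using F'(2) by blast
  qed
  have good0: "good 0 (\<lambda>x. f (snd x))"
  proof -
    have "continuous_map (subtopology (spc Y) (skel Y 0)) (spc T) f" by (rule continuous_map_from_subtopology[OF fc(1)])
    from continuous_map_compose[OF continuous_map_snd this]
    show ?thesis using feq f0 Y.skel_topspace[of 0] by (auto simp: good_def o_def)
  qed
  have good1: "\<exists>F. good 1 F"
  proof -
    obtain I S q where att: "G_attachment G Y (Suc 0) (skel Y 0) (skel Y (Suc 0)) I S q" by (rule Y.attach_SucE)
    interpret a: G_attachment G Y "Suc 0" "skel Y 0" "skel Y (Suc 0)" I S q by (rule att)
    have "\<exists>e. continuous_map (prod_topology I01 (disc (Suc 0))) (fixed_space T (S i)) e \<and>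
          (\<forall>d\<in>ball_pts (Suc 0). e (0, d) = f (q i (S i, d)) \<and> e (1, d) = f' (q i (S i, d))) \<and>
          (\<forall>t\<in>{0..1}. \<forall>d\<in>disc_boundary (Suc 0). e (t, d) = f (snd (t, q i (S i, d))))" if i: "i \<in> I" for i
    proof -
      define c where "c t = q i (S i, axis_pt (2 * t - 1))" for t
      have qc: "continuous_map (disc 1) (fixed_space Y (S i)) (\<lambda>d. q i (S i, d))"
        using a.base_cont[OF i] unfolding fixed_space_def by (auto simp: continuous_map_in_subtopology)
      have "pathin (disc 1) (\<lambda>t. axis_pt (2 * t - 1))"
        by (rule pathin_disc_1) (auto intro!: continuous_intros)
      from pathin_compose[OF this qc] have pc: "pathin (fixed_space Y (S i)) c" by (simp add: c_def[abs_def] o_def)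
      have cd: "c ((d 0 + 1) / 2) = q i (S i, d)" if "d \<in> ball_pts 1" for d
      proof -
        have "2 * ((d 0 + 1) / 2) - 1 = d 0" by (simp add: field_simps)
        then have "c ((d 0 + 1) / 2) = q i (S i, axis_pt (d 0))" unfolding c_def by (simp only:)
        also have "axis_pt (d 0) = d" by (rule ball_pts_1(1)[OF that, symmetric])
        finally show ?thesis .
      qed
      have c01: "c 0 \<in> skel Y 0" "c 1 \<in> skel Y 0"
        using a.base_boundary[OF i] disc_boundary_1 by (auto simp: c_def)
      have hom: "path_homotopic (fixed_space T (S i)) (f \<circ> c) (f' \<circ> c)"
        by (rule bpath[OF a.S[OF i] pc c01])
      obtain h where h: "continuous_map (prod_topology I01 I01) (fixed_space T (S i)) h"
        "\<And>x. h (0, x) = (f \<circ> c) x" "\<And>x. h (1, x) = (f' \<circ> c) x"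
        "\<And>t. t \<in> {0..1} \<Longrightarrow> h (t, 0) = (f \<circ> c) 0 \<and> h (t, 1) = (f \<circ> c) 1"
        using homotopic_withE[OF hom[unfolded path_homotopic_def]] by blast
      have bd: "h (t, (d 0 + 1) / 2) = f (q i (S i, d))" if t: "t \<in> {0..1}" and d: "d \<in> disc_boundary 1" for t d
      proof -
        have "d 0 = 1 \<or> d 0 = -1" using d unfolding disc_boundary_1 by (auto simp: axis_pt_def)
        then show ?thesis using h(4)[OF t] cd[of d] d disc_boundary_subset[of 1] by auto
      qed
      show ?thesis
        using continuous_map_compose[OF interval_coord_cont h(1)] bd h(2,3) cd
        by (intro exI[of _ "h \<circ> (\<lambda>(t, d). (t, (d 0 + 1) / 2))"]) auto
    qed
    from step[OF att good0 this] show ?thesis by auto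
  qed
  have stepn: "\<exists>F'. good (Suc n) F' \<and> (\<forall>t\<in>{0..1}. \<forall>y\<in>skel Y n. F' (t, y) = F (t, y))" if n: "n \<ge> 1" and F: "good n F" for n F
  proof -
    obtain I S q where att: "G_attachment G Y (Suc n) (skel Y n) (skel Y (Suc n)) I S q" by (rule Y.attach_SucE)
    interpret a: G_attachment G Y "Suc n" "skel Y n" "skel Y (Suc n)" I S q by (rule att)
    have Fc: "continuous_map (prod_topology I01 (subtopology (spc Y) (skel Y n))) (spc T) F"
      and Feq: "\<And>g t a. g \<in> carrier G \<Longrightarrow> t \<in> {0..1} \<Longrightarrow> a \<in> skel Y n \<Longrightarrow> F (t, act Y g a) = act T g (F (t, a))"
      and Fe: "\<And>y. y \<in> skel Y n \<Longrightarrow> F (0, y) = f y \<and> F (1, y) = f' y" using F by (auto simp: good_def)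
    show ?thesis
    proof (rule step[OF att F])
      fix i assume i: "i \<in> I"
      have qc: "continuous_map (disc (Suc n)) (fixed_space Y (S i)) (\<lambda>d. q i (S i, d))"
        using a.base_cont[OF i] unfolding fixed_space_def by (auto simp: continuous_map_in_subtopology)
      have nz: "Suc n > 0" by simp
      have sn: "spheres_null (Suc n) (fixed_space T (S i))" by (rule null[OF a.S[OF i]]) (use n in simp)
      have c0: "continuous_map (disc (Suc n)) (fixed_space T (S i)) (\<lambda>d. f (q i (S i, d)))"
        "continuous_map (disc (Suc n)) (fixed_space T (S i)) (\<lambda>d. f' (q i (S i, d)))"
        using continuous_map_compose[OF qc fH(1)[OF a.S[OF i]]] continuous_map_compose[OF qc fH(2)[OF a.S[OF i]]] by (simp_all add: o_def)
      have hc: "continuous_map (prod_topology I01 (top_of_set (disc_boundary (Suc n)))) (fixed_space T (S i)) (\<lambda>x. F (fst x, q i (S i, snd x)))"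
      proof -
        have "continuous_map (top_of_set (disc_boundary (Suc n))) (disc (Suc n)) id"
          by (subst disc_eq) (auto simp: disc_boundary_def)
        from continuous_map_compose[OF this qc] have "continuous_map (top_of_set (disc_boundary (Suc n))) (subtopology (spc Y) (skel Y n)) (\<lambda>d. q i (S i, d))"
          using a.base_boundary[OF i] by (auto simp: o_def fixed_space_def continuous_map_in_subtopology)
        from continuous_map_compose[OF continuous_map_prod_I01[OF this] Fc]
        have c: "continuous_map (prod_topology I01 (top_of_set (disc_boundary (Suc n)))) (spc T) (\<lambda>x. F (fst x, q i (S i, snd x)))"
          by (simp only: o_def)
        have "F (t, q i (S i, d)) \<in> fixed_set T (S i)" if t: "t \<in> {0..1}" and d: "d \<in> disc_boundary (Suc n)" for t d
        proof (rule equivariant_fixed[where Z = "skel Y n" and f = "\<lambda>y. F (t, y)"])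
          show "(\<lambda>y. F (t, y)) \<in> skel Y n \<rightarrow> topspace (spc T)"
            using continuous_map_funspace[OF Fc] t Y.skel_topspace[of n] by force
          show "q i (S i, d) \<in> fixed_set Y (S i)" using a.base_in_fixed[OF i] d disc_boundary_subset by blast
        qed (use Feq t a.S[OF i] a.base_boundary[OF i d] in auto)
        then show ?thesis using c unfolding fixed_space_def continuous_map_in_subtopology by auto
      qed
      obtain e where "continuous_map (prod_topology I01 (disc (Suc n))) (fixed_space T (S i)) e"
        "\<And>d. d \<in> ball_pts (Suc n) \<Longrightarrow> e (0, d) = f (q i (S i, d))" "\<And>d. d \<in> ball_pts (Suc n) \<Longrightarrow> e (1, d) = f' (q i (S i, d))"
        "\<And>t d. t \<in> {0..1} \<Longrightarrow> d \<in> disc_boundary (Suc n) \<Longrightarrow> e (t, d) = F (fst (t, d), q i (S i, snd (t, d)))"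
        by (rule box_extension[OF nz sn c0 hc]) (use Fe a.base_boundary[OF i] in auto)
      then show "\<exists>e. continuous_map (prod_topology I01 (disc (Suc n))) (fixed_space T (S i)) e \<and>
          (\<forall>d\<in>ball_pts (Suc n). e (0, d) = f (q i (S i, d)) \<and> e (1, d) = f' (q i (S i, d))) \<and>
          (\<forall>t\<in>{0..1}. \<forall>d\<in>disc_boundary (Suc n). e (t, d) = F (t, q i (S i, d)))"
        by (intro exI[of _ e]) auto
    qed
  qed
  have "\<exists>F. \<forall>n. good (n + 1) (F n) \<and> (\<forall>t\<in>{0..1}. \<forall>y\<in>skel Y (n + 1). F (Suc n) (t, y) = F n (t, y))"
    by (rule dependent_nat_choice) (use good1 stepn in auto)
  then obtain F where F: "\<And>n. good (n + 1) (F n)" "\<And>n t y. t \<in> {0..1} \<Longrightarrow> y \<in> skel Y (n + 1) \<Longrightarrow> F (Suc n) (t, y) = F n (t, y)"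
    by blast
  obtain H where H: "continuous_map (prod_topology I01 (spc Y)) (spc T) H"
    "\<And>n t x. t \<in> {0..1} \<Longrightarrow> x \<in> skel Y (n + 1) \<Longrightarrow> H (t, x) = F n (t, x)"
    by (rule Y.glue_over_skeleta[of 1 "spc T" F]) (use F in \<open>auto simp: good_def\<close>)
  have ex: "\<exists>n. y \<in> skel Y (n + 1)" if "y \<in> topspace (spc Y)" for y
    using that Y.topspace_skel Y.skel_Suc by auto
  show ?thesis unfolding G_homotopic_def
  proof (rule homotopic_withI[OF H(1)])
    fix y assume "y \<in> topspace (spc Y)"
    then obtain n where n: "y \<in> skel Y (n + 1)" using ex by blast
    then show "H (0, y) = f y" "H (1, y) = f' y" using H(2)[OF _ n] F(1)[of n] by (auto simp: good_def)
  next
    fix t :: real assume t: "t \<in> {0..1}"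
    show "G_equivariant G Y T (\<lambda>x. H (t, x))" unfolding G_equivariant_def
    proof (intro ballI)
      fix g y assume g: "g \<in> carrier G" and "y \<in> topspace (spc Y)"
      then obtain n where n: "y \<in> skel Y (n + 1)" using ex by blast
      show "H (t, act Y g y) = act T g (H (t, y))"
        using H(2)[OF t n] H(2)[OF t Y.act_skel[OF g n]] F(1)[of n] g t n by (simp add: good_def)
    qed
  next
    fix h k :: "'y \<Rightarrow> 't" assume "\<And>x. x \<in> topspace (spc Y) \<Longrightarrow> h x = k x"
    then show "G_equivariant G Y T h = G_equivariant G Y T k"
      using Y.act_closed unfolding G_equivariant_def by auto
  qed
qed

end

section \<open>Cancellation of paths\<close>

lemma pathin_edge_param: "pathin (disc (Suc 0)) (\<lambda>t. axis_pt (2 * t - 1))"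
  unfolding One_nat_def[symmetric] by (rule pathin_disc_1) (auto intro!: continuous_intros)

text \<open>Inverses in the fundamental groupoid are unique.\<close>

lemma path_homotopic_rev_unique:
  assumes p: "pathin X p" and r: "pathin X r" and "p 1 = r 0" "r 1 = p 0"
    and h: "path_homotopic X (path_join p r) (\<lambda>t. p 0)"
  shows "path_homotopic X r (path_rev p)"
proof -
  have u: "pathin X (path_rev p)" by (rule pathin_rev[OF p])
  have "path_homotopic X r (path_join (\<lambda>t. r 0) r)"
    by (rule path_homotopic_sym[OF path_homotopic_const_left[OF r]])
  also have "path_homotopic X (path_join (\<lambda>t. r 0) r) (path_join (path_join (path_rev p) p) r)"
    using path_homotopic_join[OF path_homotopic_sym[OF path_homotopic_rev_left[OF p]] path_homotopic_refl[OF r]] assms(3) by simp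
  also have "path_homotopic X (path_join (path_join (path_rev p) p) r) (path_join (path_rev p) (path_join p r))"
    by (rule path_homotopic_assoc[OF u p r]) (use assms(3) in auto)
  also have "path_homotopic X (path_join (path_rev p) (path_join p r)) (path_join (path_rev p) (\<lambda>t. path_rev p 1))"
    by (rule path_homotopic_join[OF path_homotopic_refl[OF u]]) (use h in auto)
  also have "path_homotopic X (path_join (path_rev p) (\<lambda>t. path_rev p 1)) (path_rev p)"
    by (rule path_homotopic_const_right[OF u])
  finally show ?thesis .
qed

lemma path_homotopic_const_if_conjugate:
  assumes l: "pathin X l" and g: "pathin X g" and ends: "l 0 = g 0" "l 1 = g 0"
    and h: "path_homotopic X (path_join (path_join (path_rev g) l) g) (\<lambda>t. g 1)"
  shows "path_homotopic X l (\<lambda>t. g 0)"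
proof -
  have u: "pathin X (path_rev g)" by (rule pathin_rev[OF g])
  have ul: "pathin X (path_join (path_rev g) l)" by (rule pathin_join[OF u l]) (use ends in auto)
  have gu: "path_homotopic X (path_join g (path_rev g)) (\<lambda>t. g 0)" by (rule path_homotopic_rev_right[OF g])
  have "path_homotopic X (path_join (path_rev g) l) (path_join (path_join (path_rev g) l) (\<lambda>t. g 0))"
    using path_homotopic_sym[OF path_homotopic_const_right[OF ul]] ends by simp
  also have "path_homotopic X (path_join (path_join (path_rev g) l) (\<lambda>t. g 0)) (path_join (path_join (path_rev g) l) (path_join g (path_rev g)))"
    by (rule path_homotopic_join[OF path_homotopic_refl[OF ul] path_homotopic_sym[OF gu]]) (use ends in auto)
  also have "path_homotopic X (path_join (path_join (path_rev g) l) (path_join g (path_rev g))) (path_join (path_join (path_join (path_rev g) l) g) (path_rev g))"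
    by (rule path_homotopic_sym[OF path_homotopic_assoc[OF ul g u]]) (use ends in auto)
  also have "path_homotopic X (path_join (path_join (path_join (path_rev g) l) g) (path_rev g)) (path_join (\<lambda>t. path_rev g 0) (path_rev g))"
    by (rule path_homotopic_join[OF _ path_homotopic_refl[OF u]]) (use h in auto)
  also have "path_homotopic X (path_join (\<lambda>t. path_rev g 0) (path_rev g)) (path_rev g)"
    by (rule path_homotopic_const_left[OF u])
  finally have a: "path_homotopic X (path_join (path_rev g) l) (path_rev g)" .
  have "path_homotopic X l (path_join (\<lambda>t. l 0) l)"
    by (rule path_homotopic_sym[OF path_homotopic_const_left[OF l]])
  also have "path_homotopic X (path_join (\<lambda>t. l 0) l) (path_join (path_join g (path_rev g)) l)"
    using path_homotopic_join[OF path_homotopic_sym[OF gu] path_homotopic_refl[OF l]] ends by simp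
  also have "path_homotopic X (path_join (path_join g (path_rev g)) l) (path_join g (path_join (path_rev g) l))"
    by (rule path_homotopic_assoc[OF g u l]) (use ends in auto)
  also have "path_homotopic X (path_join g (path_join (path_rev g) l)) (path_join g (path_rev g))"
    by (rule path_homotopic_join[OF path_homotopic_refl[OF g] a]) auto
  also note gu
  finally show ?thesis .
qed

section \<open>Morphisms of the orbit category\<close>

text \<open>The map of orbits \<open>xH \<mapsto> xgK\<close> is right multiplication of cosets by the set \<open>gK\<close>, which is
  well defined as \<open>H \<cdot> gK = gK\<close>.\<close>

lemma (in group) coset_gives_orb_hom:
  assumes H: "subgroup H G" and K: "subgroup K G" and g: "g \<in> carrier G"
    and sub: "\<forall>h\<in>H. h <# (g <# K) = g <# K"
  obtains f where "f \<in> orb_hom G H K" "f H = g <# K"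
proof -
  define M where "M = g <# K"
  have MG: "M \<subseteq> carrier G" unfolding M_def by (rule l_coset_subset_G[OF subgroup.subset[OF K] g])
  have HM: "H <#> M = M"
  proof -
    have "H <#> M = (\<Union>h\<in>H. h <# M)" by (auto simp: set_mult_def l_coset_def)
    also have "\<dots> = (\<Union>h\<in>H. M)" using sub by (simp add: M_def)
    also have "\<dots> = M" using subgroup.one_closed[OF H] by auto
    finally show ?thesis .
  qed
  define f where "f = (\<lambda>C\<in>lcosets H. C <#> M)"
  have fC: "f (x <# H) = x <# M" if "x \<in> carrier G" for x
    using setmult_lcos_assoc[OF subgroup.subset[OF H] MG that] lcosetI[OF that] HM by (simp add: f_def)
  have "f \<in> orb_hom G H K" unfolding orb_hom_def
  proof (intro CollectI conjI H K ballI)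
    show "f \<in> (lcosets H) \<rightarrow>\<^sub>E (lcosets K)"
    proof (rule PiE_I)
      fix C assume "C \<in> lcosets H"
      then obtain x where x: "x \<in> carrier G" "C = x <# H" by (rule lcosetE)
      have "x <# M = (x \<otimes> g) <# K" unfolding M_def by (rule lcos_m_assoc[OF subgroup.subset[OF K] x(1) g])
      then show "f C \<in> lcosets K" using fC[OF x(1)] x g by (simp add: lcosetI)
    qed (simp add: f_def)
    fix a C assume a: "a \<in> carrier G" and C: "C \<in> lcosets H"
    then obtain x where x: "x \<in> carrier G" "C = x <# H" by (auto elim: lcosetE)
    have "a <# C = (a \<otimes> x) <# H" unfolding x(2) by (rule lcos_m_assoc[OF subgroup.subset[OF H] a x(1)])
    then have "f (a <# C) = (a \<otimes> x) <# M" using fC a x(1) by simp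
    also have "\<dots> = a <# (x <# M)" by (rule lcos_m_assoc[OF MG a x(1), symmetric])
    finally show "f (a <# C) = a <# f C" using fC x by simp
  qed
  moreover have "f H = g <# K" using self_lcoset[OF H] HM by (simp add: f_def M_def)
  ultimately show ?thesis using that by blast
qed

context G_space_loc
begin

lemma act_coset_rep:
  assumes K: "subgroup K G" and g: "g \<in> carrier G" and g': "g' \<in> g <# K" and x: "x \<in> fixed_set X K"
  shows "act X g' x = act X g x"
proof -
  obtain k where k: "k \<in> K" "g' = g \<otimes> k" using g' by (auto simp: l_coset_def)
  have "k \<in> carrier G" using K k by (simp add: subgroup.mem_carrier)
  then show ?thesis using act_mult[OF g, of k x] x k by (simp add: fixed_set_def)
qed

lemma val_Pi1: "val (Pi1 X) H = fund_groupoid (fixed_space X H) (skel X 0)"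
  by (simp add: Pi1_def)

text \<open>Restriction is defined with a chosen representative of the coset, but points fixed by \<open>K\<close> do not
  see the choice.\<close>

lemma res_Pi1:
  assumes H: "subgroup H G" and K: "subgroup K G" and g: "g \<in> carrier G"
    and sub: "\<forall>h\<in>H. h <# (g <# K) = g <# K" and fH: "f H = g <# K"
  shows "y \<in> fixed_set X K \<Longrightarrow> on_ob (res (Pi1 X) H K f) y = act X g y"
    and "pathin (fixed_space X K) p \<Longrightarrow>
      on_mor (res (Pi1 X) H K f) (path_class (fixed_space X K) p) = path_class (fixed_space X H) (act X g \<circ> p)"
proof -
  define g' where "g' = (SOME g. g \<in> f H)"
  have g': "g' \<in> g <# K" unfolding g'_def fH by (rule someI[of _ g]) (rule lcos_self[OF g K])
  have g'G: "g' \<in> carrier G" by (rule l_coset_carrier[OF g' g K])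
  have g'K: "g' <# K = g <# K" by (rule l_repr_independence[OF g' g K, symmetric])
  have res: "res (Pi1 X) H K f = fund_groupoid_map (fixed_space X H) (act X g')" by (simp add: Pi1_def g'_def)
  show "on_ob (res (Pi1 X) H K f) y = act X g y" if "y \<in> fixed_set X K"
    using act_coset_rep[OF K g g' that] by (simp add: res)
  show "on_mor (res (Pi1 X) H K f) (path_class (fixed_space X K) p) = path_class (fixed_space X H) (act X g \<circ> p)"
    if p: "pathin (fixed_space X K) p"
  proof -
    have c: "continuous_map (fixed_space X K) (fixed_space X H) (act X g')"
      by (rule act_fixed_cont[OF K H g'G]) (use sub g'K in simp)
    have pt: "p t \<in> fixed_set X K" if "t \<in> {0..1}" for t using path_image_subset_topspace[OF p] that by auto
    have "path_homotopic (fixed_space X H) (act X g' \<circ> p) (act X g \<circ> p)"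
      by (rule path_homotopic_eq_on[OF pathin_compose[OF p c]]) (use act_coset_rep[OF K g g'] pt in simp)
    then show ?thesis using on_mor_fund_map[OF c p] path_class_eqI by (simp add: res)
  qed
qed

end

context G_CW
begin

lemma compress_path:
  assumes H: "subgroup H G" and p: "pathin (fixed_space X H) p" "p 0 \<in> skel X 1" "p 1 \<in> skel X 1"
  obtains p' where "path_homotopic (fixed_space X H) p p'" "\<And>t. t \<in> {0..1} \<Longrightarrow> p' t \<in> skel X 1"
proof -
  have c: "compact {0..1::real}" by simp
  obtain p' where p': "homotopic_with (\<lambda>h. \<forall>k\<in>{0..1}. p k \<in> skel X 1 \<longrightarrow> h k = p k) (top_of_set {0..1}) (fixed_space X H) p p'"
    "p' ` {0..1} \<subseteq> skel X 1"
    by (rule compress_into_skel[OF H c box_dim_le_interval order_refl p(1)[unfolded pathin_def]])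
  have "path_homotopic (fixed_space X H) p p'" unfolding path_homotopic_def
    by (rule homotopic_with_mono[OF p'(1)]) (use p in auto)
  then show ?thesis using that p'(2) by blast
qed

end

section \<open>Realizing a transformation\<close>

locale Pi1_transformation = G_CW_pair G Y T for G :: "('g, 'z) monoid_scheme" (structure)
    and Y :: "('g, 'y) gcw_data" and T :: "('g, 't) gcw_data" +
  fixes \<Psi> :: "'g set \<Rightarrow> ('y, (real \<Rightarrow> 'y) set, 't, (real \<Rightarrow> 't) set) gpd_map"
  assumes nat: "orb_nat_trans G (Pi1 Y) (Pi1 T) \<Psi>"
begin

lemma Psi_functor: "subgroup H G \<Longrightarrow> gpd_functor (fund_groupoid (fixed_space Y H) (skel Y 0)) (fund_groupoid (fixed_space T H) (skel T 0)) (\<Psi> H)"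
  using nat unfolding orb_nat_trans_def Y.val_Pi1 T.val_Pi1 by blast

lemma Psi_ob: "subgroup H G \<Longrightarrow> y \<in> fixed_set Y H \<Longrightarrow> y \<in> skel Y 0 \<Longrightarrow> on_ob (\<Psi> H) y \<in> fixed_set T H \<inter> skel T 0"
  using Psi_functor[of H] unfolding gpd_functor_def by simp

lemma Psi_path:
  assumes H: "subgroup H G" and p: "pathin (fixed_space Y H) p" "p 0 \<in> skel Y 0" "p 1 \<in> skel Y 0"
  obtains r where "pathin (fixed_space T H) r" "on_mor (\<Psi> H) (path_class (fixed_space Y H) p) = path_class (fixed_space T H) r"
    "r 0 = on_ob (\<Psi> H) (p 0)" "r 1 = on_ob (\<Psi> H) (p 1)"
proof -
  have m: "path_class (fixed_space Y H) p \<in> Mor (fund_groupoid (fixed_space Y H) (skel Y 0))" by (rule Mor_fundI[OF p])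
  note F = Psi_functor[OF H, unfolded gpd_functor_def, THEN conjunct2, THEN conjunct1, rule_format, OF m]
  obtain r where r: "on_mor (\<Psi> H) (path_class (fixed_space Y H) p) = path_class (fixed_space T H) r" "pathin (fixed_space T H) r"
    using F unfolding Mor_fund by blast
  show ?thesis using F by (intro that[OF r(2,1)]) (simp_all add: r src_fund tgt_fund p)
qed

lemma Psi_join:
  assumes H: "subgroup H G" and p: "pathin (fixed_space Y H) p" "p 0 \<in> skel Y 0" "p 1 \<in> skel Y 0"
    and p': "pathin (fixed_space Y H) p'" "p' 1 \<in> skel Y 0" "p 1 = p' 0"
    and r: "pathin (fixed_space T H) r" "on_mor (\<Psi> H) (path_class (fixed_space Y H) p) = path_class (fixed_space T H) r"
    and r': "pathin (fixed_space T H) r'" "on_mor (\<Psi> H) (path_class (fixed_space Y H) p') = path_class (fixed_space T H) r'"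
    and rr: "r 1 = r' 0"
  shows "on_mor (\<Psi> H) (path_class (fixed_space Y H) (path_join p p')) = path_class (fixed_space T H) (path_join r r')"
proof -
  have m: "path_class (fixed_space Y H) p \<in> Mor (fund_groupoid (fixed_space Y H) (skel Y 0))"
     "path_class (fixed_space Y H) p' \<in> Mor (fund_groupoid (fixed_space Y H) (skel Y 0))"
    using p p' by (auto intro!: Mor_fundI)
  have "tgt (fund_groupoid (fixed_space Y H) (skel Y 0)) (path_class (fixed_space Y H) p) =
      src (fund_groupoid (fixed_space Y H) (skel Y 0)) (path_class (fixed_space Y H) p')"
    using p p' by (simp add: src_fund tgt_fund)
  from Psi_functor[OF H, unfolded gpd_functor_def, THEN conjunct2, THEN conjunct2, rule_format, OF m this]
  show ?thesis using p p' r r' rr by (simp add: cmp_fund)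
qed

lemma Psi_const:
  assumes H: "subgroup H G" and y: "y \<in> fixed_set Y H" "y \<in> skel Y 0"
  shows "on_mor (\<Psi> H) (path_class (fixed_space Y H) (\<lambda>t. y)) = path_class (fixed_space T H) (\<lambda>t. on_ob (\<Psi> H) y)"
  using Psi_functor[OF H] y unfolding gpd_functor_def idm_fund by simp

text \<open>Naturality of \<open>\<Psi>\<close> along the map of orbits given by \<open>g\<close>.\<close>

lemma Psi_translate:
  assumes H: "subgroup H G" and K: "subgroup K G" and g: "g \<in> carrier G"
    and sub: "\<forall>h\<in>H. h <# (g <# K) = g <# K"
  shows "y \<in> fixed_set Y K \<Longrightarrow> y \<in> skel Y 0 \<Longrightarrow> on_ob (\<Psi> H) (act Y g y) = act T g (on_ob (\<Psi> K) y)"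
    and "pathin (fixed_space Y K) p \<Longrightarrow> p 0 \<in> skel Y 0 \<Longrightarrow> p 1 \<in> skel Y 0 \<Longrightarrow> pathin (fixed_space T K) r \<Longrightarrow>
       on_mor (\<Psi> K) (path_class (fixed_space Y K) p) = path_class (fixed_space T K) r \<Longrightarrow>
       on_mor (\<Psi> H) (path_class (fixed_space Y H) (act Y g \<circ> p)) = path_class (fixed_space T H) (act T g \<circ> r)"
proof -
  obtain f where f: "f \<in> orb_hom G H K" "f H = g <# K" by (rule Y.coset_gives_orb_hom[OF H K g sub])
  have e: "gpd_map_eq (fund_groupoid (fixed_space Y K) (skel Y 0)) (\<Psi> H \<circ>\<^sub>g res (Pi1 Y) H K f) (res (Pi1 T) H K f \<circ>\<^sub>g \<Psi> K)"
    using nat f(1) unfolding orb_nat_trans_def Y.val_Pi1 by blast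
  note rY = Y.res_Pi1[where f = f, OF H K g sub f(2)] and rT = T.res_Pi1[where f = f, OF H K g sub f(2)]
  show "on_ob (\<Psi> H) (act Y g y) = act T g (on_ob (\<Psi> K) y)" if y: "y \<in> fixed_set Y K" "y \<in> skel Y 0"
  proof -
    have "on_ob (\<Psi> H \<circ>\<^sub>g res (Pi1 Y) H K f) y = on_ob (res (Pi1 T) H K f \<circ>\<^sub>g \<Psi> K) y"
      using e y unfolding gpd_map_eq_def by simp
    then show ?thesis using rY(1)[OF y(1)] rT(1)[of "on_ob (\<Psi> K) y"] Psi_ob[OF K y] by (simp add: gpd_comp_def)
  qed
  show "on_mor (\<Psi> H) (path_class (fixed_space Y H) (act Y g \<circ> p)) = path_class (fixed_space T H) (act T g \<circ> r)"
    if p: "pathin (fixed_space Y K) p" "p 0 \<in> skel Y 0" "p 1 \<in> skel Y 0" and r: "pathin (fixed_space T K) r"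
       "on_mor (\<Psi> K) (path_class (fixed_space Y K) p) = path_class (fixed_space T K) r"
  proof -
    have "on_mor (\<Psi> H \<circ>\<^sub>g res (Pi1 Y) H K f) (path_class (fixed_space Y K) p) = on_mor (res (Pi1 T) H K f \<circ>\<^sub>g \<Psi> K) (path_class (fixed_space Y K) p)"
      using e Mor_fundI[OF p] unfolding gpd_map_eq_def by blast
    then show ?thesis using rY(2)[OF p(1)] rT(2)[OF r(1)] r(2) by (simp add: gpd_comp_def)
  qed
qed

definition vertex_map :: "'y \<Rightarrow> 't" where
  "vertex_map y = on_ob (\<Psi> {\<one>}) y"

text \<open>By naturality along \<open>G/{1} \<rightarrow> G/H\<close> the value of \<open>\<Psi> H\<close> on a vertex is independent of \<open>H\<close>.\<close>

lemma vertex_map: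
  assumes H: "subgroup H G" and y: "y \<in> fixed_set Y H" "y \<in> skel Y 0"
  shows "on_ob (\<Psi> H) y = vertex_map y"
proof -
  have yX: "y \<in> topspace (spc Y)" using y(1) by (simp add: fixed_set_def)
  have tX: "on_ob (\<Psi> H) y \<in> topspace (spc T)" using Psi_ob[OF H y] by (simp add: fixed_set_def)
  have "on_ob (\<Psi> {\<one>}) (act Y \<one> y) = act T \<one> (on_ob (\<Psi> H) y)"
    by (rule Psi_translate(1)[OF Y.triv_subgroup H Y.one_closed _ y])
      (use Y.lcos_mult_one[OF subgroup.subset[OF H]] in simp)
  then show ?thesis using Y.act_one[OF yX] T.act_one[OF tX] by (simp add: vertex_map_def)
qed

lemma vertex_map_in: "y \<in> skel Y 0 \<Longrightarrow> vertex_map y \<in> skel T 0"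
  using Psi_ob[OF Y.triv_subgroup, of y] Y.fixed_one Y.skel_topspace[of 0] by (auto simp: vertex_map_def)

lemma vertex_map_equivariant:
  assumes g: "g \<in> carrier G" and y: "y \<in> skel Y 0" shows "vertex_map (act Y g y) = act T g (vertex_map y)"
  unfolding vertex_map_def
proof (rule Psi_translate(1)[OF Y.triv_subgroup Y.triv_subgroup g])
  show "\<forall>h\<in>{\<one>}. h <# (g <# {\<one>}) = g <# {\<one>}"
    using Y.lcos_mult_one[OF Y.l_coset_subset_G[OF subgroup.subset[OF Y.triv_subgroup] g]] by simp
qed (use y Y.skel_topspace[of 0] Y.fixed_one in auto)

text \<open>The map is required to be cellular on all skeleta up to the \<open>n\<close>-th, not only on the last one, so
  that the limit of such maps is cellular.\<close>

definition partial_map :: "nat \<Rightarrow> ('y \<Rightarrow> 't) \<Rightarrow> bool" where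
  "partial_map n f \<longleftrightarrow> continuous_map (subtopology (spc Y) (skel Y n)) (spc T) f \<and>
     (\<forall>g\<in>carrier G. \<forall>y\<in>skel Y n. f (act Y g y) = act T g (f y)) \<and> (\<forall>k\<le>n. f ` skel Y k \<subseteq> skel T k)"

lemma partial_map_fixed:
  assumes f: "partial_map n f" and H: "subgroup H G"
  shows "continuous_map (subtopology (spc Y) (skel Y n \<inter> fixed_set Y H)) (fixed_space T H) f"
proof -
  have f1: "continuous_map (subtopology (spc Y) (skel Y n)) (spc T) f"
    and feq: "\<And>g y. g \<in> carrier G \<Longrightarrow> y \<in> skel Y n \<Longrightarrow> f (act Y g y) = act T g (f y)"
    using f by (auto simp: partial_map_def)
  have top: "f \<in> skel Y n \<rightarrow> topspace (spc T)"
    using continuous_map_funspace[OF f1] Y.skel_topspace[of n] by auto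
  have "continuous_map (subtopology (subtopology (spc Y) (skel Y n)) (fixed_set Y H)) (spc T) f"
    by (rule continuous_map_from_subtopology[OF f1])
  moreover have "f y \<in> fixed_set T H" if "y \<in> skel Y n" "y \<in> fixed_set Y H" for y
    by (rule equivariant_fixed[OF feq top H that])
  ultimately show ?thesis unfolding fixed_space_def by (auto simp: continuous_map_in_subtopology subtopology_subtopology)
qed

text \<open>Given extensions \<open>e i\<close> to the cells, cellular approximation relative to the boundary makes them
  cellular. The homotopy in the conclusion records that the path class represented by an edge has not
  changed.\<close>

lemma extend_partial_map:
  assumes att: "G_attachment G Y (Suc n) (skel Y n) (skel Y (Suc n)) I S q" and f: "partial_map n f"
    and e: "\<And>i. i \<in> I \<Longrightarrow> continuous_map (disc (Suc n)) (fixed_space T (S i)) (e i)"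
    and agree: "\<And>i d. i \<in> I \<Longrightarrow> d \<in> disc_boundary (Suc n) \<Longrightarrow> e i d = f (q i (S i, d))"
  obtains f' where "partial_map (Suc n) f'" "\<And>y. y \<in> skel Y n \<Longrightarrow> f' y = f y"
    "\<And>i. i \<in> I \<Longrightarrow> homotopic_with (\<lambda>h. \<forall>d\<in>disc_boundary (Suc n). h d = e i d) (disc (Suc n)) (fixed_space T (S i))
       (e i) (\<lambda>d. f' (q i (S i, d)))"
proof -
  interpret a: G_attachment G Y "Suc n" "skel Y n" "skel Y (Suc n)" I S q by (rule att)
  have fc: "continuous_map (subtopology (spc Y) (skel Y n)) (spc T) f"
    and feq: "\<And>g y. g \<in> carrier G \<Longrightarrow> y \<in> skel Y n \<Longrightarrow> f (act Y g y) = act T g (f y)"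
    and fsk: "\<And>k. k \<le> n \<Longrightarrow> f ` skel Y k \<subseteq> skel T k" using f by (auto simp: partial_map_def)
  define Q where "Q i e' \<longleftrightarrow> homotopic_with (\<lambda>h. \<forall>d\<in>disc_boundary (Suc n). h d = e i d) (disc (Suc n)) (fixed_space T (S i)) (e i) e' \<and>
      e' ` ball_pts (Suc n) \<subseteq> skel T (Suc n)" for i e'
  have "\<exists>e'. Q i e'" if i: "i \<in> I" for i
  proof -
    have "continuous_map (top_of_set (ball_pts (Suc n))) (fixed_space T (S i)) (e i)" using e[OF i] by (subst (asm) disc_eq)
    from T.compress_into_skel[OF a.S[OF i] compact_ball_pts box_dim_le_ball_pts order_refl this]
    obtain e' where e': "homotopic_with (\<lambda>h. \<forall>k\<in>ball_pts (Suc n). e i k \<in> skel T (Suc n) \<longrightarrow> h k = e i k) (top_of_set (ball_pts (Suc n)))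
         (fixed_space T (S i)) (e i) e'" "e' ` ball_pts (Suc n) \<subseteq> skel T (Suc n)" by blast
    have "e i d \<in> skel T (Suc n)" if "d \<in> disc_boundary (Suc n)" for d
      using agree[OF i that] fsk[of n] a.base_boundary[OF i that] T.skel_Suc[of n] by auto
    then have "homotopic_with (\<lambda>h. \<forall>d\<in>disc_boundary (Suc n). h d = e i d) (top_of_set (ball_pts (Suc n))) (fixed_space T (S i)) (e i) e'"
      using disc_boundary_subset by (intro homotopic_with_mono[OF e'(1)]) blast
    then have "homotopic_with (\<lambda>h. \<forall>d\<in>disc_boundary (Suc n). h d = e i d) (disc (Suc n)) (fixed_space T (S i)) (e i) e'"
      by (subst disc_eq)
    then show ?thesis using e'(2) unfolding Q_def by blast
  qed
  then obtain e' where "\<forall>i\<in>I. Q i (e' i)" using bchoice[of I Q] by blast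
  then have e': "\<And>i. i \<in> I \<Longrightarrow> homotopic_with (\<lambda>h. \<forall>d\<in>disc_boundary (Suc n). h d = e i d) (disc (Suc n)) (fixed_space T (S i)) (e i) (e' i)"
    "\<And>i. i \<in> I \<Longrightarrow> e' i ` ball_pts (Suc n) \<subseteq> skel T (Suc n)" unfolding Q_def by blast+
  have e'c: "continuous_map (disc (Suc n)) (fixed_space T (S i)) (e' i)" if "i \<in> I" for i
    using homotopic_with_imp_continuous_maps[OF e'(1)[OF that]] by blast
  have e'b: "e' i d = f (q i (S i, d))" if "i \<in> I" "d \<in> disc_boundary (Suc n)" for i d
    using homotopic_with_imp_property[OF e'(1)[OF that(1)]] agree[OF that] that(2) by auto
  obtain f' where f': "continuous_map (subtopology (spc Y) (skel Y (Suc n))) (spc T) f'"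
    "\<And>a. a \<in> skel Y n \<Longrightarrow> f' a = f a"
    "\<And>g b. g \<in> carrier G \<Longrightarrow> b \<in> skel Y (Suc n) \<Longrightarrow> f' (act Y g b) = act T g (f' b)"
    "\<And>i d. i \<in> I \<Longrightarrow> d \<in> ball_pts (Suc n) \<Longrightarrow> f' (q i (S i, d)) = e' i d"
    using a.equivariant_map_extension[OF T.G_space fc Y.act_skel feq e'c e'b] by blast
  show ?thesis
  proof (rule that[OF _ f'(2)])
    have "f' y \<in> skel T (Suc n)" if y: "y \<in> skel Y (Suc n)" for y
      using y
    proof (cases rule: a.orbit_cases)
      case 1
      then show ?thesis using f'(2) fsk[of n] T.skel_Suc[of n] by auto
    next
      case (2 i g d)
      have "e' i d \<in> skel T (Suc n)" using e'(2)[OF 2(1)] 2(3) by blast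
      then show ?thesis using f'(3)[OF 2(2) a.base_in_B[OF 2(1,3)]] f'(4)[OF 2(1,3)] T.act_skel[OF 2(2)] 2(4) by simp
    qed
    moreover have "f' y \<in> skel T k" if "k \<le> n" "y \<in> skel Y k" for k y
      using f'(2)[of y] fsk[OF that(1)] that Y.skel_mono[OF that(1)] by auto
    ultimately show "partial_map (Suc n) f'" using f'(1,3) unfolding partial_map_def by (auto simp: le_Suc_eq)
  next
    fix i assume i: "i \<in> I"
    show "homotopic_with (\<lambda>h. \<forall>d\<in>disc_boundary (Suc n). h d = e i d) (disc (Suc n)) (fixed_space T (S i)) (e i) (\<lambda>d. f' (q i (S i, d)))"
    proof (rule homotopic_with_trans[OF e'(1)[OF i]], rule homotopic_with_equal)
      show "\<forall>d\<in>disc_boundary (Suc n). e' i d = e i d" using homotopic_with_imp_property[OF e'(1)[OF i]] by blast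
      then show "\<forall>d\<in>disc_boundary (Suc n). f' (q i (S i, d)) = e i d"
        using f'(4)[OF i subsetD[OF disc_boundary_subset]] by simp
    qed (use e'c[OF i] f'(4)[OF i] in auto)
  qed blast
qed

text \<open>The map on the graph induces \<open>\<Psi>\<close> on path classes that are represented in the 1-skeleton of a
  fixed point set. All subgroups \<open>H\<close> are included since a 2-cell of type \<open>S\<close> is attached along a loop
  in the \<open>S\<close>-fixed part of the graph, whose edges may have larger isotropy.\<close>

definition follows_Psi :: "('y \<Rightarrow> 't) \<Rightarrow> bool" where
  "follows_Psi f \<longleftrightarrow> (\<forall>y\<in>skel Y 0. f y = vertex_map y) \<and>
     (\<forall>H p. subgroup H G \<and> pathin (subtopology (spc Y) (skel Y 1 \<inter> fixed_set Y H)) p \<and> p 0 \<in> skel Y 0 \<and> p 1 \<in> skel Y 0 \<longrightarrow>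
        on_mor (\<Psi> H) (path_class (fixed_space Y H) p) = path_class (fixed_space T H) (f \<circ> p))"

lemma graph_of_fixed_points:
  assumes att: "G_attachment G Y (Suc 0) (skel Y 0) (skel Y (Suc 0)) I S q" and H: "subgroup H G"
  shows "graph (spc Y) (skel Y 0 \<inter> fixed_set Y H) (skel Y 1 \<inter> fixed_set Y H) (G_attachment.fixed_cells G I S H) (G_attachment.char_map q)"
proof -
  interpret a: G_attachment G Y "Suc 0" "skel Y 0" "skel Y (Suc 0)" I S q by (rule att)
  show ?thesis
  proof (intro graph.intro graph_axioms.intro)
    show "cell_attachment (spc Y) 1 (skel Y 0 \<inter> fixed_set Y H) (skel Y 1 \<inter> fixed_set Y H) (a.fixed_cells H) a.char_map"
      using a.fixed_attachment(1)[OF H Y.closedin_sub_fixed[OF H]] unfolding One_nat_def .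
    fix U assume U: "U \<subseteq> skel Y 0 \<inter> fixed_set Y H"
    then obtain V where V: "openin (spc Y) V" "U = V \<inter> skel Y 0"
      using Y.skel_0_discrete[of U] by (auto simp: openin_subtopology)
    then have "U = V \<inter> (skel Y 0 \<inter> fixed_set Y H)" using U by blast
    then show "openin (subtopology (spc Y) (skel Y 0 \<inter> fixed_set Y H)) U" using V(1) by (auto simp: openin_subtopology)
  qed
qed

text \<open>The \<open>H\<close>-fixed part of the 1-skeleton is a graph whose edges are translates of equivariant edges
  over the trivial coset, where \<open>\<Psi>\<close> is known by assumption. Naturality handles the translation,
  functoriality and \<open>path_induct\<close> all other paths.\<close>

lemma follows_Psi_if_on_edges:
  assumes att: "G_attachment G Y (Suc 0) (skel Y 0) (skel Y (Suc 0)) I S q" and f: "partial_map 1 f"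
    and f0: "\<And>y. y \<in> skel Y 0 \<Longrightarrow> f y = vertex_map y"
    and edges: "\<And>i. i \<in> I \<Longrightarrow> on_mor (\<Psi> (S i)) (path_class (fixed_space Y (S i)) (\<lambda>t. q i (S i, axis_pt (2 * t - 1)))) =
        path_class (fixed_space T (S i)) (\<lambda>t. f (q i (S i, axis_pt (2 * t - 1))))"
  shows "follows_Psi f"
  unfolding follows_Psi_def
proof (intro conjI ballI allI impI f0)
  fix H p
  assume as: "subgroup H G \<and> pathin (subtopology (spc Y) (skel Y 1 \<inter> fixed_set Y H)) p \<and> p 0 \<in> skel Y 0 \<and> p 1 \<in> skel Y 0"
  then have H: "subgroup H G" and p: "pathin (subtopology (spc Y) (skel Y 1 \<inter> fixed_set Y H)) p" "p 0 \<in> skel Y 0" "p 1 \<in> skel Y 0" by auto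
  interpret a: G_attachment G Y "Suc 0" "skel Y 0" "skel Y (Suc 0)" I S q by (rule att)
  interpret g: graph "spc Y" "skel Y 0 \<inter> fixed_set Y H" "skel Y 1 \<inter> fixed_set Y H" "a.fixed_cells H" a.char_map
    by (rule graph_of_fixed_points[OF att H])
  have fc: "continuous_map g.\<Gamma> (fixed_space T H) f" by (rule partial_map_fixed[OF f H])
  have up: "path_homotopic (fixed_space Y H) r r'" if "path_homotopic g.\<Gamma> r r'" for r r'
    unfolding fixed_space_def by (rule path_homotopic_subtopology[OF that]) auto
  have pup: "pathin (fixed_space Y H) r" if "pathin g.\<Gamma> r" for r
    unfolding fixed_space_def by (rule pathin_mono[OF that]) auto
  have p01: "p 0 \<in> skel Y 0 \<inter> fixed_set Y H" "p 1 \<in> skel Y 0 \<inter> fixed_set Y H"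
    using p path_start_in_topspace[OF p(1)] path_finish_in_topspace[OF p(1)] by auto
  define E where "E r \<longleftrightarrow> on_mor (\<Psi> H) (path_class (fixed_space Y H) r) = path_class (fixed_space T H) (f \<circ> r)" for r
  have joinE: "E (path_join r r')" if "pathin g.\<Gamma> r" "pathin g.\<Gamma> r'" "r 0 \<in> skel Y 0 \<inter> fixed_set Y H" "r 1 \<in> skel Y 0 \<inter> fixed_set Y H"
     "r' 1 \<in> skel Y 0 \<inter> fixed_set Y H" "r 1 = r' 0" "E r" "E r'" for r r'
    unfolding E_def path_join_compose
    by (rule Psi_join[OF H]) (use that pup pathin_compose[OF _ fc] in \<open>auto simp: E_def\<close>)
  have constE: "E (\<lambda>t. y)" if "y \<in> skel Y 0 \<inter> fixed_set Y H" for y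
    using Psi_const[OF H, of y] vertex_map[OF H, of y] f0 that by (simp add: E_def o_def)
  have "E p"
  proof (rule g.path_induct[where E = E, OF _ joinE _ constE _ p(1) p01])
    show "E r'" if "path_homotopic g.\<Gamma> r r'" "r 0 \<in> skel Y 0 \<inter> fixed_set Y H" "r 1 \<in> skel Y 0 \<inter> fixed_set Y H" "E r" for r r'
      using path_class_eqI[OF up[OF that(1)]] path_class_eqI[OF path_homotopic_compose[OF that(1) fc]] that(4) by (simp add: E_def)
    show "E (path_rev r)" if r: "pathin g.\<Gamma> r" "r 0 \<in> skel Y 0 \<inter> fixed_set Y H" "r 1 \<in> skel Y 0 \<inter> fixed_set Y H" "E r" for r
    proof -
      \<comment> \<open>the image of the inverse composes with \<open>f \<circ> r\<close> to an identity, so it is the inverse of the class of \<open>f \<circ> r\<close>\<close>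
      have rr: "pathin (fixed_space Y H) (path_rev r)" by (rule pathin_rev[OF pup[OF r(1)]])
      obtain s where s: "pathin (fixed_space T H) s" "on_mor (\<Psi> H) (path_class (fixed_space Y H) (path_rev r)) = path_class (fixed_space T H) s"
        "s 0 = on_ob (\<Psi> H) (path_rev r 0)" "s 1 = on_ob (\<Psi> H) (path_rev r 1)"
        by (rule Psi_path[OF H rr]) (use r in auto)
      have fr: "pathin (fixed_space T H) (f \<circ> r)" by (rule pathin_compose[OF r(1) fc])
      have ends: "(f \<circ> r) 1 = s 0" "s 1 = (f \<circ> r) 0"
        using s(3,4) vertex_map[OF H] f0 r by auto
      have "on_mor (\<Psi> H) (path_class (fixed_space Y H) (path_join r (path_rev r))) = path_class (fixed_space T H) (path_join (f \<circ> r) s)"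
        by (rule Psi_join[OF H]) (use r pup rr fr s ends in \<open>auto simp: E_def\<close>)
      moreover have "path_class (fixed_space Y H) (path_join r (path_rev r)) = path_class (fixed_space Y H) (\<lambda>t. r 0)"
        by (rule path_class_eqI[OF path_homotopic_rev_right[OF pup[OF r(1)]]])
      ultimately have "path_class (fixed_space T H) (path_join (f \<circ> r) s) = path_class (fixed_space T H) (\<lambda>t. (f \<circ> r) 0)"
        using constE[OF r(2)] by (simp add: E_def o_def)
      then have "path_homotopic (fixed_space T H) (path_join (f \<circ> r) s) (\<lambda>t. (f \<circ> r) 0)"
        using path_class_eq_iff pathin_join[OF fr s(1) ends(1)] path_start_in_topspace[OF fr] by (metis pathin_const)
      then have "path_homotopic (fixed_space T H) s (path_rev (f \<circ> r))"
        by (rule path_homotopic_rev_unique[OF fr s(1) ends])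
      then show ?thesis unfolding E_def path_rev_compose s(2) by (rule path_class_eqI)
    qed
    fix j assume j: "j \<in> a.fixed_cells H"
    then obtain i C where iC: "j = (i, C)" "i \<in> I" "C \<in> lcosets (S i)" "\<And>h. h \<in> H \<Longrightarrow> h <# C = C"
      by (auto simp: a.fixed_cells_def)
    then obtain k where k: "k \<in> carrier G" "C = k <# S i" by (auto elim: Y.lcosetE)
    define c where "c t = q i (S i, axis_pt (2 * t - 1))" for t
    have ax: "pathin (disc (Suc 0)) (\<lambda>t. axis_pt (2 * t - 1))"
      by (rule pathin_edge_param)
    have ax_in: "axis_pt (2 * t - 1) \<in> ball_pts (Suc 0)" if "t \<in> {0..1}" for t
      using path_image_subset_topspace[OF ax] that by auto
    have pc0: "pathin (subtopology (spc Y) (skel Y (Suc 0) \<inter> fixed_set Y (S i))) c"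
      using pathin_compose[OF ax a.base_cont[OF iC(2)]] by (simp add: o_def c_def[abs_def])
    then have pc: "pathin (fixed_space Y (S i)) c" unfolding fixed_space_def by (rule pathin_mono) auto
    have c01: "c 0 \<in> skel Y 0" "c 1 \<in> skel Y 0"
      using a.base_boundary[OF iC(2)] disc_boundary_1 by (auto simp: c_def)
    have fcc: "pathin (fixed_space T (S i)) (f \<circ> c)"
      using pathin_compose[OF pc0] partial_map_fixed[OF f a.S[OF iC(2)]] by simp
    have "on_mor (\<Psi> H) (path_class (fixed_space Y H) (act Y k \<circ> c)) = path_class (fixed_space T H) (act T k \<circ> (f \<circ> c))"
      by (rule Psi_translate(2)[OF H a.S[OF iC(2)] k(1) _ pc c01 fcc])
        (use iC(4) k(2) edges[OF iC(2)] in \<open>simp_all add: c_def[abs_def] o_def\<close>)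
    moreover have ge: "g.edge j t = act Y k (c t)" if "t \<in> {0..1}" for t
      using a.q_translate[OF iC(2) k(1) ax_in[OF that]] by (simp add: g.edge_def iC(1) k(2) c_def)
    moreover have act_c: "pathin (fixed_space Y H) (act Y k \<circ> c)"
      by (rule pathin_compose[OF pc Y.act_fixed_cont[OF a.S[OF iC(2)] H k(1)]]) (use iC(4) k(2) in simp)
    moreover have "path_class (fixed_space Y H) (act Y k \<circ> c) = path_class (fixed_space Y H) (g.edge j)"
      by (rule path_class_eqI[OF path_homotopic_eq_on[OF act_c]]) (use ge in simp)
    moreover have "path_class (fixed_space T H) (act T k \<circ> (f \<circ> c)) = path_class (fixed_space T H) (f \<circ> g.edge j)"
    proof (rule path_class_eqI[OF path_homotopic_eq_on])
      show "pathin (fixed_space T H) (act T k \<circ> (f \<circ> c))"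
        by (rule pathin_compose[OF fcc T.act_fixed_cont[OF a.S[OF iC(2)] H k(1)]]) (use iC(4) k(2) in simp)
      fix t :: real assume t: "t \<in> {0..1}"
      have "c t \<in> skel Y 1" using a.base_in_B[OF iC(2) ax_in[OF t]] by (simp add: c_def)
      then have "f (act Y k (c t)) = act T k (f (c t))" using f k(1) unfolding partial_map_def by blast
      then show "(act T k \<circ> (f \<circ> c)) t = (f \<circ> g.edge j) t" using ge[OF t] by simp
    qed
    ultimately show "E (g.edge j)" by (simp add: E_def)
  qed
  then show "on_mor (\<Psi> H) (path_class (fixed_space Y H) p) = path_class (fixed_space T H) (f \<circ> p)" by (simp add: E_def)
qed

text \<open>On an edge choose a representative of the image of its path class under \<open>\<Psi>\<close>.\<close>

lemma map_on_graph:
  obtains f where "partial_map 1 f" "follows_Psi f"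
proof -
  obtain I S q where att: "G_attachment G Y (Suc 0) (skel Y 0) (skel Y (Suc 0)) I S q" by (rule Y.attach_SucE)
  interpret a: G_attachment G Y "Suc 0" "skel Y 0" "skel Y (Suc 0)" I S q by (rule att)
  have v: "partial_map 0 vertex_map"
  proof -
    have "continuous_map (subtopology (spc Y) (skel Y 0)) (spc T) vertex_map"
      unfolding continuous_map_def
    proof (intro conjI allI impI)
      show "vertex_map \<in> topspace (subtopology (spc Y) (skel Y 0)) \<rightarrow> topspace (spc T)"
        using vertex_map_in T.skel_topspace[of 0] by auto
      show "openin (subtopology (spc Y) (skel Y 0)) {x \<in> topspace (subtopology (spc Y) (skel Y 0)). vertex_map x \<in> U}" for U
        by (rule Y.skel_0_discrete) auto
    qed
    then show ?thesis using vertex_map_equivariant vertex_map_in by (auto simp: partial_map_def)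
  qed
  define c where "c i t = q i (S i, axis_pt (2 * t - 1))" for i t
  have ax: "pathin (disc (Suc 0)) (\<lambda>t. axis_pt (2 * t - 1))"
    by (rule pathin_edge_param)
  have pc: "pathin (fixed_space Y (S i)) (c i)" if i: "i \<in> I" for i
  proof -
    have "pathin (subtopology (spc Y) (skel Y (Suc 0) \<inter> fixed_set Y (S i))) (c i)"
      using pathin_compose[OF ax a.base_cont[OF i]] by (simp add: o_def c_def[abs_def])
    then show ?thesis unfolding fixed_space_def by (rule pathin_mono) auto
  qed
  have c01: "c i 0 \<in> skel Y 0" "c i 1 \<in> skel Y 0" if "i \<in> I" for i
    using a.base_boundary[OF that] disc_boundary_1 by (auto simp: c_def)
  have cfix: "c i 0 \<in> fixed_set Y (S i)" "c i 1 \<in> fixed_set Y (S i)" if "i \<in> I" for i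
    using path_start_in_topspace[OF pc[OF that]] path_finish_in_topspace[OF pc[OF that]] by auto
  have "\<exists>r. pathin (fixed_space T (S i)) r \<and> on_mor (\<Psi> (S i)) (path_class (fixed_space Y (S i)) (c i)) = path_class (fixed_space T (S i)) r \<and>
     r 0 = vertex_map (c i 0) \<and> r 1 = vertex_map (c i 1)" if i: "i \<in> I" for i
    using Psi_path[OF a.S[OF i] pc[OF i] c01[OF i]] vertex_map[OF a.S[OF i] cfix(1)[OF i] c01(1)[OF i]]
      vertex_map[OF a.S[OF i] cfix(2)[OF i] c01(2)[OF i]] by metis
  then obtain r where r: "\<And>i. i \<in> I \<Longrightarrow> pathin (fixed_space T (S i)) (r i)"
    "\<And>i. i \<in> I \<Longrightarrow> on_mor (\<Psi> (S i)) (path_class (fixed_space Y (S i)) (c i)) = path_class (fixed_space T (S i)) (r i)"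
    "\<And>i. i \<in> I \<Longrightarrow> r i 0 = vertex_map (c i 0)" "\<And>i. i \<in> I \<Longrightarrow> r i 1 = vertex_map (c i 1)" by metis
  define e where "e i d = r i ((d 0 + 1) / 2)" for i and d :: "nat \<Rightarrow> real"
  have s: "continuous_map (disc (Suc 0)) I01 (\<lambda>d. (d 0 + 1) / 2)"
  proof -
    have "continuous_on (ball_pts 1) (\<lambda>d. (d 0 + 1) / 2)"
      by (intro continuous_intros continuous_on_coord[OF continuous_on_id]) auto
    moreover have "(d 0 + 1) / 2 \<in> {0..1}" if "d \<in> ball_pts 1" for d using ball_pts_1(2)[OF that] by auto
    ultimately show ?thesis by (subst disc_eq) (auto simp: continuous_map_subtopology_eu)
  qed
  obtain f where f: "partial_map (Suc 0) f" "\<And>y. y \<in> skel Y 0 \<Longrightarrow> f y = vertex_map y"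
    "\<And>i. i \<in> I \<Longrightarrow> homotopic_with (\<lambda>h. \<forall>d\<in>disc_boundary (Suc 0). h d = e i d) (disc (Suc 0)) (fixed_space T (S i))
       (e i) (\<lambda>d. f (q i (S i, d)))"
  proof (rule extend_partial_map[OF att v, of e])
    show "continuous_map (disc (Suc 0)) (fixed_space T (S i)) (e i)" if "i \<in> I" for i
      using continuous_map_compose[OF s r(1)[OF that, unfolded pathin_def]] by (simp add: o_def e_def[abs_def])
    show "e i d = vertex_map (q i (S i, d))" if "i \<in> I" "d \<in> disc_boundary (Suc 0)" for i d
    proof -
      have "d = axis_pt 1 \<or> d = axis_pt (-1)" using that(2) disc_boundary_1 by auto
      then show ?thesis using r(3,4)[OF that(1)] by (auto simp: e_def c_def axis_pt_def)
    qed
  qed blast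
  have "follows_Psi f"
  proof (rule follows_Psi_if_on_edges[OF att])
    show "partial_map 1 f" using f(1) by simp
    show "f y = vertex_map y" if "y \<in> skel Y 0" for y by (rule f(2)[OF that])
    fix i assume i: "i \<in> I"
    have "homotopic_with (\<lambda>h. h 0 = (e i \<circ> (\<lambda>t. axis_pt (2 * t - 1))) 0 \<and> h 1 = (e i \<circ> (\<lambda>t. axis_pt (2 * t - 1))) 1) I01 (fixed_space T (S i))
      (e i \<circ> (\<lambda>t. axis_pt (2 * t - 1))) ((\<lambda>d. f (q i (S i, d))) \<circ> (\<lambda>t. axis_pt (2 * t - 1)))"
      by (rule homotopic_with_compose_continuous_map_right[OF f(3)[OF i] ax[unfolded pathin_def]])
        (use disc_boundary_1 in auto)
    then have "path_homotopic (fixed_space T (S i)) (e i \<circ> (\<lambda>t. axis_pt (2 * t - 1))) ((\<lambda>d. f (q i (S i, d))) \<circ> (\<lambda>t. axis_pt (2 * t - 1)))"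
      unfolding path_homotopic_def .
    moreover have "e i \<circ> (\<lambda>t. axis_pt (2 * t - 1)) = r i" by (auto simp: e_def axis_pt_def fun_eq_iff)
    ultimately have "path_class (fixed_space T (S i)) (r i) = path_class (fixed_space T (S i)) (\<lambda>t. f (q i (S i, axis_pt (2 * t - 1))))"
      by (intro path_class_eqI) (simp add: o_def)
    then show "on_mor (\<Psi> (S i)) (path_class (fixed_space Y (S i)) (\<lambda>t. q i (S i, axis_pt (2 * t - 1)))) =
        path_class (fixed_space T (S i)) (\<lambda>t. f (q i (S i, axis_pt (2 * t - 1))))"
      using r(2)[OF i] by (simp add: c_def[abs_def])
  qed
  then show ?thesis using that f(1) by simp
qed

text \<open>Joined to a vertex by a path \<open>\<gamma>\<close> in the graph, the attaching circle becomes a loop \<open>p\<close> that is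
  trivial in the fixed points of \<open>Y\<close> because the 2-cell fills it. Hence \<open>\<Psi>\<close> maps it to an identity,
  and this is the class of the image of \<open>p\<close>. The circle itself need not pass through a vertex,
  which is why \<open>\<gamma>\<close> is there and has to be cancelled in the end.\<close>

lemma attaching_circle_null:
  assumes att: "G_attachment G Y (Suc 1) (skel Y 1) (skel Y (Suc 1)) I S q" and i: "i \<in> I"
    and f: "partial_map 1 f" and fP: "follows_Psi f"
  defines "b \<equiv> \<lambda>d. f (q i (S i, d))"
  shows "homotopic_with (\<lambda>h. \<forall>d\<in>disc_boundary 1. h d = b (pole 1)) (disc 1) (fixed_space T (S i)) (b \<circ> collapse 1) (\<lambda>_. b (pole 1))"
proof -
  interpret a: G_attachment G Y "Suc 1" "skel Y 1" "skel Y (Suc 1)" I S q by (rule att)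
  obtain I0 S0 q0 where att0: "G_attachment G Y (Suc 0) (skel Y 0) (skel Y (Suc 0)) I0 S0 q0" by (rule Y.attach_SucE)
  define H where "H = S i"
  have H: "subgroup H G" unfolding H_def by (rule a.S[OF i])
  interpret a0: G_attachment G Y "Suc 0" "skel Y 0" "skel Y (Suc 0)" I0 S0 q0 by (rule att0)
  interpret g: graph "spc Y" "skel Y 0 \<inter> fixed_set Y H" "skel Y 1 \<inter> fixed_set Y H" "a0.fixed_cells H" a0.char_map
    by (rule graph_of_fixed_points[OF att0 H])
  have fc: "continuous_map g.\<Gamma> (fixed_space T H) f" by (rule partial_map_fixed[OF f H])
  have pup: "pathin (fixed_space Y H) r" if "pathin g.\<Gamma> r" for r
    unfolding fixed_space_def by (rule pathin_mono[OF that]) auto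
  have ax: "pathin (disc 1) (\<lambda>t. axis_pt (2 * t - 1))"
    by (rule pathin_disc_1) (auto intro!: continuous_intros)
  define w where "w t = collapse 1 (axis_pt (2 * t - 1))" for t
  have ax_in: "axis_pt (2 * t - 1) \<in> ball_pts 1" if "t \<in> {0..1}" for t
    using path_image_subset_topspace[OF ax] that by auto
  have w_bd: "w t \<in> disc_boundary (Suc 1)" if "t \<in> {0..1}" for t
    unfolding w_def by (rule collapse_in_sphere[OF ax_in[OF that]])
  have w01: "w 0 = pole 1" "w 1 = pole 1"
    unfolding w_def by (rule collapse_boundary, simp add: disc_boundary_1[unfolded One_nat_def])+
  have pw: "pathin (disc (Suc 1)) w"
  proof -
    have "continuous_on {0..1} (\<lambda>t. axis_pt (2 * t - 1))" using ax unfolding pathin_disc_iff by blast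
    then have "continuous_on {0..1} w" unfolding w_def
      by (rule continuous_on_compose2[OF continuous_on_collapse[of UNIV 1]]) auto
    then show ?thesis unfolding pathin_disc_iff using w_bd disc_boundary_subset by blast
  qed
  have qc: "continuous_map (disc (Suc 1)) (fixed_space Y H) (\<lambda>d. q i (S i, d))"
    using a.base_cont[OF i] unfolding fixed_space_def H_def by (auto simp: continuous_map_in_subtopology)
  define l where "l = (\<lambda>d. q i (S i, d)) \<circ> w"
  define y0 where "y0 = q i (S i, pole 1)"
  have l01: "l 0 = y0" "l 1 = y0" by (auto simp: l_def y0_def w01)
  have lY: "path_homotopic (fixed_space Y H) l (\<lambda>t. y0)"
  proof -
    have "pathin (disc (Suc 1)) (\<lambda>t. pole 1)" using path_start_in_topspace[OF pw] w01 by simp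
    from path_homotopic_compose[OF path_homotopic_disc[OF pw this] qc] w01 show ?thesis by (simp add: l_def y0_def o_def)
  qed
  have lG: "pathin g.\<Gamma> l"
  proof -
    have lf: "pathin (fixed_space Y H) l" using path_homotopic_imp(1)[OF lY] .
    have "l t \<in> skel Y 1" if "t \<in> {0..1}" for t using a.base_boundary[OF i w_bd[OF that]] by (simp add: l_def)
    then show ?thesis using lf unfolding fixed_space_def by (auto simp: pathin_subtopology)
  qed
  have y0B: "y0 \<in> skel Y 1 \<inter> fixed_set Y H" using path_start_in_topspace[OF lG] l01 by simp
  obtain \<gamma> where \<gamma>: "pathin g.\<Gamma> \<gamma>" "\<gamma> 0 = y0" "\<gamma> 1 \<in> skel Y 0 \<inter> fixed_set Y H"
    by (rule g.paths_to_vertices) (use y0B in blast)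
  define p where "p = path_join (path_join (path_rev \<gamma>) l) \<gamma>"
  have u: "pathin g.\<Gamma> (path_rev \<gamma>)" by (rule pathin_rev[OF \<gamma>(1)])
  have ul: "pathin g.\<Gamma> (path_join (path_rev \<gamma>) l)" by (rule pathin_join[OF u lG]) (use l01 \<gamma> in simp)
  have pp: "pathin g.\<Gamma> p" unfolding p_def by (rule pathin_join[OF ul \<gamma>(1)]) (use l01 \<gamma> in simp)
  have pconst: "path_homotopic (fixed_space Y H) p (\<lambda>t. \<gamma> 1)"
  proof -
    note \<gamma>Y = pup[OF \<gamma>(1)] and uY = pup[OF u]
    have "path_homotopic (fixed_space Y H) (path_join (path_rev \<gamma>) l) (path_join (path_rev \<gamma>) (\<lambda>t. path_rev \<gamma> 1))"
      by (rule path_homotopic_join[OF path_homotopic_refl[OF uY]]) (use lY l01 \<gamma> in auto)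
    also have "path_homotopic (fixed_space Y H) (path_join (path_rev \<gamma>) (\<lambda>t. path_rev \<gamma> 1)) (path_rev \<gamma>)"
      by (rule path_homotopic_const_right[OF uY])
    finally have "path_homotopic (fixed_space Y H) p (path_join (path_rev \<gamma>) \<gamma>)"
      unfolding p_def by (rule path_homotopic_join[OF _ path_homotopic_refl[OF \<gamma>Y]]) (use l01 \<gamma> in simp)
    also have "path_homotopic (fixed_space Y H) (path_join (path_rev \<gamma>) \<gamma>) (\<lambda>t. \<gamma> 1)"
      by (rule path_homotopic_rev_left[OF \<gamma>Y])
    finally show ?thesis .
  qed
  have p01: "p 0 \<in> skel Y 0" "p 1 \<in> skel Y 0" using \<gamma> by (auto simp: p_def)
  have v: "\<gamma> 1 \<in> fixed_set Y H" "\<gamma> 1 \<in> skel Y 0" using \<gamma> by auto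
  have "path_class (fixed_space T H) (f \<circ> p) = on_mor (\<Psi> H) (path_class (fixed_space Y H) p)"
    using fP H pp p01 unfolding follows_Psi_def by simp
  also have "\<dots> = on_mor (\<Psi> H) (path_class (fixed_space Y H) (\<lambda>t. \<gamma> 1))"
    using path_class_eqI[OF pconst] by simp
  also have "\<dots> = path_class (fixed_space T H) (\<lambda>t. f (\<gamma> 1))"
    using Psi_const[OF H v] vertex_map[OF H v] fP v(2) by (simp add: follows_Psi_def)
  finally have eq: "path_class (fixed_space T H) (f \<circ> p) = path_class (fixed_space T H) (\<lambda>t. f (\<gamma> 1))" .
  have fp: "pathin (fixed_space T H) (f \<circ> p)" by (rule pathin_compose[OF pp fc])
  have "pathin (fixed_space T H) (\<lambda>t. f (\<gamma> 1))"
    using path_finish_in_topspace[OF pathin_compose[OF \<gamma>(1) fc]] unfolding pathin_const by simp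
  then have "path_homotopic (fixed_space T H) (f \<circ> p) (\<lambda>t. f (\<gamma> 1))" using path_class_eq_iff[OF fp] eq by blast
  then have "path_homotopic (fixed_space T H) (path_join (path_join (path_rev (f \<circ> \<gamma>)) (f \<circ> l)) (f \<circ> \<gamma>)) (\<lambda>t. (f \<circ> \<gamma>) 1)"
    by (simp add: p_def path_join_compose path_rev_compose)
  then have "path_homotopic (fixed_space T H) (f \<circ> l) (\<lambda>t. (f \<circ> \<gamma>) 0)"
    by (intro path_homotopic_const_if_conjugate[OF pathin_compose[OF lG fc] pathin_compose[OF \<gamma>(1) fc]]) (use l01 \<gamma> in auto)
  then have hom: "path_homotopic (fixed_space T H) (f \<circ> l) (\<lambda>t. b (pole 1))" using \<gamma>(2) by (simp add: b_def y0_def)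
  have s: "continuous_map (disc 1) I01 (\<lambda>d. (d 0 + 1) / 2)"
  proof -
    have "continuous_on (ball_pts 1) (\<lambda>d. (d 0 + 1) / 2)"
      by (intro continuous_intros continuous_on_coord[OF continuous_on_id]) auto
    moreover have "(d 0 + 1) / 2 \<in> {0..1}" if "d \<in> ball_pts 1" for d using ball_pts_1(2)[OF that] by auto
    ultimately show ?thesis by (subst disc_eq) (auto simp: continuous_map_subtopology_eu)
  qed
  have fl: "(f \<circ> l) ((d 0 + 1) / 2) = (b \<circ> collapse 1) d" if "d \<in> ball_pts 1" for d
  proof -
    have "2 * ((d 0 + 1) / 2) - 1 = d 0" by (simp add: field_simps)
    then have "(f \<circ> l) ((d 0 + 1) / 2) = b (collapse 1 (axis_pt (d 0)))" unfolding l_def w_def b_def o_def by (simp only:)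
    also have "axis_pt (d 0) = d" by (rule ball_pts_1(1)[OF that, symmetric])
    finally show ?thesis by simp
  qed
  have f01: "(f \<circ> l) 0 = b (pole 1)" "(f \<circ> l) 1 = b (pole 1)" using l01 by (auto simp: b_def y0_def)
  have "homotopic_with (\<lambda>h. \<forall>d\<in>disc_boundary 1. h d = b (pole 1)) (disc 1) (fixed_space T H)
      ((f \<circ> l) \<circ> (\<lambda>d. (d 0 + 1) / 2)) ((\<lambda>t. b (pole 1)) \<circ> (\<lambda>d. (d 0 + 1) / 2))"
  proof (rule homotopic_with_compose_continuous_map_right[OF hom[unfolded path_homotopic_def] s])
    fix k :: "real \<Rightarrow> 't" assume "k 0 = (f \<circ> l) 0 \<and> k 1 = (f \<circ> l) 1"
    then have k: "k 0 = b (pole 1)" "k 1 = b (pole 1)" using f01 by auto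
    show "\<forall>d\<in>disc_boundary 1. (k \<circ> (\<lambda>d. (d 0 + 1) / 2)) d = b (pole 1)"
      unfolding disc_boundary_1 using k by (simp add: axis_pt_def)
  qed
  then have h: "homotopic_with (\<lambda>h. \<forall>d\<in>disc_boundary 1. h d = b (pole 1)) (disc 1) (fixed_space T H)
      ((f \<circ> l) \<circ> (\<lambda>d. (d 0 + 1) / 2)) (\<lambda>_. b (pole 1))" by (simp only: o_def)
  have "homotopic_with (\<lambda>h. \<forall>d\<in>disc_boundary 1. h d = b (pole 1)) (disc 1) (fixed_space T H)
      ((f \<circ> l) \<circ> (\<lambda>d. (d 0 + 1) / 2)) (b \<circ> collapse 1)"
  proof (rule homotopic_with_equal)
    show "\<forall>d\<in>disc_boundary 1. ((f \<circ> l) \<circ> (\<lambda>d. (d 0 + 1) / 2)) d = b (pole 1)"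
      using homotopic_with_imp_property[OF h] by blast
    show "\<forall>d\<in>disc_boundary 1. (b \<circ> collapse 1) d = b (pole 1)" using collapse_boundary by simp
    show "continuous_map (disc 1) (fixed_space T H) ((f \<circ> l) \<circ> (\<lambda>d. (d 0 + 1) / 2))"
      using homotopic_with_imp_continuous_maps[OF h] by blast
    show "((f \<circ> l) \<circ> (\<lambda>d. (d 0 + 1) / 2)) d = (b \<circ> collapse 1) d" if "d \<in> ball_pts 1" for d
      using fl[OF that] by (simp only: o_apply)
  qed
  then show ?thesis unfolding H_def[symmetric] by (rule homotopic_with_trans[OF homotopic_with_symD h])
qed

text \<open>Start with the map on the graph. The obstruction to extending over a 2-cell is its attaching
  circle; over higher cells there is none because the spheres in fixed point sets of \<open>T\<close> are null
  homotopic. Every path between vertices of \<open>Y\<close> is homotopic to one in the graph, so the resulting map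
  induces \<open>\<Psi>\<close>.\<close>

lemma realization:
  assumes null: "\<And>H n. subgroup H G \<Longrightarrow> n \<ge> 2 \<Longrightarrow> spheres_null n (fixed_space T H)"
  obtains f where "cellular_G_map G Y T f" "orb_trans_eq G (Pi1 Y) (Pi1_map T f) \<Psi>"
proof -
  obtain f1 where f1: "partial_map 1 f1" "follows_Psi f1" by (rule map_on_graph)
  have step: "\<exists>f'. partial_map (Suc n) f' \<and> (\<forall>y\<in>skel Y n. f' y = f y)"
    if f: "partial_map n f" and n: "n > 0"
      and circ: "n = 1 \<Longrightarrow> follows_Psi f" for n f
  proof -
    obtain I S q where att: "G_attachment G Y (Suc n) (skel Y n) (skel Y (Suc n)) I S q" by (rule Y.attach_SucE)
    interpret a: G_attachment G Y "Suc n" "skel Y n" "skel Y (Suc n)" I S q by (rule att)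
    have "\<exists>e. continuous_map (disc (Suc n)) (fixed_space T (S i)) e \<and> (\<forall>d\<in>disc_boundary (Suc n). e d = f (q i (S i, d)))"
      if i: "i \<in> I" for i
    proof -
      define b where "b d = f (q i (S i, d))" for d
      have bc: "continuous_map (top_of_set (disc_boundary (Suc n))) (fixed_space T (S i)) b"
      proof -
        have "continuous_map (top_of_set (disc_boundary (Suc n))) (disc (Suc n)) id"
          by (subst disc_eq) (auto simp: disc_boundary_def)
        from continuous_map_compose[OF this a.base_cont[OF i]]
        have "continuous_map (top_of_set (disc_boundary (Suc n))) (subtopology (spc Y) (skel Y n \<inter> fixed_set Y (S i))) (\<lambda>d. q i (S i, d))"
          using a.base_boundary[OF i] by (auto simp: o_def continuous_map_in_subtopology)
        from continuous_map_compose[OF this partial_map_fixed[OF f a.S[OF i]]] show ?thesis by (simp add: o_def b_def[abs_def])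
      qed
      have "homotopic_with (\<lambda>h. \<forall>d\<in>disc_boundary n. h d = b (pole n)) (disc n) (fixed_space T (S i)) (b \<circ> collapse n) (\<lambda>_. b (pole n))"
      proof (cases "n = 1")
        case True
        then show ?thesis using attaching_circle_null[of I S q i f] att i f circ unfolding b_def[abs_def] by simp
      next
        case False
        then show ?thesis using null[OF a.S[OF i], of n] n bc unfolding spheres_null_def by simp
      qed
      then show ?thesis
      proof (rule sphere_extends_over_disc[OF n])
        fix F assume "continuous_map (disc (Suc n)) (fixed_space T (S i)) F" "\<And>z. z \<in> disc_boundary (Suc n) \<Longrightarrow> F z = b z"
        then show ?thesis unfolding b_def by (intro exI[of _ F]) simp
      qed
    qed
    then obtain e where e: "\<And>i. i \<in> I \<Longrightarrow> continuous_map (disc (Suc n)) (fixed_space T (S i)) (e i)"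
      "\<And>i d. i \<in> I \<Longrightarrow> d \<in> disc_boundary (Suc n) \<Longrightarrow> e i d = f (q i (S i, d))" by metis
    obtain f' where "partial_map (Suc n) f'" "\<And>y. y \<in> skel Y n \<Longrightarrow> f' y = f y"
      using extend_partial_map[OF att f e] by metis
    then show ?thesis by blast
  qed
  obtain f2 where f2: "partial_map 2 f2" "\<And>y. y \<in> skel Y 1 \<Longrightarrow> f2 y = f1 y"
    using step[OF f1(1)] f1(2) by (auto simp: numeral_2_eq_2)
  \<comment> \<open>the start of the sequence is fixed so that the limit agrees with \<open>f1\<close> on the graph\<close>
  have "\<exists>F. \<forall>n. (partial_map (n + 2) (F n) \<and> (n = 0 \<longrightarrow> F n = f2)) \<and> (\<forall>y\<in>skel Y (n + 2). F (Suc n) y = F n y)"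
  proof (rule dependent_nat_choice)
    have "0 + 2 = (2::nat)" by simp
    then show "\<exists>f. partial_map (0 + 2) f \<and> (0 = (0::nat) \<longrightarrow> f = f2)" using f2(1) by metis
    fix f n assume "partial_map (n + 2) f \<and> (n = 0 \<longrightarrow> f = f2)"
    then obtain f' where "partial_map (Suc (n + 2)) f'" "\<forall>y\<in>skel Y (n + 2). f' y = f y"
      using step[of "n + 2" f] by auto
    then show "\<exists>f'. (partial_map (Suc n + 2) f' \<and> (Suc n = 0 \<longrightarrow> f' = f2)) \<and> (\<forall>y\<in>skel Y (n + 2). f' y = f y)"
      by (intro exI[of _ f']) simp
  qed
  then obtain F where F: "\<And>n. partial_map (n + 2) (F n)" "F 0 = f2" "\<And>n y. y \<in> skel Y (n + 2) \<Longrightarrow> F (Suc n) y = F n y"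
    by blast
  obtain f where f: "continuous_map (spc Y) (spc T) f" "\<And>n y. y \<in> skel Y (n + 2) \<Longrightarrow> f y = F n y"
    by (rule Y.glue_maps_over_skeleta[of 2 "spc T" F]) (use F in \<open>auto simp: partial_map_def\<close>)
  have cell: "cellular_G_map G Y T f" unfolding cellular_G_map_def G_equivariant_def
  proof (intro conjI f(1) ballI allI)
    fix g y assume g: "g \<in> carrier G" and "y \<in> topspace (spc Y)"
    then obtain n where "y \<in> skel Y n" using Y.topspace_skel by blast
    then have n: "y \<in> skel Y (n + 2)" using Y.skel_mono[of n "n + 2"] by auto
    then show "f (act Y g y) = act T g (f y)"
      using f(2)[OF n] f(2)[OF Y.act_skel[OF g n]] F(1)[of n] g unfolding partial_map_def by simp
  next
    fix n
    have "f y \<in> skel T n" if "y \<in> skel Y n" for y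
    proof -
      have "y \<in> skel Y (n + 2)" using that Y.skel_mono[of n "n + 2"] by auto
      moreover have "F n ` skel Y n \<subseteq> skel T n" using F(1)[of n] unfolding partial_map_def by simp
      ultimately show ?thesis using f(2) that by auto
    qed
    then show "f ` skel Y n \<subseteq> skel T n" by blast
  qed
  have ff1: "f y = f1 y" if "y \<in> skel Y 1" for y
  proof -
    have "y \<in> skel Y (0 + 2)" using that Y.skel_mono[of 1 "0 + 2"] by auto
    from f(2)[OF this] show ?thesis using F(2) f2(2)[OF that] by simp
  qed
  have "orb_trans_eq G (Pi1 Y) (Pi1_map T f) \<Psi>" unfolding orb_trans_eq_def gpd_map_eq_def Y.val_Pi1
  proof (intro allI impI conjI ballI)
    fix H y assume H: "subgroup H G" and "y \<in> Ob (fund_groupoid (fixed_space Y H) (skel Y 0))"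
    then have y: "y \<in> fixed_set Y H" "y \<in> skel Y 0" by auto
    then have "f y = vertex_map y" using ff1 f1(2) Y.skel_mono[of 0 1] by (auto simp: follows_Psi_def)
    then show "on_ob (Pi1_map T f H) y = on_ob (\<Psi> H) y" using vertex_map[OF H y] by (simp add: Pi1_map_def)
  next
    fix H c assume H: "subgroup H G" and c: "c \<in> Mor (fund_groupoid (fixed_space Y H) (skel Y 0))"
    then obtain p where p: "c = path_class (fixed_space Y H) p" "pathin (fixed_space Y H) p" "p 0 \<in> skel Y 0" "p 1 \<in> skel Y 0"
      unfolding Mor_fund by blast
    have fH: "continuous_map (fixed_space Y H) (fixed_space T H) f"
    proof -
      have "f y \<in> fixed_set T H" if y: "y \<in> fixed_set Y H" for y
      proof (rule equivariant_fixed[OF _ _ H _ y])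
        show "f (act Y g y) = act T g (f y)" if "g \<in> carrier G" "y \<in> topspace (spc Y)" for g y
          using cell that unfolding cellular_G_map_def G_equivariant_def by blast
        show "f \<in> topspace (spc Y) \<rightarrow> topspace (spc T)" by (rule continuous_map_funspace[OF f(1)])
        show "y \<in> topspace (spc Y)" using y by (simp add: fixed_set_def)
      qed
      then show ?thesis using f(1) unfolding fixed_space_def
        by (auto simp: continuous_map_in_subtopology intro: continuous_map_from_subtopology)
    qed
    have p1: "p 0 \<in> skel Y 1" "p 1 \<in> skel Y 1" using p Y.skel_mono[of 0 1] by auto
    obtain p' where p': "path_homotopic (fixed_space Y H) p p'" "\<And>t. t \<in> {0..1} \<Longrightarrow> p' t \<in> skel Y 1"
      using Y.compress_path[OF H p(2) p1] by blast
    note imp = path_homotopic_imp[OF p'(1)]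
    have p'G: "pathin (subtopology (spc Y) (skel Y 1 \<inter> fixed_set Y H)) p'"
      using imp(2) p'(2) unfolding fixed_space_def by (auto simp: pathin_subtopology)
    have "on_mor (\<Psi> H) (path_class (fixed_space Y H) p') = path_class (fixed_space T H) (f1 \<circ> p')"
      using f1(2) H p'G imp p unfolding follows_Psi_def by simp
    moreover have "path_class (fixed_space T H) (f1 \<circ> p') = path_class (fixed_space T H) (f \<circ> p')"
    proof (rule path_class_eqI, rule path_homotopic_sym, rule path_homotopic_eq_on)
      show "pathin (fixed_space T H) (f \<circ> p')" by (rule pathin_compose[OF imp(2) fH])
      show "(f \<circ> p') t = (f1 \<circ> p') t" if "t \<in> {0..1}" for t using ff1[OF p'(2)[OF that]] by simp
    qed
    moreover have "path_class (fixed_space T H) (f \<circ> p) = path_class (fixed_space T H) (f \<circ> p')"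
      by (rule path_class_eqI[OF path_homotopic_compose[OF p'(1) fH]])
    moreover have "path_class (fixed_space Y H) p = path_class (fixed_space Y H) p'" by (rule path_class_eqI[OF p'(1)])
    ultimately show "on_mor (Pi1_map T f H) c = on_mor (\<Psi> H) c"
      using on_mor_fund_map[OF fH p(2)] by (simp add: Pi1_map_def p(1))
  qed
  then show ?thesis using that cell by blast
qed

end

section \<open>Transporting transformations along isomorphisms\<close>

text \<open>Closure under the structure maps, which makes the inverse of a bijective functor a functor.\<close>

definition cat_closed :: "('o, 'm) cat_data \<Rightarrow> bool" where
  "cat_closed A \<longleftrightarrow> (\<forall>x\<in>Ob A. idm A x \<in> Mor A) \<and> (\<forall>f\<in>Mor A. src A f \<in> Ob A \<and> tgt A f \<in> Ob A) \<and>
     (\<forall>f\<in>Mor A. \<forall>g\<in>Mor A. tgt A f = src A g \<longrightarrow> cmp A f g \<in> Mor A)"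

lemma cat_closed_fund_groupoid: "cat_closed (fund_groupoid X A)"
  unfolding cat_closed_def
proof (intro conjI ballI impI)
  fix x assume "x \<in> Ob (fund_groupoid X A)"
  then show "idm (fund_groupoid X A) x \<in> Mor (fund_groupoid X A)" by (auto simp: idm_fund intro!: Mor_fundI)
next
  fix f assume "f \<in> Mor (fund_groupoid X A)"
  then obtain p where p: "f = path_class X p" "pathin X p" "p 0 \<in> A" "p 1 \<in> A" unfolding Mor_fund by blast
  then show "src (fund_groupoid X A) f \<in> Ob (fund_groupoid X A)" "tgt (fund_groupoid X A) f \<in> Ob (fund_groupoid X A)"
    using path_start_in_topspace[OF p(2)] path_finish_in_topspace[OF p(2)] by (auto simp: src_fund tgt_fund)
  fix g assume "g \<in> Mor (fund_groupoid X A)" and e: "tgt (fund_groupoid X A) f = src (fund_groupoid X A) g"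
  then obtain r where r: "g = path_class X r" "pathin X r" "r 0 \<in> A" "r 1 \<in> A" unfolding Mor_fund by blast
  have "p 1 = r 0" using e p r by (simp add: src_fund tgt_fund)
  then show "cmp (fund_groupoid X A) f g \<in> Mor (fund_groupoid X A)"
    using p r by (auto simp: cmp_fund intro!: Mor_fundI pathin_join)
qed

lemma gpd_functor_inv:
  assumes A: "cat_closed A" and F: "gpd_iso A B F"
  shows "gpd_functor B A (gpd_inv A F)"
proof -
  have fn: "gpd_functor A B F" and bo: "bij_betw (on_ob F) (Ob A) (Ob B)" and bm: "bij_betw (on_mor F) (Mor A) (Mor B)"
    using F by (auto simp: gpd_iso_def)
  have o: "on_ob (gpd_inv A F) (on_ob F x) = x" if "x \<in> Ob A" for x
    using bij_betw_inv_into_left[OF bo that] by (simp add: gpd_inv_def)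
  have m: "on_mor (gpd_inv A F) (on_mor F f) = f" if "f \<in> Mor A" for f
    using bij_betw_inv_into_left[OF bm that] by (simp add: gpd_inv_def)
  have Oc: "\<exists>x\<in>Ob A. y = on_ob F x" if "y \<in> Ob B" for y
    using bo that unfolding bij_betw_def by blast
  have Mc: "\<exists>f\<in>Mor A. g = on_mor F f" if "g \<in> Mor B" for g
    using bm that unfolding bij_betw_def by blast
  note f = fn[unfolded gpd_functor_def] and cl = A[unfolded cat_closed_def]
  show ?thesis unfolding gpd_functor_def
  proof (intro conjI ballI impI)
    fix y assume "y \<in> Ob B"
    then obtain x where x: "x \<in> Ob A" "y = on_ob F x" using Oc by blast
    then show "on_ob (gpd_inv A F) y \<in> Ob A" using o by simp
    have "idm B y = on_mor F (idm A x)" using f x by simp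
    then show "on_mor (gpd_inv A F) (idm B y) = idm A (on_ob (gpd_inv A F) y)" using m o x cl by simp
  next
    fix h assume "h \<in> Mor B"
    then obtain k where k: "k \<in> Mor A" "h = on_mor F k" using Mc by blast
    then show "on_mor (gpd_inv A F) h \<in> Mor A" using m by simp
    show "src A (on_mor (gpd_inv A F) h) = on_ob (gpd_inv A F) (src B h)"
      "tgt A (on_mor (gpd_inv A F) h) = on_ob (gpd_inv A F) (tgt B h)" using f k m o cl by simp_all
    fix h' assume "h' \<in> Mor B" and e: "tgt B h = src B h'"
    then obtain k' where k': "k' \<in> Mor A" "h' = on_mor F k'" using Mc by blast
    have "on_ob F (tgt A k) = on_ob F (src A k')" using e f k k' by simp
    then have tk: "tgt A k = src A k'" using bo k k' cl unfolding bij_betw_def inj_on_def by blast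
    then have "cmp B h h' = on_mor F (cmp A k k')" using f k k' by simp
    then show "on_mor (gpd_inv A F) (cmp B h h') = cmp A (on_mor (gpd_inv A F) h) (on_mor (gpd_inv A F) h')"
      using m k k' cl tk by simp
  qed
qed

definition orb_closed :: "('g, 'z) monoid_scheme \<Rightarrow> ('g, 'o, 'm) orb_data \<Rightarrow> bool" where
  "orb_closed G P \<longleftrightarrow> (\<forall>H. subgroup H G \<longrightarrow> cat_closed (val P H)) \<and>
     (\<forall>H K. \<forall>f\<in>orb_hom G H K. (\<forall>x\<in>Ob (val P K). on_ob (res P H K f) x \<in> Ob (val P H)) \<and>
        (\<forall>m\<in>Mor (val P K). on_mor (res P H K f) m \<in> Mor (val P H)))"

lemma orb_nat_trans_inv:
  assumes P: "orb_closed G P" and F: "orb_nat_iso G P P' F"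
  shows "orb_nat_trans G P' P (\<lambda>H. gpd_inv (val P H) (F H))"
  unfolding orb_nat_trans_def
proof (intro conjI allI impI ballI)
  fix H assume "subgroup H G"
  then show "gpd_functor (val P' H) (val P H) (gpd_inv (val P H) (F H))"
    using P F gpd_functor_inv unfolding orb_closed_def orb_nat_iso_def by blast
next
  fix H K f assume f: "f \<in> orb_hom G H K"
  then have H: "subgroup H G" and K: "subgroup K G" by (auto simp: orb_hom_def)
  have bo: "bij_betw (on_ob (F H)) (Ob (val P H)) (Ob (val P' H))" "bij_betw (on_ob (F K)) (Ob (val P K)) (Ob (val P' K))"
    and bm: "bij_betw (on_mor (F H)) (Mor (val P H)) (Mor (val P' H))" "bij_betw (on_mor (F K)) (Mor (val P K)) (Mor (val P' K))"
    using F H K unfolding orb_nat_iso_def gpd_iso_def by blast+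
  have n: "gpd_map_eq (val P K) (F H \<circ>\<^sub>g res P H K f) (res P' H K f \<circ>\<^sub>g F K)"
    using F f unfolding orb_nat_iso_def orb_nat_trans_def by blast
  have cl: "\<And>x. x \<in> Ob (val P K) \<Longrightarrow> on_ob (res P H K f) x \<in> Ob (val P H)"
    "\<And>m. m \<in> Mor (val P K) \<Longrightarrow> on_mor (res P H K f) m \<in> Mor (val P H)"
    using P f unfolding orb_closed_def by blast+
  show "gpd_map_eq (val P' K) (gpd_inv (val P H) (F H) \<circ>\<^sub>g res P' H K f) (res P H K f \<circ>\<^sub>g gpd_inv (val P K) (F K))"
    unfolding gpd_map_eq_def
  proof (intro conjI ballI)
    fix y assume "y \<in> Ob (val P' K)"
    then obtain x where x: "x \<in> Ob (val P K)" "y = on_ob (F K) x" using bo(2) unfolding bij_betw_def by blast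
    have "on_ob (res P' H K f) y = on_ob (F H) (on_ob (res P H K f) x)"
      using n x unfolding gpd_map_eq_def gpd_comp_def by simp
    then show "on_ob (gpd_inv (val P H) (F H) \<circ>\<^sub>g res P' H K f) y = on_ob (res P H K f \<circ>\<^sub>g gpd_inv (val P K) (F K)) y"
      using bij_betw_inv_into_left[OF bo(1) cl(1)[OF x(1)]] bij_betw_inv_into_left[OF bo(2) x(1)] x(2)
      by (simp add: gpd_comp_def gpd_inv_def)
  next
    fix y assume "y \<in> Mor (val P' K)"
    then obtain x where x: "x \<in> Mor (val P K)" "y = on_mor (F K) x" using bm(2) unfolding bij_betw_def by blast
    have "on_mor (res P' H K f) y = on_mor (F H) (on_mor (res P H K f) x)"
      using n x unfolding gpd_map_eq_def gpd_comp_def by simp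
    then show "on_mor (gpd_inv (val P H) (F H) \<circ>\<^sub>g res P' H K f) y = on_mor (res P H K f \<circ>\<^sub>g gpd_inv (val P K) (F K)) y"
      using bij_betw_inv_into_left[OF bm(1) cl(2)[OF x(1)]] bij_betw_inv_into_left[OF bm(2) x(1)] x(2)
      by (simp add: gpd_comp_def gpd_inv_def)
  qed
qed

lemma orb_nat_trans_comp:
  assumes F: "orb_nat_trans G P P' F" and F': "orb_nat_trans G P' P'' F'"
  shows "orb_nat_trans G P P'' (\<lambda>H. F' H \<circ>\<^sub>g F H)"
  unfolding orb_nat_trans_def
proof (intro conjI allI impI ballI)
  fix H assume H: "subgroup H G"
  have "gpd_functor (val P H) (val P' H) (F H)" "gpd_functor (val P' H) (val P'' H) (F' H)"
    using F F' H unfolding orb_nat_trans_def by blast+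
  then show "gpd_functor (val P H) (val P'' H) (F' H \<circ>\<^sub>g F H)"
    unfolding gpd_functor_def gpd_comp_def by simp
next
  fix H K f assume f: "f \<in> orb_hom G H K"
  then have K: "subgroup K G" by (auto simp: orb_hom_def)
  have "gpd_map_eq (val P K) (F H \<circ>\<^sub>g res P H K f) (res P' H K f \<circ>\<^sub>g F K)"
    "gpd_map_eq (val P' K) (F' H \<circ>\<^sub>g res P' H K f) (res P'' H K f \<circ>\<^sub>g F' K)" "gpd_functor (val P K) (val P' K) (F K)"
    using F F' f K unfolding orb_nat_trans_def by blast+
  then show "gpd_map_eq (val P K) ((F' H \<circ>\<^sub>g F H) \<circ>\<^sub>g res P H K f) (res P'' H K f \<circ>\<^sub>g (F' K \<circ>\<^sub>g F K))"
    unfolding gpd_map_eq_def gpd_functor_def gpd_comp_def by simp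
qed

section \<open>The universal space\<close>

context G_space_loc
begin

lemma orb_homE:
  assumes f: "f \<in> orb_hom G H K"
  obtains g where "subgroup H G" "subgroup K G" "g \<in> carrier G" "f H = g <# K" "\<forall>h\<in>H. h <# (g <# K) = g <# K"
proof -
  have H: "subgroup H G" and K: "subgroup K G" and fm: "f \<in> (lcosets H) \<rightarrow>\<^sub>E (lcosets K)"
    and eq: "\<And>g C. g \<in> carrier G \<Longrightarrow> C \<in> lcosets H \<Longrightarrow> f (g <# C) = g <# f C"
    using f by (auto simp: orb_hom_def)
  have "f H \<in> lcosets K" using PiE_mem[OF fm self_lcoset[OF H]] .
  then obtain g where g: "g \<in> carrier G" "f H = g <# K" by (rule lcosetE)
  have "h <# (g <# K) = g <# K" if "h \<in> H" for h
    using eq[OF subgroup.mem_carrier[OF H that] self_lcoset[OF H]] coset_join3[OF subgroup.mem_carrier[OF H that] H that] g(2) by simp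
  then show ?thesis using that H K g by blast
qed

lemma orb_closed_Pi1:
  assumes inv: "\<And>g x. g \<in> carrier G \<Longrightarrow> x \<in> skel X 0 \<Longrightarrow> act X g x \<in> skel X 0"
  shows "orb_closed G (Pi1 X)"
  unfolding orb_closed_def
proof (intro conjI allI impI ballI)
  show "cat_closed (val (Pi1 X) H)" for H unfolding val_Pi1 by (rule cat_closed_fund_groupoid)
  fix H K f assume "f \<in> orb_hom G H K"
  then obtain g where g: "subgroup H G" "subgroup K G" "g \<in> carrier G" "f H = g <# K" "\<forall>h\<in>H. h <# (g <# K) = g <# K"
    using orb_homE by metis
  note r = res_Pi1[where f = f, OF g(1,2,3,5,4)]
  show "on_ob (res (Pi1 X) H K f) x \<in> Ob (val (Pi1 X) H)" if "x \<in> Ob (val (Pi1 X) K)" for x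
    using that r(1)[of x] act_fixed[OF g(2,1,3,5), of x] inv[OF g(3)] unfolding val_Pi1 by simp
  show "on_mor (res (Pi1 X) H K f) m \<in> Mor (val (Pi1 X) H)" if m: "m \<in> Mor (val (Pi1 X) K)" for m
  proof -
    obtain p where p: "m = path_class (fixed_space X K) p" "pathin (fixed_space X K) p" "p 0 \<in> skel X 0" "p 1 \<in> skel X 0"
      using m unfolding val_Pi1 Mor_fund by blast
    have "pathin (fixed_space X H) (act X g \<circ> p)" by (rule pathin_compose[OF p(2) act_fixed_cont[OF g(2,1,3,5)]])
    then show ?thesis unfolding val_Pi1 p(1) r(2)[OF p(2)] using inv[OF g(3)] p by (intro Mor_fundI) auto
  qed
qed

end

locale universal = T: G_CW G T for G :: "('g, 'z) monoid_scheme" (structure) and T :: "('g, 't) gcw_data" +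
  fixes P :: "('g, 'o, 'm) orb_data" and Xs :: "nat \<Rightarrow> 't set"
    and \<theta> :: "'g set \<Rightarrow> ('t, (real \<Rightarrow> 't) set, 'o, 'm) gpd_map"
  assumes univ: "universal_space G P T Xs \<theta>"
begin

abbreviation "T2 \<equiv> sub_gcw T (Xs 2)"

lemma attach: "k \<ge> 2 \<Longrightarrow> attach_G_cells G T (Suc k) (Xs k) (Xs (Suc k))"
  using univ unfolding universal_space_def by (metis Suc_le_mono diff_Suc_1 eval_nat_numeral(3))

lemma stage_eq: "k \<ge> 2 \<Longrightarrow> Xs k = Xs 2 \<union> skel T k"
  using univ unfolding universal_space_def by blast

lemma skel_in_stage: "k \<ge> 2 \<Longrightarrow> skel T k \<subseteq> Xs k"
  using stage_eq[of k] by blast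

lemma vertices: "skel T 0 \<subseteq> Xs 2"
  using skel_in_stage[of 2] T.skel_mono[of 0 2] by auto

lemma stage_topspace: "k \<ge> 2 \<Longrightarrow> Xs k \<subseteq> topspace (spc T)"
  using conjunct1[OF conjunct2[OF attach[unfolded attach_G_cells_def]]] conjunct1[OF attach[unfolded attach_G_cells_def]]
  by (rule order_trans[rotated])

lemma stage_Suc: "k \<ge> 2 \<Longrightarrow> Xs k \<subseteq> Xs (Suc k)"
  by (rule conjunct1[OF attach[unfolded attach_G_cells_def]])

lemma T2_CW: "G_CW_complex G T2"
  using univ unfolding universal_space_def by blast

sublocale T2: G_CW G T2
  by unfold_locales (rule T2_CW)

lemma colim: "colimit_topology (spc T) (\<lambda>n. Xs (n + 2))"
  using univ unfolding universal_space_def by blast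

lemma fixed_set_stage:
  assumes "k \<ge> 2" shows "fixed_set (sub_gcw T (Xs k)) H = Xs k \<inter> fixed_set T H"
  using stage_topspace[OF assms] by (auto simp: fixed_set_def sub_gcw_def)

lemma fixed_space_stage:
  assumes "k \<ge> 2" shows "fixed_space (sub_gcw T (Xs k)) H = subtopology (spc T) (Xs k \<inter> fixed_set T H)"
  unfolding fixed_space_def fixed_set_stage[OF assms] by (simp add: sub_gcw_def subtopology_subtopology Int_assoc)

lemma skel_T2: "skel T2 0 = skel T 0"
  using vertices by (auto simp: sub_gcw_def)

text \<open>Cells attached after the stage \<open>n\<close> have dimension larger than \<open>n\<close>, so this goes as for skeleta.\<close>

lemma compress_into_stage:
  fixes K :: "'k::metric_space set"
  assumes H: "subgroup H G" and K: "compact K" "box_dim_le l K" and n: "l \<le> n" "n \<ge> 2"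
    and f: "continuous_map (top_of_set K) (fixed_space T H) f"
  obtains f' where "homotopic_with (\<lambda>h. \<forall>k\<in>K. f k \<in> Xs n \<longrightarrow> h k = f k) (top_of_set K) (fixed_space T H) f f'"
    "f' ` K \<subseteq> Xs n"
proof -
  have mono: "Xs (k + 2) \<subseteq> Xs (k + 2 + m)" for k m
  proof (induction m)
    case (Suc m)
    have "Xs (k + 2 + m) \<subseteq> Xs (k + 2 + Suc m)" using stage_Suc[of "k + 2 + m"] by simp
    with Suc show ?case by (rule order_trans)
  qed simp
  have "compactin (spc T) (f ` K)"
  proof (rule image_compactin)
    show "compactin (top_of_set K) K" using K(1) by (simp add: compactin_subtopology)
    show "continuous_map (top_of_set K) (spc T) f" using f by (simp add: fixed_space_def continuous_map_in_subtopology)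
  qed
  then obtain N where "f ` K \<subseteq> Xs (N + 2)"
    using compactin_subset_stage[OF colim _ T.closedin_point, of "f ` K"] stage_Suc by auto
  also have "Xs (N + 2) \<subseteq> Xs (n + N)"
  proof -
    have "N + 2 + (n - 2) = n + N" using n(2) by simp
    then show ?thesis using mono[of N "n - 2"] by (simp only:)
  qed
  finally have N: "f ` K \<subseteq> Xs (n + N)" .
  have cells: "\<exists>d>l. \<exists>(J :: ('t \<times> 'g set) set) q. cell_attachment (spc T) d (Xs (n + k) \<inter> fixed_set T H) (Xs (n + Suc k) \<inter> fixed_set T H) J q" for k
  proof -
    obtain I S q where "G_attachment G T (Suc (n + k)) (Xs (n + k)) (Xs (Suc (n + k))) I S q"
      using attach_G_cellsE[OF T.is_group T.G_space attach[of "n + k"]] n(2) by auto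
    from G_attachment.fixed_attachment(1)[OF this H T.closedin_sub_fixed[OF H]] show ?thesis
      using n(1) by (intro exI[of _ "Suc (n + k)"] conjI) auto
  qed
  show ?thesis
    by (rule compress_into_first_stage[where Fs = "\<lambda>k. Xs (n + k)" and X = "spc T" and C = "fixed_set T H" and K = K and l = l and N = N and f = f])
      (use cells f N K that in \<open>auto simp: fixed_space_def\<close>)
qed

lemma inclusion_cont: "continuous_map (fixed_space T2 H) (fixed_space T H) (\<lambda>x. x)"
proof -
  have "continuous_map (subtopology (spc T) (Xs 2 \<inter> fixed_set T H)) (spc T) (\<lambda>x. x)"
    by (rule continuous_map_from_subtopology) (simp add: continuous_map_id[unfolded id_def])
  then show ?thesis unfolding fixed_space_stage[OF order_refl] unfolding fixed_space_def
    by (auto simp: continuous_map_in_subtopology)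
qed

lemma inclusion_path:
  assumes "pathin (fixed_space T2 H) p"
  shows "on_mor (Pi1_map T (\<lambda>x. x) H) (path_class (fixed_space T2 H) p) = path_class (fixed_space T H) p"
  using on_mor_fund_map[OF inclusion_cont assms] by (simp add: Pi1_map_def o_def)

text \<open>A homotopy of paths is a map on a square, which can be compressed into \<open>X\<^sub>2\<close> relative to the
  two paths and their end points.\<close>

lemma path_homotopic_in_stage:
  assumes H: "subgroup H G" and p: "pathin (fixed_space T2 H) p" and r: "pathin (fixed_space T2 H) r"
    and h: "path_homotopic (fixed_space T H) p r"
  shows "path_homotopic (fixed_space T2 H) p r"
proof -
  obtain k where k: "continuous_map (prod_topology I01 I01) (fixed_space T H) k"
    "\<And>x. k (0, x) = p x" "\<And>x. k (1, x) = r x" "\<And>t. t \<in> {0..1} \<Longrightarrow> k (t, 0) = p 0 \<and> k (t, 1) = p 1"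
    using homotopic_withE[OF h[unfolded path_homotopic_def]] by blast
  define K where "K = {0..1::real} \<times> {0..1::real}"
  have K: "prod_topology I01 I01 = top_of_set K" by (simp add: K_def)
  have cK: "compact K" unfolding K_def by (intro compact_Times) auto
  have dK: "box_dim_le (1 + 1) K" unfolding K_def by (rule box_dim_le_Times[OF box_dim_le_interval box_dim_le_interval])
  have le: "1 + 1 \<le> (2::nat)" "2 \<le> (2::nat)" by auto
  obtain k' where k': "homotopic_with (\<lambda>h. \<forall>z\<in>K. k z \<in> Xs 2 \<longrightarrow> h z = k z) (top_of_set K) (fixed_space T H) k k'" "k' ` K \<subseteq> Xs 2"
    using compress_into_stage[OF H cK dK le k(1)[unfolded K]] by blast
  have kk: "k' z = k z" if "z \<in> K" "k z \<in> Xs 2" for z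
    using homotopic_with_imp_property[OF k'(1)] that by blast
  have kc: "continuous_map (prod_topology I01 I01) (fixed_space T2 H) k'"
    using homotopic_with_imp_continuous_maps[OF k'(1)] k'(2) unfolding K fixed_space_stage[OF order_refl]
    unfolding fixed_space_def by (auto simp: continuous_map_in_subtopology)
  have in2: "p t \<in> Xs 2" "r t \<in> Xs 2" if "t \<in> {0..1}" for t
    using path_image_subset_topspace[OF p] path_image_subset_topspace[OF r] that fixed_set_stage[of 2 H] by auto
  show ?thesis unfolding path_homotopic_def
  proof (rule homotopic_withI[OF kc])
    show "k' (0, t) = p t" "k' (1, t) = r t" if "t \<in> topspace I01" for t
      using that kk[of "(0, t)"] kk[of "(1, t)"] k in2 by (auto simp: K_def)
    show "k' (t, 0) = p 0 \<and> k' (t, 1) = p 1" if t: "t \<in> {0..1}" for t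
      using t kk[of "(t, 0)"] kk[of "(t, 1)"] k(4)[OF t] in2[of 0] in2[of 1] by (auto simp: K_def)
  qed auto
qed

text \<open>Paths and homotopies of paths have domains of dimension at most 2 and can be compressed into
  \<open>X\<^sub>2\<close>; the later cells change neither generators nor relations of the fundamental groupoid.\<close>

lemma inclusion_iso: "orb_nat_iso G (Pi1 T2) (Pi1 T) (Pi1_map T (\<lambda>x. x))"
  unfolding orb_nat_iso_def
proof (intro conjI allI impI)
  show "gpd_iso (val (Pi1 T2) H) (val (Pi1 T) H) (Pi1_map T (\<lambda>x. x) H)" if H: "subgroup H G" for H
    unfolding gpd_iso_def T.val_Pi1 T2.val_Pi1 skel_T2
  proof (intro conjI)
    have ob: "Ob (fund_groupoid (fixed_space T2 H) (skel T 0)) = Ob (fund_groupoid (fixed_space T H) (skel T 0))"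
      using vertices fixed_set_stage[of 2 H] by auto
    show fn: "gpd_functor (fund_groupoid (fixed_space T2 H) (skel T 0)) (fund_groupoid (fixed_space T H) (skel T 0)) (Pi1_map T (\<lambda>x. x) H)"
      unfolding gpd_functor_def
    proof (intro conjI ballI impI)
      fix x assume x: "x \<in> Ob (fund_groupoid (fixed_space T2 H) (skel T 0))"
      then show "on_ob (Pi1_map T (\<lambda>x. x) H) x \<in> Ob (fund_groupoid (fixed_space T H) (skel T 0))"
        unfolding ob by (simp add: Pi1_map_def)
      show "on_mor (Pi1_map T (\<lambda>x. x) H) (idm (fund_groupoid (fixed_space T2 H) (skel T 0)) x) =
          idm (fund_groupoid (fixed_space T H) (skel T 0)) (on_ob (Pi1_map T (\<lambda>x. x) H) x)"
        using inclusion_path[of H "\<lambda>t. x"] x by (simp add: idm_fund Pi1_map_def)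
    next
      fix c assume "c \<in> Mor (fund_groupoid (fixed_space T2 H) (skel T 0))"
      then obtain p where p: "c = path_class (fixed_space T2 H) p" "pathin (fixed_space T2 H) p" "p 0 \<in> skel T 0" "p 1 \<in> skel T 0"
        unfolding Mor_fund by blast
      have p': "pathin (fixed_space T H) p" using pathin_compose[OF p(2) inclusion_cont] by (simp add: o_def)
      note c = inclusion_path[OF p(2)]
      show "on_mor (Pi1_map T (\<lambda>x. x) H) c \<in> Mor (fund_groupoid (fixed_space T H) (skel T 0))"
        using c p p' by (simp add: Mor_fundI)
      show "src (fund_groupoid (fixed_space T H) (skel T 0)) (on_mor (Pi1_map T (\<lambda>x. x) H) c) =
          on_ob (Pi1_map T (\<lambda>x. x) H) (src (fund_groupoid (fixed_space T2 H) (skel T 0)) c)"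
        "tgt (fund_groupoid (fixed_space T H) (skel T 0)) (on_mor (Pi1_map T (\<lambda>x. x) H) c) =
          on_ob (Pi1_map T (\<lambda>x. x) H) (tgt (fund_groupoid (fixed_space T2 H) (skel T 0)) c)"
        using c p p' by (simp_all add: src_fund tgt_fund Pi1_map_def)
      fix d assume "d \<in> Mor (fund_groupoid (fixed_space T2 H) (skel T 0))"
        and e: "tgt (fund_groupoid (fixed_space T2 H) (skel T 0)) c = src (fund_groupoid (fixed_space T2 H) (skel T 0)) d"
      then obtain r where r: "d = path_class (fixed_space T2 H) r" "pathin (fixed_space T2 H) r" "r 0 \<in> skel T 0" "r 1 \<in> skel T 0"
        unfolding Mor_fund by blast
      have r': "pathin (fixed_space T H) r" using pathin_compose[OF r(2) inclusion_cont] by (simp add: o_def)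
      have pr: "p 1 = r 0" using e p r by (simp add: src_fund tgt_fund)
      show "on_mor (Pi1_map T (\<lambda>x. x) H) (cmp (fund_groupoid (fixed_space T2 H) (skel T 0)) c d) =
          cmp (fund_groupoid (fixed_space T H) (skel T 0)) (on_mor (Pi1_map T (\<lambda>x. x) H) c) (on_mor (Pi1_map T (\<lambda>x. x) H) d)"
        unfolding p(1) r(1) cmp_fund[OF p(2) r(2) pr] inclusion_path[OF p(2)] inclusion_path[OF r(2)]
          inclusion_path[OF pathin_join[OF p(2) r(2) pr]] cmp_fund[OF p' r' pr] ..
    qed
    show "bij_betw (on_ob (Pi1_map T (\<lambda>x. x) H)) (Ob (fund_groupoid (fixed_space T2 H) (skel T 0))) (Ob (fund_groupoid (fixed_space T H) (skel T 0)))"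
      unfolding ob by (simp add: Pi1_map_def bij_betw_def inj_on_def)
    show "bij_betw (on_mor (Pi1_map T (\<lambda>x. x) H)) (Mor (fund_groupoid (fixed_space T2 H) (skel T 0))) (Mor (fund_groupoid (fixed_space T H) (skel T 0)))"
    proof (rule bij_betw_imageI)
      show "inj_on (on_mor (Pi1_map T (\<lambda>x. x) H)) (Mor (fund_groupoid (fixed_space T2 H) (skel T 0)))"
      proof (rule inj_onI)
        fix c d assume "c \<in> Mor (fund_groupoid (fixed_space T2 H) (skel T 0))" "d \<in> Mor (fund_groupoid (fixed_space T2 H) (skel T 0))"
          and e: "on_mor (Pi1_map T (\<lambda>x. x) H) c = on_mor (Pi1_map T (\<lambda>x. x) H) d"
        then obtain p r where p: "c = path_class (fixed_space T2 H) p" "pathin (fixed_space T2 H) p"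
          and r: "d = path_class (fixed_space T2 H) r" "pathin (fixed_space T2 H) r"
          unfolding Mor_fund by blast
        have "pathin (fixed_space T H) p" "pathin (fixed_space T H) r"
          using pathin_compose[OF p(2) inclusion_cont] pathin_compose[OF r(2) inclusion_cont] by (simp_all add: o_def)
        then have "path_homotopic (fixed_space T H) p r"
          using e p r inclusion_path[OF p(2)] inclusion_path[OF r(2)] path_class_eq_iff by metis
        from path_homotopic_in_stage[OF H p(2) r(2) this] show "c = d" unfolding p(1) r(1) by (rule path_class_eqI)
      qed
      show "on_mor (Pi1_map T (\<lambda>x. x) H) ` Mor (fund_groupoid (fixed_space T2 H) (skel T 0)) = Mor (fund_groupoid (fixed_space T H) (skel T 0))"
      proof (intro equalityI subsetI)
        fix c assume "c \<in> on_mor (Pi1_map T (\<lambda>x. x) H) ` Mor (fund_groupoid (fixed_space T2 H) (skel T 0))"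
        then show "c \<in> Mor (fund_groupoid (fixed_space T H) (skel T 0))" using fn unfolding gpd_functor_def by blast
      next
        fix c assume "c \<in> Mor (fund_groupoid (fixed_space T H) (skel T 0))"
        then obtain p where p: "c = path_class (fixed_space T H) p" "pathin (fixed_space T H) p" "p 0 \<in> skel T 0" "p 1 \<in> skel T 0"
          unfolding Mor_fund by blast
        have cI: "compact {0..1::real}" by simp
        have le: "1 \<le> (2::nat)" "2 \<le> (2::nat)" by auto
        obtain p' where p': "homotopic_with (\<lambda>h. \<forall>k\<in>{0..1}. p k \<in> Xs 2 \<longrightarrow> h k = p k) (top_of_set {0..1}) (fixed_space T H) p p'" "p' ` {0..1} \<subseteq> Xs 2"
          using compress_into_stage[OF H cI box_dim_le_interval le p(2)[unfolded pathin_def]] by blast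
        have hom: "path_homotopic (fixed_space T H) p p'" unfolding path_homotopic_def
          by (rule homotopic_with_mono[OF p'(1)]) (use p vertices in auto)
        note imp = path_homotopic_imp[OF hom]
        have pp: "pathin (fixed_space T2 H) p'"
          using imp(2) p'(2) unfolding fixed_space_stage[OF order_refl] unfolding fixed_space_def by (auto simp: pathin_subtopology)
        have "c = on_mor (Pi1_map T (\<lambda>x. x) H) (path_class (fixed_space T2 H) p')"
          unfolding inclusion_path[OF pp] p(1) by (rule path_class_eqI[OF hom])
        moreover have "path_class (fixed_space T2 H) p' \<in> Mor (fund_groupoid (fixed_space T2 H) (skel T 0))"
          by (rule Mor_fundI[OF pp]) (use imp p in auto)
        ultimately show "c \<in> on_mor (Pi1_map T (\<lambda>x. x) H) ` Mor (fund_groupoid (fixed_space T2 H) (skel T 0))" by blast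
      qed
    qed
  qed
  then have fn: "gpd_functor (val (Pi1 T2) H) (val (Pi1 T) H) (Pi1_map T (\<lambda>x. x) H)" if "subgroup H G" for H
    using that unfolding gpd_iso_def by blast
  show "orb_nat_trans G (Pi1 T2) (Pi1 T) (Pi1_map T (\<lambda>x. x))" unfolding orb_nat_trans_def
  proof (intro conjI allI impI ballI fn)
    fix H K f assume "f \<in> orb_hom G H K"
    then obtain g where g: "subgroup H G" "subgroup K G" "g \<in> carrier G" "f H = g <# K" "\<forall>h\<in>H. h <# (g <# K) = g <# K"
      using T.orb_homE by metis
    note r2 = T2.res_Pi1[where f = f, OF g(1,2,3,5,4)] and r = T.res_Pi1[where f = f, OF g(1,2,3,5,4)]
    have act2: "act T2 g x = act T g x" if "x \<in> Xs 2" for x using that by (simp add: sub_gcw_def)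
    show "gpd_map_eq (val (Pi1 T2) K) (Pi1_map T (\<lambda>x. x) H \<circ>\<^sub>g res (Pi1 T2) H K f) (res (Pi1 T) H K f \<circ>\<^sub>g Pi1_map T (\<lambda>x. x) K)"
      unfolding gpd_map_eq_def T2.val_Pi1
    proof (intro conjI ballI)
      fix x assume "x \<in> Ob (fund_groupoid (fixed_space T2 K) (skel T2 0))"
      then have x: "x \<in> fixed_set T2 K" by simp
      then have "x \<in> fixed_set T K" "x \<in> Xs 2" using fixed_set_stage[of 2 K] by auto
      then show "on_ob (Pi1_map T (\<lambda>x. x) H \<circ>\<^sub>g res (Pi1 T2) H K f) x = on_ob (res (Pi1 T) H K f \<circ>\<^sub>g Pi1_map T (\<lambda>x. x) K) x"
        using r2(1)[OF x] r(1)[of x] act2 by (simp add: gpd_comp_def Pi1_map_def)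
    next
      fix c assume "c \<in> Mor (fund_groupoid (fixed_space T2 K) (skel T2 0))"
      then obtain p where p: "c = path_class (fixed_space T2 K) p" "pathin (fixed_space T2 K) p"
        unfolding Mor_fund by blast
      have p': "pathin (fixed_space T K) p" using pathin_compose[OF p(2) inclusion_cont] by (simp add: o_def)
      have gp: "pathin (fixed_space T2 H) (act T2 g \<circ> p)"
        by (rule pathin_compose[OF p(2) T2.act_fixed_cont[OF g(2,1,3,5)]])
      have "path_class (fixed_space T H) (act T2 g \<circ> p) = path_class (fixed_space T H) (act T g \<circ> p)"
      proof (rule path_class_eqI, rule path_homotopic_sym, rule path_homotopic_eq_on)
        show "pathin (fixed_space T H) (act T g \<circ> p)" by (rule pathin_compose[OF p' T.act_fixed_cont[OF g(2,1,3,5)]])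
        show "(act T g \<circ> p) t = (act T2 g \<circ> p) t" if "t \<in> {0..1}" for t
        proof -
          have "p t \<in> Xs 2" using path_image_subset_topspace[OF p(2)] that fixed_set_stage[of 2 K] by auto
          then show ?thesis using act2 by simp
        qed
      qed
      then show "on_mor (Pi1_map T (\<lambda>x. x) H \<circ>\<^sub>g res (Pi1 T2) H K f) c = on_mor (res (Pi1 T) H K f \<circ>\<^sub>g Pi1_map T (\<lambda>x. x) K) c"
        using r2(2)[OF p(2)] r(2)[OF p'] inclusion_path[OF p(2)] inclusion_path[OF gp] by (simp add: gpd_comp_def p(1))
    qed
  qed
qed

text \<open>A map of the \<open>n\<close>-disc is compressed into the stage \<open>X\<^sub>k\<close> for a large \<open>k\<close> that contains the base
  point. There it is null homotopic by construction.\<close>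

lemma fixed_points_aspherical:
  assumes H: "subgroup H G" and n: "n \<ge> 2"
  shows "spheres_null n (fixed_space T H)"
proof (rule spheres_null_if_homotopy_group_vanishes)
  fix x assume x: "x \<in> topspace (fixed_space T H)"
  then have xT: "x \<in> fixed_set T H" by simp
  then have "x \<in> topspace (spc T)" by (simp add: fixed_set_def)
  then obtain m where m: "x \<in> skel T m" using T.topspace_skel by blast
  define k where "k = m + n + 1"
  have k: "k \<ge> 3" "n \<le> k - 1" "k \<ge> 2" "n \<le> k" using n by (auto simp: k_def)
  have xk: "x \<in> Xs k" using m T.skel_mono[of m k] skel_in_stage[OF k(3)] by (auto simp: k_def)
  have van: "homotopy_group_vanishes n (fixed_space (sub_gcw T (Xs k)) H) x"
  proof -
    have "\<forall>k\<ge>3. \<forall>H. subgroup H G \<longrightarrow> (\<forall>j\<in>{2..k - 1}. \<forall>x\<in>fixed_set (sub_gcw T (Xs k)) H.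
        homotopy_group_vanishes j (fixed_space (sub_gcw T (Xs k)) H) x)"
      using univ unfolding universal_space_def by (elim conjE)
    moreover have "x \<in> fixed_set (sub_gcw T (Xs k)) H" using xT xk by (simp add: fixed_set_stage[OF k(3)])
    moreover have "n \<in> {2..k - 1}" using n k(2) by simp
    ultimately show ?thesis using k(1) H by blast
  qed
  show "homotopy_group_vanishes n (fixed_space T H) x" unfolding homotopy_group_vanishes_def
  proof (intro equalityI subsetI)
    have cx: "(\<lambda>d. x) \<in> disc_maps n (fixed_space T H) x" using xT by (auto simp: disc_maps_def)
    {
      fix c assume "c \<in> {disc_class n (fixed_space T H) x (\<lambda>d. x)}"
      then show "c \<in> homotopy_group_set n (fixed_space T H) x" using cx by (auto simp: homotopy_group_set_def)
    }
    fix c assume "c \<in> homotopy_group_set n (fixed_space T H) x"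
    then obtain f where f: "c = disc_class n (fixed_space T H) x f" "f \<in> disc_maps n (fixed_space T H) x"
      by (auto simp: homotopy_group_set_def)
    let ?R = "\<lambda>f g. homotopic_with (\<lambda>h. \<forall>d\<in>disc_boundary n. h d = x) (disc n) (fixed_space T H) f g"
    have fc: "continuous_map (top_of_set (ball_pts n)) (fixed_space T H) f" and fx: "\<And>d. d \<in> disc_boundary n \<Longrightarrow> f d = x"
      using f(2) disc_eq[of n] by (auto simp: disc_maps_def)
    obtain f' where f': "homotopic_with (\<lambda>h. \<forall>k'\<in>ball_pts n. f k' \<in> Xs k \<longrightarrow> h k' = f k') (top_of_set (ball_pts n)) (fixed_space T H) f f'"
      "f' ` ball_pts n \<subseteq> Xs k"
      using compress_into_stage[OF H compact_ball_pts box_dim_le_ball_pts k(4,3) fc] by blast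
    have "homotopic_with (\<lambda>h. \<forall>d\<in>disc_boundary n. h d = x) (top_of_set (ball_pts n)) (fixed_space T H) f f'"
      using fx xk disc_boundary_subset by (intro homotopic_with_mono[OF f'(1)]) blast
    then have 1: "?R f f'" by (subst disc_eq)
    have f'c: "continuous_map (disc n) (fixed_space (sub_gcw T (Xs k)) H) f'"
      using homotopic_with_imp_continuous_maps[OF 1] f'(2) unfolding fixed_space_stage[OF k(3)] unfolding fixed_space_def
      by (auto simp: continuous_map_in_subtopology)
    then have m': "f' \<in> disc_maps n (fixed_space (sub_gcw T (Xs k)) H) x"
      using homotopic_with_imp_property[OF 1] by (auto simp: disc_maps_def)
    then have "disc_class n (fixed_space (sub_gcw T (Xs k)) H) x f' = disc_class n (fixed_space (sub_gcw T (Xs k)) H) x (\<lambda>d. x)"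
      using van unfolding homotopy_group_vanishes_def homotopy_group_set_def by blast
    moreover have "f' \<in> disc_class n (fixed_space (sub_gcw T (Xs k)) H) x f'"
      using m' f'c by (auto simp: disc_class_def disc_maps_def)
    ultimately have h: "homotopic_with (\<lambda>h. \<forall>d\<in>disc_boundary n. h d = x) (disc n) (fixed_space (sub_gcw T (Xs k)) H) (\<lambda>d. x) f'"
      by (simp add: disc_class_def)
    have inc: "continuous_map (fixed_space (sub_gcw T (Xs k)) H) (fixed_space T H) (\<lambda>x. x)"
      unfolding fixed_space_stage[OF k(3)] unfolding fixed_space_def
      by (auto simp: continuous_map_in_subtopology intro: continuous_map_from_subtopology[OF continuous_map_id[unfolded id_def]])
    have "homotopic_with (\<lambda>h. \<forall>d\<in>disc_boundary n. h d = x) (disc n) (fixed_space T H) ((\<lambda>x. x) \<circ> (\<lambda>d. x)) ((\<lambda>x. x) \<circ> f')"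
      by (rule homotopic_with_compose_continuous_map_left[OF h inc]) auto
    then have 2: "?R (\<lambda>d. x) f'" by (simp add: o_def)
    have 3: "?R f (\<lambda>d. x)" by (rule homotopic_with_trans[OF 1 homotopic_with_symD[OF 2]])
    have "?R f g \<longleftrightarrow> ?R (\<lambda>d. x) g" for g using 3 homotopic_with_trans homotopic_with_symD by blast
    then show "c \<in> {disc_class n (fixed_space T H) x (\<lambda>d. x)}" unfolding f(1) disc_class_def by simp
  qed
qed

lemma theta_iso: "orb_nat_iso G (Pi1 T2) P \<theta>"
  using univ unfolding universal_space_def by blast

text \<open>A transformation into \<open>P\<close>, carried back to one into the fundamental groupoids of the universal
  space itself, so that it can be compared with path classes in fixed point sets.\<close>

definition lift_trans :: "('g set \<Rightarrow> ('y, 'n, 'o, 'm) gpd_map) \<Rightarrow> 'g set \<Rightarrow> ('y, 'n, 't, (real \<Rightarrow> 't) set) gpd_map" where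
  "lift_trans \<Phi> H = Pi1_map T (\<lambda>x. x) H \<circ>\<^sub>g gpd_inv (val (Pi1 T2) H) (\<theta> H) \<circ>\<^sub>g \<Phi> H"

lemma orb_closed_T2: "orb_closed G (Pi1 T2)"
  by (rule T2.orb_closed_Pi1[OF T2.act_skel])

lemma lift_trans_nat:
  assumes "orb_nat_trans G Q P \<Phi>" shows "orb_nat_trans G Q (Pi1 T) (lift_trans \<Phi>)"
proof -
  have "orb_nat_trans G (Pi1 T2) (Pi1 T) (Pi1_map T (\<lambda>x. x))" using inclusion_iso by (simp add: orb_nat_iso_def)
  from orb_nat_trans_comp[OF orb_nat_trans_comp[OF assms orb_nat_trans_inv[OF orb_closed_T2 theta_iso]] this]
  show ?thesis by (simp add: lift_trans_def[abs_def])
qed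

text \<open>The identification of the functor of the universal space with \<open>P\<close> is the composite of \<open>\<theta>\<close> and
  the inverse of the inclusion, both bijective on objects and morphisms; it can be moved to the other
  side of the equation.\<close>

lemma universal_map_iff:
  assumes Y: "G_CW G Y" and \<Phi>: "orb_nat_trans G (Pi1 Y) P \<Phi>" and f: "cellular_G_map G Y T f"
  shows "orb_trans_eq G (Pi1 Y) (universal_map T Xs \<theta> f) \<Phi> \<longleftrightarrow> orb_trans_eq G (Pi1 Y) (Pi1_map T f) (lift_trans \<Phi>)"
proof -
  interpret Y: G_CW G Y by (rule Y)
  interpret G_CW_pair G Y T by unfold_locales
  have fc: "continuous_map (spc Y) (spc T) f" and feq: "\<And>g y. g \<in> carrier G \<Longrightarrow> y \<in> topspace (spc Y) \<Longrightarrow> f (act Y g y) = act T g (f y)"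
    and fsk: "f ` skel Y 0 \<subseteq> skel T 0"
    using f by (auto simp: cellular_G_map_def G_equivariant_def)
  have "gpd_map_eq (val (Pi1 Y) H) (universal_map T Xs \<theta> f H) (\<Phi> H) \<longleftrightarrow> gpd_map_eq (val (Pi1 Y) H) (Pi1_map T f H) (lift_trans \<Phi> H)"
    if H: "subgroup H G" for H
  proof -
    define i where "i = Pi1_map T (\<lambda>x. x) H"
    have I: "gpd_iso (val (Pi1 T2) H) (val (Pi1 T) H) i" using inclusion_iso H by (simp add: orb_nat_iso_def i_def)
    have Th: "gpd_iso (val (Pi1 T2) H) (val P H) (\<theta> H)" using theta_iso H by (simp add: orb_nat_iso_def)
    have \<Phi>H: "gpd_functor (val (Pi1 Y) H) (val P H) (\<Phi> H)" using \<Phi> H by (simp add: orb_nat_trans_def)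
    have gen: "t0 (inv_into A i0 b) = p \<longleftrightarrow> b = i0 (inv_into A t0 p)"
      if "bij_betw i0 A B" "bij_betw t0 A C" "b \<in> B" "p \<in> C" for i0 :: "'u \<Rightarrow> 'v" and t0 :: "'u \<Rightarrow> 'w" and A B C b p
    proof -
      have "t0 (inv_into A i0 b) = p \<longleftrightarrow> inv_into A i0 b = inv_into A t0 p"
        using bij_betw_inv_into_left[OF that(2), of "inv_into A i0 b"] bij_betw_inv_into_right[OF that(2,4)]
          bij_betw_apply[OF bij_betw_inv_into[OF that(1)] that(3)] by auto
      also have "\<dots> \<longleftrightarrow> b = i0 (inv_into A t0 p)"
        using bij_betw_inv_into_left[OF that(1), of "inv_into A t0 p"] bij_betw_inv_into_right[OF that(1,3)]
          bij_betw_apply[OF bij_betw_inv_into[OF that(2)] that(4)] by auto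
      finally show ?thesis .
    qed
    have fH: "continuous_map (fixed_space Y H) (fixed_space T H) f"
    proof -
      have "f y \<in> fixed_set T H" if y: "y \<in> fixed_set Y H" for y
        by (rule equivariant_fixed[OF feq continuous_map_funspace[OF fc] H _ y]) (use y in \<open>auto simp: fixed_set_def\<close>)
      then show ?thesis using fc unfolding fixed_space_def
        by (auto simp: continuous_map_in_subtopology intro: continuous_map_from_subtopology)
    qed
    have ob: "on_ob (Pi1_map T f H) y \<in> Ob (val (Pi1 T) H)" if "y \<in> Ob (val (Pi1 Y) H)" for y
      using that continuous_map_funspace[OF fH] fsk unfolding Y.val_Pi1 T.val_Pi1 by (auto simp: Pi1_map_def)
    have mor: "on_mor (Pi1_map T f H) c \<in> Mor (val (Pi1 T) H)" if c: "c \<in> Mor (val (Pi1 Y) H)" for c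
    proof -
      obtain p where p: "c = path_class (fixed_space Y H) p" "pathin (fixed_space Y H) p" "p 0 \<in> skel Y 0" "p 1 \<in> skel Y 0"
        using c unfolding Y.val_Pi1 Mor_fund by blast
      then show ?thesis unfolding T.val_Pi1 Pi1_map_def p(1) on_mor_fund_map[OF fH p(2)]
        using pathin_compose[OF p(2) fH] fsk by (intro Mor_fundI) auto
    qed
    have "on_ob (universal_map T Xs \<theta> f H) y = on_ob (\<Phi> H) y \<longleftrightarrow> on_ob (Pi1_map T f H) y = on_ob (lift_trans \<Phi> H) y"
      if y: "y \<in> Ob (val (Pi1 Y) H)" for y
      using gen[of "on_ob i" "Ob (val (Pi1 T2) H)" "Ob (val (Pi1 T) H)" "on_ob (\<theta> H)" "Ob (val P H)" "on_ob (Pi1_map T f H) y" "on_ob (\<Phi> H) y"]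
        I Th ob[OF y] \<Phi>H y
      by (simp add: universal_map_def universal_ident_def lift_trans_def gpd_comp_def gpd_inv_def gpd_iso_def gpd_functor_def i_def)
    moreover have "on_mor (universal_map T Xs \<theta> f H) y = on_mor (\<Phi> H) y \<longleftrightarrow> on_mor (Pi1_map T f H) y = on_mor (lift_trans \<Phi> H) y"
      if y: "y \<in> Mor (val (Pi1 Y) H)" for y
      using gen[of "on_mor i" "Mor (val (Pi1 T2) H)" "Mor (val (Pi1 T) H)" "on_mor (\<theta> H)" "Mor (val P H)" "on_mor (Pi1_map T f H) y" "on_mor (\<Phi> H) y"]
        I Th mor[OF y] \<Phi>H y
      by (simp add: universal_map_def universal_ident_def lift_trans_def gpd_comp_def gpd_inv_def gpd_iso_def gpd_functor_def i_def)
    ultimately show ?thesis unfolding gpd_map_eq_def by blast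
  qed
  then show ?thesis unfolding orb_trans_eq_def by blast
qed

end

section \<open>Existence and uniqueness\<close>

theorem proposition5p7:
  fixes G :: "('g, 'z) monoid_scheme"
    and P :: "('g, 'o, 'm) orb_data"
    and B :: "('g, 'x) gcw_data"
    and Xs :: "nat \<Rightarrow> 'x set"
    and \<theta> :: "'g set \<Rightarrow> ('x, (real \<Rightarrow> 'x) set, 'o, 'm) gpd_map"
    and Y :: "('g, 'y) gcw_data"
    and \<Phi> :: "'g set \<Rightarrow> ('y, (real \<Rightarrow> 'y) set, 'o, 'm) gpd_map"
  assumes "group G"
    and "orb_functor G P"
    and "universal_space G P B Xs \<theta>"
    and "G_CW_complex G Y"
    and "orb_nat_trans G (Pi1 Y) P \<Phi>"
  shows "(\<exists>\<phi>. cellular_G_map G Y B \<phi> \<and>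
              orb_trans_eq G (Pi1 Y) (universal_map B Xs \<theta> \<phi>) \<Phi>) \<and>
         (\<forall>\<phi> \<phi>'.
              cellular_G_map G Y B \<phi> \<and> orb_trans_eq G (Pi1 Y) (universal_map B Xs \<theta> \<phi>) \<Phi> \<and>
              cellular_G_map G Y B \<phi>' \<and> orb_trans_eq G (Pi1 Y) (universal_map B Xs \<theta> \<phi>') \<Phi>
              \<longrightarrow> G_homotopic G Y B \<phi> \<phi>')"
proof -
  have Y: "G_CW G Y" by (intro G_CW.intro G_CW_axioms.intro assms(1,4))
  have B: "G_CW G B"
    using assms(3) by (intro G_CW.intro G_CW_axioms.intro assms(1)) (simp add: universal_space_def)
  interpret universal G B P Xs \<theta> by (intro universal.intro universal_axioms.intro B assms(3))
  interpret Y: G_CW G Y by (rule Y)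
  interpret Pi1_transformation G Y B "lift_trans \<Phi>"
    by (intro Pi1_transformation.intro Pi1_transformation_axioms.intro G_CW_pair.intro Y B lift_trans_nat[OF assms(5)])
  note iff = universal_map_iff[OF Y assms(5)]
  show ?thesis
  proof (intro conjI allI impI)
    obtain f where f: "cellular_G_map G Y B f" "orb_trans_eq G (Pi1 Y) (Pi1_map B f) (lift_trans \<Phi>)"
      by (rule realization[OF fixed_points_aspherical])
    then show "\<exists>\<phi>. cellular_G_map G Y B \<phi> \<and> orb_trans_eq G (Pi1 Y) (universal_map B Xs \<theta> \<phi>) \<Phi>"
      using iff by blast
  next
    fix \<phi> \<phi>' assume h: "cellular_G_map G Y B \<phi> \<and> orb_trans_eq G (Pi1 Y) (universal_map B Xs \<theta> \<phi>) \<Phi> \<and>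
              cellular_G_map G Y B \<phi>' \<and> orb_trans_eq G (Pi1 Y) (universal_map B Xs \<theta> \<phi>') \<Phi>"
    then have "orb_trans_eq G (Pi1 Y) (Pi1_map B \<phi>) (lift_trans \<Phi>)" "orb_trans_eq G (Pi1 Y) (Pi1_map B \<phi>') (lift_trans \<Phi>)"
      using iff by blast+
    then have "orb_trans_eq G (Pi1 Y) (Pi1_map B \<phi>) (Pi1_map B \<phi>')"
      unfolding orb_trans_eq_def gpd_map_eq_def by simp
    then show "G_homotopic G Y B \<phi> \<phi>'" using equivariant_homotopy_unique h fixed_points_aspherical by blast
  qed
qed

end
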